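(* Let $\mathcal E$ be a toric sheaf on a toric variety $X$ and let $\Phi=\sum_{r\in M}\phi^r\otimes\chi^r:\mathcal E\to\mathcal E\otimes\mathcal T_X$ be a Higgs field on $\mathcal E$. For any $s,s'\in M$ we have $[\Phi_s,\Phi_{s'}]=0$ in $\mathrm{End}(E)\otimes\mathbb C[M]$. In particular, every Higgs field defines a family $$ \mathcal A(t)=\mathbb C\Bigl[\Phi_s(t)=\sum_{r\in M}\chi^r(t)\,\phi^r_s\ \Big|\ s\in M\Bigr]\subset\mathrm{End}(E),\qquad t\in T, $$ of commutative finitely generated subalgebras with $\mathrm{id}_E$ as unit.
   Context: $X$ is the toric variety of a fan $\Sigma$ in $N_{\mathbb R}$, where $N$ is a lattice of finite rank; $M=\mathrm{Hom}_{\mathbb Z}(N,\mathbb Z)$, $N_{\mathbb C}=N\otimes\mathbb C$, $T=N\otimes_{\mathbb Z}\mathbb C^*\subseteq X$ is the torus, $\chi^r$ is the character of $r\in M$. A toric sheaf $\mathcal E$ is a $T$-equivariant (i.e. $T$-linearized) reflexive sheaf of $\mathcal O_X$-modules; $E=\mathcal E_1/\mathfrak m_{X,1}\mathcal E_1$ is its fibre at $1\in T$. For the tangent sheaf $\mathcal T_X$ this fibre is $N_{\mathbb C}$. The sheaf $\mathcal E\otimes_{\mathcal O_X}\mathcal T_X$ is treated as a toric sheaf (in particular as reflexive), with fibre $E\otimes N_{\mathbb C}$. A pre-Higgs field is an $\mathcal O_X$-linear map $\Phi:\mathcal E\to\mathcal E\otimes_{\mathcal O_X}\mathcal T_X$ ("Higgs"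 here means what is usually called "co-Higgs"). It decomposes as a finite sum of $M$-homogeneous components $\Phi=\sum_{r\in M}\Phi^r$, $\Phi^r=\phi^r\otimes\chi^r$, with $\mathbb C$-linear maps $\phi^r:E\to E\otimes N_{\mathbb C}$, so that $\Phi$ is an element of $\mathrm{End}(E)\otimes N_{\mathbb C}\otimes\mathbb C[M]$. It is called a Higgs field (not necessarily homogeneous) if $\Phi\wedge\Phi=0$, where $\Phi\wedge\Phi:\mathcal E\to\mathcal E\otimes\Lambda^2\mathcal T_X$ is the composition of $\Phi$, then $\Phi\otimes\mathrm{id}:\mathcal E\otimes\mathcal T_X\to\mathcal E\otimes\mathcal T_X\otimes\mathcal T_X$, then $\mathrm{id}\otimes\wedge$. For $s\in M$, regarded as a linear map $N_{\mathbb C}\to\mathbb C$, put $\phi^r_s=(\mathrm{id}_E\otimes s)\circ\phi^r\in\mathrm{End}(E)$ and $\Phi_s=\sum_{r\in M}\phi^r_s\otimes\chi^r\in\mathrm{End}(E)\otimes\mathbb C[M]$; $\Phi_s(t)\in\mathrm{End}(E)$ is its evaluation at $t\in T$. $[\cdot,\cdot]$ is the commutator, and $\mathbb C[\Phi_s(t)\mid s\in M]$ is the unital $\mathbb C$-subalgebra generated by the indicated elements. *)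

theory Defs
  imports
    "HOL-Analysis.Derivative"
    "HOL-Algebra.Subrings"
    "Jordan_Normal_Form.VS_Connect"
begin

(* HOL-Analysis is only needed for deriv; vectors are those of Jordan_Normal_Form.Matrix. *)
hide_type (open) Finite_Cartesian_Product.vec
hide_const (open) Finite_Cartesian_Product.vec Finite_Cartesian_Product.vec_nth
no_notation inner (infix "\<bullet>" 70)

section \<open>Cones and fans\<close>

text \<open>The lattice is \<open>N = \<int>\<^sup>n\<close>, that is \<open>carrier_vec n :: int vec set\<close>, where \<open>n = 0\<close> is allowed.
  Via the scalar product, \<open>M = Hom(N, \<int>)\<close> is again \<open>carrier_vec n :: int vec set\<close>; the spaces
  \<open>N\<^sub>\<real>\<close> and \<open>N\<^sub>\<complex>\<close> are \<open>carrier_vec n\<close> over \<open>real\<close> and \<open>complex\<close>.\<close>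

definition rational_cone :: "nat \<Rightarrow> int vec set \<Rightarrow> real vec set" where
  "rational_cone n A =
     {vec n (\<lambda>i. \<Sum>a\<in>A. c a * real_of_int (a $ i)) | c. \<forall>a\<in>A. 0 \<le> c a}"

definition rational_polyhedral_cone :: "nat \<Rightarrow> real vec set \<Rightarrow> bool" where
  "rational_polyhedral_cone n \<sigma> \<longleftrightarrow>
     (\<exists>A. finite A \<and> A \<subseteq> carrier_vec n \<and> \<sigma> = rational_cone n A)"

definition strongly_convex :: "nat \<Rightarrow> real vec set \<Rightarrow> bool" where
  "strongly_convex n \<sigma> \<longleftrightarrow> (\<forall>v\<in>\<sigma>. - v \<in> \<sigma> \<longrightarrow> v = 0\<^sub>v n)"

definition dual_cone :: "nat \<Rightarrow> real vec set \<Rightarrow> real vec set" where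
  "dual_cone n \<sigma> = {u \<in> carrier_vec n. \<forall>v\<in>\<sigma>. 0 \<le> u \<bullet> v}"

definition face_of_cone :: "nat \<Rightarrow> real vec set \<Rightarrow> real vec set \<Rightarrow> bool" where
  "face_of_cone n \<tau> \<sigma> \<longleftrightarrow> (\<exists>u\<in>dual_cone n \<sigma>. \<tau> = {v \<in> \<sigma>. u \<bullet> v = 0})"

definition fan :: "nat \<Rightarrow> real vec set set \<Rightarrow> bool" where
  "fan n \<Delta> \<longleftrightarrow> finite \<Delta> \<and> \<Delta> \<noteq> {} \<and>
     (\<forall>\<sigma>\<in>\<Delta>. rational_polyhedral_cone n \<sigma> \<and> strongly_convex n \<sigma>) \<and>
     (\<forall>\<sigma>\<in>\<Delta>. \<forall>\<tau>. face_of_cone n \<tau> \<sigma> \<longrightarrow> \<tau> \<in> \<Delta>) \<and>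
     (\<forall>\<sigma>\<in>\<Delta>. \<forall>\<sigma>'\<in>\<Delta>. face_of_cone n (\<sigma> \<inter> \<sigma>') \<sigma> \<and> face_of_cone n (\<sigma> \<inter> \<sigma>') \<sigma>')"


section \<open>Linear algebra over the complex numbers\<close>

definition End_algebra :: "(complex, 'v) module \<Rightarrow> (complex, 'v \<Rightarrow> 'v) module" where
  "End_algebra V =
     \<lparr>carrier = LinearCombinations.module_hom class_ring V V \<inter> extensional (carrier V),
      mult = compose (carrier V),
      one = (\<lambda>e\<in>carrier V. e),
      zero = (\<lambda>e\<in>carrier V. \<zero>\<^bsub>V\<^esub>),
      add = (\<lambda>a b. \<lambda>e\<in>carrier V. a e \<oplus>\<^bsub>V\<^esub> b e),
      smult = (\<lambda>c a. \<lambda>e\<in>carrier V. c \<odot>\<^bsub>V\<^esub> a e)\<rparr>"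

text \<open>\<open>R \<otimes> \<complex>[M]\<close> for a \<open>\<complex>\<close>-algebra \<open>R\<close>: the element \<open>\<Sum>\<^sub>r a\<^sub>r \<otimes> \<chi>\<^sup>r\<close> is the finitely supported
  family \<open>r \<mapsto> a\<^sub>r\<close>, and the product is convolution.\<close>

definition tensor_group_algebra :: "nat \<Rightarrow> ('a, 'b) ring_scheme \<Rightarrow> (int vec \<Rightarrow> 'a) ring" where
  "tensor_group_algebra n R =
     \<lparr>carrier = {a \<in> carrier_vec n \<rightarrow>\<^sub>E carrier R. finite {r \<in> carrier_vec n. a r \<noteq> \<zero>\<^bsub>R\<^esub>}},
      mult = (\<lambda>a b. \<lambda>r\<in>carrier_vec n.
        \<Oplus>\<^bsub>R\<^esub>p\<in>{p \<in> carrier_vec n. a p \<noteq> \<zero>\<^bsub>R\<^esub>}. a p \<otimes>\<^bsub>R\<^esub> b (r - p)),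
      one = (\<lambda>r\<in>carrier_vec n. if r = 0\<^sub>v n then \<one>\<^bsub>R\<^esub> else \<zero>\<^bsub>R\<^esub>),
      zero = (\<lambda>r\<in>carrier_vec n. \<zero>\<^bsub>R\<^esub>),
      add = (\<lambda>a b. \<lambda>r\<in>carrier_vec n. a r \<oplus>\<^bsub>R\<^esub> b r)\<rparr>"

definition commutator :: "('a, 'b) ring_scheme \<Rightarrow> 'a \<Rightarrow> 'a \<Rightarrow> 'a" where
  "commutator R a b = a \<otimes>\<^bsub>R\<^esub> b \<ominus>\<^bsub>R\<^esub> b \<otimes>\<^bsub>R\<^esub> a"

definition is_subalgebra :: "'a set \<Rightarrow> (complex, 'a) module \<Rightarrow> bool" where
  "is_subalgebra H A \<longleftrightarrow> subring H A \<and> Module.submodule H class_ring A"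

definition generated_subalgebra :: "(complex, 'a) module \<Rightarrow> 'a set \<Rightarrow> 'a set" where
  "generated_subalgebra A S = \<Inter>{H. is_subalgebra H A \<and> S \<subseteq> H}"


section \<open>Points, characters and the torus\<close>

text \<open>A closed point of the toric variety is encoded by the characters regular at it, together with
  their values: a point of the orbit of the cone \<open>\<tau>\<close> is a partial function on \<open>M\<close>, with domain the
  semigroup \<open>S\<^sub>\<tau> = \<tau>\<^sup>\<or> \<inter> M\<close>, which is a monoid homomorphism \<open>S\<^sub>\<tau> \<rightarrow> (\<complex>, \<cdot>)\<close> that is nonzero
  exactly on \<open>\<tau>\<^sup>\<bottom> \<inter> M\<close>. Restricting to \<open>S\<^sub>\<sigma> \<subseteq> S\<^sub>\<tau>\<close> for the cones \<open>\<sigma>\<close> with face \<open>\<tau>\<close> identifies the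
  affine chart \<open>U\<^sub>\<sigma>\<close> with the set of all monoid homomorphisms \<open>S\<^sub>\<sigma> \<rightarrow> \<complex>\<close>.\<close>

type_synonym point = "int vec \<Rightarrow> complex option"

definition cone_semigroup :: "nat \<Rightarrow> real vec set \<Rightarrow> int vec set" where
  "cone_semigroup n \<sigma> = {m \<in> carrier_vec n. \<forall>v\<in>\<sigma>. 0 \<le> map_vec real_of_int m \<bullet> v}"

definition cone_perp :: "nat \<Rightarrow> real vec set \<Rightarrow> int vec set" where
  "cone_perp n \<sigma> = {m \<in> carrier_vec n. \<forall>v\<in>\<sigma>. map_vec real_of_int m \<bullet> v = 0}"

definition chi :: "int vec \<Rightarrow> point \<Rightarrow> complex" where
  "chi m x = (case x m of None \<Rightarrow> 0 | Some c \<Rightarrow> c)"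

definition orbit :: "nat \<Rightarrow> real vec set \<Rightarrow> point set" where
  "orbit n \<tau> = {x. dom x = cone_semigroup n \<tau> \<and> chi (0\<^sub>v n) x = 1 \<and>
     (\<forall>m\<in>cone_semigroup n \<tau>. \<forall>m'\<in>cone_semigroup n \<tau>. chi (m + m') x = chi m x * chi m' x) \<and>
     (\<forall>m\<in>cone_semigroup n \<tau>. chi m x \<noteq> 0 \<longleftrightarrow> m \<in> cone_perp n \<tau>)}"

text \<open>\<open>T = N \<otimes> \<complex>\<^sup>* = Hom(M, \<complex>\<^sup>*)\<close>\<close>

definition torus :: "nat \<Rightarrow> point set" where
  "torus n = {t. dom t = carrier_vec n \<and> chi (0\<^sub>v n) t = 1 \<and>
     (\<forall>m\<in>carrier_vec n. \<forall>m'\<in>carrier_vec n. chi (m + m') t = chi m t * chi m' t)}"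

definition torus_one :: "nat \<Rightarrow> point" where
  "torus_one n = (\<lambda>m. if m \<in> carrier_vec n then Some 1 else None)"

definition torus_inv :: "point \<Rightarrow> point" where
  "torus_inv t = (\<lambda>m. map_option inverse (t m))"

text \<open>The action of \<open>T\<close> on points; on \<open>T\<close> itself it is the multiplication.\<close>

definition act :: "point \<Rightarrow> point \<Rightarrow> point" where
  "act t x = (\<lambda>m. map_option (\<lambda>c. chi m t * c) (x m))"

text \<open>The exponential map \<open>N\<^sub>\<complex> = Lie(T) \<rightarrow> T\<close>\<close>

definition torus_exp :: "nat \<Rightarrow> complex vec \<Rightarrow> point" where
  "torus_exp n v = (\<lambda>m. if m \<in> carrier_vec n
     then Some (exp (map_vec complex_of_int m \<bullet> v)) else None)"


section \<open>Toric varieties, toric sheaves and Higgs fields\<close>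

type_synonym reg = "point \<Rightarrow> complex"

text \<open>The data of a presheaf of \<open>\<O>\<^sub>X\<close>-modules: the module of sections over each open set, and for
  open sets \<open>V \<subseteq> U\<close> the restriction map \<open>res F U V\<close> from sections over \<open>U\<close> to sections over \<open>V\<close>.
  The multiplicative components of the module records play no role.\<close>

record 's presheaf =
  sec :: "point set \<Rightarrow> (reg, 's) module"
  res :: "point set \<Rightarrow> point set \<Rightarrow> 's \<Rightarrow> 's"

text \<open>Type of vector fields, and of sections of sheaves of \<open>\<O>\<^sub>X\<close>-valued maps on arguments of type \<open>'a\<close>
  (given on all smaller open sets)\<close>

type_synonym 'a fam = "point set \<Rightarrow> 'a \<Rightarrow> reg"
type_synonym vfield = "reg fam"
type_synonym 's tensor_T = "('s \<times> vfield) fam fam"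

locale toric_variety =
  fixes n :: nat and \<Delta> :: "real vec set set"
  assumes fan: "fan n \<Delta>"
begin

subsection \<open>The variety and its structure sheaf\<close>

definition X :: "point set" where
  "X = (\<Union>\<tau>\<in>\<Delta>. orbit n \<tau>)"

definition chart :: "real vec set \<Rightarrow> point set" where
  "chart \<sigma> = {x \<in> X. cone_semigroup n \<sigma> \<subseteq> dom x}"

text \<open>The coordinate ring \<open>\<complex>[S\<^sub>\<sigma>]\<close> of the chart of \<open>\<sigma>\<close>, as functions on points\<close>

definition coord_ring :: "real vec set \<Rightarrow> reg set" where
  "coord_ring \<sigma> = {(\<lambda>x. \<Sum>m\<in>A. c m * chi m x) | A c. finite A \<and> A \<subseteq> cone_semigroup n \<sigma>}"

text \<open>Zariski topology\<close>

definition zopen :: "point set \<Rightarrow> bool" where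
  "zopen U \<longleftrightarrow> U \<subseteq> X \<and>
     (\<forall>\<sigma>\<in>\<Delta>. \<exists>F \<subseteq> coord_ring \<sigma>. U \<inter> chart \<sigma> = {x \<in> chart \<sigma>. \<exists>f\<in>F. f x \<noteq> 0})"

definition opens :: "point set \<Rightarrow> point set set" where
  "opens U = {W. zopen W \<and> W \<subseteq> U}"

text \<open>Regular functions on \<open>U\<close> are extended by zero outside \<open>U\<close>.\<close>

definition regular :: "point set \<Rightarrow> reg \<Rightarrow> bool" where
  "regular U f \<longleftrightarrow> (\<forall>x. x \<notin> U \<longrightarrow> f x = 0) \<and>
     (\<forall>x\<in>U. \<exists>\<sigma>\<in>\<Delta>. \<exists>g\<in>coord_ring \<sigma>. \<exists>h\<in>coord_ring \<sigma>. \<exists>V\<in>opens (U \<inter> chart \<sigma>).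
        x \<in> V \<and> (\<forall>y\<in>V. h y \<noteq> 0 \<and> f y = g y / h y))"

definition on_set :: "point set \<Rightarrow> reg \<Rightarrow> reg" where
  "on_set U f = (\<lambda>x. if x \<in> U then f x else 0)"

definition const :: "point set \<Rightarrow> complex \<Rightarrow> reg" where
  "const U c = on_set U (\<lambda>_. c)"

text \<open>\<open>reg_ring U\<close> is the ring of sections of \<open>\<O>\<^sub>X\<close> over \<open>U\<close>, also viewed as a module over itself.\<close>

definition reg_ring :: "point set \<Rightarrow> (reg, reg) module" where
  "reg_ring U =
     \<lparr>carrier = {f. regular U f},
      mult = (\<lambda>f g x. f x * g x), one = const U 1,
      zero = (\<lambda>_. 0), add = (\<lambda>f g x. f x + g x),
      smult = (\<lambda>f g x. f x * g x)\<rparr>"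

definition structure_sheaf :: "reg presheaf" where
  "structure_sheaf = \<lparr>sec = reg_ring, res = (\<lambda>U V. on_set V)\<rparr>"

subsection \<open>Sheaves of modules\<close>

definition sheaf_of_modules :: "'s presheaf \<Rightarrow> bool" where
  "sheaf_of_modules F \<longleftrightarrow>
     (\<forall>U. zopen U \<longrightarrow> Module.module (reg_ring U) (sec F U)) \<and>
     (\<forall>U. zopen U \<longrightarrow> (\<forall>V\<in>opens U.
        res F U V \<in> carrier (sec F U) \<rightarrow> carrier (sec F V) \<and>
        (\<forall>s\<in>carrier (sec F U). \<forall>s'\<in>carrier (sec F U).
           res F U V (s \<oplus>\<^bsub>sec F U\<^esub> s') = res F U V s \<oplus>\<^bsub>sec F V\<^esub> res F U V s') \<and>
        (\<forall>f\<in>carrier (reg_ring U). \<forall>s\<in>carrier (sec F U).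
           res F U V (f \<odot>\<^bsub>sec F U\<^esub> s) = on_set V f \<odot>\<^bsub>sec F V\<^esub> res F U V s) \<and>
        (\<forall>W\<in>opens V. \<forall>s\<in>carrier (sec F U). res F V W (res F U V s) = res F U W s))) \<and>
     (\<forall>U. zopen U \<longrightarrow> (\<forall>s\<in>carrier (sec F U). res F U U s = s)) \<and>
     (\<forall>\<U> s. \<U> \<subseteq> Collect zopen \<and> (\<forall>V\<in>\<U>. s V \<in> carrier (sec F V)) \<and>
        (\<forall>V\<in>\<U>. \<forall>W\<in>\<U>. res F V (V \<inter> W) (s V) = res F W (V \<inter> W) (s W)) \<longrightarrow>
        (\<exists>!t. t \<in> carrier (sec F (\<Union>\<U>)) \<and> (\<forall>V\<in>\<U>. res F (\<Union>\<U>) V t = s V)))"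

definition sheaf_map :: "'s presheaf \<Rightarrow> 't presheaf \<Rightarrow> (point set \<Rightarrow> 's \<Rightarrow> 't) \<Rightarrow> bool" where
  "sheaf_map F G \<Phi> \<longleftrightarrow>
     (\<forall>U. zopen U \<longrightarrow>
        \<Phi> U \<in> LinearCombinations.module_hom (reg_ring U) (sec F U) (sec G U) \<and>
        (\<forall>V\<in>opens U. \<forall>s\<in>carrier (sec F U). res G U V (\<Phi> U s) = \<Phi> V (res F U V s)))"

text \<open>Coherence: over each affine chart \<open>U\<^sub>\<sigma>\<close> the sheaf is the one associated with a finitely generated
  module. The localization condition says that the sections over the principal open set \<open>D(f)\<close> are
  the localization at \<open>f\<close> of the sections over the chart.\<close>

definition principal_open :: "real vec set \<Rightarrow> reg \<Rightarrow> point set" where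
  "principal_open \<sigma> f = {x \<in> chart \<sigma>. f x \<noteq> 0}"

definition coherent :: "'s presheaf \<Rightarrow> bool" where
  "coherent F \<longleftrightarrow> (\<forall>\<sigma>\<in>\<Delta>. let U = chart \<sigma> in
     (\<exists>G. finite G \<and> G \<subseteq> carrier (sec F U) \<and>
        (\<forall>s\<in>carrier (sec F U). \<exists>a\<in>G \<rightarrow> carrier (reg_ring U).
           s = (\<Oplus>\<^bsub>sec F U\<^esub>g\<in>G. a g \<odot>\<^bsub>sec F U\<^esub> g))) \<and>
     (\<forall>f\<in>carrier (reg_ring U).
        (\<forall>s\<in>carrier (sec F (principal_open \<sigma> f)). \<exists>k::nat. \<exists>s'\<in>carrier (sec F U).
           on_set (principal_open \<sigma> f) (f [^]\<^bsub>reg_ring U\<^esub> k) \<odot>\<^bsub>sec F (principal_open \<sigma> f)\<^esub> s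
             = res F U (principal_open \<sigma> f) s') \<and>
        (\<forall>s\<in>carrier (sec F U).
           res F U (principal_open \<sigma> f) s = \<zero>\<^bsub>sec F (principal_open \<sigma> f)\<^esub> \<longrightarrow>
           (\<exists>k::nat. f [^]\<^bsub>reg_ring U\<^esub> k \<odot>\<^bsub>sec F U\<^esub> s = \<zero>\<^bsub>sec F U\<^esub>))))"

subsection \<open>Duals, tangent sheaf and tensor products\<close>

text \<open>The sheaf whose sections over \<open>U\<close> are the families of maps \<open>\<gamma> W : D W \<rightarrow> \<O>\<^sub>X(W)\<close>, for all open
  \<open>W \<subseteq> U\<close>, that have the property \<open>P W\<close> and commute with restriction; here \<open>\<rho> W V : D W \<rightarrow> D V\<close> is the
  restriction of arguments. Such families are extensional.\<close>

definition fam_sheaf ::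
    "(point set \<Rightarrow> 'a set) \<Rightarrow> (point set \<Rightarrow> point set \<Rightarrow> 'a \<Rightarrow> 'a) \<Rightarrow>
     (point set \<Rightarrow> ('a \<Rightarrow> reg) \<Rightarrow> bool) \<Rightarrow> 'a fam presheaf" where
  "fam_sheaf D \<rho> P =
     \<lparr>sec = (\<lambda>U.
        \<lparr>carrier = {\<gamma> \<in> (\<Pi>\<^sub>E W\<in>opens U. D W \<rightarrow>\<^sub>E carrier (reg_ring W)).
           \<forall>W\<in>opens U. P W (\<gamma> W) \<and>
             (\<forall>V\<in>opens W. \<forall>a\<in>D W. \<gamma> V (\<rho> W V a) = on_set V (\<gamma> W a))},
         mult = undefined, one = undefined,
         zero = (\<lambda>W\<in>opens U. \<lambda>a\<in>D W. \<zero>\<^bsub>reg_ring W\<^esub>),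
         add = (\<lambda>\<gamma> \<delta>. \<lambda>W\<in>opens U. \<lambda>a\<in>D W. \<gamma> W a \<oplus>\<^bsub>reg_ring W\<^esub> \<delta> W a),
         smult = (\<lambda>f \<gamma>. \<lambda>W\<in>opens U. \<lambda>a\<in>D W. on_set W f \<otimes>\<^bsub>reg_ring W\<^esub> \<gamma> W a)\<rparr>),
      res = (\<lambda>U V \<gamma>. restrict \<gamma> (opens V))\<rparr>"

definition linear_form :: "'s presheaf \<Rightarrow> point set \<Rightarrow> ('s \<Rightarrow> reg) \<Rightarrow> bool" where
  "linear_form F W g \<longleftrightarrow> g \<in> LinearCombinations.module_hom (reg_ring W) (sec F W) (reg_ring W)"

text \<open>\<open>F\<^sup>\<or> = Hom(F, \<O>\<^sub>X)\<close> (sheaf Hom)\<close>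

definition dual_sheaf :: "'s presheaf \<Rightarrow> 's fam presheaf" where
  "dual_sheaf F = fam_sheaf (\<lambda>W. carrier (sec F W)) (res F) (linear_form F)"

definition bidual_map :: "'s presheaf \<Rightarrow> point set \<Rightarrow> 's \<Rightarrow> 's fam fam" where
  "bidual_map F U s =
     (\<lambda>W\<in>opens U. \<lambda>\<gamma>\<in>carrier (sec (dual_sheaf F) W). \<gamma> W (res F U W s))"

definition reflexive :: "'s presheaf \<Rightarrow> bool" where
  "reflexive F \<longleftrightarrow> coherent F \<and>
     (\<forall>U. zopen U \<longrightarrow>
        bij_betw (bidual_map F U) (carrier (sec F U))
          (carrier (sec (dual_sheaf (dual_sheaf F)) U)))"

definition derivation :: "point set \<Rightarrow> (reg \<Rightarrow> reg) \<Rightarrow> bool" where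
  "derivation W d \<longleftrightarrow>
     (\<forall>f\<in>carrier (reg_ring W). \<forall>g\<in>carrier (reg_ring W).
        d (f \<oplus>\<^bsub>reg_ring W\<^esub> g) = d f \<oplus>\<^bsub>reg_ring W\<^esub> d g \<and>
        d (f \<otimes>\<^bsub>reg_ring W\<^esub> g) = f \<otimes>\<^bsub>reg_ring W\<^esub> d g \<oplus>\<^bsub>reg_ring W\<^esub> g \<otimes>\<^bsub>reg_ring W\<^esub> d f) \<and>
     (\<forall>c. d (const W c) = \<zero>\<^bsub>reg_ring W\<^esub>)"

text \<open>\<open>\<T>\<^sub>X = Der\<^sub>\<complex>(\<O>\<^sub>X)\<close>\<close>

definition tangent_sheaf :: "vfield presheaf" where
  "tangent_sheaf = fam_sheaf (\<lambda>W. carrier (reg_ring W)) (\<lambda>W V. on_set V) derivation"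

definition bilinear_sheaf :: "'s presheaf \<Rightarrow> 't presheaf \<Rightarrow> ('s \<times> 't) fam presheaf" where
  "bilinear_sheaf F G =
     fam_sheaf (\<lambda>W. carrier (sec F W) \<times> carrier (sec G W))
       (\<lambda>W V. map_prod (res F W V) (res G W V))
       (\<lambda>W b. (\<forall>y\<in>carrier (sec G W). linear_form F W (\<lambda>x. b (x, y))) \<and>
              (\<forall>x\<in>carrier (sec F W). linear_form G W (\<lambda>y. b (x, y))))"

definition trilinear ::
    "'s presheaf \<Rightarrow> 't presheaf \<Rightarrow> 'u presheaf \<Rightarrow> point set \<Rightarrow> ('s \<times> 't \<times> 'u \<Rightarrow> reg) \<Rightarrow> bool" where
  "trilinear F G H W b \<longleftrightarrow>
     (\<forall>y\<in>carrier (sec G W). \<forall>z\<in>carrier (sec H W). linear_form F W (\<lambda>x. b (x, y, z))) \<and>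
     (\<forall>x\<in>carrier (sec F W). \<forall>z\<in>carrier (sec H W). linear_form G W (\<lambda>y. b (x, y, z))) \<and>
     (\<forall>x\<in>carrier (sec F W). \<forall>y\<in>carrier (sec G W). linear_form H W (\<lambda>z. b (x, y, z)))"

definition trilinear_sheaf ::
    "'s presheaf \<Rightarrow> 't presheaf \<Rightarrow> 'u presheaf \<Rightarrow> ('s \<times> 't \<times> 'u) fam presheaf" where
  "trilinear_sheaf F G H =
     fam_sheaf (\<lambda>W. carrier (sec F W) \<times> carrier (sec G W) \<times> carrier (sec H W))
       (\<lambda>W V. map_prod (res F W V) (map_prod (res G W V) (res H W V)))
       (trilinear F G H)"

text \<open>Maps \<open>F \<times> G \<times> G \<rightarrow> \<O>\<^sub>X\<close> that are trilinear and alternating in the last two arguments, that is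
  linear forms on \<open>F \<otimes> \<Lambda>\<^sup>2 G\<close>\<close>

definition alternating_sheaf :: "'s presheaf \<Rightarrow> 't presheaf \<Rightarrow> ('s \<times> 't \<times> 't) fam presheaf" where
  "alternating_sheaf F G =
     fam_sheaf (\<lambda>W. carrier (sec F W) \<times> carrier (sec G W) \<times> carrier (sec G W))
       (\<lambda>W V. map_prod (res F W V) (map_prod (res G W V) (res G W V)))
       (\<lambda>W b. trilinear F G G W b \<and>
          (\<forall>x\<in>carrier (sec F W). \<forall>y\<in>carrier (sec G W). b (x, y, y) = \<zero>\<^bsub>reg_ring W\<^esub>))"

text \<open>Tensor products are reflexive, i.e. they are the double duals of the tensor products of
  \<open>\<O>\<^sub>X\<close>-modules. By the universal property, the dual of \<open>F \<otimes> G\<close> is the sheaf of bilinear maps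
  \<open>F \<times> G \<rightarrow> \<O>\<^sub>X\<close>, so the double dual is the dual of that sheaf; similarly for \<open>F \<otimes> G \<otimes> H\<close> and
  \<open>F \<otimes> \<Lambda>\<^sup>2 G\<close>.\<close>

definition tensor :: "'s presheaf \<Rightarrow> 't presheaf \<Rightarrow> ('s \<times> 't) fam fam presheaf" where
  "tensor F G = dual_sheaf (bilinear_sheaf F G)"

definition tensor3 ::
    "'s presheaf \<Rightarrow> 't presheaf \<Rightarrow> 'u presheaf \<Rightarrow> ('s \<times> 't \<times> 'u) fam fam presheaf" where
  "tensor3 F G H = dual_sheaf (trilinear_sheaf F G H)"

definition tensor_wedge2 :: "'s presheaf \<Rightarrow> 't presheaf \<Rightarrow> ('s \<times> 't \<times> 't) fam fam presheaf" where
  "tensor_wedge2 F G = dual_sheaf (alternating_sheaf F G)"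

text \<open>The section \<open>s \<otimes> v\<close> of \<open>F \<otimes> G\<close> over \<open>U\<close>\<close>

definition pure_tensor :: "'s presheaf \<Rightarrow> 't presheaf \<Rightarrow> point set \<Rightarrow> 's \<Rightarrow> 't \<Rightarrow> ('s \<times> 't) fam fam"
  where
  "pure_tensor F G U s v =
     (\<lambda>W\<in>opens U. \<lambda>\<beta>\<in>carrier (sec (bilinear_sheaf F G) W). \<beta> W (res F U W s, res G U W v))"

subsection \<open>Higgs fields\<close>

definition pre_higgs_field :: "'s presheaf \<Rightarrow> (point set \<Rightarrow> 's \<Rightarrow> 's tensor_T) \<Rightarrow> bool" where
  "pre_higgs_field E \<Phi> \<longleftrightarrow> sheaf_map E (tensor E tangent_sheaf) \<Phi>"

text \<open>Pullback along \<open>\<Phi> \<otimes> id : E \<otimes> \<T>\<^sub>X \<rightarrow> E \<otimes> \<T>\<^sub>X \<otimes> \<T>\<^sub>X\<close> of a linear form on the target, that is of a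
  trilinear map \<open>\<tau>\<close>: it sends \<open>e \<otimes> v\<close> to the value of \<open>\<tau>(\<cdot>, \<cdot>, v)\<close> at \<open>\<Phi>(e)\<close>.\<close>

definition pullback_form ::
    "'s presheaf \<Rightarrow> (point set \<Rightarrow> 's \<Rightarrow> 's tensor_T) \<Rightarrow> point set \<Rightarrow>
     ('s \<times> vfield \<times> vfield) fam \<Rightarrow> ('s \<times> vfield) fam" where
  "pullback_form E \<Phi> W \<tau> =
     (\<lambda>V\<in>opens W. restrict (\<lambda>(e, v).
        \<Phi> V e V (\<lambda>V'\<in>opens V. restrict (\<lambda>(e', w). \<tau> V' (e', w, res tangent_sheaf V V' v))
          (carrier (sec E V') \<times> carrier (sec tangent_sheaf V'))))
        (carrier (sec E V) \<times> carrier (sec tangent_sheaf V)))"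

text \<open>\<open>\<Phi> \<otimes> id\<close> on double duals\<close>

definition tensor_id ::
    "'s presheaf \<Rightarrow> (point set \<Rightarrow> 's \<Rightarrow> 's tensor_T) \<Rightarrow> point set \<Rightarrow>
     's tensor_T \<Rightarrow> ('s \<times> vfield \<times> vfield) fam fam" where
  "tensor_id E \<Phi> U \<xi> =
     (\<lambda>W\<in>opens U. \<lambda>\<tau>\<in>carrier (sec (trilinear_sheaf E tangent_sheaf tangent_sheaf) W).
        \<xi> W (pullback_form E \<Phi> W \<tau>))"

text \<open>\<open>id \<otimes> \<and> : E \<otimes> \<T>\<^sub>X \<otimes> \<T>\<^sub>X \<rightarrow> E \<otimes> \<Lambda>\<^sup>2 \<T>\<^sub>X\<close>, dual to the inclusion of alternating into trilinear maps\<close>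

definition id_wedge ::
    "'s presheaf \<Rightarrow> point set \<Rightarrow> ('s \<times> vfield \<times> vfield) fam fam \<Rightarrow>
     ('s \<times> vfield \<times> vfield) fam fam" where
  "id_wedge E U \<zeta> =
     (\<lambda>W\<in>opens U. \<lambda>\<omega>\<in>carrier (sec (alternating_sheaf E tangent_sheaf) W). \<zeta> W \<omega>)"

definition higgs_wedge ::
    "'s presheaf \<Rightarrow> (point set \<Rightarrow> 's \<Rightarrow> 's tensor_T) \<Rightarrow> point set \<Rightarrow>
     's \<Rightarrow> ('s \<times> vfield \<times> vfield) fam fam" where
  "higgs_wedge E \<Phi> U e = id_wedge E U (tensor_id E \<Phi> U (\<Phi> U e))"

definition higgs_field :: "'s presheaf \<Rightarrow> (point set \<Rightarrow> 's \<Rightarrow> 's tensor_T) \<Rightarrow> bool" where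
  "higgs_field E \<Phi> \<longleftrightarrow> pre_higgs_field E \<Phi> \<and>
     (\<forall>U. zopen U \<longrightarrow> (\<forall>e\<in>carrier (sec E U).
        higgs_wedge E \<Phi> U e = \<zero>\<^bsub>sec (tensor_wedge2 E tangent_sheaf) U\<^esub>))"

subsection \<open>Toric sheaves\<close>

definition translate :: "point \<Rightarrow> reg \<Rightarrow> reg" where
  "translate t f = (\<lambda>x. f (act (torus_inv t) x))"

definition weight_vector ::
    "'s presheaf \<Rightarrow> (point \<Rightarrow> point set \<Rightarrow> 's \<Rightarrow> 's) \<Rightarrow> point set \<Rightarrow> int vec \<Rightarrow> 's \<Rightarrow> bool" where
  "weight_vector F \<alpha> U m s \<longleftrightarrow> s \<in> carrier (sec F U) \<and>
     (\<forall>t\<in>torus n. \<alpha> t U s = const U (chi m t) \<odot>\<^bsub>sec F U\<^esub> s)"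

text \<open>A \<open>T\<close>-linearization, given by the maps \<open>\<alpha> t U : F(U) \<rightarrow> F(t U)\<close>, which lift the action on \<open>\<O>\<^sub>X\<close>.
  The last condition is the algebraicity of the action: the representation of \<open>T\<close> on the sections over
  every (invariant) affine chart is rational. Equivalently, the \<open>\<alpha> t\<close> come from an isomorphism between
  the pullbacks of \<open>F\<close> along the action map and the projection \<open>T \<times> X \<rightarrow> X\<close>.\<close>

definition linearization :: "'s presheaf \<Rightarrow> (point \<Rightarrow> point set \<Rightarrow> 's \<Rightarrow> 's) \<Rightarrow> bool" where
  "linearization F \<alpha> \<longleftrightarrow>
     (\<forall>t\<in>torus n. \<forall>U. zopen U \<longrightarrow>
        \<alpha> t U \<in> carrier (sec F U) \<rightarrow> carrier (sec F (act t ` U)) \<and>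
        (\<forall>s\<in>carrier (sec F U). \<forall>s'\<in>carrier (sec F U).
           \<alpha> t U (s \<oplus>\<^bsub>sec F U\<^esub> s') = \<alpha> t U s \<oplus>\<^bsub>sec F (act t ` U)\<^esub> \<alpha> t U s') \<and>
        (\<forall>f\<in>carrier (reg_ring U). \<forall>s\<in>carrier (sec F U).
           \<alpha> t U (f \<odot>\<^bsub>sec F U\<^esub> s) = translate t f \<odot>\<^bsub>sec F (act t ` U)\<^esub> \<alpha> t U s) \<and>
        (\<forall>V\<in>opens U. \<forall>s\<in>carrier (sec F U).
           res F (act t ` U) (act t ` V) (\<alpha> t U s) = \<alpha> t V (res F U V s))) \<and>
     (\<forall>U. zopen U \<longrightarrow> (\<forall>s\<in>carrier (sec F U).
        \<alpha> (torus_one n) U s = s \<and>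
        (\<forall>t\<in>torus n. \<forall>t'\<in>torus n. \<alpha> (act t t') U s = \<alpha> t (act t' ` U) (\<alpha> t' U s)))) \<and>
     (\<forall>\<sigma>\<in>\<Delta>. \<forall>s\<in>carrier (sec F (chart \<sigma>)). \<exists>A w.
        finite A \<and> A \<subseteq> carrier_vec n \<and> (\<forall>m\<in>A. weight_vector F \<alpha> (chart \<sigma>) m (w m)) \<and>
        s = (\<Oplus>\<^bsub>sec F (chart \<sigma>)\<^esub>m\<in>A. w m))"

definition toric_sheaf :: "'s presheaf \<Rightarrow> (point \<Rightarrow> point set \<Rightarrow> 's \<Rightarrow> 's) \<Rightarrow> bool" where
  "toric_sheaf E \<alpha> \<longleftrightarrow> sheaf_of_modules E \<and> reflexive E \<and> linearization E \<alpha>"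

subsection \<open>The fibre\<close>

text \<open>\<open>\<mm>\<^sub>x F\<close> on the open neighbourhood \<open>W\<close> of \<open>x\<close>\<close>

definition max_ideal_sections :: "'s presheaf \<Rightarrow> point \<Rightarrow> point set \<Rightarrow> 's set" where
  "max_ideal_sections F x W =
     {(\<Oplus>\<^bsub>sec F W\<^esub>g\<in>G. a g \<odot>\<^bsub>sec F W\<^esub> g) | G a.
        finite G \<and> G \<subseteq> carrier (sec F W) \<and> a \<in> G \<rightarrow> {f \<in> carrier (reg_ring W). f x = 0}}"

text \<open>The class in \<open>F\<^sub>x / \<mm>\<^sub>x F\<^sub>x\<close> of the germ at \<open>x\<close> of a section \<open>s\<close> over \<open>U\<close>, as the set of all sections
  near \<open>x\<close> that have the same class; two germs are congruent modulo \<open>\<mm>\<^sub>x F\<^sub>x\<close> iff the difference of their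
  representatives lies in \<open>\<mm>\<^sub>x F\<close> on some neighbourhood of \<open>x\<close>.\<close>

definition fibre_class ::
    "'s presheaf \<Rightarrow> point \<Rightarrow> point set \<Rightarrow> 's \<Rightarrow> (point set \<times> 's) set" where
  "fibre_class F x U s =
     {(V, s'). zopen V \<and> x \<in> V \<and> s' \<in> carrier (sec F V) \<and>
        (\<exists>W\<in>opens (U \<inter> V). x \<in> W \<and>
           res F U W s \<ominus>\<^bsub>sec F W\<^esub> res F V W s' \<in> max_ideal_sections F x W)}"

definition fibre :: "'s presheaf \<Rightarrow> point \<Rightarrow> (complex, (point set \<times> 's) set) module" where
  "fibre F x =
     \<lparr>carrier = {fibre_class F x U s | U s. zopen U \<and> x \<in> U \<and> s \<in> carrier (sec F U)},
      mult = undefined, one = undefined,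
      zero = fibre_class F x X \<zero>\<^bsub>sec F X\<^esub>,
      add = (\<lambda>a b. \<Union>(U, s)\<in>a. \<Union>(V, s')\<in>b.
        fibre_class F x (U \<inter> V) (res F U (U \<inter> V) s \<oplus>\<^bsub>sec F (U \<inter> V)\<^esub> res F V (U \<inter> V) s')),
      smult = (\<lambda>c a. \<Union>(U, s)\<in>a. fibre_class F x U (const U c \<odot>\<^bsub>sec F U\<^esub> s))\<rparr>"

abbreviation fibre_at_one :: "'s presheaf \<Rightarrow> (complex, (point set \<times> 's) set) module" where
  "fibre_at_one F \<equiv> fibre F (torus_one n)"

subsection \<open>Homogeneous components\<close>

text \<open>The invariant vector field given by \<open>v \<in> N\<^sub>\<complex>\<close>, i.e. the derivative along \<open>z \<mapsto> exp(z v) \<in> T\<close>; it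
  maps \<open>\<chi>\<^sup>m\<close> to \<open>\<langle>m, v\<rangle> \<chi>\<^sup>m\<close>. Its value at \<open>1\<close> is the tangent vector \<open>v\<close>, which is the identification of
  \<open>N\<^sub>\<complex>\<close> with the fibre of \<open>\<T>\<^sub>X\<close>.\<close>

definition invariant_field :: "point set \<Rightarrow> complex vec \<Rightarrow> vfield" where
  "invariant_field U v = (\<lambda>W\<in>opens U. \<lambda>f\<in>carrier (reg_ring W).
     on_set W (\<lambda>x. deriv (\<lambda>z. f (act (torus_exp n (z \<cdot>\<^sub>v v)) x)) 0))"

definition invariant_sections :: "'s presheaf \<Rightarrow> (point \<Rightarrow> point set \<Rightarrow> 's \<Rightarrow> 's) \<Rightarrow> 's set" where
  "invariant_sections F \<alpha> = {s \<in> carrier (sec F (torus n)). \<forall>t\<in>torus n. \<alpha> t (torus n) s = s}"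

text \<open>With the standard basis of \<open>N\<^sub>\<complex>\<close>, an element of \<open>V \<otimes> N\<^sub>\<complex>\<close> is an \<open>n\<close>-tuple \<open>u\<close> of elements of \<open>V\<close>,
  standing for \<open>\<Sum>\<^sub>i u i \<otimes> e\<^sub>i\<close>.\<close>

definition tensor_N :: "(complex, 'v) module \<Rightarrow> (nat \<Rightarrow> 'v) set" where
  "tensor_N V = {..<n} \<rightarrow>\<^sub>E carrier V"

definition linear_to_tensor_N :: "(complex, 'v) module \<Rightarrow> ('v \<Rightarrow> nat \<Rightarrow> 'v) \<Rightarrow> bool" where
  "linear_to_tensor_N V \<phi> \<longleftrightarrow> \<phi> \<in> carrier V \<rightarrow>\<^sub>E tensor_N V \<and>
     (\<forall>i<n. (\<lambda>e. \<phi> e i) \<in> LinearCombinations.module_hom class_ring V V)"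

definition component_support ::
    "(complex, 'v) module \<Rightarrow> (int vec \<Rightarrow> 'v \<Rightarrow> nat \<Rightarrow> 'v) \<Rightarrow> int vec set" where
  "component_support V \<phi> = {r \<in> carrier_vec n. \<exists>e\<in>carrier V. \<exists>i<n. \<phi> r e i \<noteq> \<zero>\<^bsub>V\<^esub>}"

text \<open>\<open>\<Phi> = \<Sum>\<^sub>r \<phi>\<^sup>r \<otimes> \<chi>\<^sup>r\<close>. Over \<open>T\<close> the linearization identifies \<open>E\<close> with (fibre at \<open>1\<close>) \<open>\<otimes> \<O>\<^sub>T\<close>, an element
  of the fibre corresponding to the invariant section with that value at \<open>1\<close>; likewise \<open>v \<in> N\<^sub>\<complex>\<close>
  corresponds to the invariant field of \<open>v\<close>. Under these identifications an invariant section \<open>e\<close> is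
  mapped to \<open>\<Sum>\<^sub>r \<chi>\<^sup>r \<phi>\<^sup>r(e)\<close>; below, \<open>u r i\<close> is the invariant section given by the \<open>i\<close>-th coordinate of
  \<open>\<phi>\<^sup>r(e)\<close>.\<close>

definition homogeneous_decomposition ::
    "'s presheaf \<Rightarrow> (point \<Rightarrow> point set \<Rightarrow> 's \<Rightarrow> 's) \<Rightarrow> (point set \<Rightarrow> 's \<Rightarrow> 's tensor_T) \<Rightarrow>
     (int vec \<Rightarrow> (point set \<times> 's) set \<Rightarrow> nat \<Rightarrow> (point set \<times> 's) set) \<Rightarrow> bool" where
  "homogeneous_decomposition E \<alpha> \<Phi> \<phi> \<longleftrightarrow>
     (\<forall>r\<in>carrier_vec n. linear_to_tensor_N (fibre_at_one E) (\<phi> r)) \<and>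
     finite (component_support (fibre_at_one E) \<phi>) \<and>
     (\<forall>e\<in>invariant_sections E \<alpha>. \<exists>u.
        (\<forall>r\<in>carrier_vec n. \<forall>i<n. u r i \<in> invariant_sections E \<alpha> \<and>
           fibre_class E (torus_one n) (torus n) (u r i)
             = \<phi> r (fibre_class E (torus_one n) (torus n) e) i) \<and>
        \<Phi> (torus n) e =
          (\<Oplus>\<^bsub>sec (tensor E tangent_sheaf) (torus n)\<^esub>r\<in>component_support (fibre_at_one E) \<phi>.
             on_set (torus n) (chi r) \<odot>\<^bsub>sec (tensor E tangent_sheaf) (torus n)\<^esub>
             (\<Oplus>\<^bsub>sec (tensor E tangent_sheaf) (torus n)\<^esub>i\<in>{..<n}.
                pure_tensor E tangent_sheaf (torus n) (u r i)
                  (invariant_field (torus n) (unit_vec n i)))))"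

text \<open>\<open>id \<otimes> s : V \<otimes> N\<^sub>\<complex> \<rightarrow> V\<close> for \<open>s \<in> M\<close>\<close>

definition contract_N :: "(complex, 'v) module \<Rightarrow> int vec \<Rightarrow> (nat \<Rightarrow> 'v) \<Rightarrow> 'v" where
  "contract_N V s u = (\<Oplus>\<^bsub>V\<^esub>i\<in>{..<n}. complex_of_int (s $ i) \<odot>\<^bsub>V\<^esub> u i)"

text \<open>\<open>\<Phi>\<^sub>s = \<Sum>\<^sub>r \<phi>\<^sup>r\<^sub>s \<otimes> \<chi>\<^sup>r\<close> with \<open>\<phi>\<^sup>r\<^sub>s = (id \<otimes> s) \<circ> \<phi>\<^sup>r\<close>\<close>

definition Phi_s ::
    "(complex, 'v) module \<Rightarrow> (int vec \<Rightarrow> 'v \<Rightarrow> nat \<Rightarrow> 'v) \<Rightarrow> int vec \<Rightarrow> int vec \<Rightarrow> 'v \<Rightarrow> 'v" where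
  "Phi_s V \<phi> s = (\<lambda>r\<in>carrier_vec n. \<lambda>e\<in>carrier V. contract_N V s (\<phi> r e))"

text \<open>Evaluation at \<open>t \<in> T\<close> of an element of \<open>A \<otimes> \<complex>[M]\<close>\<close>

definition eval_at :: "(complex, 'a) module \<Rightarrow> (int vec \<Rightarrow> 'a) \<Rightarrow> point \<Rightarrow> 'a" where
  "eval_at A a t = (\<Oplus>\<^bsub>A\<^esub>r\<in>{r \<in> carrier_vec n. a r \<noteq> \<zero>\<^bsub>A\<^esub>}. chi r t \<odot>\<^bsub>A\<^esub> a r)"

definition higgs_algebra ::
    "(complex, 'v) module \<Rightarrow> (int vec \<Rightarrow> 'v \<Rightarrow> nat \<Rightarrow> 'v) \<Rightarrow> point \<Rightarrow> ('v \<Rightarrow> 'v) set" where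
  "higgs_algebra V \<phi> t =
     generated_subalgebra (End_algebra V)
       {eval_at (End_algebra V) (Phi_s V \<phi> s) t | s. s \<in> carrier_vec n}"

end

end

theory Submission
  imports Defs
begin

text \<open>
  Over the torus \<open>T\<close> the contraction of \<open>\<Phi>\<close> with the logarithmic differential
  \<open>dlog \<chi>\<^sup>s = \<chi>\<^sup>-\<^sup>s d\<chi>\<^sup>s\<close> is an \<open>\<O>\<^sub>T\<close>-linear endomorphism of \<open>E|T\<close>. Since \<open>dlog \<chi>\<^sup>s\<close> has the
  constant value \<open>\<langle>s, v\<rangle>\<close> on the invariant vector field of \<open>v\<close>, this endomorphism maps the invariant
  section with value \<open>e\<close> at \<open>1\<close> to \<open>\<Sum>\<^sub>r \<chi>\<^sup>r \<phi>\<^sup>r\<^sub>s(e)\<close>: it is \<open>\<Phi>\<^sub>s\<close>. Pairing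
  \<open>\<Phi> \<and> \<Phi> = 0\<close> with \<open>dlog \<chi>\<^sup>s \<and> dlog \<chi>\<^sup>s\<^sup>'\<close> says that the contractions for \<open>s\<close> and
  \<open>s'\<close> commute.

  Tensor products are double duals here, so that sections of \<open>E \<otimes> \<T>\<^sub>X\<close> are known by their values on
  bilinear forms. Therefore the argument runs on the dual of \<open>E\<close>. A local linear form \<open>\<gamma>\<close> on \<open>E\<close>
  is sent to \<open>e \<mapsto> \<Phi>(e)(\<gamma> \<otimes> dlog \<chi>\<^sup>s)\<close>, the transpose of the contraction, and
  \<open>\<Phi> \<and> \<Phi> = 0\<close>, evaluated on \<open>\<gamma> \<otimes> (dlog \<chi>\<^sup>s \<and> dlog \<chi>\<^sup>s\<^sup>')\<close>, makes these
  transposes commute (\<open>Phi_transpose_commute\<close>). On invariant sections the transposes are given by the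
  homogeneous components of \<open>\<Phi>\<close> (\<open>contraction_of_invariant\<close>), and reflexivity of \<open>E\<close> turns the
  equality of all linear forms into an equality of sections over \<open>T\<close> (\<open>sections_separated\<close>). Translating
  that equality by \<open>t\<close> and taking values at \<open>1\<close> shows that \<open>\<Sum>\<^sub>p\<^sub>q \<chi>\<^sup>p\<^sup>+\<^sup>q(t) \<phi>\<^sup>p\<^sub>s \<phi>\<^sup>q\<^sub>s\<^sub>'\<close> is symmetric in
  \<open>s\<close> and \<open>s'\<close> for every \<open>t \<in> T\<close> (\<open>contractions_commute\<close>). This is the commutation of \<open>\<Phi>\<^sub>s(t)\<close> with
  \<open>\<Phi>\<^sub>s\<^sub>'(t)\<close>, and by the linear independence of characters (\<open>characters_independent\<close>) the coefficients
  agree as well, which is \<open>[\<Phi>\<^sub>s, \<Phi>\<^sub>s\<^sub>'] = 0\<close>.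

  Three facts make this work. The torus is an open subset of \<open>X\<close>, and so are its principal open subsets,
  because the dual of every cone of the fan contains a character that vanishes exactly outside the torus on
  the chart of the cone (\<open>interior_character\<close>, \<open>zopen_principal\<close>). The fields of \<open>v \<in> N\<^sub>\<complex>\<close> are sections of the tangent
  sheaf over \<open>T\<close> (\<open>invariant_field_in_tangent_sheaf\<close>). The fibre at \<open>1\<close> is a complex vector space, and
  each of its elements is the value of an invariant section (\<open>invariant_representative\<close>): by coherence
  it is represented by a section over \<open>T\<close>, this section is a sum of weight vectors, and multiplying the
  vector of weight \<open>m\<close> by \<open>\<chi>\<^sup>m\<close> makes it invariant without changing its value at \<open>1\<close>.

  Finally, commuting elements generate a commutative subalgebra, by the usual double centralizer
  argument (\<open>generated_commutative\<close>), and \<open>n\<close> generators are enough because \<open>\<Phi>\<^sub>s(t)\<close> is linear in \<open>s\<close>.\<close>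


section \<open>Integral functionals in the interior of a dual cone\<close>

no_notation Finite_Cartesian_Product.vec_nth (infixl \<open>$\<close> 90)

lemma exists_small_perturbation:
  fixes p q :: "'i \<Rightarrow> 'a::linordered_field"
  assumes "finite I" "\<And>i. i \<in> I \<Longrightarrow> 0 < p i"
  shows "\<exists>\<delta>>0. \<forall>i\<in>I. 0 < p i + \<delta> * q i"
  using assms
proof (induction I)
  case empty
  show ?case by (auto intro: exI[of _ 1])
next
  case (insert b I)
  then obtain \<delta> where \<delta>: "0 < \<delta>" "\<forall>i\<in>I. 0 < p i + \<delta> * q i" by auto
  define \<epsilon> where "\<epsilon> = min \<delta> (p b / (\<bar>q b\<bar> + 1))"
  have q1: "0 < \<bar>q b\<bar> + 1" by (simp add: add_nonneg_pos)
  have \<epsilon>: "0 < \<epsilon>" "\<epsilon> \<le> \<delta>"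
    using \<delta>(1) insert.prems[of b] q1 by (auto simp: \<epsilon>_def)
  have \<epsilon>': "\<epsilon> * (\<bar>q b\<bar> + 1) \<le> p b"
    using q1 by (subst pos_le_divide_eq[symmetric]) (auto simp: \<epsilon>_def)
  have "0 < p b + \<epsilon> * q b"
  proof -
    have "- (\<epsilon> * q b) \<le> \<epsilon> * \<bar>q b\<bar>"
      using \<epsilon>(1) by (metis abs_ge_minus_self abs_mult abs_of_pos)
    also have "\<dots> < \<epsilon> * (\<bar>q b\<bar> + 1)" using \<epsilon>(1) by (simp add: algebra_simps)
    also have "\<dots> \<le> p b" by (rule \<epsilon>')
    finally show ?thesis by simp
  qed
  moreover have "0 < p i + \<epsilon> * q i" if i: "i \<in> I" for i
  proof (cases "0 \<le> q i")
    case True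
    then show ?thesis using insert.prems[of i] i \<epsilon>(1) by (simp add: add_pos_nonneg)
  next
    case False
    then have "\<delta> * q i \<le> \<epsilon> * q i" using \<epsilon>(2) by (simp add: mult_right_mono_neg)
    then show ?thesis using \<delta>(2) i by force
  qed
  ultimately show ?case using \<epsilon>(1) by auto
qed

text \<open>Induction on the family. Removing from each \<open>a i\<close> its component along \<open>a b\<close> gives a smaller family. If
  some \<open>w\<close> is positive on it, then \<open>w\<close> can be corrected along \<open>a b\<close> to become slightly positive on \<open>a b\<close>.
  Otherwise a nonnegative combination of the \<open>a i\<close> is a multiple of \<open>a b\<close>. For a multiple at most zero this
  is the second alternative; for a positive one, a functional that is positive on the \<open>a i\<close> is positive on
  \<open>a b\<close> too, and the induction hypothesis applies to the original \<open>a i\<close>.\<close>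

lemma gordan_alternative:
  fixes a :: "'i \<Rightarrow> nat \<Rightarrow> 'a::linordered_field"
  assumes "finite I"
  shows "(\<exists>u. \<forall>i\<in>I. 0 < (\<Sum>k<n. u k * a i k)) \<or>
    (\<exists>c. (\<forall>i\<in>I. 0 \<le> c i) \<and> (\<exists>i\<in>I. c i \<noteq> 0) \<and> (\<forall>k<n. (\<Sum>i\<in>I. c i * a i k) = 0))"
  using assms
proof (induction I arbitrary: a)
  case empty
  show ?case by auto
next
  case (insert b I)
  define d :: "(nat \<Rightarrow> 'a) \<Rightarrow> (nat \<Rightarrow> 'a) \<Rightarrow> 'a" where "d u v = (\<Sum>k<n. u k * v k)" for u v
  have d_add: "d u (\<lambda>k. v k + c * w k) = d u v + c * d u w" for u v w c
    by (simp add: d_def sum.distrib sum_distrib_left algebra_simps)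
  have d_comm: "d u v = d v u" for u v by (simp add: d_def mult.commute)
  show ?case
  proof (rule ccontr)
    assume neg: "\<not> ?case"
    have no_c: False
      if c: "0 \<le> \<beta>" "\<forall>i\<in>I. 0 \<le> c i" "\<beta> \<noteq> 0 \<or> (\<exists>i\<in>I. c i \<noteq> 0)"
        "\<forall>k<n. \<beta> * a b k + (\<Sum>i\<in>I. c i * a i k) = 0" for \<beta> c
    proof -
      define c' where "c' i = (if i = b then \<beta> else c i)" for i
      have c'_b: "c' b = \<beta>" and c'_I: "c' i = c i" if "i \<in> I" for i
        using that insert.hyps(2) by (auto simp: c'_def)
      have sum_eq: "(\<Sum>i\<in>insert b I. c' i * a i k) = \<beta> * a b k + (\<Sum>i\<in>I. c i * a i k)" for k
        using insert.hyps by (simp add: c'_def cong: if_cong) (auto intro: sum.cong)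
      have "\<forall>k<n. (\<Sum>i\<in>insert b I. c' i * a i k) = 0" using c(4) sum_eq by metis
      moreover have "\<forall>i\<in>insert b I. 0 \<le> c' i" using c(1,2) by (simp add: c'_def)
      moreover have "\<exists>i\<in>insert b I. c' i \<noteq> 0"
        using c(3) insert.hyps(2) unfolding c'_def by (metis insertI1 insertI2)
      ultimately show False using neg by blast
    qed
    have no_u: False if "\<forall>i\<in>insert b I. 0 < d u (a i)" for u
      using neg that unfolding d_def by blast
    have bb: "0 < d (a b) (a b)"
    proof -
      have "0 \<le> d (a b) (a b)" unfolding d_def by (rule sum_nonneg) simp
      moreover have "d (a b) (a b) \<noteq> 0"
      proof
        assume "d (a b) (a b) = 0"
        then have z: "\<forall>k<n. a b k = 0"
          unfolding d_def by (subst (asm) sum_nonneg_eq_0_iff) auto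
        show False
          by (rule no_c[of 1 "\<lambda>_. 0"]) (use z in auto)
      qed
      ultimately show ?thesis by simp
    qed
    define pr where "pr i = d (a i) (a b) / d (a b) (a b)" for i
    have "(\<exists>w. \<forall>i\<in>I. 0 < d w (\<lambda>k. a i k + (- pr i) * a b k)) \<or>
      (\<exists>c. (\<forall>i\<in>I. 0 \<le> c i) \<and> (\<exists>i\<in>I. c i \<noteq> 0) \<and>
        (\<forall>k<n. (\<Sum>i\<in>I. c i * (a i k + (- pr i) * a b k)) = 0))"
      unfolding d_def by (rule insert.IH)
    then consider (u) w where "\<forall>i\<in>I. 0 < d w (\<lambda>k. a i k + (- pr i) * a b k)"
      | (c) c where "\<forall>i\<in>I. 0 \<le> c i" "\<exists>i\<in>I. c i \<noteq> 0"
          "\<forall>k<n. (\<Sum>i\<in>I. c i * (a i k + (- pr i) * a b k)) = 0"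
      by blast
    then show False
    proof cases
      case u
      have "\<exists>\<delta>>0. \<forall>i\<in>I. 0 < d w (\<lambda>k. a i k + (- pr i) * a b k) + \<delta> * d (a i) (a b)"
        by (rule exists_small_perturbation[OF insert.hyps(1)]) (use u in blast)
      then obtain \<delta> where \<delta>: "0 < \<delta>"
        "\<forall>i\<in>I. 0 < d w (\<lambda>k. a i k + (- pr i) * a b k) + \<delta> * d (a i) (a b)"
        by blast
      \<comment> \<open>the product with \<open>a b\<close> becomes \<open>\<delta>\<close> times that of \<open>a b\<close> with itself; those with the projected \<open>a i\<close> do not change\<close>
      define w' where "w' = (\<lambda>k. w k + (\<delta> - d w (a b) / d (a b) (a b)) * a b k)"
      have w': "d w' v = d w v + (\<delta> - d w (a b) / d (a b) (a b)) * d v (a b)" for v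
        unfolding w'_def by (subst d_comm, subst d_add) (simp add: d_comm)
      have "0 < d w' (a b)" using bb \<delta>(1) by (simp add: w' field_simps)
      moreover have "0 < d w' (a i)" if "i \<in> I" for i
      proof -
        have "d w' (a i) = d w (\<lambda>k. a i k + (- pr i) * a b k) + \<delta> * d (a i) (a b)"
          unfolding w' d_add pr_def by (simp add: left_diff_distrib)
        then show ?thesis using \<delta>(2) that by simp
      qed
      ultimately show False using no_u by auto
    next
      case c
      define \<beta> where "\<beta> = (\<Sum>i\<in>I. c i * pr i)"
      have eq: "(\<Sum>i\<in>I. c i * a i k) = \<beta> * a b k" if "k < n" for k
        using c(3) that by (simp add: \<beta>_def algebra_simps sum_subtractf sum_distrib_left)
      have "(\<exists>u. \<forall>i\<in>I. 0 < d u (a i)) \<or>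
        (\<exists>c. (\<forall>i\<in>I. 0 \<le> c i) \<and> (\<exists>i\<in>I. c i \<noteq> 0) \<and> (\<forall>k<n. (\<Sum>i\<in>I. c i * a i k) = 0))"
        unfolding d_def by (rule insert.IH)
      then consider u where "\<forall>i\<in>I. 0 < d u (a i)"
        | c' where "\<forall>i\<in>I. 0 \<le> c' i" "\<exists>i\<in>I. c' i \<noteq> 0" "\<forall>k<n. (\<Sum>i\<in>I. c' i * a i k) = 0"
        by blast
      then show False
      proof cases
        case 1
        show False
        proof (cases "\<beta> \<le> 0")
          case True
          show False
            by (rule no_c[of "- \<beta>" c]) (use True c(1,2) eq in auto)
        next
          case False
          have "\<beta> * d u (a b) = (\<Sum>k<n. u k * (\<beta> * a b k))"
            by (simp add: d_def sum_distrib_left algebra_simps)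
          also have "\<dots> = (\<Sum>k<n. \<Sum>i\<in>I. c i * (u k * a i k))"
            by (rule sum.cong) (auto simp: eq[symmetric] sum_distrib_left algebra_simps)
          also have "\<dots> = (\<Sum>i\<in>I. c i * d u (a i))"
            by (subst sum.swap) (simp add: d_def sum_distrib_left)
          also have "\<dots> > 0"
          proof -
            obtain i where "i \<in> I" "c i \<noteq> 0" using c(2) by blast
            then show ?thesis
              using c(1) 1 insert.hyps(1) by (intro sum_pos2[of I i]) (auto simp: less_le)
          qed
          finally have "0 < d u (a b)" using False by (simp add: zero_less_mult_iff)
          then show False using no_u 1 by auto
        qed
      next
        case 2
        show False
          by (rule no_c[of 0 c']) (use 2 in auto)
      qed
    qed
  qed
qed

lemma rat_common_denominator:
  fixes u :: "'k \<Rightarrow> rat"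
  assumes "finite K"
  shows "\<exists>D::int. 0 < D \<and> (\<forall>k\<in>K. of_int D * u k \<in> \<int>)"
  using assms
proof (induction K)
  case empty
  show ?case by (auto intro: exI[of _ 1])
next
  case (insert b K)
  then obtain D where D: "0 < D" "\<forall>k\<in>K. of_int D * u k \<in> \<int>" by blast
  obtain p q where pq: "u b = Rat.Fract p q" "0 < q" using Rat_cases by metis
  have "of_int (q * D) * u b = of_int (D * p)"
    using pq by (simp add: Fract_of_int_quotient)
  moreover have "of_int (q * D) * u k \<in> \<int>" if "k \<in> K" for k
  proof -
    have "of_int q * (of_int D * u k) \<in> \<int>" using D(2) that by (simp only: Ints_mult[OF Ints_of_int])
    then show ?thesis by (simp only: of_int_mult mult.assoc)
  qed
  ultimately show ?case using D(1) pq(2)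
    by (intro exI[of _ "q * D"]) (metis Ints_of_int insert_iff mult_pos_pos)
qed

text \<open>The second alternative of Gordan's theorem, applied to the nonzero generators, exhibits the negative of a
  generator as an element of the cone, which strong convexity forbids. Working over the rationals and
  clearing denominators makes the functional integral.\<close>

lemma (in toric_variety) strictly_positive_functional:
  assumes "\<sigma> \<in> \<Delta>"
  obtains m A where "m \<in> carrier_vec n" "finite A" "A \<subseteq> carrier_vec n" "\<sigma> = rational_cone n A"
    "\<And>a. a \<in> A \<Longrightarrow> a \<noteq> 0\<^sub>v n \<Longrightarrow> 1 \<le> m \<bullet> a"
proof -
  from fan assms have "rational_polyhedral_cone n \<sigma>" and sc: "strongly_convex n \<sigma>"
    by (auto simp: fan_def)
  then obtain A where A: "finite A" "A \<subseteq> carrier_vec n" "\<sigma> = rational_cone n A"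
    by (auto simp: rational_polyhedral_cone_def)
  define I where "I = A - {0\<^sub>v n}"
  have fI: "finite I" using A by (simp add: I_def)
  consider u :: "nat \<Rightarrow> rat" where "\<forall>i\<in>I. 0 < (\<Sum>k<n. u k * of_int (i $ k))"
    | c :: "int vec \<Rightarrow> rat" where "\<forall>i\<in>I. 0 \<le> c i" "\<exists>i\<in>I. c i \<noteq> 0"
      "\<forall>k<n. (\<Sum>i\<in>I. c i * of_int (i $ k)) = 0"
    using gordan_alternative[OF fI, where n = n and a = "\<lambda>(i::int vec) k. of_int (i $ k) :: rat"] by blast
  then show thesis
  proof cases
    case 1
    obtain D :: int where D: "0 < D" "\<forall>k\<in>{..<n}. of_int D * u k \<in> \<int>"
      using rat_common_denominator[of "{..<n}" u] by auto
    define m where "m = vec n (\<lambda>k. \<lfloor>of_int D * u k\<rfloor>)"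
    have m: "m \<in> carrier_vec n" by (simp add: m_def)
    have "1 \<le> m \<bullet> a" if a: "a \<in> A" "a \<noteq> 0\<^sub>v n" for a
    proof -
      have an: "dim_vec a = n" using a A(2) by auto
      have "rat_of_int (m \<bullet> a) = (\<Sum>k<n. of_int (m $ k) * of_int (a $ k))"
        using an by (simp add: scalar_prod_def atLeast0LessThan)
      also have "\<dots> = (\<Sum>k<n. of_int D * (u k * of_int (a $ k)))"
      proof (rule sum.cong)
        fix k assume "k \<in> {..<n}"
        then have "of_int (m $ k) = of_int D * u k" using D(2)
          by (auto simp: m_def elim!: Ints_cases)
        then show "of_int (m $ k) * of_int (a $ k) = of_int D * (u k * of_int (a $ k))" by simp
      qed simp
      also have "\<dots> > 0" using 1 a D(1)
        by (auto simp: sum_distrib_left[symmetric] I_def)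
      finally show ?thesis by simp
    qed
    then show thesis using that m A by blast
  next
    case 2
    then obtain b where b: "b \<in> I" "c b > 0" by (metis less_le)
    have bA: "b \<in> A" "b \<noteq> 0\<^sub>v n" "dim_vec b = n" using b A(2) by (auto simp: I_def)
    define v where "v = vec n (\<lambda>i. \<Sum>a\<in>A. (if a = b then 1 else 0) * real_of_int (a $ i))"
    define c' where "c' a = (if a \<in> I \<and> a \<noteq> b then real_of_rat (c a / c b) else 0)" for a
    have "v \<in> \<sigma>" unfolding A(3) rational_cone_def v_def
      by (auto intro!: exI[of _ "\<lambda>a. if a = b then 1 else 0"])
    have vb: "v $ i = real_of_int (b $ i)" if "i < n" for i
    proof -
      have "v $ i = (\<Sum>a\<in>{b}. (if a = b then 1 else 0) * real_of_int (a $ i))"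
        unfolding v_def using that A(1) bA(1) by (simp only: index_vec, intro sum.mono_neutral_right) auto
      then show ?thesis by simp
    qed
    have "- v = vec n (\<lambda>i. \<Sum>a\<in>A. c' a * real_of_int (a $ i))"
    proof (rule eq_vecI)
      fix i assume "i < dim_vec (vec n (\<lambda>i. \<Sum>a\<in>A. c' a * real_of_int (a $ i)))"
      then have i: "i < n" by simp
      have "0 = (\<Sum>a\<in>I. c a * of_int (a $ i))" using 2 i by simp
      also have "\<dots> = c b * of_int (b $ i) + (\<Sum>a\<in>I - {b}. c a * of_int (a $ i))"
        using b(1) fI by (simp add: sum.remove)
      finally have "of_int (b $ i) = - (\<Sum>a\<in>I - {b}. c a / c b * of_int (a $ i))"
        using b(2) by (simp add: field_simps sum_divide_distrib[symmetric])
      then have "real_of_rat (of_int (b $ i)) = - (\<Sum>a\<in>I - {b}. real_of_rat (c a / c b) * real_of_int (a $ i))"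
        by (simp only: of_rat_minus of_rat_sum of_rat_mult of_rat_of_int_eq)
      also have "(\<Sum>a\<in>I - {b}. real_of_rat (c a / c b) * real_of_int (a $ i))
        = (\<Sum>a\<in>A. c' a * real_of_int (a $ i))"
        using A(1) by (intro sum.mono_neutral_cong_left) (auto simp: c'_def I_def)
      finally show "(- v) $ i = vec n (\<lambda>i. \<Sum>a\<in>A. c' a * real_of_int (a $ i)) $ i"
        using i vb[OF i] by (simp add: v_def)
    qed (simp add: v_def)
    moreover have "0 \<le> c' a" for a using 2(1) b(2) by (auto simp: c'_def)
    ultimately have "- v \<in> \<sigma>" unfolding A(3) rational_cone_def by blast
    with sc \<open>v \<in> \<sigma>\<close> have "v = 0\<^sub>v n" by (auto simp: strongly_convex_def)
    then have "b = 0\<^sub>v n" using vb bA(3) by (intro eq_vecI) auto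
    with bA(2) show thesis by simp
  qed
qed


section \<open>The torus inside the toric variety\<close>

lemma cone_pairing:
  assumes "m \<in> carrier_vec n" "A \<subseteq> carrier_vec n"
  shows "map_vec real_of_int m \<bullet> vec n (\<lambda>i. \<Sum>a\<in>A. c a * real_of_int (a $ i))
    = (\<Sum>a\<in>A. c a * real_of_int (m \<bullet> a))"
proof -
  have "map_vec real_of_int m \<bullet> vec n (\<lambda>i. \<Sum>a\<in>A. c a * real_of_int (a $ i))
    = (\<Sum>i<n. \<Sum>a\<in>A. c a * (real_of_int (m $ i) * real_of_int (a $ i)))"
    using assms(1) by (simp add: scalar_prod_def atLeast0LessThan sum_distrib_left algebra_simps)
  also have "\<dots> = (\<Sum>a\<in>A. \<Sum>i<n. c a * (real_of_int (m $ i) * real_of_int (a $ i)))"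
    by (rule sum.swap)
  also have "\<dots> = (\<Sum>a\<in>A. c a * real_of_int (m \<bullet> a))"
  proof (rule sum.cong)
    fix a assume "a \<in> A"
    then have "dim_vec a = n" using assms(2) by auto
    then show "(\<Sum>i<n. c a * (real_of_int (m $ i) * real_of_int (a $ i))) = c a * real_of_int (m \<bullet> a)"
      by (simp add: scalar_prod_def atLeast0LessThan sum_distrib_left)
  qed simp
  finally show ?thesis .
qed

lemma rational_cone_carrier: "v \<in> rational_cone n A \<Longrightarrow> v \<in> carrier_vec n"
  by (auto simp: rational_cone_def)

lemma zero_in_rational_cone: "0\<^sub>v n \<in> rational_cone n A"
  unfolding rational_cone_def by (auto intro!: exI[of _ "\<lambda>_. 0"] eq_vecI)

lemma cone_semigroup_carrier: "m \<in> cone_semigroup n \<sigma> \<Longrightarrow> m \<in> carrier_vec n"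
  by (simp add: cone_semigroup_def)

lemma real_pairing_add:
  assumes "a \<in> carrier_vec n" "b \<in> carrier_vec n" "v \<in> carrier_vec n"
  shows "map_vec real_of_int (a + b) \<bullet> v = map_vec real_of_int a \<bullet> v + map_vec real_of_int b \<bullet> v"
  using assms by (simp add: scalar_prod_def sum.distrib algebra_simps)

lemma real_pairing_smult:
  assumes "a \<in> carrier_vec n" "v \<in> carrier_vec n"
  shows "map_vec real_of_int (k \<cdot>\<^sub>v a) \<bullet> v = real_of_int k * (map_vec real_of_int a \<bullet> v)"
  using assms by (simp add: scalar_prod_def sum_distrib_left algebra_simps)

context toric_variety
begin

abbreviation origin :: "real vec set" where "origin \<equiv> {0\<^sub>v n}"

lemma cone_carrier: "\<sigma> \<in> \<Delta> \<Longrightarrow> v \<in> \<sigma> \<Longrightarrow> v \<in> carrier_vec n"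
  using fan rational_cone_carrier unfolding fan_def rational_polyhedral_cone_def by metis

lemma zero_in_cone: "\<sigma> \<in> \<Delta> \<Longrightarrow> 0\<^sub>v n \<in> \<sigma>"
  using fan zero_in_rational_cone unfolding fan_def rational_polyhedral_cone_def by metis

lemma cone_semigroup_zero [simp]: "\<sigma> \<in> \<Delta> \<Longrightarrow> 0\<^sub>v n \<in> cone_semigroup n \<sigma>"
  by (auto simp: cone_semigroup_def scalar_prod_def dest: cone_carrier)

lemma cone_semigroup_add:
  assumes "\<sigma> \<in> \<Delta>" "a \<in> cone_semigroup n \<sigma>" "b \<in> cone_semigroup n \<sigma>"
  shows "a + b \<in> cone_semigroup n \<sigma>"
  using assms real_pairing_add[of a n b] cone_carrier[OF assms(1)] by (auto simp: cone_semigroup_def)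

text \<open>The character \<open>m\<close> is a lattice point in the interior of the dual cone. Adding large multiples of it moves
  every character into the semigroup, which is how functions on the torus are extended to the chart.\<close>

lemma interior_character:
  assumes "\<sigma> \<in> \<Delta>"
  obtains m where "m \<in> cone_semigroup n \<sigma>"
    "\<And>v. v \<in> \<sigma> \<Longrightarrow> v \<noteq> 0\<^sub>v n \<Longrightarrow> 0 < map_vec real_of_int m \<bullet> v"
    "\<And>w. w \<in> carrier_vec n \<Longrightarrow> \<exists>k::nat. \<forall>k'\<ge>k. w + int k' \<cdot>\<^sub>v m \<in> cone_semigroup n \<sigma>"
proof -
  obtain m A where m: "m \<in> carrier_vec n" and A: "finite A" "A \<subseteq> carrier_vec n" "\<sigma> = rational_cone n A"
    and ma: "\<And>a. a \<in> A \<Longrightarrow> a \<noteq> 0\<^sub>v n \<Longrightarrow> 1 \<le> m \<bullet> a"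
    using strictly_positive_functional[OF assms] by metis
  have m0: "0 \<le> m \<bullet> a" if "a \<in> A" for a
    using ma[OF that] m by (cases "a = 0\<^sub>v n") auto
  have inS: "w \<in> cone_semigroup n \<sigma>" if w: "w \<in> carrier_vec n" "\<forall>a\<in>A. 0 \<le> w \<bullet> a" for w
    unfolding cone_semigroup_def A(3) rational_cone_def
    using w by (auto simp: cone_pairing[OF w(1) A(2)] intro!: sum_nonneg)
  show thesis
  proof (rule that)
    show "m \<in> cone_semigroup n \<sigma>" using inS m m0 by blast
    show "0 < map_vec real_of_int m \<bullet> v" if v: "v \<in> \<sigma>" "v \<noteq> 0\<^sub>v n" for v
    proof -
      obtain c where c: "\<forall>a\<in>A. 0 \<le> c a" "v = vec n (\<lambda>i. \<Sum>a\<in>A. c a * real_of_int (a $ i))"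
        using v(1) unfolding A(3) rational_cone_def by blast
      have "\<exists>a\<in>A. c a \<noteq> 0 \<and> a \<noteq> 0\<^sub>v n"
      proof (rule ccontr)
        assume neg: "\<not> ?thesis"
        have "v = 0\<^sub>v n" unfolding c(2)
        proof (rule eq_vecI)
          fix i assume "i < dim_vec (0\<^sub>v n :: real vec)"
          then show "vec n (\<lambda>i. \<Sum>a\<in>A. c a * real_of_int (a $ i)) $ i = 0\<^sub>v n $ i"
            using neg by (auto intro!: sum.neutral)
        qed simp
        with v(2) show False by simp
      qed
      then obtain a where a: "a \<in> A" "c a \<noteq> 0" "a \<noteq> 0\<^sub>v n" by blast
      have "0 < (\<Sum>a\<in>A. c a * real_of_int (m \<bullet> a))"
      proof (rule sum_pos2[OF A(1) a(1)])
        show "0 < c a * real_of_int (m \<bullet> a)"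
          using a ma[of a] c(1) by (intro mult_pos_pos) (auto simp: less_le)
        show "0 \<le> c b * real_of_int (m \<bullet> b)" if "b \<in> A" for b
          using c(1) m0 that by simp
      qed
      then show ?thesis unfolding c(2) by (simp add: cone_pairing[OF m A(2)])
    qed
    show "\<exists>k::nat. \<forall>k'\<ge>k. w + int k' \<cdot>\<^sub>v m \<in> cone_semigroup n \<sigma>" if w: "w \<in> carrier_vec n" for w
    proof (intro exI allI impI)
      fix k' assume k': "nat (\<Sum>a\<in>A. \<bar>w \<bullet> a\<bar>) \<le> k'"
      show "w + int k' \<cdot>\<^sub>v m \<in> cone_semigroup n \<sigma>"
      proof (rule inS)
        show "\<forall>a\<in>A. 0 \<le> (w + int k' \<cdot>\<^sub>v m) \<bullet> a"
        proof
          fix a assume a: "a \<in> A"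
          have an: "a \<in> carrier_vec n" using a A(2) by blast
          have "(w + int k' \<cdot>\<^sub>v m) \<bullet> a = w \<bullet> a + int k' * (m \<bullet> a)"
            using an w m by (simp add: add_scalar_prod_distrib[of _ n])
          moreover have "\<bar>w \<bullet> a\<bar> \<le> (\<Sum>a\<in>A. \<bar>w \<bullet> a\<bar>)"
            using a A(1) by (intro member_le_sum) auto
          moreover have "a = 0\<^sub>v n \<or> int k' * 1 \<le> int k' * (m \<bullet> a)"
            using ma[OF a] by (cases "a = 0\<^sub>v n") (auto simp: mult_le_cancel_left1)
          ultimately show "0 \<le> (w + int k' \<cdot>\<^sub>v m) \<bullet> a" using k' w m by auto
        qed
      qed (use w m in auto)
    qed
  qed
qed

text \<open>The origin is the face cut out by an interior point of the dual cone.\<close>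

lemma origin_in_fan: "origin \<in> \<Delta>"
proof -
  obtain \<sigma> where \<sigma>: "\<sigma> \<in> \<Delta>" using fan by (auto simp: fan_def)
  obtain m where m: "m \<in> cone_semigroup n \<sigma>"
    "\<And>v. v \<in> \<sigma> \<Longrightarrow> v \<noteq> 0\<^sub>v n \<Longrightarrow> 0 < map_vec real_of_int m \<bullet> v"
    using interior_character[OF \<sigma>] by metis
  have "origin = {v \<in> \<sigma>. map_vec real_of_int m \<bullet> v = 0}"
    using m(2) zero_in_cone[OF \<sigma>] cone_semigroup_carrier[OF m(1)] by fastforce
  moreover have "map_vec real_of_int m \<in> dual_cone n \<sigma>"
    using m(1) by (auto simp: dual_cone_def cone_semigroup_def)
  ultimately have "face_of_cone n origin \<sigma>" unfolding face_of_cone_def by blast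
  then show ?thesis using fan \<sigma> unfolding fan_def by blast
qed

lemma cone_semigroup_origin [simp]: "cone_semigroup n origin = carrier_vec n"
  by (auto simp: cone_semigroup_def)

lemma cone_perp_origin [simp]: "cone_perp n origin = carrier_vec n"
  by (auto simp: cone_perp_def)

lemma cone_eq_originI:
  assumes "\<tau> \<in> \<Delta>" "carrier_vec n \<subseteq> cone_semigroup n \<tau>"
  shows "\<tau> = origin"
proof -
  obtain m where m: "m \<in> cone_semigroup n \<tau>"
    "\<And>v. v \<in> \<tau> \<Longrightarrow> v \<noteq> 0\<^sub>v n \<Longrightarrow> 0 < map_vec real_of_int m \<bullet> v"
    using interior_character[OF assms(1)] by metis
  have mc: "m \<in> carrier_vec n" using m(1) by (rule cone_semigroup_carrier)
  have "v = 0\<^sub>v n" if v: "v \<in> \<tau>" for v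
  proof (rule ccontr)
    assume "v \<noteq> 0\<^sub>v n"
    then have "0 < map_vec real_of_int m \<bullet> v" using m(2) v by blast
    moreover have "(-1) \<cdot>\<^sub>v m \<in> cone_semigroup n \<tau>" using assms(2) mc by auto
    then have "0 \<le> - (map_vec real_of_int m \<bullet> v)"
      using v real_pairing_smult[OF mc cone_carrier[OF assms(1) v], of "-1"]
      by (auto simp: cone_semigroup_def)
    ultimately show False by simp
  qed
  then show ?thesis using zero_in_cone[OF assms(1)] by blast
qed

lemma orbit_origin: "orbit n origin = torus n"
proof -
  have "chi m t \<noteq> 0"
    if t: "t \<in> torus n" and m: "m \<in> carrier_vec n" for m t
  proof -
    have "chi (m + (-1) \<cdot>\<^sub>v m) t = chi m t * chi ((-1) \<cdot>\<^sub>v m) t"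
      using t m unfolding torus_def by (metis (mono_tags, lifting) mem_Collect_eq smult_carrier_vec)
    moreover have "m + (-1) \<cdot>\<^sub>v m = 0\<^sub>v n" using m by (intro eq_vecI) auto
    ultimately show ?thesis using t by (auto simp: torus_def)
  qed
  then show ?thesis by (auto simp: orbit_def torus_def)
qed

lemma torus_subset_X: "torus n \<subseteq> X"
  unfolding X_def using origin_in_fan orbit_origin by blast

lemma X_orbit:
  assumes "x \<in> X" obtains \<tau> where "\<tau> \<in> \<Delta>" "x \<in> orbit n \<tau>" "dom x = cone_semigroup n \<tau>"
  using assms by (auto simp: X_def orbit_def)

lemma chart_origin: "chart origin = torus n"
proof
  show "torus n \<subseteq> chart origin"
    using torus_subset_X by (auto simp: chart_def torus_def)
  show "chart origin \<subseteq> torus n"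
  proof
    fix x assume "x \<in> chart origin"
    then have x: "x \<in> X" "carrier_vec n \<subseteq> dom x" by (auto simp: chart_def)
    then obtain \<tau> where "\<tau> \<in> \<Delta>" "x \<in> orbit n \<tau>" "dom x = cone_semigroup n \<tau>"
      by (metis X_orbit)
    then show "x \<in> torus n" using cone_eq_originI x(2) orbit_origin by metis
  qed
qed

text \<open>If \<open>\<chi>\<^sup>m\<close> does not vanish at a point of the orbit of \<open>\<tau>\<close>, then \<open>m\<close> is orthogonal to \<open>\<tau>\<close>, so that
  \<open>w + k m\<close> and \<open>w\<close> agree on \<open>\<tau>\<close>. Hence every \<open>w\<close> is nonnegative on \<open>\<tau>\<close>, and the orbit is the torus.\<close>

lemma chart_boundary:
  assumes "\<sigma> \<in> \<Delta>" "x \<in> chart \<sigma>" "x \<notin> torus n" "m \<in> cone_semigroup n \<sigma>"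
    "\<And>w. w \<in> carrier_vec n \<Longrightarrow> \<exists>k::nat. \<forall>k'\<ge>k. w + int k' \<cdot>\<^sub>v m \<in> cone_semigroup n \<sigma>"
  shows "chi m x = 0"
proof (rule ccontr)
  assume nz: "chi m x \<noteq> 0"
  obtain \<tau> where \<tau>: "\<tau> \<in> \<Delta>" "x \<in> orbit n \<tau>" "dom x = cone_semigroup n \<tau>"
    using assms(2) X_orbit unfolding chart_def by blast
  have sub: "cone_semigroup n \<sigma> \<subseteq> cone_semigroup n \<tau>"
    using assms(2) \<tau>(3) by (simp add: chart_def)
  have m\<tau>: "m \<in> cone_perp n \<tau>" using nz \<tau>(2) sub assms(4) by (auto simp: orbit_def)
  have mc: "m \<in> carrier_vec n" using assms(4) by (rule cone_semigroup_carrier)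
  have "w \<in> cone_semigroup n \<tau>" if w: "w \<in> carrier_vec n" for w
  proof -
    obtain k :: nat where "w + int k \<cdot>\<^sub>v m \<in> cone_semigroup n \<tau>"
      using assms(5)[OF w] sub by blast
    moreover have "map_vec real_of_int (w + int k \<cdot>\<^sub>v m) \<bullet> v = map_vec real_of_int w \<bullet> v"
      if v: "v \<in> \<tau>" for v
      using cone_carrier[OF \<tau>(1) v] w mc m\<tau> v
      by (simp add: real_pairing_add[of _ n] real_pairing_smult[of _ n] cone_perp_def)
    ultimately show ?thesis using w by (auto simp: cone_semigroup_def)
  qed
  then have "\<tau> = origin" using cone_eq_originI[OF \<tau>(1)] by blast
  then show False using \<tau>(2) assms(3) orbit_origin by blast
qed

lemma chi_zero_vec: "x \<in> X \<Longrightarrow> chi (0\<^sub>v n) x = 1"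
  by (auto simp: X_def orbit_def)

lemma chi_add_chart:
  assumes "x \<in> chart \<sigma>" "a \<in> cone_semigroup n \<sigma>" "b \<in> cone_semigroup n \<sigma>"
  shows "chi (a + b) x = chi a x * chi b x"
proof -
  obtain \<tau> where \<tau>: "\<tau> \<in> \<Delta>" "x \<in> orbit n \<tau>" "dom x = cone_semigroup n \<tau>"
    using assms(1) X_orbit unfolding chart_def by blast
  then have "a \<in> cone_semigroup n \<tau>" "b \<in> cone_semigroup n \<tau>"
    using assms by (auto simp: chart_def)
  then show ?thesis using \<tau>(2) by (simp add: orbit_def)
qed

lemma chi_add_torus:
  "x \<in> torus n \<Longrightarrow> a \<in> carrier_vec n \<Longrightarrow> b \<in> carrier_vec n \<Longrightarrow> chi (a + b) x = chi a x * chi b x"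
  by (auto simp: torus_def)

lemma chi_nonzero_torus: "x \<in> torus n \<Longrightarrow> a \<in> carrier_vec n \<Longrightarrow> chi a x \<noteq> 0"
  unfolding orbit_origin[symmetric] by (auto simp: orbit_def)

lemma chi_nat_smult_torus:
  assumes "x \<in> torus n" "a \<in> carrier_vec n"
  shows "chi (int k \<cdot>\<^sub>v a) x = chi a x ^ k"
proof (induction k)
  case 0
  have "int 0 \<cdot>\<^sub>v a = 0\<^sub>v n" using assms(2) by (intro eq_vecI) auto
  then show ?case using assms(1) by (simp add: torus_def)
next
  case (Suc k)
  have "int (Suc k) \<cdot>\<^sub>v a = a + int k \<cdot>\<^sub>v a"
    using assms(2) by (intro eq_vecI) (auto simp: algebra_simps)
  then show ?case using chi_add_torus[OF assms(1), of a "int k \<cdot>\<^sub>v a"] assms(2) Suc by simp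
qed

subsection \<open>Coordinate rings\<close>

lemma coord_ringI:
  "finite A \<Longrightarrow> A \<subseteq> cone_semigroup n \<sigma> \<Longrightarrow> (\<lambda>x. \<Sum>m\<in>A. c m * chi m x) \<in> coord_ring \<sigma>"
  unfolding coord_ring_def by blast

lemma coord_ringE:
  assumes "f \<in> coord_ring \<sigma>"
  obtains A c where "finite A" "A \<subseteq> cone_semigroup n \<sigma>" "f = (\<lambda>x. \<Sum>m\<in>A. c m * chi m x)"
  using assms unfolding coord_ring_def by blast

lemma scaled_chi_in_coord_ring: "m \<in> cone_semigroup n \<sigma> \<Longrightarrow> (\<lambda>x. a * chi m x) \<in> coord_ring \<sigma>"
  using coord_ringI[of "{m}" \<sigma> "\<lambda>_. a"] by simp

lemma chi_in_coord_ring: "m \<in> cone_semigroup n \<sigma> \<Longrightarrow> chi m \<in> coord_ring \<sigma>"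
  using scaled_chi_in_coord_ring[of m \<sigma> 1] by simp

lemma coord_ring_origin: "coord_ring \<sigma> \<subseteq> coord_ring origin"
proof
  fix f assume "f \<in> coord_ring \<sigma>"
  then obtain A c where A: "finite A" "A \<subseteq> cone_semigroup n \<sigma>" "f = (\<lambda>x. \<Sum>m\<in>A. c m * chi m x)"
    by (rule coord_ringE)
  then have "A \<subseteq> cone_semigroup n origin" using cone_semigroup_carrier by auto
  then show "f \<in> coord_ring origin" unfolding A(3) by (rule coord_ringI[OF A(1)])
qed

text \<open>The exponents \<open>d k\<close> may coincide; the terms are collected by exponent.\<close>

lemma coord_ring_family:
  assumes "finite K" "\<And>k. k \<in> K \<Longrightarrow> d k \<in> cone_semigroup n \<sigma>"
  shows "(\<lambda>x. \<Sum>k\<in>K. c k * chi (d k) x) \<in> coord_ring \<sigma>"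
proof -
  have "(\<lambda>x. \<Sum>k\<in>K. c k * chi (d k) x)
    = (\<lambda>x. \<Sum>m\<in>d ` K. (\<Sum>k\<in>{k\<in>K. d k = m}. c k) * chi m x)"
    using assms(1) by (subst sum.image_gen[of K _ d]) (auto simp: sum_distrib_right)
  also have "\<dots> \<in> coord_ring \<sigma>"
    using assms by (intro coord_ringI) auto
  finally show ?thesis .
qed

lemma coord_ring_add:
  assumes "f \<in> coord_ring \<sigma>" "g \<in> coord_ring \<sigma>"
  shows "(\<lambda>x. f x + g x) \<in> coord_ring \<sigma>"
proof -
  obtain A c where A: "finite A" "A \<subseteq> cone_semigroup n \<sigma>" "f = (\<lambda>x. \<Sum>m\<in>A. c m * chi m x)"
    using assms(1) by (rule coord_ringE)
  obtain B d where B: "finite B" "B \<subseteq> cone_semigroup n \<sigma>" "g = (\<lambda>x. \<Sum>m\<in>B. d m * chi m x)"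
    using assms(2) by (rule coord_ringE)
  have "(\<lambda>x. f x + g x) = (\<lambda>x. \<Sum>k\<in>A <+> B. (case k of Inl m \<Rightarrow> c m | Inr m \<Rightarrow> d m) *
      chi (case k of Inl m \<Rightarrow> m | Inr m \<Rightarrow> m) x)"
    using A B by (simp add: sum.Plus comp_def)
  also have "\<dots> \<in> coord_ring \<sigma>"
    using A B by (intro coord_ring_family) auto
  finally show ?thesis .
qed

lemma coord_ring_mult:
  assumes "f \<in> coord_ring \<sigma>" "g \<in> coord_ring \<sigma>" "\<sigma> \<in> \<Delta>"
  obtains h where "h \<in> coord_ring \<sigma>" "\<And>x. x \<in> chart \<sigma> \<Longrightarrow> h x = f x * g x"
proof -
  obtain A c where A: "finite A" "A \<subseteq> cone_semigroup n \<sigma>" "f = (\<lambda>x. \<Sum>m\<in>A. c m * chi m x)"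
    using assms(1) by (rule coord_ringE)
  obtain B d where B: "finite B" "B \<subseteq> cone_semigroup n \<sigma>" "g = (\<lambda>x. \<Sum>m\<in>B. d m * chi m x)"
    using assms(2) by (rule coord_ringE)
  define h where "h = (\<lambda>x. \<Sum>k\<in>A\<times>B. (c (fst k) * d (snd k)) * chi (fst k + snd k) x)"
  have "h \<in> coord_ring \<sigma>" unfolding h_def
    using A B by (intro coord_ring_family cone_semigroup_add assms(3)) auto
  moreover have "h x = f x * g x" if "x \<in> chart \<sigma>" for x
  proof -
    have "h x = (\<Sum>k\<in>A\<times>B. (c (fst k) * chi (fst k) x) * (d (snd k) * chi (snd k) x))"
      unfolding h_def
      by (rule sum.cong) (use A B chi_add_chart[OF that] in \<open>auto simp: subset_iff\<close>)
    then show ?thesis unfolding A(3) B(3) by (simp add: sum_product sum.cartesian_product case_prod_unfold)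
  qed
  ultimately show thesis by (rule that)
qed

subsection \<open>The Zariski topology\<close>

lemma zopenI:
  assumes "U \<subseteq> X"
    "\<And>\<sigma> x. \<sigma> \<in> \<Delta> \<Longrightarrow> x \<in> U \<Longrightarrow> x \<in> chart \<sigma> \<Longrightarrow>
      \<exists>f\<in>coord_ring \<sigma>. f x \<noteq> 0 \<and> (\<forall>y\<in>chart \<sigma>. f y \<noteq> 0 \<longrightarrow> y \<in> U)"
  shows "zopen U"
  unfolding zopen_def
proof (intro conjI ballI)
  fix \<sigma> assume \<sigma>: "\<sigma> \<in> \<Delta>"
  define F where "F = {f \<in> coord_ring \<sigma>. \<forall>y\<in>chart \<sigma>. f y \<noteq> 0 \<longrightarrow> y \<in> U}"
  have "U \<inter> chart \<sigma> = {x \<in> chart \<sigma>. \<exists>f\<in>F. f x \<noteq> 0}"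
    using assms(2)[OF \<sigma>] by (auto simp: F_def)
  then show "\<exists>F\<subseteq>coord_ring \<sigma>. U \<inter> chart \<sigma> = {x \<in> chart \<sigma>. \<exists>f\<in>F. f x \<noteq> 0}"
    by (intro exI[of _ F]) (auto simp: F_def)
qed (rule assms(1))

lemma zopenD:
  assumes "zopen U" "\<sigma> \<in> \<Delta>" "x \<in> U" "x \<in> chart \<sigma>"
  obtains f where "f \<in> coord_ring \<sigma>" "f x \<noteq> 0" "\<And>y. y \<in> chart \<sigma> \<Longrightarrow> f y \<noteq> 0 \<Longrightarrow> y \<in> U"
proof -
  obtain F where F: "F \<subseteq> coord_ring \<sigma>" "U \<inter> chart \<sigma> = {x \<in> chart \<sigma>. \<exists>f\<in>F. f x \<noteq> 0}"
    using assms(1,2) unfolding zopen_def by blast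
  have "x \<in> U \<inter> chart \<sigma>" using assms(3,4) by simp
  then obtain f where f: "f \<in> F" "f x \<noteq> 0" unfolding F(2) by blast
  show thesis
  proof (rule that)
    show "f \<in> coord_ring \<sigma>" using f(1) F(1) by blast
    fix y assume "y \<in> chart \<sigma>" "f y \<noteq> 0"
    then have "y \<in> U \<inter> chart \<sigma>" unfolding F(2) using f(1) by blast
    then show "y \<in> U" by simp
  qed (rule f(2))
qed

lemma zopen_subset: "zopen U \<Longrightarrow> U \<subseteq> X"
  by (simp add: zopen_def)

lemma zopen_X: "zopen X"
proof (rule zopenI)
  fix \<sigma> x assume "\<sigma> \<in> \<Delta>" "x \<in> X"
  then show "\<exists>f\<in>coord_ring \<sigma>. f x \<noteq> 0 \<and> (\<forall>y\<in>chart \<sigma>. f y \<noteq> 0 \<longrightarrow> y \<in> X)"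
    using chi_in_coord_ring[OF cone_semigroup_zero, of \<sigma>] chi_zero_vec[of x]
    by (intro bexI[of _ "chi (0\<^sub>v n)"]) (auto simp: chart_def)
qed simp

lemma zopen_Int: 
  assumes "zopen U" "zopen V" shows "zopen (U \<inter> V)"
proof (rule zopenI)
  fix \<sigma> x assume \<sigma>: "\<sigma> \<in> \<Delta>" and x: "x \<in> U \<inter> V" "x \<in> chart \<sigma>"
  obtain f where f: "f \<in> coord_ring \<sigma>" "f x \<noteq> 0" "\<And>y. y \<in> chart \<sigma> \<Longrightarrow> f y \<noteq> 0 \<Longrightarrow> y \<in> U"
    using zopenD[OF assms(1) \<sigma>] x by blast
  obtain g where g: "g \<in> coord_ring \<sigma>" "g x \<noteq> 0" "\<And>y. y \<in> chart \<sigma> \<Longrightarrow> g y \<noteq> 0 \<Longrightarrow> y \<in> V"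
    using zopenD[OF assms(2) \<sigma>] x by blast
  obtain h where h: "h \<in> coord_ring \<sigma>" "\<And>x. x \<in> chart \<sigma> \<Longrightarrow> h x = f x * g x"
    using coord_ring_mult[OF f(1) g(1) \<sigma>] by blast
  then show "\<exists>f\<in>coord_ring \<sigma>. f x \<noteq> 0 \<and> (\<forall>y\<in>chart \<sigma>. f y \<noteq> 0 \<longrightarrow> y \<in> U \<inter> V)"
    using f g x by (intro bexI[of _ h]) auto
qed (use assms in \<open>auto simp: zopen_def\<close>)

text \<open>In the chart of \<open>\<sigma>\<close> this set is the locus where \<open>\<chi>\<^sup>(\<^sup>k\<^sup>+\<^sup>1\<^sup>)\<^sup>m f\<close> does not vanish, for an interior character
  \<open>m\<close> and large \<open>k\<close>: the factor \<open>\<chi>\<^sup>k\<^sup>m\<close> makes \<open>f\<close> regular on the chart and one more factor \<open>\<chi>\<^sup>m\<close> kills the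
  boundary.\<close>

lemma zopen_principal:
  assumes "f \<in> coord_ring origin"
  shows "zopen {x \<in> torus n. f x \<noteq> 0}"
proof (rule zopenI)
  fix \<sigma> x assume \<sigma>: "\<sigma> \<in> \<Delta>" and x: "x \<in> {x \<in> torus n. f x \<noteq> 0}" "x \<in> chart \<sigma>"
  obtain A c where A: "finite A" "A \<subseteq> carrier_vec n" "f = (\<lambda>x. \<Sum>m\<in>A. c m * chi m x)"
    using coord_ringE[OF assms] by (metis cone_semigroup_origin)
  obtain m where m: "m \<in> cone_semigroup n \<sigma>"
    "\<And>w. w \<in> carrier_vec n \<Longrightarrow> \<exists>k::nat. \<forall>k'\<ge>k. w + int k' \<cdot>\<^sub>v m \<in> cone_semigroup n \<sigma>"
    using interior_character[OF \<sigma>] by metis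
  have mc: "m \<in> carrier_vec n" using m(1) by (rule cone_semigroup_carrier)
  obtain k where k: "\<And>w k'. w \<in> A \<Longrightarrow> k w \<le> k' \<Longrightarrow> w + int k' \<cdot>\<^sub>v m \<in> cone_semigroup n \<sigma>"
    using m(2) A(2) by (metis subset_iff)
  define K where "K = (\<Sum>w\<in>A. k w)"
  have K: "w + int K \<cdot>\<^sub>v m \<in> cone_semigroup n \<sigma>" if "w \<in> A" for w
    using that A(1) by (intro k) (auto simp: K_def intro: member_le_sum)
  define h where "h = (\<lambda>x. \<Sum>w\<in>A. c w * chi ((w + int K \<cdot>\<^sub>v m) + m) x)"
  have hc: "h \<in> coord_ring \<sigma>" unfolding h_def
    using A(1) K m(1) \<sigma> by (intro coord_ring_family cone_semigroup_add[OF \<sigma> K]) auto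
  have hx: "h y = f y * chi m y ^ Suc K" if y: "y \<in> torus n" for y
  proof -
    have "chi ((w + int K \<cdot>\<^sub>v m) + m) y = chi w y * chi m y ^ Suc K" if "w \<in> A" for w
    proof -
      have w: "w \<in> carrier_vec n" using that A(2) by blast
      show ?thesis using w mc y
        by (subst chi_add_torus[OF y], simp_all, subst chi_add_torus[OF y])
           (simp_all add: chi_nat_smult_torus)
    qed
    then show ?thesis unfolding h_def A(3) sum_distrib_right by (intro sum.cong) auto
  qed
  have h0: "h y = 0" if y: "y \<in> chart \<sigma>" "y \<notin> torus n" for y
  proof -
    have "chi m y = 0" using chart_boundary[OF \<sigma> y m] .
    then show ?thesis unfolding h_def
      using chi_add_chart[OF y(1) K m(1)] by (auto intro!: sum.neutral)
  qed
  show "\<exists>g\<in>coord_ring \<sigma>. g x \<noteq> 0 \<and>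
      (\<forall>y\<in>chart \<sigma>. g y \<noteq> 0 \<longrightarrow> y \<in> {x \<in> torus n. f x \<noteq> 0})"
  proof (intro bexI[of _ h] conjI ballI impI hc)
    show "h x \<noteq> 0" using x hx[of x] chi_nonzero_torus[OF _ mc, of x] by simp
    fix y assume y: "y \<in> chart \<sigma>" "h y \<noteq> 0"
    then have "y \<in> torus n" using h0 by blast
    then show "y \<in> {x \<in> torus n. f x \<noteq> 0}" using hx[of y] y(2) by auto
  qed
qed (use torus_subset_X in auto)

lemma zopen_torus: "zopen (torus n)"
proof -
  have "{x \<in> torus n. chi (0\<^sub>v n) x \<noteq> 0} = torus n" by (auto simp: torus_def)
  then show ?thesis
    using zopen_principal[OF chi_in_coord_ring[of "0\<^sub>v n"]] by simp
qed

subsection \<open>The torus as a group\<close>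

lemma chi_act: "chi m (act t x) = chi m t * chi m x"
  by (cases "x m") (auto simp: chi_def act_def)

lemma chi_inv: "chi m (torus_inv t) = inverse (chi m t)"
  by (cases "t m") (auto simp: chi_def torus_inv_def)

lemma chi_one: "m \<in> carrier_vec n \<Longrightarrow> chi m (torus_one n) = 1"
  by (simp add: chi_def torus_one_def)

lemma torus_one_in_torus: "torus_one n \<in> torus n"
  by (auto simp: torus_def chi_one) (auto simp: torus_one_def split: if_splits)

lemma act_in_torus: "t \<in> torus n \<Longrightarrow> x \<in> torus n \<Longrightarrow> act t x \<in> torus n"
  by (auto simp: torus_def chi_act) (auto simp: act_def)

lemma torus_inv_in_torus: "t \<in> torus n \<Longrightarrow> torus_inv t \<in> torus n"
  by (auto simp: torus_def chi_inv) (auto simp: torus_inv_def)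

lemma torus_eqI:
  assumes "t \<in> torus n" "t' \<in> torus n" "\<And>m. m \<in> carrier_vec n \<Longrightarrow> chi m t = chi m t'"
  shows "t = t'"
proof
  fix m
  show "t m = t' m"
  proof (cases "m \<in> carrier_vec n")
    case True
    then have "m \<in> dom t" "m \<in> dom t'" using assms by (auto simp: torus_def)
    then show ?thesis using assms(3)[OF True] by (auto simp: chi_def)
  next
    case False
    then have "m \<notin> dom t" "m \<notin> dom t'" using assms by (auto simp: torus_def)
    then show ?thesis by (simp add: domIff)
  qed
qed

lemma act_torus_image: assumes "t \<in> torus n" shows "act t ` torus n = torus n"
proof -
  have "x \<in> act t ` torus n" if "x \<in> torus n" for x
  proof (rule image_eqI)
    show "act (torus_inv t) x \<in> torus n" using assms that by (simp add: act_in_torus torus_inv_in_torus)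
    then show "x = act t (act (torus_inv t) x)"
      using assms that chi_nonzero_torus[OF assms]
      by (intro torus_eqI) (auto simp: chi_act chi_inv intro: act_in_torus)
  qed
  then show ?thesis using act_in_torus[OF assms] by auto
qed

lemma chi_torus_exp: "m \<in> carrier_vec n \<Longrightarrow> chi m (torus_exp n v) = exp (map_vec complex_of_int m \<bullet> v)"
  by (simp add: chi_def torus_exp_def)

lemma torus_exp_in_torus: "v \<in> carrier_vec n \<Longrightarrow> torus_exp n v \<in> torus n"
proof -
  assume v: "v \<in> carrier_vec n"
  have "map_vec complex_of_int (m + m') \<bullet> v
      = map_vec complex_of_int m \<bullet> v + map_vec complex_of_int m' \<bullet> v"
    if "m \<in> carrier_vec n" "m' \<in> carrier_vec n" for m m'
    using that v by (simp add: scalar_prod_def sum.distrib algebra_simps)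
  moreover have "map_vec complex_of_int (0\<^sub>v n) \<bullet> v = 0"
    using v by (simp add: scalar_prod_def)
  ultimately show ?thesis
    by (auto simp: torus_def chi_torus_exp exp_add) (auto simp: torus_exp_def split: if_splits)
qed

text \<open>Evaluation at \<open>exp(e\<^sub>i)\<close>, where \<open>i\<close> is a coordinate in which \<open>r\<close> and \<open>r'\<close> differ.\<close>

lemma characters_separated:
  assumes "r \<in> carrier_vec n" "r' \<in> carrier_vec n" "r \<noteq> r'"
  obtains t where "t \<in> torus n" "chi r t \<noteq> chi r' t"
proof -
  obtain i where i: "i < n" "r $ i \<noteq> r' $ i"
    using assms by (metis carrier_vecD eq_vecI)
  have "map_vec complex_of_int m \<bullet> unit_vec n i = of_real (real_of_int (m $ i))"
    if "m \<in> carrier_vec n" for m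
    using that i(1) by simp
  then have "chi m (torus_exp n (unit_vec n i)) = of_real (exp (real_of_int (m $ i)))"
    if "m \<in> carrier_vec n" for m
    using that by (simp only: chi_torus_exp exp_of_real)
  then have "chi r (torus_exp n (unit_vec n i)) \<noteq> chi r' (torus_exp n (unit_vec n i))"
    using i(2) assms by simp
  then show thesis using that torus_exp_in_torus[of "unit_vec n i"] by auto
qed

end


section \<open>Regular functions and invariant vector fields on the torus\<close>

text \<open>Introduces the three witnesses at once, since numerator and denominator range over the same ring and
  separate applications of the rule for one quantifier could confuse them.\<close>

lemma bex3I: "P a b c \<Longrightarrow> a \<in> A \<Longrightarrow> b \<in> B \<Longrightarrow> c \<in> C \<Longrightarrow> \<exists>a\<in>A. \<exists>b\<in>B. \<exists>c\<in>C. P a b c"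
  by blast

context toric_variety
begin

lemma on_set_simps [simp]: "x \<in> U \<Longrightarrow> on_set U f x = f x" "x \<notin> U \<Longrightarrow> on_set U f x = 0"
  by (auto simp: on_set_def)

lemma on_set_on_set [simp]: "V \<subseteq> U \<Longrightarrow> on_set V (on_set U f) = on_set V f"
  by (auto simp: on_set_def fun_eq_iff)

lemma carrier_reg_ring [simp]: "carrier (reg_ring U) = {f. regular U f}"
  by (simp add: reg_ring_def)

lemma reg_ring_simps [simp]:
  "f \<otimes>\<^bsub>reg_ring U\<^esub> g = (\<lambda>x. f x * g x)" "f \<oplus>\<^bsub>reg_ring U\<^esub> g = (\<lambda>x. f x + g x)"
  "\<one>\<^bsub>reg_ring U\<^esub> = const U 1" "\<zero>\<^bsub>reg_ring U\<^esub> = (\<lambda>_. 0)"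
  "f \<odot>\<^bsub>reg_ring U\<^esub> g = (\<lambda>x. f x * g x)"
  by (simp_all add: reg_ring_def)

lemma regular_outside: "regular U f \<Longrightarrow> x \<notin> U \<Longrightarrow> f x = 0"
  by (simp add: regular_def)

lemma regular_on_set [simp]: "regular U f \<Longrightarrow> on_set U f = f"
  by (auto simp: on_set_def regular_outside)

lemma regular_restrict:
  assumes "regular U f" "V \<in> opens U"
  shows "regular V (on_set V f)"
  unfolding regular_def
proof (intro conjI allI impI ballI)
  fix x assume x: "x \<in> V"
  have V: "zopen V" "V \<subseteq> U" using assms(2) by (auto simp: opens_def)
  obtain \<sigma> g h V' where *: "\<sigma> \<in> \<Delta>" "g \<in> coord_ring \<sigma>" "h \<in> coord_ring \<sigma>"
    "V' \<in> opens (U \<inter> chart \<sigma>)" "x \<in> V'" "\<forall>y\<in>V'. h y \<noteq> 0 \<and> f y = g y / h y"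
    using assms(1) x V(2) unfolding regular_def by blast
  have "V' \<inter> V \<in> opens (V \<inter> chart \<sigma>)" using *(4) V by (auto simp: opens_def zopen_Int)
  then show "\<exists>\<sigma>\<in>\<Delta>. \<exists>g\<in>coord_ring \<sigma>. \<exists>h\<in>coord_ring \<sigma>. \<exists>V'\<in>opens (V \<inter> chart \<sigma>).
      x \<in> V' \<and> (\<forall>y\<in>V'. h y \<noteq> 0 \<and> on_set V f y = g y / h y)"
    using * x
    by (intro bexI[of _ \<sigma>] bex3I[where a = g and b = h and c = "V' \<inter> V"]) auto
qed simp

lemma coord_ring_scale:
  assumes "f \<in> coord_ring \<sigma>" shows "(\<lambda>x. c * f x) \<in> coord_ring \<sigma>"
proof -
  obtain A d where A: "finite A" "A \<subseteq> cone_semigroup n \<sigma>" "f = (\<lambda>x. \<Sum>m\<in>A. d m * chi m x)"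
    using assms by (rule coord_ringE)
  have "(\<lambda>x. \<Sum>m\<in>A. (c * d m) * chi m x) \<in> coord_ring \<sigma>" by (rule coord_ringI[OF A(1,2)])
  then show ?thesis unfolding A(3) by (simp add: sum_distrib_left mult.assoc)
qed

lemma regular_scale:
  assumes "regular U f" shows "regular U (\<lambda>x. c * f x)"
  unfolding regular_def
proof (intro conjI allI impI ballI)
  fix x assume x: "x \<in> U"
  obtain \<sigma> g h V' where *: "\<sigma> \<in> \<Delta>" "g \<in> coord_ring \<sigma>" "h \<in> coord_ring \<sigma>"
    "V' \<in> opens (U \<inter> chart \<sigma>)" "x \<in> V'" "\<forall>y\<in>V'. h y \<noteq> 0 \<and> f y = g y / h y"
    using assms x unfolding regular_def by blast
  then show "\<exists>\<sigma>\<in>\<Delta>. \<exists>g\<in>coord_ring \<sigma>. \<exists>h\<in>coord_ring \<sigma>. \<exists>V'\<in>opens (U \<inter> chart \<sigma>).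
      x \<in> V' \<and> (\<forall>y\<in>V'. h y \<noteq> 0 \<and> c * f y = g y / h y)"
    by (intro bexI[of _ \<sigma>] bex3I[where a = "\<lambda>x. c * g x" and b = h and c = V']) (auto intro: coord_ring_scale)
qed (use assms in \<open>auto simp: regular_def\<close>)

subsection \<open>Regular functions on open subsets of the torus\<close>

lemma opens_torusD: "W \<in> opens (torus n) \<Longrightarrow> zopen W" "W \<in> opens (torus n) \<Longrightarrow> W \<subseteq> torus n"
  by (auto simp: opens_def)

lemma opens_trans: "V \<in> opens W \<Longrightarrow> W \<in> opens U \<Longrightarrow> V \<in> opens U"
  by (auto simp: opens_def)

lemma opens_self: "zopen U \<Longrightarrow> U \<in> opens U"
  by (simp add: opens_def)

lemma opens_Int: "V \<in> opens U \<Longrightarrow> W \<in> opens U \<Longrightarrow> V \<inter> W \<in> opens U"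
  by (auto simp: opens_def zopen_Int)

text \<open>On the torus one chart, that of the zero cone, is enough.\<close>

lemma regular_torusI:
  assumes "W \<in> opens (torus n)" "\<And>x. x \<notin> W \<Longrightarrow> f x = 0"
    "\<And>x. x \<in> W \<Longrightarrow> \<exists>g\<in>coord_ring origin. \<exists>h\<in>coord_ring origin. \<exists>V\<in>opens W.
       x \<in> V \<and> (\<forall>y\<in>V. h y \<noteq> 0 \<and> f y = g y / h y)"
  shows "regular W f"
proof -
  have "W \<inter> chart origin = W" using assms(1) by (auto simp: opens_def chart_origin)
  then show ?thesis using assms(2,3) origin_in_fan unfolding regular_def by metis
qed

lemma regular_torusE:
  assumes "W \<in> opens (torus n)" "regular W f" "x \<in> W"
  obtains g h V where "g \<in> coord_ring origin" "h \<in> coord_ring origin" "V \<in> opens W" "x \<in> V"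
    "\<And>y. y \<in> V \<Longrightarrow> h y \<noteq> 0" "\<And>y. y \<in> V \<Longrightarrow> f y = g y / h y"
proof -
  obtain \<sigma> g h V where *: "\<sigma> \<in> \<Delta>" "g \<in> coord_ring \<sigma>" "h \<in> coord_ring \<sigma>"
    "V \<in> opens (W \<inter> chart \<sigma>)" "x \<in> V" "\<forall>y\<in>V. h y \<noteq> 0 \<and> f y = g y / h y"
    using assms(2,3) unfolding regular_def by blast
  have "V \<in> opens W" using *(4) by (auto simp: opens_def)
  then show thesis using that[of g h V] * coord_ring_origin by blast
qed

lemma coord_ring_torus_mult:
  assumes "f \<in> coord_ring origin" "g \<in> coord_ring origin"
  obtains h where "h \<in> coord_ring origin" "\<And>x. x \<in> torus n \<Longrightarrow> h x = f x * g x"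
  using coord_ring_mult[OF assms origin_in_fan] chart_origin by auto

lemma chi_coord_ring_origin: "m \<in> carrier_vec n \<Longrightarrow> chi m \<in> coord_ring origin"
  using chi_in_coord_ring[of m origin] by simp

lemma regular_coord:
  assumes "W \<in> opens (torus n)" "f \<in> coord_ring origin"
  shows "regular W (on_set W f)"
proof (rule regular_torusI[OF assms(1)])
  fix x assume "x \<in> W"
  moreover have "chi (0\<^sub>v n) y = 1" if "y \<in> W" for y
    using that assms(1) by (auto simp: opens_def torus_def)
  ultimately show "\<exists>g\<in>coord_ring origin. \<exists>h\<in>coord_ring origin. \<exists>V\<in>opens W.
       x \<in> V \<and> (\<forall>y\<in>V. h y \<noteq> 0 \<and> on_set W f y = g y / h y)"
    using assms opens_self[of W] chi_coord_ring_origin[of "0\<^sub>v n"]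
    by (intro bex3I[where a = f and b = "chi (0\<^sub>v n)" and c = W]) (auto simp: opens_def)
qed simp

lemma regular_chi: "W \<in> opens (torus n) \<Longrightarrow> m \<in> carrier_vec n \<Longrightarrow> regular W (on_set W (chi m))"
  by (rule regular_coord) (auto intro: chi_coord_ring_origin)

lemma regular_torus_const: assumes "W \<in> opens (torus n)" shows "regular W (const W c)"
proof -
  have "const W c = on_set W (\<lambda>x. c * chi (0\<^sub>v n) x)"
    using assms by (auto simp: const_def on_set_def fun_eq_iff opens_def torus_def subset_iff)
  then show ?thesis using regular_coord[OF assms coord_ring_scale[OF chi_coord_ring_origin]] by simp
qed

lemma regular_torus_mult:
  assumes W: "W \<in> opens (torus n)" and f: "regular W f" and g: "regular W g"
  shows "regular W (\<lambda>x. f x * g x)"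
proof (rule regular_torusI[OF W])
  fix x assume x: "x \<in> W"
  obtain p q V where pq: "p \<in> coord_ring origin" "q \<in> coord_ring origin" "V \<in> opens W" "x \<in> V"
    "\<And>y. y \<in> V \<Longrightarrow> q y \<noteq> 0" "\<And>y. y \<in> V \<Longrightarrow> f y = p y / q y"
    using regular_torusE[OF W f x] by metis
  obtain p' q' V' where pq': "p' \<in> coord_ring origin" "q' \<in> coord_ring origin" "V' \<in> opens W" "x \<in> V'"
    "\<And>y. y \<in> V' \<Longrightarrow> q' y \<noteq> 0" "\<And>y. y \<in> V' \<Longrightarrow> g y = p' y / q' y"
    using regular_torusE[OF W g x] by metis
  obtain a where a: "a \<in> coord_ring origin" "\<And>x. x \<in> torus n \<Longrightarrow> a x = p x * p' x"
    using coord_ring_torus_mult[OF pq(1) pq'(1)] by metis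
  obtain b where b: "b \<in> coord_ring origin" "\<And>x. x \<in> torus n \<Longrightarrow> b x = q x * q' x"
    using coord_ring_torus_mult[OF pq(2) pq'(2)] by metis
  have T: "y \<in> torus n" if "y \<in> V" for y using that pq(3) W by (auto simp: opens_def)
  show "\<exists>g'\<in>coord_ring origin. \<exists>h\<in>coord_ring origin. \<exists>V\<in>opens W.
       x \<in> V \<and> (\<forall>y\<in>V. h y \<noteq> 0 \<and> f y * g y = g' y / h y)"
    using pq(3-6) pq'(3-6) a b T
    by (intro bex3I[where a = a and b = b and c = "V \<inter> V'"]) (auto intro: opens_Int)
qed (use f in \<open>simp add: regular_outside\<close>)

lemma regular_torus_add:
  assumes W: "W \<in> opens (torus n)" and f: "regular W f" and g: "regular W g"
  shows "regular W (\<lambda>x. f x + g x)"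
proof (rule regular_torusI[OF W])
  fix x assume x: "x \<in> W"
  obtain p q V where pq: "p \<in> coord_ring origin" "q \<in> coord_ring origin" "V \<in> opens W" "x \<in> V"
    "\<And>y. y \<in> V \<Longrightarrow> q y \<noteq> 0" "\<And>y. y \<in> V \<Longrightarrow> f y = p y / q y"
    using regular_torusE[OF W f x] by metis
  obtain p' q' V' where pq': "p' \<in> coord_ring origin" "q' \<in> coord_ring origin" "V' \<in> opens W" "x \<in> V'"
    "\<And>y. y \<in> V' \<Longrightarrow> q' y \<noteq> 0" "\<And>y. y \<in> V' \<Longrightarrow> g y = p' y / q' y"
    using regular_torusE[OF W g x] by metis
  obtain a where a: "a \<in> coord_ring origin" "\<And>x. x \<in> torus n \<Longrightarrow> a x = p x * q' x"
    using coord_ring_torus_mult[OF pq(1) pq'(2)] by metis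
  obtain a' where a': "a' \<in> coord_ring origin" "\<And>x. x \<in> torus n \<Longrightarrow> a' x = p' x * q x"
    using coord_ring_torus_mult[OF pq'(1) pq(2)] by metis
  obtain b where b: "b \<in> coord_ring origin" "\<And>x. x \<in> torus n \<Longrightarrow> b x = q x * q' x"
    using coord_ring_torus_mult[OF pq(2) pq'(2)] by metis
  have T: "y \<in> torus n" if "y \<in> V" for y using that pq(3) W by (auto simp: opens_def)
  show "\<exists>g'\<in>coord_ring origin. \<exists>h\<in>coord_ring origin. \<exists>V\<in>opens W.
       x \<in> V \<and> (\<forall>y\<in>V. h y \<noteq> 0 \<and> f y + g y = g' y / h y)"
  proof (intro bex3I[where a = "\<lambda>x. a x + a' x" and b = b and c = "V \<inter> V'"] conjI ballI)
    fix y assume y: "y \<in> V \<inter> V'"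
    then have "q y \<noteq> 0" "q' y \<noteq> 0" "f y = p y / q y" "g y = p' y / q' y" "y \<in> torus n"
      using pq pq' T by auto
    then show "b y \<noteq> 0" "f y + g y = (a y + a' y) / b y"
      using a(2) a'(2) b(2) by (auto simp: add_frac_eq)
  qed (use pq(3,4) pq'(3,4) a a' b in \<open>auto intro: opens_Int coord_ring_add\<close>)
qed (use f g in \<open>simp add: regular_outside\<close>)

subsection \<open>Invariant vector fields\<close>

definition flow :: "complex vec \<Rightarrow> point \<Rightarrow> complex \<Rightarrow> point" where
  "flow v x z = act (torus_exp n (z \<cdot>\<^sub>v v)) x"

lemma chi_flow:
  assumes "m \<in> carrier_vec n" "v \<in> carrier_vec n"
  shows "chi m (flow v x z) = exp (z * (map_vec complex_of_int m \<bullet> v)) * chi m x"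
  using assms by (simp add: flow_def chi_act chi_torus_exp)

lemma flow_in_torus: "v \<in> carrier_vec n \<Longrightarrow> x \<in> torus n \<Longrightarrow> flow v x z \<in> torus n"
  by (simp add: flow_def act_in_torus torus_exp_in_torus)

lemma flow_0: "v \<in> carrier_vec n \<Longrightarrow> x \<in> torus n \<Longrightarrow> flow v x 0 = x"
  by (intro torus_eqI flow_in_torus) (auto simp: chi_flow)

text \<open>The flow of \<open>v\<close> multiplies \<open>\<chi>\<^sup>m\<close> by \<open>exp(z \<langle>m, v\<rangle>)\<close>, so the derivative of a Laurent polynomial is one again.\<close>

lemma coord_ring_deriv:
  assumes "g \<in> coord_ring origin" "v \<in> carrier_vec n"
  obtains g' where "g' \<in> coord_ring origin"
    "\<And>x. ((\<lambda>z. g (flow v x z)) has_field_derivative g' x) (at 0)"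
proof -
  obtain A c where A: "finite A" "A \<subseteq> carrier_vec n" "g = (\<lambda>x. \<Sum>m\<in>A. c m * chi m x)"
    using coord_ringE[OF assms(1)] by (metis cone_semigroup_origin)
  define g' where "g' = (\<lambda>x. \<Sum>m\<in>A. (c m * (map_vec complex_of_int m \<bullet> v)) * chi m x)"
  have "g' \<in> coord_ring origin" unfolding g'_def using A by (intro coord_ringI) auto
  moreover have "((\<lambda>z. g (flow v x z)) has_field_derivative g' x) (at 0)" for x
  proof -
    have "((\<lambda>z. c m * chi m (flow v x z)) has_field_derivative
        c m * (map_vec complex_of_int m \<bullet> v) * chi m x) (at 0)" if "m \<in> A" for m
    proof -
      have m: "m \<in> carrier_vec n" using that A(2) by blast
      show ?thesis unfolding chi_flow[OF m assms(2)]
        by (auto intro!: derivative_eq_intros)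
    qed
    then show ?thesis unfolding A(3) g'_def by (rule DERIV_sum)
  qed
  ultimately show thesis by (rule that)
qed

text \<open>Zariski open subsets of the torus are open along flow lines, because Laurent polynomials are continuous
  there. This makes the derivative of a function at a point depend only on its germ.\<close>

lemma eventually_flow_in_open:
  assumes "V \<in> opens (torus n)" "x \<in> V" "v \<in> carrier_vec n"
  shows "\<forall>\<^sub>F z in nhds 0. flow v x z \<in> V"
proof -
  have V: "zopen V" "V \<subseteq> torus n" using assms(1) by (auto simp: opens_def)
  have x: "x \<in> torus n" using V(2) assms(2) by blast
  obtain f where f: "f \<in> coord_ring origin" "f x \<noteq> 0" "\<And>y. y \<in> torus n \<Longrightarrow> f y \<noteq> 0 \<Longrightarrow> y \<in> V"
    using zopenD[OF V(1) origin_in_fan assms(2)] x unfolding chart_origin by blast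
  obtain f' where "\<And>x. ((\<lambda>z. f (flow v x z)) has_field_derivative f' x) (at 0)"
    using coord_ring_deriv[OF f(1) assms(3)] by metis
  then have "isCont (\<lambda>z. f (flow v x z)) 0" using DERIV_isCont by blast
  then have "((\<lambda>z. f (flow v x z)) \<longlongrightarrow> f x) (nhds 0)"
    using flow_0[OF assms(3) x] by (simp add: isCont_def tendsto_nhds_iff)
  then have "\<forall>\<^sub>F z in nhds 0. f (flow v x z) \<noteq> 0"
    using f(2) by (rule tendsto_imp_eventually_ne)
  then show ?thesis
    by eventually_elim (use f(3) flow_in_torus[OF assms(3) x] in blast)
qed

text \<open>The quotient rule, with numerator and denominator that serve a whole neighbourhood.\<close>

lemma regular_deriv:
  assumes W: "W \<in> opens (torus n)" and f: "regular W f" and v: "v \<in> carrier_vec n" and x: "x \<in> W"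
  obtains a b V where "a \<in> coord_ring origin" "b \<in> coord_ring origin" "V \<in> opens W" "x \<in> V"
    "\<And>y. y \<in> V \<Longrightarrow> b y \<noteq> 0"
    "\<And>y. y \<in> V \<Longrightarrow> ((\<lambda>z. f (flow v y z)) has_field_derivative a y / b y) (at 0)"
proof -
  obtain p q V where pq: "p \<in> coord_ring origin" "q \<in> coord_ring origin" "V \<in> opens W" "x \<in> V"
    "\<And>y. y \<in> V \<Longrightarrow> q y \<noteq> 0" "\<And>y. y \<in> V \<Longrightarrow> f y = p y / q y"
    using regular_torusE[OF W f x] by metis
  obtain p' where p': "p' \<in> coord_ring origin"
    "\<And>x. ((\<lambda>z. p (flow v x z)) has_field_derivative p' x) (at 0)"
    using coord_ring_deriv[OF pq(1) v] by metis
  obtain q' where q': "q' \<in> coord_ring origin"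
    "\<And>x. ((\<lambda>z. q (flow v x z)) has_field_derivative q' x) (at 0)"
    using coord_ring_deriv[OF pq(2) v] by metis
  obtain a1 where a1: "a1 \<in> coord_ring origin" "\<And>x. x \<in> torus n \<Longrightarrow> a1 x = p' x * q x"
    using coord_ring_torus_mult[OF p'(1) pq(2)] by metis
  obtain a2 where a2: "a2 \<in> coord_ring origin" "\<And>x. x \<in> torus n \<Longrightarrow> a2 x = p x * q' x"
    using coord_ring_torus_mult[OF pq(1) q'(1)] by metis
  obtain b where b: "b \<in> coord_ring origin" "\<And>x. x \<in> torus n \<Longrightarrow> b x = q x * q x"
    using coord_ring_torus_mult[OF pq(2) pq(2)] by metis
  have VT: "V \<in> opens (torus n)" using opens_trans[OF pq(3) W] .
  have T: "y \<in> torus n" if "y \<in> V" for y using that VT by (auto simp: opens_def)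
  show thesis
  proof (rule that[of "\<lambda>x. a1 x + (-1) * a2 x" b V])
    fix y assume y: "y \<in> V"
    have ne: "q (flow v y 0) \<noteq> 0" using pq(5) y flow_0[OF v T[OF y]] by simp
    have "((\<lambda>z. p (flow v y z) / q (flow v y z)) has_field_derivative
        (p' y * q (flow v y 0) - p (flow v y 0) * q' y) / (q (flow v y 0) * q (flow v y 0))) (at 0)"
      by (rule DERIV_divide[OF p'(2) q'(2) ne])
    then have "((\<lambda>z. p (flow v y z) / q (flow v y z)) has_field_derivative
        (a1 y + (-1) * a2 y) / b y) (at 0)"
      using a1(2) a2(2) b(2) T[OF y] flow_0[OF v T[OF y]] by simp
    moreover have "\<forall>\<^sub>F z in nhds 0. f (flow v y z) = p (flow v y z) / q (flow v y z)"
      using eventually_flow_in_open[OF VT y v] by eventually_elim (use pq(6) in blast)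
    ultimately show "((\<lambda>z. f (flow v y z)) has_field_derivative (a1 y + (-1) * a2 y) / b y) (at 0)"
      by (subst DERIV_cong_ev[OF refl _ refl])
    show "b y \<noteq> 0" using b(2)[OF T[OF y]] pq(5)[OF y] by simp
  next
    show "(\<lambda>x. a1 x + (-1) * a2 x) \<in> coord_ring origin"
      by (rule coord_ring_add[OF a1(1) coord_ring_scale[OF a2(1)]])
  qed (use pq b in auto)
qed

lemma regular_has_deriv:
  assumes "W \<in> opens (torus n)" "regular W f" "v \<in> carrier_vec n" "x \<in> W"
  shows "((\<lambda>z. f (flow v x z)) has_field_derivative deriv (\<lambda>z. f (flow v x z)) 0) (at 0)"
proof -
  obtain a b V where "x \<in> V"
    "\<And>y. y \<in> V \<Longrightarrow> ((\<lambda>z. f (flow v y z)) has_field_derivative a y / b y) (at 0)"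
    using regular_deriv[OF assms] by metis
  then show ?thesis using DERIV_imp_deriv by metis
qed

lemma regular_deriv_along:
  assumes W: "W \<in> opens (torus n)" and f: "regular W f" and v: "v \<in> carrier_vec n"
  shows "regular W (on_set W (\<lambda>x. deriv (\<lambda>z. f (flow v x z)) 0))"
proof (rule regular_torusI[OF W])
  fix x assume x: "x \<in> W"
  obtain a b V where ab: "a \<in> coord_ring origin" "b \<in> coord_ring origin" "V \<in> opens W" "x \<in> V"
    "\<And>y. y \<in> V \<Longrightarrow> b y \<noteq> 0"
    "\<And>y. y \<in> V \<Longrightarrow> ((\<lambda>z. f (flow v y z)) has_field_derivative a y / b y) (at 0)"
    using regular_deriv[OF W f v x] by metis
  have "on_set W (\<lambda>x. deriv (\<lambda>z. f (flow v x z)) 0) y = a y / b y" if y: "y \<in> V" for y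
  proof -
    have "y \<in> W" using ab(3) y by (auto simp: opens_def)
    then show ?thesis using DERIV_imp_deriv[OF ab(6)[OF y]] by simp
  qed
  then show "\<exists>g\<in>coord_ring origin. \<exists>h\<in>coord_ring origin. \<exists>V\<in>opens W. x \<in> V \<and>
      (\<forall>y\<in>V. h y \<noteq> 0 \<and> on_set W (\<lambda>x. deriv (\<lambda>z. f (flow v x z)) 0) y = g y / h y)"
    using ab by blast
qed simp

lemma invariant_field_apply:
  "W \<in> opens U \<Longrightarrow> regular W f \<Longrightarrow>
    invariant_field U v W f = on_set W (\<lambda>x. deriv (\<lambda>z. f (flow v x z)) 0)"
  by (simp add: invariant_field_def flow_def)

lemma restrict_invariant_field:
  "V \<in> opens U \<Longrightarrow> res tangent_sheaf U V (invariant_field U v) = invariant_field V v"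
  by (auto simp: tangent_sheaf_def fam_sheaf_def invariant_field_def restrict_def fun_eq_iff opens_def)

lemma deriv_on_set:
  assumes "V \<in> opens (torus n)" "x \<in> V" "v \<in> carrier_vec n"
  shows "deriv (\<lambda>z. on_set V f (flow v x z)) 0 = deriv (\<lambda>z. f (flow v x z)) 0"
  by (rule deriv_cong_ev[OF eventually_mono[OF eventually_flow_in_open[OF assms]]]) auto

lemma invariant_field_in_tangent_sheaf:
  assumes U: "U \<in> opens (torus n)" and v: "v \<in> carrier_vec n"
  shows "invariant_field U v \<in> carrier (sec tangent_sheaf U)"
proof -
  have W: "W \<in> opens (torus n)" if "W \<in> opens U" for W using opens_trans[OF that U] .
  have "derivation W (invariant_field U v W)" if WU: "W \<in> opens U" for W
    unfolding derivation_def
  proof (intro conjI ballI allI)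
    fix f g assume "f \<in> carrier (reg_ring W)" "g \<in> carrier (reg_ring W)"
    then have f: "regular W f" and g: "regular W g" by auto
    note df = regular_has_deriv[OF W[OF WU] f v] and dg = regular_has_deriv[OF W[OF WU] g v]
    have "regular W (\<lambda>x. f x + g x)" "regular W (\<lambda>x. f x * g x)"
      using regular_torus_add regular_torus_mult W[OF WU] f g by blast+
    moreover have "deriv (\<lambda>z. f (flow v x z) + g (flow v x z)) 0
        = deriv (\<lambda>z. f (flow v x z)) 0 + deriv (\<lambda>z. g (flow v x z)) 0" if "x \<in> W" for x
      by (rule DERIV_imp_deriv[OF DERIV_add[OF df[OF that] dg[OF that]]])
    moreover have "deriv (\<lambda>z. f (flow v x z) * g (flow v x z)) 0
        = f x * deriv (\<lambda>z. g (flow v x z)) 0 + g x * deriv (\<lambda>z. f (flow v x z)) 0" if "x \<in> W" for x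
      using DERIV_imp_deriv[OF DERIV_mult[OF df[OF that] dg[OF that]]]
        flow_0[OF v, of x] that W[OF WU] by (auto simp: opens_def algebra_simps subset_iff)
    ultimately show "invariant_field U v W (f \<oplus>\<^bsub>reg_ring W\<^esub> g)
          = invariant_field U v W f \<oplus>\<^bsub>reg_ring W\<^esub> invariant_field U v W g"
        "invariant_field U v W (f \<otimes>\<^bsub>reg_ring W\<^esub> g)
          = f \<otimes>\<^bsub>reg_ring W\<^esub> invariant_field U v W g \<oplus>\<^bsub>reg_ring W\<^esub> g \<otimes>\<^bsub>reg_ring W\<^esub> invariant_field U v W f"
      using f g WU by (auto simp: invariant_field_apply fun_eq_iff on_set_def)
  next
    fix c
    have "deriv (\<lambda>z. const W c (flow v x z)) 0 = 0" if "x \<in> W" for x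
      unfolding const_def using deriv_on_set[OF W[OF WU] that v] by simp
    then show "invariant_field U v W (const W c) = \<zero>\<^bsub>reg_ring W\<^esub>"
      using WU regular_torus_const[OF W[OF WU]] by (auto simp: invariant_field_apply fun_eq_iff on_set_def)
  qed
  moreover have "invariant_field U v V (on_set V a) = on_set V (invariant_field U v W a)"
    if WU: "W \<in> opens U" and VW: "V \<in> opens W" and a: "regular W a" for W V a
  proof -
    have VU: "V \<in> opens U" using opens_trans[OF VW WU] .
    have "V \<subseteq> W" using VW by (simp add: opens_def)
    then show ?thesis
      using deriv_on_set[OF W[OF VU] _ v, of _ a] regular_restrict[OF a VW] WU VU a
      by (auto simp: invariant_field_apply fun_eq_iff on_set_def)
  qed
  moreover have "invariant_field U v W f \<in> carrier (reg_ring W)"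
    if "W \<in> opens U" "regular W f" for W f
    using regular_deriv_along[OF W[OF that(1)] that(2) v] that by (simp add: invariant_field_apply)
  ultimately show ?thesis
    by (auto simp: tangent_sheaf_def fam_sheaf_def invariant_field_def)
qed

text \<open>The invariant field of \<open>e\<^sub>i\<close> has \<open>\<chi>\<^sup>s\<close> as an eigenfunction with eigenvalue \<open>s\<^sub>i\<close>.\<close>

lemma invariant_field_chi:
  assumes V: "V \<in> opens (torus n)" and s: "s \<in> carrier_vec n" and i: "i < n"
  shows "invariant_field V (unit_vec n i) V (on_set V (chi s))
    = on_set V (\<lambda>x. of_int (s $ i) * chi s x)"
proof
  fix x
  have e: "unit_vec n i \<in> carrier_vec n" by simp
  show "invariant_field V (unit_vec n i) V (on_set V (chi s)) x
    = on_set V (\<lambda>x. of_int (s $ i) * chi s x) x"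
  proof (cases "x \<in> V")
    case True
    have "((\<lambda>z. chi s (flow (unit_vec n i) x z)) has_field_derivative of_int (s $ i) * chi s x) (at 0)"
      unfolding chi_flow[OF s e] using s i by (auto intro!: derivative_eq_intros)
    then have "deriv (\<lambda>z. chi s (flow (unit_vec n i) x z)) 0 = of_int (s $ i) * chi s x"
      by (rule DERIV_imp_deriv)
    then show ?thesis
      using True V regular_chi[OF V s] deriv_on_set[OF V True e]
      by (simp add: invariant_field_apply opens_self opens_def)
  next
    case False
    then show ?thesis using V regular_chi[OF V s]
      by (simp add: invariant_field_apply opens_self opens_def)
  qed
qed

end


section \<open>The fibre of a sheaf of modules\<close>

lemma (in abelian_monoid) finsum_induct:
  assumes "finite A" "f \<in> A \<rightarrow> carrier G" "P \<zero>"
    "\<And>a. a \<in> A \<Longrightarrow> P (f a)" "\<And>x y. x \<in> carrier G \<Longrightarrow> y \<in> carrier G \<Longrightarrow> P x \<Longrightarrow> P y \<Longrightarrow> P (x \<oplus> y)"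
  shows "P (\<Oplus>a\<in>A. f a)"
  using assms(1,2,4)
proof (induction A)
  case empty
  then show ?case using assms(3) by simp
next
  case (insert b A)
  have "(\<Oplus>a\<in>insert b A. f a) = f b \<oplus> (\<Oplus>a\<in>A. f a)"
    using insert by (intro finsum_insert) auto
  then show ?case using insert by (auto intro!: assms(5))
qed

lemma finsum_hom:
  assumes "abelian_monoid G" "abelian_monoid H" "finite A" "f \<in> A \<rightarrow> carrier G"
    "h \<in> carrier G \<rightarrow> carrier H" "h \<zero>\<^bsub>G\<^esub> = \<zero>\<^bsub>H\<^esub>"
    "\<And>x y. x \<in> carrier G \<Longrightarrow> y \<in> carrier G \<Longrightarrow> h (x \<oplus>\<^bsub>G\<^esub> y) = h x \<oplus>\<^bsub>H\<^esub> h y"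
  shows "h (\<Oplus>\<^bsub>G\<^esub>a\<in>A. f a) = (\<Oplus>\<^bsub>H\<^esub>a\<in>A. h (f a))"
proof -
  interpret G: abelian_monoid G by fact
  interpret H: abelian_monoid H by fact
  show ?thesis using assms(3,4)
  proof (induction A)
    case empty
    then show ?case using assms(6) by simp
  next
    case (insert b A)
    have f: "f \<in> A \<rightarrow> carrier G" "f b \<in> carrier G" using insert.prems by auto
    have hf: "(\<lambda>a. h (f a)) \<in> A \<rightarrow> carrier H" "h (f b) \<in> carrier H" using f assms(5) by auto
    have "h (\<Oplus>\<^bsub>G\<^esub>a\<in>insert b A. f a) = h (f b \<oplus>\<^bsub>G\<^esub> (\<Oplus>\<^bsub>G\<^esub>a\<in>A. f a))"
      by (simp only: G.finsum_insert[OF insert.hyps f])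
    also have "\<dots> = h (f b) \<oplus>\<^bsub>H\<^esub> h (\<Oplus>\<^bsub>G\<^esub>a\<in>A. f a)"
      by (rule assms(7)[OF f(2) G.finsum_closed[OF f(1)]])
    also have "\<dots> = (\<Oplus>\<^bsub>H\<^esub>a\<in>insert b A. h (f a))"
      by (simp only: H.finsum_insert[OF insert.hyps hf] insert.IH[OF f(1)])
    finally show ?case .
  qed
qed

locale module_sheaf = toric_variety n \<Delta> for n :: nat and \<Delta> :: "real vec set set" +
  fixes F :: "'s presheaf"
  assumes sheaf: "sheaf_of_modules F"
begin

lemma section_module: "zopen U \<Longrightarrow> Module.module (reg_ring U) (sec F U)"
  using sheaf[unfolded sheaf_of_modules_def, THEN conjunct1] by blast

lemma cring_reg_ring: "zopen U \<Longrightarrow> cring (reg_ring U)"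
  using section_module Module.module.axioms(1) by blast

lemma abelian_group_sections: "zopen U \<Longrightarrow> abelian_group (sec F U)"
  using section_module Module.module.axioms(2) by blast

lemma res_facts:
  assumes "zopen U" "V \<in> opens U"
  shows "res F U V \<in> carrier (sec F U) \<rightarrow> carrier (sec F V) \<and>
        (\<forall>s\<in>carrier (sec F U). \<forall>s'\<in>carrier (sec F U).
           res F U V (s \<oplus>\<^bsub>sec F U\<^esub> s') = res F U V s \<oplus>\<^bsub>sec F V\<^esub> res F U V s') \<and>
        (\<forall>f\<in>carrier (reg_ring U). \<forall>s\<in>carrier (sec F U).
           res F U V (f \<odot>\<^bsub>sec F U\<^esub> s) = on_set V f \<odot>\<^bsub>sec F V\<^esub> res F U V s) \<and>
        (\<forall>W\<in>opens V. \<forall>s\<in>carrier (sec F U). res F V W (res F U V s) = res F U W s)"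
  using assms sheaf[unfolded sheaf_of_modules_def, THEN conjunct2, THEN conjunct1, rule_format, of U V]
  by simp

lemma res_closed: "V \<in> opens U \<Longrightarrow> zopen U \<Longrightarrow> s \<in> carrier (sec F U) \<Longrightarrow> res F U V s \<in> carrier (sec F V)"
  using res_facts by blast

lemma res_add: "V \<in> opens U \<Longrightarrow> zopen U \<Longrightarrow> s \<in> carrier (sec F U) \<Longrightarrow> s' \<in> carrier (sec F U) \<Longrightarrow>
  res F U V (s \<oplus>\<^bsub>sec F U\<^esub> s') = res F U V s \<oplus>\<^bsub>sec F V\<^esub> res F U V s'"
  using res_facts by blast

lemma res_smult: "V \<in> opens U \<Longrightarrow> zopen U \<Longrightarrow> regular U f \<Longrightarrow> s \<in> carrier (sec F U) \<Longrightarrow>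
  res F U V (f \<odot>\<^bsub>sec F U\<^esub> s) = on_set V f \<odot>\<^bsub>sec F V\<^esub> res F U V s"
  using res_facts by (metis carrier_reg_ring mem_Collect_eq)

lemma res_res: "W \<in> opens V \<Longrightarrow> V \<in> opens U \<Longrightarrow> zopen U \<Longrightarrow> s \<in> carrier (sec F U) \<Longrightarrow>
  res F V W (res F U V s) = res F U W s"
  using res_facts by blast

lemma res_self: "zopen U \<Longrightarrow> s \<in> carrier (sec F U) \<Longrightarrow> res F U U s = s"
  using sheaf[unfolded sheaf_of_modules_def, THEN conjunct2, THEN conjunct2, THEN conjunct1] by blast

lemma opens_zopen: "W \<in> opens U \<Longrightarrow> zopen W"
  by (simp add: opens_def)

lemma res_zero: assumes "V \<in> opens U" "zopen U" shows "res F U V \<zero>\<^bsub>sec F U\<^esub> = \<zero>\<^bsub>sec F V\<^esub>"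
proof -
  interpret U: abelian_group "sec F U" by (rule abelian_group_sections) fact
  interpret V: abelian_group "sec F V" by (rule abelian_group_sections[OF opens_zopen[OF assms(1)]])
  have "res F U V \<zero>\<^bsub>sec F U\<^esub> = res F U V \<zero>\<^bsub>sec F U\<^esub> \<oplus>\<^bsub>sec F V\<^esub> res F U V \<zero>\<^bsub>sec F U\<^esub>"
    using res_add[OF assms U.zero_closed U.zero_closed] by simp
  then show ?thesis using res_closed[OF assms U.zero_closed]
    by (metis V.add.l_cancel_one)
qed

lemma res_minus:
  assumes "V \<in> opens U" "zopen U" "s \<in> carrier (sec F U)" "s' \<in> carrier (sec F U)"
  shows "res F U V (s \<ominus>\<^bsub>sec F U\<^esub> s') = res F U V s \<ominus>\<^bsub>sec F V\<^esub> res F U V s'"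
proof -
  interpret U: abelian_group "sec F U" by (rule abelian_group_sections) fact
  interpret V: abelian_group "sec F V" by (rule abelian_group_sections[OF opens_zopen[OF assms(1)]])
  have "res F U V (\<ominus>\<^bsub>sec F U\<^esub> s') \<oplus>\<^bsub>sec F V\<^esub> res F U V s' = \<zero>\<^bsub>sec F V\<^esub>"
    using res_add[OF assms(1,2) U.a_inv_closed[OF assms(4)] assms(4)] res_zero[OF assms(1,2)] assms(4)
    by (simp add: U.l_neg)
  then have "res F U V (\<ominus>\<^bsub>sec F U\<^esub> s') = \<ominus>\<^bsub>sec F V\<^esub> res F U V s'"
    using res_closed[OF assms(1,2)] assms(4) V.minus_equality by auto
  then show ?thesis
    using assms by (simp add: a_minus_def res_add)
qed

text \<open>The constant \<open>1\<close> is regular as the unit of the ring over which the sections form a module; the other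
  constants are its multiples.\<close>

lemma regular_const: assumes "zopen U" shows "regular U (const U c)"
proof -
  interpret cring "reg_ring U" by (rule cring_reg_ring) fact
  have "regular U (\<lambda>x. c * const U 1 x)" using one_closed by (intro regular_scale) auto
  moreover have "(\<lambda>x. c * const U 1 x) = const U c" by (auto simp: const_def on_set_def)
  ultimately show ?thesis by simp
qed

lemma on_set_const [simp]: "V \<subseteq> U \<Longrightarrow> on_set V (const U c) = const V c"
  by (auto simp: const_def on_set_def fun_eq_iff)

subsection \<open>Sections vanishing in the fibre\<close>

context
  fixes x :: point
begin

lemma max_ideal_generator:
  assumes "zopen W" "regular W f" "f x = 0" "g \<in> carrier (sec F W)"
  shows "f \<odot>\<^bsub>sec F W\<^esub> g \<in> max_ideal_sections F x W"
proof -
  interpret Module.module "reg_ring W" "sec F W" by (rule section_module) fact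
  have "f \<odot>\<^bsub>sec F W\<^esub> g = (\<Oplus>\<^bsub>sec F W\<^esub>g'\<in>{g}. f \<odot>\<^bsub>sec F W\<^esub> g')"
    using assms by (subst M.finsum_insert) auto
  then show ?thesis unfolding max_ideal_sections_def using assms
    by (intro CollectI exI[of _ "{g}"] exI[of _ "\<lambda>_. f"]) auto
qed

lemma max_ideal_zero: "\<zero>\<^bsub>sec F W\<^esub> \<in> max_ideal_sections F x W" if "zopen W"
proof -
  interpret Module.module "reg_ring W" "sec F W" by (rule section_module) fact
  show ?thesis unfolding max_ideal_sections_def
    by (intro CollectI exI[of _ "{}"] exI[of _ "\<lambda>_. \<zero>\<^bsub>reg_ring W\<^esub>"]) (simp del: reg_ring_simps)
qed

text \<open>Two combinations may share generators, so their coefficients are extended by zero and added.\<close>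

lemma max_ideal_add:
  assumes "zopen W" "a \<in> max_ideal_sections F x W" "b \<in> max_ideal_sections F x W"
  shows "a \<oplus>\<^bsub>sec F W\<^esub> b \<in> max_ideal_sections F x W"
proof -
  interpret Module.module "reg_ring W" "sec F W" by (rule section_module) fact
  obtain G c where a: "finite G" "G \<subseteq> carrier (sec F W)" "c \<in> G \<rightarrow> {f \<in> carrier (reg_ring W). f x = 0}"
    "a = (\<Oplus>\<^bsub>sec F W\<^esub>g\<in>G. c g \<odot>\<^bsub>sec F W\<^esub> g)"
    using assms(2) unfolding max_ideal_sections_def by blast
  obtain H d where b: "finite H" "H \<subseteq> carrier (sec F W)" "d \<in> H \<rightarrow> {f \<in> carrier (reg_ring W). f x = 0}"
    "b = (\<Oplus>\<^bsub>sec F W\<^esub>g\<in>H. d g \<odot>\<^bsub>sec F W\<^esub> g)"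
    using assms(3) unfolding max_ideal_sections_def by blast
  define c' where "c' g = (if g \<in> G then c g else \<zero>\<^bsub>reg_ring W\<^esub>)" for g
  define d' where "d' g = (if g \<in> H then d g else \<zero>\<^bsub>reg_ring W\<^esub>)" for g
  have c': "c' g \<in> carrier (reg_ring W)" "c' g x = 0" if "g \<in> G \<union> H" for g
    using a(3) that R.zero_closed by (auto simp: c'_def)
  have d': "d' g \<in> carrier (reg_ring W)" "d' g x = 0" if "g \<in> G \<union> H" for g
    using b(3) that R.zero_closed by (auto simp: d'_def)
  have cl: "g \<in> carrier (sec F W)" if "g \<in> G \<union> H" for g using that a(2) b(2) by blast
  have "a = (\<Oplus>\<^bsub>sec F W\<^esub>g\<in>G \<union> H. c' g \<odot>\<^bsub>sec F W\<^esub> g)" unfolding a(4)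
    by (rule M.add.finprod_mono_neutral_cong_left)
       (use a(1,2) b(1,2) c' cl in \<open>auto simp: c'_def simp del: reg_ring_simps carrier_reg_ring\<close>)
  moreover have "b = (\<Oplus>\<^bsub>sec F W\<^esub>g\<in>G \<union> H. d' g \<odot>\<^bsub>sec F W\<^esub> g)" unfolding b(4)
    by (rule M.add.finprod_mono_neutral_cong_left)
       (use a(1,2) b(1,2) d' cl in \<open>auto simp: d'_def simp del: reg_ring_simps carrier_reg_ring\<close>)
  ultimately have "a \<oplus>\<^bsub>sec F W\<^esub> b
      = (\<Oplus>\<^bsub>sec F W\<^esub>g\<in>G \<union> H. c' g \<odot>\<^bsub>sec F W\<^esub> g \<oplus>\<^bsub>sec F W\<^esub> d' g \<odot>\<^bsub>sec F W\<^esub> g)"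
    using c' d' cl by (simp add: M.finsum_addf Pi_def)
  also have "\<dots> = (\<Oplus>\<^bsub>sec F W\<^esub>g\<in>G \<union> H. (c' g \<oplus>\<^bsub>reg_ring W\<^esub> d' g) \<odot>\<^bsub>sec F W\<^esub> g)"
    using c' d' cl by (intro M.finsum_cong') (auto simp: smult_l_distr simp del: reg_ring_simps carrier_reg_ring)
  finally have eq: "a \<oplus>\<^bsub>sec F W\<^esub> b = (\<Oplus>\<^bsub>sec F W\<^esub>g\<in>G \<union> H. (c' g \<oplus>\<^bsub>reg_ring W\<^esub> d' g) \<odot>\<^bsub>sec F W\<^esub> g)" .
  have "(\<lambda>g. c' g \<oplus>\<^bsub>reg_ring W\<^esub> d' g) \<in> G \<union> H \<rightarrow> {f \<in> carrier (reg_ring W). f x = 0}"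
  proof (rule Pi_I)
    fix g assume "g \<in> G \<union> H"
    then show "c' g \<oplus>\<^bsub>reg_ring W\<^esub> d' g \<in> {f \<in> carrier (reg_ring W). f x = 0}"
      using c'[of g] d'[of g] R.a_closed[of "c' g" "d' g"] by simp
  qed
  then show ?thesis unfolding max_ideal_sections_def using eq a(1,2) b(1,2)
    by (intro CollectI exI[of _ "G \<union> H"] exI[of _ "\<lambda>g. c' g \<oplus>\<^bsub>reg_ring W\<^esub> d' g"]) auto
qed

text \<open>Reduces statements about \<open>\<mm>\<^sub>x F\<close> to single products \<open>f g\<close> with \<open>f x = 0\<close>.\<close>

lemma max_ideal_induct:
  assumes W: "zopen W" and a: "a \<in> max_ideal_sections F x W" and z: "P \<zero>\<^bsub>sec F W\<^esub>"
    and g: "\<And>f g. regular W f \<Longrightarrow> f x = 0 \<Longrightarrow> g \<in> carrier (sec F W) \<Longrightarrow> P (f \<odot>\<^bsub>sec F W\<^esub> g)"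
    and p: "\<And>a b. a \<in> carrier (sec F W) \<Longrightarrow> b \<in> carrier (sec F W) \<Longrightarrow> P a \<Longrightarrow> P b \<Longrightarrow> P (a \<oplus>\<^bsub>sec F W\<^esub> b)"
  shows "P a"
proof -
  interpret Module.module "reg_ring W" "sec F W" by (rule section_module) fact
  obtain G c where a: "finite G" "G \<subseteq> carrier (sec F W)" "c \<in> G \<rightarrow> {f \<in> carrier (reg_ring W). f x = 0}"
    "a = (\<Oplus>\<^bsub>sec F W\<^esub>g\<in>G. c g \<odot>\<^bsub>sec F W\<^esub> g)"
    using a unfolding max_ideal_sections_def by blast
  show ?thesis unfolding a(4)
  proof (rule M.finsum_induct[OF a(1)])
    show "(\<lambda>g. c g \<odot>\<^bsub>sec F W\<^esub> g) \<in> G \<rightarrow> carrier (sec F W)"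
      using a(2) funcset_mem[OF a(3)] by auto
    show "P (c b \<odot>\<^bsub>sec F W\<^esub> b)" if "b \<in> G" for b using a(2,3) that by (intro g) auto
  qed (rule z, rule p)
qed

lemma max_ideal_carrier: 
  assumes "zopen W" "a \<in> max_ideal_sections F x W" shows "a \<in> carrier (sec F W)"
proof -
  interpret Module.module "reg_ring W" "sec F W" by (rule section_module) fact
  show ?thesis using assms(1,2) by (rule max_ideal_induct) auto
qed

lemma max_ideal_smult:
  assumes "zopen W" "a \<in> max_ideal_sections F x W" "regular W h"
  shows "h \<odot>\<^bsub>sec F W\<^esub> a \<in> max_ideal_sections F x W"
proof -
  interpret Module.module "reg_ring W" "sec F W" by (rule section_module) fact
  show ?thesis using assms(1,2)
  proof (rule max_ideal_induct)
    show "h \<odot>\<^bsub>sec F W\<^esub> \<zero>\<^bsub>sec F W\<^esub> \<in> max_ideal_sections F x W"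
      using max_ideal_zero[OF assms(1)] assms(3) by simp
    fix f g assume f: "regular W f" "f x = 0" and g: "g \<in> carrier (sec F W)"
    have "h \<odot>\<^bsub>sec F W\<^esub> (f \<odot>\<^bsub>sec F W\<^esub> g) = (\<lambda>x. h x * f x) \<odot>\<^bsub>sec F W\<^esub> g"
      using smult_assoc1[of h f g] f g assms(3) by simp
    moreover have "regular W (\<lambda>x. h x * f x)" using R.m_closed[of h f] f assms(3) by simp
    ultimately show "h \<odot>\<^bsub>sec F W\<^esub> (f \<odot>\<^bsub>sec F W\<^esub> g) \<in> max_ideal_sections F x W"
      using max_ideal_generator[OF assms(1), of "\<lambda>x. h x * f x" g] f g by simp
  next
    fix a b assume "a \<in> carrier (sec F W)" "b \<in> carrier (sec F W)"
      "h \<odot>\<^bsub>sec F W\<^esub> a \<in> max_ideal_sections F x W" "h \<odot>\<^bsub>sec F W\<^esub> b \<in> max_ideal_sections F x W"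
    then show "h \<odot>\<^bsub>sec F W\<^esub> (a \<oplus>\<^bsub>sec F W\<^esub> b) \<in> max_ideal_sections F x W"
      using assms(3) by (simp add: smult_r_distr max_ideal_add[OF assms(1)])
  qed
qed

lemma max_ideal_uminus:
  assumes "zopen W" "a \<in> max_ideal_sections F x W"
  shows "\<ominus>\<^bsub>sec F W\<^esub> a \<in> max_ideal_sections F x W"
proof -
  interpret Module.module "reg_ring W" "sec F W" by (rule section_module) fact
  have "\<ominus>\<^bsub>sec F W\<^esub> a = (\<ominus>\<^bsub>reg_ring W\<^esub> \<one>\<^bsub>reg_ring W\<^esub>) \<odot>\<^bsub>sec F W\<^esub> a"
    using max_ideal_carrier[OF assms] by (simp add: smult_l_minus del: reg_ring_simps carrier_reg_ring)
  moreover have "regular W (\<ominus>\<^bsub>reg_ring W\<^esub> \<one>\<^bsub>reg_ring W\<^esub>)"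
    using R.a_inv_closed[OF R.one_closed] by simp
  ultimately show ?thesis using max_ideal_smult[OF assms] by simp
qed

lemma max_ideal_res:
  assumes "zopen W" "V \<in> opens W" "x \<in> V" "a \<in> max_ideal_sections F x W"
  shows "res F W V a \<in> max_ideal_sections F x V"
  using assms(1,4)
proof (rule max_ideal_induct)
  have V: "zopen V" using assms(2) by (rule opens_zopen)
  show "res F W V \<zero>\<^bsub>sec F W\<^esub> \<in> max_ideal_sections F x V"
    using max_ideal_zero[OF V] res_zero assms by simp
  fix f g assume f: "regular W f" "f x = 0" and g: "g \<in> carrier (sec F W)"
  then show "res F W V (f \<odot>\<^bsub>sec F W\<^esub> g) \<in> max_ideal_sections F x V"
    using max_ideal_generator[OF V regular_restrict[OF f(1) assms(2)] _ res_closed[OF assms(2,1) g]] assms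
    by (simp add: res_smult)
next
  fix a b assume "a \<in> carrier (sec F W)" "b \<in> carrier (sec F W)"
      "res F W V a \<in> max_ideal_sections F x V" "res F W V b \<in> max_ideal_sections F x V"
  then show "res F W V (a \<oplus>\<^bsub>sec F W\<^esub> b) \<in> max_ideal_sections F x V"
    using assms max_ideal_add opens_zopen by (simp add: res_add)
qed

subsection \<open>The fibre\<close>

text \<open>Congruence of germs at \<open>x\<close> modulo \<open>\<mm>\<^sub>x\<close>; the elements of the fibre are its classes.\<close>

definition fibre_equiv :: "point set \<Rightarrow> 's \<Rightarrow> point set \<Rightarrow> 's \<Rightarrow> bool" where
  "fibre_equiv U s V s' \<longleftrightarrow> (\<exists>W\<in>opens (U \<inter> V). x \<in> W \<and>
     res F U W s \<ominus>\<^bsub>sec F W\<^esub> res F V W s' \<in> max_ideal_sections F x W)"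

definition section_near :: "point set \<Rightarrow> 's \<Rightarrow> bool" where
  "section_near U s \<longleftrightarrow> zopen U \<and> x \<in> U \<and> s \<in> carrier (sec F U)"

lemma fibre_class_altdef:
  "fibre_class F x U s = {(V, s'). section_near V s' \<and> fibre_equiv U s V s'}"
  unfolding fibre_class_def fibre_equiv_def section_near_def by auto

text \<open>The difference stays in \<open>\<mm>\<^sub>x F\<close> on smaller neighbourhoods, which lets two congruences be compared on a common
  one.\<close>

lemma fibre_equiv_shrink:
  assumes "section_near U s" "section_near V s'" "fibre_equiv U s V s'"
  obtains W where "W \<in> opens (U \<inter> V)" "x \<in> W"
    "\<And>W'. W' \<in> opens W \<Longrightarrow> x \<in> W' \<Longrightarrow>
      res F U W' s \<ominus>\<^bsub>sec F W'\<^esub> res F V W' s' \<in> max_ideal_sections F x W'"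
proof -
  obtain W where W: "W \<in> opens (U \<inter> V)" "x \<in> W"
    "res F U W s \<ominus>\<^bsub>sec F W\<^esub> res F V W s' \<in> max_ideal_sections F x W"
    using assms(3) unfolding fibre_equiv_def by blast
  have WU: "W \<in> opens U" "W \<in> opens V" using W(1) by (auto simp: opens_def)
  have sn: "zopen U" "s \<in> carrier (sec F U)" "zopen V" "s' \<in> carrier (sec F V)"
    using assms(1,2) by (auto simp: section_near_def)
  show thesis
  proof (rule that[OF W(1,2)])
    fix W' assume W': "W' \<in> opens W" "x \<in> W'"
    have zW: "zopen W" using W(1) by (rule opens_zopen)
    have "res F W W' (res F U W s \<ominus>\<^bsub>sec F W\<^esub> res F V W s') \<in> max_ideal_sections F x W'"
      by (rule max_ideal_res[OF zW W' W(3)])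
    then show "res F U W' s \<ominus>\<^bsub>sec F W'\<^esub> res F V W' s' \<in> max_ideal_sections F x W'"
      using W'(1) WU sn zW by (simp add: res_minus res_closed res_res)
  qed
qed

lemma fibre_equivI:
  assumes "section_near U s" "section_near U s'"
    "s \<ominus>\<^bsub>sec F U\<^esub> s' \<in> max_ideal_sections F x U"
  shows "fibre_equiv U s U s'"
  using assms unfolding fibre_equiv_def section_near_def
  by (intro bexI[of _ U]) (auto simp: res_self opens_def)

lemma fibre_equiv_res:
  assumes "section_near U s" "V \<in> opens U" "x \<in> V"
  shows "fibre_equiv U s V (res F U V s)"
proof -
  have V: "zopen V" "V \<subseteq> U" using assms(2) by (auto simp: opens_def)
  have sn: "zopen U" "s \<in> carrier (sec F U)" using assms(1) by (auto simp: section_near_def)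
  interpret abelian_group "sec F V" by (rule abelian_group_sections[OF V(1)])
  have r: "res F U V s \<in> carrier (sec F V)" using res_closed assms(2) sn by blast
  show ?thesis unfolding fibre_equiv_def
    using V assms(3) r max_ideal_zero[OF V(1)]
    by (intro bexI[of _ V]) (auto simp: opens_def res_self a_minus_def r_neg)
qed

lemma fibre_equiv_sym:
  assumes "section_near U s" "section_near V s'" "fibre_equiv U s V s'"
  shows "fibre_equiv V s' U s"
proof -
  obtain W where W: "W \<in> opens (U \<inter> V)" "x \<in> W"
    "\<And>W'. W' \<in> opens W \<Longrightarrow> x \<in> W' \<Longrightarrow>
      res F U W' s \<ominus>\<^bsub>sec F W'\<^esub> res F V W' s' \<in> max_ideal_sections F x W'"
    using fibre_equiv_shrink[OF assms] by metis
  have zW: "zopen W" using W(1) by (rule opens_zopen)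
  interpret abelian_group "sec F W" by (rule abelian_group_sections[OF zW])
  have WU: "W \<in> opens U" "W \<in> opens V" using W(1) by (auto simp: opens_def)
  have c: "res F U W s \<in> carrier (sec F W)" "res F V W s' \<in> carrier (sec F W)"
    using assms(1,2) WU by (auto simp: section_near_def intro: res_closed)
  have "\<ominus>\<^bsub>sec F W\<^esub> (res F U W s \<ominus>\<^bsub>sec F W\<^esub> res F V W s') \<in> max_ideal_sections F x W"
    by (rule max_ideal_uminus[OF zW W(3)[OF opens_self[OF zW] W(2)]])
  moreover have "\<ominus>\<^bsub>sec F W\<^esub> (res F U W s \<ominus>\<^bsub>sec F W\<^esub> res F V W s') = res F V W s' \<ominus>\<^bsub>sec F W\<^esub> res F U W s"
    using c by (simp add: a_minus_def minus_add a_comm minus_minus)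
  ultimately show ?thesis unfolding fibre_equiv_def using W(1,2) by (auto simp: Int_commute)
qed

lemma fibre_equiv_trans:
  assumes "section_near U s" "section_near V s'" "section_near U' s''"
    "fibre_equiv U s V s'" "fibre_equiv V s' U' s''"
  shows "fibre_equiv U s U' s''"
proof -
  obtain W1 where W1: "W1 \<in> opens (U \<inter> V)" "x \<in> W1"
    "\<And>W'. W' \<in> opens W1 \<Longrightarrow> x \<in> W' \<Longrightarrow>
      res F U W' s \<ominus>\<^bsub>sec F W'\<^esub> res F V W' s' \<in> max_ideal_sections F x W'"
    using fibre_equiv_shrink[OF assms(1,2,4)] by metis
  obtain W2 where W2: "W2 \<in> opens (V \<inter> U')" "x \<in> W2"
    "\<And>W'. W' \<in> opens W2 \<Longrightarrow> x \<in> W' \<Longrightarrow>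
      res F V W' s' \<ominus>\<^bsub>sec F W'\<^esub> res F U' W' s'' \<in> max_ideal_sections F x W'"
    using fibre_equiv_shrink[OF assms(2,3,5)] by metis
  define W where "W = W1 \<inter> W2"
  have zW: "zopen W" using W1(1) W2(1) unfolding W_def by (auto intro: zopen_Int opens_zopen)
  have W: "W \<in> opens W1" "W \<in> opens W2" "x \<in> W" "W \<in> opens U" "W \<in> opens V" "W \<in> opens U'"
    using zW W1(1,2) W2(1,2) by (auto simp: W_def opens_def)
  interpret abelian_group "sec F W" by (rule abelian_group_sections[OF zW])
  have c: "res F U W s \<in> carrier (sec F W)" "res F V W s' \<in> carrier (sec F W)" "res F U' W s'' \<in> carrier (sec F W)"
    using assms(1-3) W by (auto simp: section_near_def intro: res_closed)
  have "(res F U W s \<ominus>\<^bsub>sec F W\<^esub> res F V W s') \<oplus>\<^bsub>sec F W\<^esub> (res F V W s' \<ominus>\<^bsub>sec F W\<^esub> res F U' W s'')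
      \<in> max_ideal_sections F x W"
    using W1(3) W2(3) W by (intro max_ideal_add[OF zW]) auto
  moreover have "(res F U W s \<ominus>\<^bsub>sec F W\<^esub> res F V W s') \<oplus>\<^bsub>sec F W\<^esub> (res F V W s' \<ominus>\<^bsub>sec F W\<^esub> res F U' W s'')
      = res F U W s \<ominus>\<^bsub>sec F W\<^esub> res F U' W s''"
    using c by (simp add: a_minus_def a_assoc r_neg1)
  ultimately show ?thesis unfolding fibre_equiv_def using W zW
    by (intro bexI[of _ W]) (auto simp: opens_def)
qed

lemma fibre_class_eqI:
  assumes "section_near U s" "section_near V s'" "fibre_equiv U s V s'"
  shows "fibre_class F x U s = fibre_class F x V s'"
  unfolding fibre_class_altdef
  using assms fibre_equiv_sym[OF assms] fibre_equiv_trans[OF assms(2,1)] fibre_equiv_trans[OF assms(1,2)]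
  by blast

lemma fibre_class_res:
  assumes "section_near U s" "V \<in> opens U" "x \<in> V"
  shows "fibre_class F x V (res F U V s) = fibre_class F x U s"
  using assms fibre_equiv_res[OF assms]
  by (intro fibre_class_eqI[symmetric]) (auto simp: section_near_def intro: opens_zopen res_closed)

lemma fibre_class_self: "section_near U s \<Longrightarrow> (U, s) \<in> fibre_class F x U s"
  using fibre_equiv_res[of U s U] opens_self
  by (auto simp: fibre_class_altdef section_near_def res_self)

lemma fibre_class_members:
  assumes "section_near U s" "(V, s') \<in> fibre_class F x U s"
  shows "section_near V s'" "fibre_class F x V s' = fibre_class F x U s"
  using assms fibre_class_eqI[OF assms(1), of V s'] by (auto simp: fibre_class_altdef)

text \<open>Addition of classes is well defined; this is what makes the union in the definition of the fibre a single
  class.\<close>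

lemma fibre_class_add_cong:
  assumes s: "section_near U s" "section_near U s'" and t: "section_near V t" "section_near V t'"
    and eq: "fibre_class F x U s = fibre_class F x V t" "fibre_class F x U s' = fibre_class F x V t'"
  shows "fibre_class F x U (s \<oplus>\<^bsub>sec F U\<^esub> s') = fibre_class F x V (t \<oplus>\<^bsub>sec F V\<^esub> t')"
proof (rule fibre_class_eqI)
  have U: "zopen U" "x \<in> U" and V: "zopen V" "x \<in> V" using s t by (auto simp: section_near_def)
  interpret U: abelian_group "sec F U" by (rule abelian_group_sections[OF U(1)])
  interpret V: abelian_group "sec F V" by (rule abelian_group_sections[OF V(1)])
  show "section_near U (s \<oplus>\<^bsub>sec F U\<^esub> s')" "section_near V (t \<oplus>\<^bsub>sec F V\<^esub> t')"
    using s t by (auto simp: section_near_def)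
  have "fibre_equiv U s V t" "fibre_equiv U s' V t'"
    using fibre_class_self[OF t(1)] fibre_class_self[OF t(2)] eq by (auto simp: fibre_class_altdef)
  then obtain W1 W2 where W1: "W1 \<in> opens (U \<inter> V)" "x \<in> W1"
    "\<And>W'. W' \<in> opens W1 \<Longrightarrow> x \<in> W' \<Longrightarrow>
      res F U W' s \<ominus>\<^bsub>sec F W'\<^esub> res F V W' t \<in> max_ideal_sections F x W'"
    and W2: "W2 \<in> opens (U \<inter> V)" "x \<in> W2"
    "\<And>W'. W' \<in> opens W2 \<Longrightarrow> x \<in> W' \<Longrightarrow>
      res F U W' s' \<ominus>\<^bsub>sec F W'\<^esub> res F V W' t' \<in> max_ideal_sections F x W'"
    using fibre_equiv_shrink[OF s(1) t(1)] fibre_equiv_shrink[OF s(2) t(2)] by metis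
  define W where "W = W1 \<inter> W2"
  have zW: "zopen W" using W1(1) W2(1) unfolding W_def by (auto intro: zopen_Int opens_zopen)
  have W: "W \<in> opens W1" "W \<in> opens W2" "x \<in> W" "W \<in> opens U" "W \<in> opens V"
    using zW W1(1,2) W2(1,2) by (auto simp: W_def opens_def)
  interpret abelian_group "sec F W" by (rule abelian_group_sections[OF zW])
  have c: "res F U W s \<in> carrier (sec F W)" "res F U W s' \<in> carrier (sec F W)"
      "res F V W t \<in> carrier (sec F W)" "res F V W t' \<in> carrier (sec F W)"
    using s t W by (auto simp: section_near_def intro: res_closed)
  have "(res F U W s \<ominus>\<^bsub>sec F W\<^esub> res F V W t) \<oplus>\<^bsub>sec F W\<^esub> (res F U W s' \<ominus>\<^bsub>sec F W\<^esub> res F V W t')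
      \<in> max_ideal_sections F x W"
    using W1(3) W2(3) W by (intro max_ideal_add[OF zW]) auto
  moreover have "(res F U W s \<ominus>\<^bsub>sec F W\<^esub> res F V W t) \<oplus>\<^bsub>sec F W\<^esub> (res F U W s' \<ominus>\<^bsub>sec F W\<^esub> res F V W t')
      = res F U W (s \<oplus>\<^bsub>sec F U\<^esub> s') \<ominus>\<^bsub>sec F W\<^esub> res F V W (t \<oplus>\<^bsub>sec F V\<^esub> t')"
    using c s t W U V by (simp add: res_add section_near_def a_minus_def minus_add a_ac)
  ultimately show "fibre_equiv U (s \<oplus>\<^bsub>sec F U\<^esub> s') V (t \<oplus>\<^bsub>sec F V\<^esub> t')"
    unfolding fibre_equiv_def using W zW by (intro bexI[of _ W]) (auto simp: opens_def)
qed

lemma fibre_class_smult_cong: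
  assumes s: "section_near U s" and t: "section_near V t"
    and eq: "fibre_class F x U s = fibre_class F x V t"
  shows "fibre_class F x U (const U c \<odot>\<^bsub>sec F U\<^esub> s) = fibre_class F x V (const V c \<odot>\<^bsub>sec F V\<^esub> t)"
proof (rule fibre_class_eqI)
  have U: "zopen U" "x \<in> U" and V: "zopen V" "x \<in> V" using s t by (auto simp: section_near_def)
  interpret U: Module.module "reg_ring U" "sec F U" by (rule section_module[OF U(1)])
  interpret V: Module.module "reg_ring V" "sec F V" by (rule section_module[OF V(1)])
  show "section_near U (const U c \<odot>\<^bsub>sec F U\<^esub> s)" "section_near V (const V c \<odot>\<^bsub>sec F V\<^esub> t)"
    using s t regular_const by (auto simp: section_near_def)
  have "fibre_equiv U s V t"
    using fibre_class_self[OF t(1)] eq by (auto simp: fibre_class_altdef)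
  then obtain W where W1: "W \<in> opens (U \<inter> V)" "x \<in> W"
    "res F U W s \<ominus>\<^bsub>sec F W\<^esub> res F V W t \<in> max_ideal_sections F x W"
    unfolding fibre_equiv_def by blast
  have zW: "zopen W" using W1(1) by (rule opens_zopen)
  have W: "W \<in> opens U" "W \<in> opens V" using W1 by (auto simp: opens_def)
  interpret Module.module "reg_ring W" "sec F W" by (rule section_module[OF zW])
  have c: "res F U W s \<in> carrier (sec F W)" "res F V W t \<in> carrier (sec F W)"
    using s t W by (auto simp: section_near_def intro: res_closed)
  have cr: "regular W (const W c)" by (rule regular_const[OF zW])
  have "const W c \<odot>\<^bsub>sec F W\<^esub> (res F U W s \<ominus>\<^bsub>sec F W\<^esub> res F V W t) \<in> max_ideal_sections F x W"
    by (rule max_ideal_smult[OF zW W1(3) cr])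
  moreover have "const W c \<odot>\<^bsub>sec F W\<^esub> (res F U W s \<ominus>\<^bsub>sec F W\<^esub> res F V W t)
      = res F U W (const U c \<odot>\<^bsub>sec F U\<^esub> s) \<ominus>\<^bsub>sec F W\<^esub> res F V W (const V c \<odot>\<^bsub>sec F V\<^esub> t)"
    using c s t W U V cr
    by (simp add: res_smult section_near_def a_minus_def smult_r_distr smult_r_minus regular_const opens_def)
  ultimately show "fibre_equiv U (const U c \<odot>\<^bsub>sec F U\<^esub> s) V (const V c \<odot>\<^bsub>sec F V\<^esub> t)"
    unfolding fibre_equiv_def using W zW W1 by (intro bexI[of _ W]) (auto simp: opens_def)
qed

lemma fibre_add:
  assumes "section_near U s" "section_near U s'"
  shows "fibre_class F x U s \<oplus>\<^bsub>fibre F x\<^esub> fibre_class F x U s'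
    = fibre_class F x U (s \<oplus>\<^bsub>sec F U\<^esub> s')"
proof -
  have "fibre_class F x (U1 \<inter> U2)
        (res F U1 (U1 \<inter> U2) s1 \<oplus>\<^bsub>sec F (U1 \<inter> U2)\<^esub> res F U2 (U1 \<inter> U2) s2)
      = fibre_class F x U (s \<oplus>\<^bsub>sec F U\<^esub> s')"
    if 1: "(U1, s1) \<in> fibre_class F x U s" and 2: "(U2, s2) \<in> fibre_class F x U s'" for U1 s1 U2 s2
  proof (rule fibre_class_add_cong)
    note m = fibre_class_members[OF assms(1) 1] fibre_class_members[OF assms(2) 2]
    have o: "U1 \<inter> U2 \<in> opens U1" "U1 \<inter> U2 \<in> opens U2" "x \<in> U1 \<inter> U2" "zopen (U1 \<inter> U2)"
      using m by (auto simp: section_near_def opens_def zopen_Int)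
    show "section_near (U1 \<inter> U2) (res F U1 (U1 \<inter> U2) s1)"
         "section_near (U1 \<inter> U2) (res F U2 (U1 \<inter> U2) s2)"
      using o m by (auto simp: section_near_def intro: res_closed)
    show "fibre_class F x (U1 \<inter> U2) (res F U1 (U1 \<inter> U2) s1) = fibre_class F x U s"
         "fibre_class F x (U1 \<inter> U2) (res F U2 (U1 \<inter> U2) s2) = fibre_class F x U s'"
      using o m by (simp_all add: fibre_class_res)
  qed fact+
  then have "(\<Union>(U1, s1)\<in>fibre_class F x U s. \<Union>(U2, s2)\<in>fibre_class F x U s'.
        fibre_class F x (U1 \<inter> U2) (res F U1 (U1 \<inter> U2) s1 \<oplus>\<^bsub>sec F (U1 \<inter> U2)\<^esub> res F U2 (U1 \<inter> U2) s2))
      = (\<Union>(U1, s1)\<in>fibre_class F x U s. \<Union>(U2, s2)\<in>fibre_class F x U s'.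
          fibre_class F x U (s \<oplus>\<^bsub>sec F U\<^esub> s'))"
    by (intro SUP_cong) auto
  also have "\<dots> = fibre_class F x U (s \<oplus>\<^bsub>sec F U\<^esub> s')"
    using fibre_class_self[OF assms(1)] fibre_class_self[OF assms(2)] by auto
  finally show ?thesis by (simp add: fibre_def)
qed

lemma fibre_smult:
  assumes "section_near U s"
  shows "c \<odot>\<^bsub>fibre F x\<^esub> fibre_class F x U s = fibre_class F x U (const U c \<odot>\<^bsub>sec F U\<^esub> s)"
proof -
  have "fibre_class F x U1 (const U1 c \<odot>\<^bsub>sec F U1\<^esub> s1) = fibre_class F x U (const U c \<odot>\<^bsub>sec F U\<^esub> s)"
    if 1: "(U1, s1) \<in> fibre_class F x U s" for U1 s1
    using fibre_class_members[OF assms 1] assms by (intro fibre_class_smult_cong) auto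
  then have "(\<Union>(U1, s1)\<in>fibre_class F x U s. fibre_class F x U1 (const U1 c \<odot>\<^bsub>sec F U1\<^esub> s1))
      = (\<Union>(U1, s1)\<in>fibre_class F x U s. fibre_class F x U (const U c \<odot>\<^bsub>sec F U\<^esub> s))"
    by (intro SUP_cong) auto
  also have "\<dots> = fibre_class F x U (const U c \<odot>\<^bsub>sec F U\<^esub> s)"
    using fibre_class_self[OF assms] by auto
  finally show ?thesis by (simp add: fibre_def)
qed

lemma fibre_zero:
  assumes "zopen U" "x \<in> U"
  shows "\<zero>\<^bsub>fibre F x\<^esub> = fibre_class F x U \<zero>\<^bsub>sec F U\<^esub>"
proof -
  interpret abelian_group "sec F X" by (rule abelian_group_sections[OF zopen_X])
  have "U \<in> opens X" "x \<in> X" using assms zopen_subset[OF assms(1)] by (auto simp: opens_def)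
  then have "fibre_class F x U (res F X U \<zero>\<^bsub>sec F X\<^esub>) = fibre_class F x X \<zero>\<^bsub>sec F X\<^esub>"
    using assms zopen_X by (intro fibre_class_res) (auto simp: section_near_def)
  then show ?thesis using res_zero[OF \<open>U \<in> opens X\<close> zopen_X] by (simp add: fibre_def)
qed

lemma fibre_carrier: "e \<in> carrier (fibre F x) \<longleftrightarrow> (\<exists>U s. section_near U s \<and> e = fibre_class F x U s)"
  by (auto simp: fibre_def section_near_def)

text \<open>The vector space axioms involve at most three elements, which have representatives over one open set, so
  that the axioms can be read off there.\<close>

lemma fibre_common_representatives:
  assumes "a \<in> carrier (fibre F x)" "b \<in> carrier (fibre F x)" "c \<in> carrier (fibre F x)"
  obtains U r s t where "section_near U r" "section_near U s" "section_near U t"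
    "a = fibre_class F x U r" "b = fibre_class F x U s" "c = fibre_class F x U t"
proof -
  obtain U1 s1 U2 s2 U3 s3 where *: "section_near U1 s1" "section_near U2 s2" "section_near U3 s3"
    "a = fibre_class F x U1 s1" "b = fibre_class F x U2 s2" "c = fibre_class F x U3 s3"
    using assms unfolding fibre_carrier by blast
  define U where "U = U1 \<inter> U2 \<inter> U3"
  have U: "zopen U" "U \<in> opens U1" "U \<in> opens U2" "U \<in> opens U3" "x \<in> U"
    using * by (auto simp: U_def section_near_def opens_def zopen_Int)
  show thesis
    by (rule that[of U "res F U1 U s1" "res F U2 U s2" "res F U3 U s3"])
       (use * U in \<open>auto simp: fibre_class_res, auto simp: section_near_def intro: res_closed\<close>)
qed

end

end


section \<open>The fibre as a vector space of invariant sections\<close>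

context module_sheaf
begin

lemma section_near_add: 
  assumes "section_near x U s" "section_near x U t" shows "section_near x U (s \<oplus>\<^bsub>sec F U\<^esub> t)"
proof -
  interpret abelian_group "sec F U"
    by (rule abelian_group_sections) (use assms in \<open>auto simp: section_near_def\<close>)
  show ?thesis using assms by (auto simp: section_near_def)
qed

lemma section_near_smult:
  assumes "section_near x U s" "regular U f" shows "section_near x U (f \<odot>\<^bsub>sec F U\<^esub> s)"
proof -
  interpret Module.module "reg_ring U" "sec F U"
    by (rule section_module) (use assms in \<open>auto simp: section_near_def\<close>)
  show ?thesis using assms by (auto simp: section_near_def)
qed

lemma section_near_zopen: "section_near x U s \<Longrightarrow> zopen U"
  by (simp add: section_near_def)

lemma const_add: "(\<lambda>y. const U c y + const U d y) = const U (c + d)"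
  by (auto simp: const_def on_set_def fun_eq_iff)

lemma const_mult: "(\<lambda>y. const U c y * const U d y) = const U (c * d)"
  by (auto simp: const_def on_set_def fun_eq_iff)

lemma fibre_module:
  assumes x: "x \<in> X"
  shows "Module.module class_ring (fibre F x)"
proof (rule Module.moduleI)
  let ?V = "fibre F x"
  show "cring (class_ring :: complex ring)" by (rule class_cring.cring_axioms)
  show "abelian_group ?V"
  proof (rule abelian_groupI)
    fix a b c assume *: "a \<in> carrier ?V" "b \<in> carrier ?V" "c \<in> carrier ?V"
    obtain U r s t where U: "section_near x U r" "section_near x U s" "section_near x U t" and
      eq: "a = fibre_class F x U r" "b = fibre_class F x U s" "c = fibre_class F x U t"
      by (rule fibre_common_representatives[OF *])
    interpret Module.module "reg_ring U" "sec F U" by (rule section_module[OF section_near_zopen[OF U(1)]])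
    have "(r \<oplus>\<^bsub>sec F U\<^esub> s) \<oplus>\<^bsub>sec F U\<^esub> t = r \<oplus>\<^bsub>sec F U\<^esub> (s \<oplus>\<^bsub>sec F U\<^esub> t)"
      using U by (simp add: section_near_def M.a_assoc)
    then show "(a \<oplus>\<^bsub>?V\<^esub> b) \<oplus>\<^bsub>?V\<^esub> c = a \<oplus>\<^bsub>?V\<^esub> (b \<oplus>\<^bsub>?V\<^esub> c)"
      unfolding eq using U by (simp only: fibre_add section_near_add)
  next
    fix a b assume *: "a \<in> carrier ?V" "b \<in> carrier ?V"
    obtain U r s t where U: "section_near x U r" "section_near x U s" and
      eq: "a = fibre_class F x U r" "b = fibre_class F x U s"
      by (rule fibre_common_representatives[OF * *(2)])
    interpret Module.module "reg_ring U" "sec F U" by (rule section_module[OF section_near_zopen[OF U(1)]])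
    have "r \<oplus>\<^bsub>sec F U\<^esub> s = s \<oplus>\<^bsub>sec F U\<^esub> r"
      using U by (simp add: section_near_def M.a_comm)
    then show "a \<oplus>\<^bsub>?V\<^esub> b = b \<oplus>\<^bsub>?V\<^esub> a"
      unfolding eq using U by (simp only: fibre_add)
    show "a \<oplus>\<^bsub>?V\<^esub> b \<in> carrier ?V"
      unfolding eq fibre_add[OF U] fibre_carrier using section_near_add[OF U] by blast
  next
    fix a assume *: "a \<in> carrier ?V"
    obtain U r s t where U: "section_near x U r" and eq: "a = fibre_class F x U r"
      by (rule fibre_common_representatives[OF * * *])
    have U': "zopen U" "x \<in> U" using U by (auto simp: section_near_def)
    interpret Module.module "reg_ring U" "sec F U" by (rule section_module[OF U'(1)])
    have z: "section_near x U \<zero>\<^bsub>sec F U\<^esub>" and m: "section_near x U (\<ominus>\<^bsub>sec F U\<^esub> r)"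
      using U by (auto simp: section_near_def)
    have rc: "r \<in> carrier (sec F U)" using U by (simp add: section_near_def)
    show "\<zero>\<^bsub>?V\<^esub> \<oplus>\<^bsub>?V\<^esub> a = a"
      unfolding eq fibre_zero[OF U'] fibre_add[OF z U] using rc by simp
    show "\<exists>y\<in>carrier ?V. y \<oplus>\<^bsub>?V\<^esub> a = \<zero>\<^bsub>?V\<^esub>"
    proof
      show "fibre_class F x U (\<ominus>\<^bsub>sec F U\<^esub> r) \<oplus>\<^bsub>?V\<^esub> a = \<zero>\<^bsub>?V\<^esub>"
        unfolding eq fibre_zero[OF U'] fibre_add[OF m U] using rc by (simp add: M.l_neg)
      show "fibre_class F x U (\<ominus>\<^bsub>sec F U\<^esub> r) \<in> carrier ?V" unfolding fibre_carrier using m by blast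
    qed
  next
    interpret Module.module "reg_ring X" "sec F X" by (rule section_module[OF zopen_X])
    have "section_near x X \<zero>\<^bsub>sec F X\<^esub>" using x zopen_X by (simp add: section_near_def)
    then show "\<zero>\<^bsub>?V\<^esub> \<in> carrier ?V" unfolding fibre_zero[OF zopen_X x] fibre_carrier by blast
  qed
next
  fix c d :: complex and a b assume *: "a \<in> carrier (fibre F x)" "b \<in> carrier (fibre F x)"
  obtain U r s t where U: "section_near x U r" "section_near x U s" and
    eq: "a = fibre_class F x U r" "b = fibre_class F x U s"
    by (rule fibre_common_representatives[OF * *(2)])
  have U': "zopen U" "x \<in> U" using U by (auto simp: section_near_def)
  interpret Module.module "reg_ring U" "sec F U" by (rule section_module[OF U'(1)])
  have rc: "r \<in> carrier (sec F U)" "s \<in> carrier (sec F U)" using U by (auto simp: section_near_def)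
  have k: "regular U (const U k)" for k by (rule regular_const[OF U'(1)])
  note near = section_near_add section_near_smult[OF _ k] U
  show "c \<odot>\<^bsub>fibre F x\<^esub> a \<in> carrier (fibre F x)"
    unfolding eq fibre_smult[OF U(1)] fibre_carrier using near by blast
  have "const U (c + d) \<odot>\<^bsub>sec F U\<^esub> r = const U c \<odot>\<^bsub>sec F U\<^esub> r \<oplus>\<^bsub>sec F U\<^esub> const U d \<odot>\<^bsub>sec F U\<^esub> r"
    using smult_l_distr[of "const U c" "const U d" r] k rc by (simp add: const_add)
  then show "(c \<oplus>\<^bsub>class_ring\<^esub> d) \<odot>\<^bsub>fibre F x\<^esub> a = c \<odot>\<^bsub>fibre F x\<^esub> a \<oplus>\<^bsub>fibre F x\<^esub> d \<odot>\<^bsub>fibre F x\<^esub> a"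
    unfolding eq by (simp add: fibre_smult fibre_add near)
  have "const U c \<odot>\<^bsub>sec F U\<^esub> (r \<oplus>\<^bsub>sec F U\<^esub> s) = const U c \<odot>\<^bsub>sec F U\<^esub> r \<oplus>\<^bsub>sec F U\<^esub> const U c \<odot>\<^bsub>sec F U\<^esub> s"
    using smult_r_distr[of "const U c" r s] k rc by simp
  then show "c \<odot>\<^bsub>fibre F x\<^esub> (a \<oplus>\<^bsub>fibre F x\<^esub> b) = c \<odot>\<^bsub>fibre F x\<^esub> a \<oplus>\<^bsub>fibre F x\<^esub> c \<odot>\<^bsub>fibre F x\<^esub> b"
    unfolding eq by (simp add: fibre_smult fibre_add near)
  have "const U (c * d) \<odot>\<^bsub>sec F U\<^esub> r = const U c \<odot>\<^bsub>sec F U\<^esub> (const U d \<odot>\<^bsub>sec F U\<^esub> r)"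
    using smult_assoc1[of "const U c" "const U d" r] k rc by (simp add: const_mult)
  then show "(c \<otimes>\<^bsub>class_ring\<^esub> d) \<odot>\<^bsub>fibre F x\<^esub> a = c \<odot>\<^bsub>fibre F x\<^esub> (d \<odot>\<^bsub>fibre F x\<^esub> a)"
    unfolding eq by (simp add: fibre_smult near)
  have "const U 1 \<odot>\<^bsub>sec F U\<^esub> r = r"
    using smult_one[of r] rc by simp
  then show "\<one>\<^bsub>class_ring\<^esub> \<odot>\<^bsub>fibre F x\<^esub> a = a"
    unfolding eq by (simp add: fibre_smult near)
qed

text \<open>The function \<open>f - f(x)\<close> vanishes at \<open>x\<close>, so \<open>f s\<close> and \<open>f(x) s\<close> differ by an element of \<open>\<mm>\<^sub>x F\<close>.\<close>

lemma fibre_smult_function: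
  assumes "section_near x U s" "regular U f"
  shows "fibre_class F x U (f \<odot>\<^bsub>sec F U\<^esub> s) = f x \<odot>\<^bsub>fibre F x\<^esub> fibre_class F x U s"
proof -
  have U: "zopen U" "x \<in> U" "s \<in> carrier (sec F U)" using assms(1) by (auto simp: section_near_def)
  interpret Module.module "reg_ring U" "sec F U" by (rule section_module[OF U(1)])
  have c: "regular U (const U k)" for k by (rule regular_const[OF U(1)])
  define h where "h = (\<lambda>y. f y + const U (- f x) y)"
  have h: "regular U h" unfolding h_def using R.a_closed[of f "const U (- f x)"] assms(2) c by simp
  have h0: "h x = 0" using U(2) by (simp add: h_def const_def)
  have "f = (\<lambda>y. h y + const U (f x) y)"
    using regular_outside[OF assms(2)] by (auto simp: h_def const_def on_set_def fun_eq_iff)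
  then have "f \<odot>\<^bsub>sec F U\<^esub> s = h \<odot>\<^bsub>sec F U\<^esub> s \<oplus>\<^bsub>sec F U\<^esub> const U (f x) \<odot>\<^bsub>sec F U\<^esub> s"
    using smult_l_distr[of h "const U (f x)" s] h c U by simp
  then have "f \<odot>\<^bsub>sec F U\<^esub> s \<ominus>\<^bsub>sec F U\<^esub> const U (f x) \<odot>\<^bsub>sec F U\<^esub> s = h \<odot>\<^bsub>sec F U\<^esub> s"
    using h c U by (simp add: a_minus_def M.a_assoc M.r_neg)
  then have "fibre_equiv x U (f \<odot>\<^bsub>sec F U\<^esub> s) U (const U (f x) \<odot>\<^bsub>sec F U\<^esub> s)"
    using max_ideal_generator[OF U(1) h h0 U(3)] section_near_smult[OF assms(1)] assms(2) c
    by (intro fibre_equivI) auto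
  then show ?thesis
    using section_near_smult[OF assms(1)] assms(2) c
    unfolding fibre_smult[OF assms(1)] by (intro fibre_class_eqI) auto
qed

definition value_at_one :: "'s \<Rightarrow> (point set \<times> 's) set" where
  "value_at_one s = fibre_class F (torus_one n) (torus n) s"

lemma section_near_torus: "s \<in> carrier (sec F (torus n)) \<Longrightarrow> section_near (torus_one n) (torus n) s"
  by (simp add: section_near_def zopen_torus torus_one_in_torus)

lemma value_at_one_closed: "s \<in> carrier (sec F (torus n)) \<Longrightarrow> value_at_one s \<in> carrier (fibre_at_one F)"
  unfolding fibre_carrier value_at_one_def using section_near_torus by blast

lemma value_at_one_add:
  "s \<in> carrier (sec F (torus n)) \<Longrightarrow> t \<in> carrier (sec F (torus n)) \<Longrightarrow>
    value_at_one (s \<oplus>\<^bsub>sec F (torus n)\<^esub> t) = value_at_one s \<oplus>\<^bsub>fibre_at_one F\<^esub> value_at_one t"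
  by (simp add: value_at_one_def fibre_add section_near_torus)

lemma value_at_one_zero: "value_at_one \<zero>\<^bsub>sec F (torus n)\<^esub> = \<zero>\<^bsub>fibre_at_one F\<^esub>"
  by (simp add: value_at_one_def fibre_zero[OF zopen_torus torus_one_in_torus])

lemma value_at_one_smult:
  "s \<in> carrier (sec F (torus n)) \<Longrightarrow> regular (torus n) f \<Longrightarrow>
    value_at_one (f \<odot>\<^bsub>sec F (torus n)\<^esub> s) = f (torus_one n) \<odot>\<^bsub>fibre_at_one F\<^esub> value_at_one s"
  by (simp add: value_at_one_def fibre_smult_function section_near_torus)

lemma fibre_at_one_module: "Module.module class_ring (fibre_at_one F)"
  using fibre_module torus_one_in_torus torus_subset_X by blast

lemma torus_section_module: "Module.module (reg_ring (torus n)) (sec F (torus n))"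
  by (rule section_module[OF zopen_torus])

lemma value_at_one_finsum:
  assumes "finite A" "f \<in> A \<rightarrow> carrier (sec F (torus n))"
  shows "value_at_one (\<Oplus>\<^bsub>sec F (torus n)\<^esub>a\<in>A. f a) = (\<Oplus>\<^bsub>fibre_at_one F\<^esub>a\<in>A. value_at_one (f a))"
proof -
  interpret V: Module.module class_ring "fibre_at_one F" by (rule fibre_at_one_module)
  interpret T: Module.module "reg_ring (torus n)" "sec F (torus n)" by (rule torus_section_module)
  show ?thesis
    by (rule finsum_hom[OF T.M.abelian_monoid_axioms V.M.abelian_monoid_axioms assms])
       (auto simp: value_at_one_closed value_at_one_add value_at_one_zero)
qed

text \<open>A germ at \<open>1\<close> is defined on a principal open subset \<open>D(f)\<close> of the torus. By coherence \<open>f\<^sup>k\<close> times it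
  extends to the torus, and dividing by the number \<open>f(1)\<^sup>k\<close> corrects the value at \<open>1\<close>.\<close>

lemma coherent_extension:
  assumes coh: "coherent F" and e: "e \<in> carrier (fibre_at_one F)"
  obtains s where "s \<in> carrier (sec F (torus n))" "e = value_at_one s"
proof -
  let ?T = "torus n" and ?one = "torus_one n"
  interpret V: Module.module class_ring "fibre_at_one F" by (rule fibre_at_one_module)
  interpret R: cring "reg_ring ?T" by (rule cring_reg_ring[OF zopen_torus])
  obtain U s where U: "section_near ?one U s" and es: "e = fibre_class F ?one U s"
    using e unfolding fibre_carrier by blast
  have zU: "zopen U" "?one \<in> U" using U by (auto simp: section_near_def)
  obtain g where g: "g \<in> coord_ring origin" "g ?one \<noteq> 0" "\<And>y. y \<in> ?T \<Longrightarrow> g y \<noteq> 0 \<Longrightarrow> y \<in> U"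
    using zopenD[OF zU(1) origin_in_fan zU(2)] torus_one_in_torus unfolding chart_origin by blast
  define f where "f = on_set ?T g"
  have f: "f \<in> carrier (reg_ring ?T)"
    using regular_coord[OF opens_self[OF zopen_torus] g(1)] by (simp add: f_def)
  have f1: "f ?one \<noteq> 0" using g(2) torus_one_in_torus by (simp add: f_def)
  define D where "D = principal_open origin f"
  have D_eq: "D = {x \<in> ?T. g x \<noteq> 0}"
    by (auto simp: D_def principal_open_def chart_origin f_def)
  have D: "zopen D" "D \<in> opens U" "D \<in> opens ?T" "?one \<in> D"
    using zopen_principal[OF g(1)] g(2,3) torus_one_in_torus by (auto simp: D_eq opens_def)
  have sD: "res F U D s \<in> carrier (sec F D)"
    using U D(2) by (auto simp: section_near_def intro: res_closed)
  have eD: "e = fibre_class F ?one D (res F U D s)"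
    unfolding es using fibre_class_res[OF U D(2,4)] by simp
  obtain k :: nat and s' where s': "s' \<in> carrier (sec F ?T)"
    "on_set D (f [^]\<^bsub>reg_ring ?T\<^esub> k) \<odot>\<^bsub>sec F D\<^esub> res F U D s = res F ?T D s'"
    using coh[unfolded coherent_def Let_def, rule_format, OF origin_in_fan, unfolded chart_origin,
        THEN conjunct2, THEN bspec[OF _ f], THEN conjunct1, folded D_def, THEN bspec[OF _ sD]]
    by auto
  have fk: "f [^]\<^bsub>reg_ring ?T\<^esub> k \<in> carrier (reg_ring ?T)" using f by (rule R.nat_pow_closed)
  have fk1: "(f [^]\<^bsub>reg_ring ?T\<^esub> k) ?one = f ?one ^ k"
    by (induction k) (auto simp: torus_one_in_torus const_def)
  define c where "c = f ?one ^ k"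
  have c: "c \<noteq> 0" using f1 by (simp add: c_def)
  have near: "section_near ?one D (res F U D s)" using D sD by (simp add: section_near_def)
  have "value_at_one s' = fibre_class F ?one D (res F ?T D s')"
    unfolding value_at_one_def by (rule fibre_class_res[OF section_near_torus[OF s'(1)] D(3,4), symmetric])
  also have "\<dots> = c \<odot>\<^bsub>fibre_at_one F\<^esub> e"
    unfolding s'(2)[symmetric] eD
    using fibre_smult_function[OF near regular_restrict[OF _ D(3)], of "f [^]\<^bsub>reg_ring ?T\<^esub> k"] fk fk1 D(4)
    by (simp add: c_def)
  finally have v: "value_at_one s' = c \<odot>\<^bsub>fibre_at_one F\<^esub> e" .
  interpret T: Module.module "reg_ring ?T" "sec F ?T" by (rule torus_section_module)
  show thesis
  proof (rule that)
    show "const ?T (inverse c) \<odot>\<^bsub>sec F ?T\<^esub> s' \<in> carrier (sec F ?T)"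
      using s'(1) regular_const[OF zopen_torus] by simp
    have "value_at_one (const ?T (inverse c) \<odot>\<^bsub>sec F ?T\<^esub> s')
        = inverse c \<odot>\<^bsub>fibre_at_one F\<^esub> (c \<odot>\<^bsub>fibre_at_one F\<^esub> e)"
      using s'(1) regular_const[OF zopen_torus] torus_one_in_torus
      by (simp add: value_at_one_smult v) (simp add: const_def)
    also have "\<dots> = e"
      using V.smult_assoc1[of "inverse c" c e] V.smult_one[OF e] e c by simp
    finally show "e = value_at_one (const ?T (inverse c) \<odot>\<^bsub>sec F ?T\<^esub> s')" by simp
  qed
qed

end

locale toric_module_sheaf = toric_variety n \<Delta> for n :: nat and \<Delta> :: "real vec set set" +
  fixes E :: "'s presheaf" and \<alpha> :: "point \<Rightarrow> point set \<Rightarrow> 's \<Rightarrow> 's"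
  assumes toric: "toric_sheaf E \<alpha>"

sublocale toric_module_sheaf \<subseteq> module_sheaf n \<Delta> E
  by unfold_locales (use toric in \<open>simp add: toric_sheaf_def\<close>)

context toric_module_sheaf
begin

lemma coherent: "coherent E" and bidual_bij: "zopen U \<Longrightarrow> bij_betw (bidual_map E U) (carrier (sec E U))
          (carrier (sec (dual_sheaf (dual_sheaf E)) U))"
  using toric by (simp_all add: toric_sheaf_def reflexive_def)

lemma linearization: "linearization E \<alpha>"
  using toric by (simp add: toric_sheaf_def)

abbreviation "ET \<equiv> sec E (torus n)"

lemma translation_facts:
  assumes "t \<in> torus n"
  shows "\<alpha> t (torus n) \<in> carrier ET \<rightarrow> carrier ET \<and>
        (\<forall>s\<in>carrier ET. \<forall>s'\<in>carrier ET.
           \<alpha> t (torus n) (s \<oplus>\<^bsub>ET\<^esub> s') = \<alpha> t (torus n) s \<oplus>\<^bsub>ET\<^esub> \<alpha> t (torus n) s') \<and>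
        (\<forall>f\<in>carrier (reg_ring (torus n)). \<forall>s\<in>carrier ET.
           \<alpha> t (torus n) (f \<odot>\<^bsub>ET\<^esub> s) = translate t f \<odot>\<^bsub>ET\<^esub> \<alpha> t (torus n) s)"
  using linearization[unfolded linearization_def, THEN conjunct1, rule_format, OF assms zopen_torus]
  unfolding act_torus_image[OF assms] by simp

lemma translation_closed: "t \<in> torus n \<Longrightarrow> s \<in> carrier ET \<Longrightarrow> \<alpha> t (torus n) s \<in> carrier ET"
  using translation_facts by blast

lemma translation_add:
  "t \<in> torus n \<Longrightarrow> s \<in> carrier ET \<Longrightarrow> s' \<in> carrier ET \<Longrightarrow>
    \<alpha> t (torus n) (s \<oplus>\<^bsub>ET\<^esub> s') = \<alpha> t (torus n) s \<oplus>\<^bsub>ET\<^esub> \<alpha> t (torus n) s'"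
  using translation_facts by blast

lemma translation_smult:
  "t \<in> torus n \<Longrightarrow> regular (torus n) f \<Longrightarrow> s \<in> carrier ET \<Longrightarrow>
    \<alpha> t (torus n) (f \<odot>\<^bsub>ET\<^esub> s) = translate t f \<odot>\<^bsub>ET\<^esub> \<alpha> t (torus n) s"
  using translation_facts by (metis carrier_reg_ring mem_Collect_eq)

lemma translation_finsum:
  assumes "t \<in> torus n" "finite A" "f \<in> A \<rightarrow> carrier ET"
  shows "\<alpha> t (torus n) (\<Oplus>\<^bsub>ET\<^esub>a\<in>A. f a) = (\<Oplus>\<^bsub>ET\<^esub>a\<in>A. \<alpha> t (torus n) (f a))"
proof -
  interpret T: Module.module "reg_ring (torus n)" ET by (rule torus_section_module)
  have "\<alpha> t (torus n) \<zero>\<^bsub>ET\<^esub> = \<alpha> t (torus n) \<zero>\<^bsub>ET\<^esub> \<oplus>\<^bsub>ET\<^esub> \<alpha> t (torus n) \<zero>\<^bsub>ET\<^esub>"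
    using translation_add[OF assms(1) T.M.zero_closed T.M.zero_closed] by simp
  then have "\<alpha> t (torus n) \<zero>\<^bsub>ET\<^esub> = \<zero>\<^bsub>ET\<^esub>"
    using translation_closed[OF assms(1) T.M.zero_closed] by (metis T.M.add.l_cancel_one)
  then show ?thesis
    using assms translation_closed translation_add
    by (intro finsum_hom T.M.abelian_monoid_axioms) auto
qed

lemma act_in_torus_iff: assumes "t \<in> torus n" shows "act t x \<in> torus n \<longleftrightarrow> x \<in> torus n"
proof
  assume a: "act t x \<in> torus n"
  have d: "dom x = carrier_vec n" using a by (auto simp: torus_def act_def dom_def)
  have "act (torus_inv t) (act t x) = x"
  proof
    fix m
    show "act (torus_inv t) (act t x) m = x m"
    proof (cases "x m")
      case (Some c)
      then have "m \<in> carrier_vec n" using d by auto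
      then show ?thesis using Some chi_nonzero_torus[OF assms, of m] by (simp add: act_def chi_inv)
    qed (simp add: act_def)
  qed
  then show "x \<in> torus n" using act_in_torus[OF torus_inv_in_torus[OF assms] a] by simp
qed (rule act_in_torus[OF assms])

text \<open>Translation by \<open>t\<close> is composition with the action of \<open>t\<^sup>-\<^sup>1\<close>, hence the inverse. The equivalence
  \<open>act_in_torus_iff\<close> is needed because functions are extended by zero outside the torus.\<close>

lemma translate_chi:
  assumes "t \<in> torus n"
  shows "translate t (on_set (torus n) (chi m))
    = (\<lambda>x. inverse (chi m t) * on_set (torus n) (chi m) x)"
  using act_in_torus_iff[OF torus_inv_in_torus[OF assms]]
  by (auto simp: translate_def on_set_def chi_act chi_inv fun_eq_iff)

lemma invariant_sectionsD:
  assumes "s \<in> invariant_sections E \<alpha>"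
  shows "s \<in> carrier ET" "t \<in> torus n \<Longrightarrow> \<alpha> t (torus n) s = s"
  using assms by (auto simp: invariant_sections_def)

text \<open>A weight vector \<open>w\<close> of weight \<open>m\<close> satisfies \<open>t w = \<chi>\<^sup>m(t) w\<close>, and \<open>\<chi>\<^sup>m\<close> is a function of weight \<open>-m\<close>. So
  \<open>\<chi>\<^sup>m w\<close> is invariant, and it has the same value at \<open>1\<close> as \<open>w\<close>.\<close>

lemma invariant_representative:
  assumes "e \<in> carrier (fibre_at_one E)"
  obtains s where "s \<in> invariant_sections E \<alpha>" "e = value_at_one s"
proof -
  interpret T: Module.module "reg_ring (torus n)" ET by (rule torus_section_module)
  interpret V: Module.module class_ring "fibre_at_one E" by (rule fibre_at_one_module)
  obtain s where s: "s \<in> carrier ET" "e = value_at_one s"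
    using coherent_extension[OF coherent assms] by metis
  have "\<exists>A w. finite A \<and> A \<subseteq> carrier_vec n \<and> (\<forall>m\<in>A. weight_vector E \<alpha> (torus n) m (w m)) \<and>
        s = (\<Oplus>\<^bsub>ET\<^esub>m\<in>A. w m)"
    using linearization[unfolded linearization_def, THEN conjunct2, THEN conjunct2] origin_in_fan s(1)
    unfolding chart_origin[symmetric] by blast
  then obtain A w where A: "finite A" "A \<subseteq> carrier_vec n"
    "\<And>m. m \<in> A \<Longrightarrow> weight_vector E \<alpha> (torus n) m (w m)" "s = (\<Oplus>\<^bsub>ET\<^esub>m\<in>A. w m)"
    by blast
  have w: "w m \<in> carrier ET" if "m \<in> A" for m
    using A(3)[OF that] by (simp add: weight_vector_def)
  have chi: "regular (torus n) (on_set (torus n) (chi m))" if "m \<in> A" for m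
    using regular_chi[OF opens_self[OF zopen_torus]] A(2) that by blast
  define s' where "s' = (\<Oplus>\<^bsub>ET\<^esub>m\<in>A. on_set (torus n) (chi m) \<odot>\<^bsub>ET\<^esub> w m)"
  have terms: "(\<lambda>m. on_set (torus n) (chi m) \<odot>\<^bsub>ET\<^esub> w m) \<in> A \<rightarrow> carrier ET"
    using w chi by auto
  have "s' \<in> carrier ET" unfolding s'_def using terms by (rule T.M.finsum_closed)
  moreover have "\<alpha> t (torus n) s' = s'" if t: "t \<in> torus n" for t
  proof -
    have "\<alpha> t (torus n) (on_set (torus n) (chi m) \<odot>\<^bsub>ET\<^esub> w m) = on_set (torus n) (chi m) \<odot>\<^bsub>ET\<^esub> w m"
      if m: "m \<in> A" for m
    proof -
      have mc: "m \<in> carrier_vec n" using m A(2) by blast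
      have c: "regular (torus n) (const (torus n) (chi m t))" by (rule regular_const[OF zopen_torus])
      have r: "regular (torus n) (\<lambda>x. inverse (chi m t) * on_set (torus n) (chi m) x)"
        by (rule regular_scale[OF chi[OF m]])
      have "\<alpha> t (torus n) (on_set (torus n) (chi m) \<odot>\<^bsub>ET\<^esub> w m)
          = translate t (on_set (torus n) (chi m)) \<odot>\<^bsub>ET\<^esub> (const (torus n) (chi m t) \<odot>\<^bsub>ET\<^esub> w m)"
        using A(3)[OF m] t translation_smult[OF t chi[OF m] w[OF m]] by (simp add: weight_vector_def)
      also have "\<dots> = (\<lambda>x. (inverse (chi m t) * on_set (torus n) (chi m) x) * const (torus n) (chi m t) x) \<odot>\<^bsub>ET\<^esub> w m"
        using T.smult_assoc1[of "\<lambda>x. inverse (chi m t) * on_set (torus n) (chi m) x"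
            "const (torus n) (chi m t)" "w m"] c r w[OF m]
        by (simp add: translate_chi[OF t])
      also have "(\<lambda>x. (inverse (chi m t) * on_set (torus n) (chi m) x) * const (torus n) (chi m t) x)
          = on_set (torus n) (chi m)"
        using chi_nonzero_torus[OF t mc] by (auto simp: const_def on_set_def fun_eq_iff)
      finally show ?thesis .
    qed
    then show ?thesis unfolding s'_def translation_finsum[OF t A(1) terms]
      using terms by (intro T.M.finsum_cong') auto
  qed
  ultimately have "s' \<in> invariant_sections E \<alpha>" by (simp add: invariant_sections_def)
  moreover have "e = value_at_one s'"
  proof -
    have "value_at_one (on_set (torus n) (chi m) \<odot>\<^bsub>ET\<^esub> w m) = value_at_one (w m)" if m: "m \<in> A" for m
      using value_at_one_smult[OF w[OF m] chi[OF m]] A(2) m torus_one_in_torus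
        V.smult_one[OF value_at_one_closed[OF w[OF m]]] by (simp add: chi_one subset_iff)
    moreover have "e = (\<Oplus>\<^bsub>fibre_at_one E\<^esub>m\<in>A. value_at_one (w m))"
      unfolding s(2) A(4) using w by (intro value_at_one_finsum[OF A(1)]) auto
    moreover have "(\<Oplus>\<^bsub>fibre_at_one E\<^esub>m\<in>A. value_at_one (on_set (torus n) (chi m) \<odot>\<^bsub>ET\<^esub> w m))
        = (\<Oplus>\<^bsub>fibre_at_one E\<^esub>m\<in>A. value_at_one (w m))"
      by (rule V.M.finsum_cong') (use w value_at_one_closed calculation(1) in auto)
    ultimately show ?thesis unfolding s'_def value_at_one_finsum[OF A(1) terms] by simp
  qed
  ultimately show thesis by (rule that)
qed

end


section \<open>Algebras of endomorphisms\<close>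

lemma (in abelian_monoid) finsum_swap:
  assumes "finite A" "finite B" "\<And>a b. a \<in> A \<Longrightarrow> b \<in> B \<Longrightarrow> f a b \<in> carrier G"
  shows "(\<Oplus>a\<in>A. \<Oplus>b\<in>B. f a b) = (\<Oplus>b\<in>B. \<Oplus>a\<in>A. f a b)"
  using assms(1,3)
proof (induction A)
  case empty
  then show ?case by (simp add: finsum_zero)
next
  case (insert x A)
  have 1: "(\<lambda>b. f x b) \<in> B \<rightarrow> carrier G" "(\<lambda>b. \<Oplus>a\<in>A. f a b) \<in> B \<rightarrow> carrier G"
    using insert.prems by (auto intro!: finsum_closed)
  have 2: "(\<lambda>a. \<Oplus>b\<in>B. f a b) \<in> A \<rightarrow> carrier G" "(\<Oplus>b\<in>B. f x b) \<in> carrier G"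
    using insert.prems by (auto intro!: finsum_closed)
  have "(\<Oplus>b\<in>B. \<Oplus>a\<in>insert x A. f a b) = (\<Oplus>b\<in>B. f x b \<oplus> (\<Oplus>a\<in>A. f a b))"
  proof (rule finsum_cong')
    fix b assume b: "b \<in> B"
    show "(\<Oplus>a\<in>insert x A. f a b) = f x b \<oplus> (\<Oplus>a\<in>A. f a b)"
      using insert.prems b by (intro finsum_insert insert.hyps) auto
  qed (use 1 in auto)
  also have "\<dots> = (\<Oplus>b\<in>B. f x b) \<oplus> (\<Oplus>b\<in>B. \<Oplus>a\<in>A. f a b)"
    using 1 by (rule finsum_addf)
  also have "\<dots> = (\<Oplus>a\<in>insert x A. \<Oplus>b\<in>B. f a b)"
    using insert by (subst finsum_insert[OF insert.hyps 2]) auto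
  finally show ?case by simp
qed

subsection \<open>Subalgebras\<close>

locale complex_algebra =
  fixes A :: "(complex, 'a) module"
  assumes ring: "ring A" and algebra_module: "Module.module class_ring A"
    and smult_mult_left: "a \<in> carrier A \<Longrightarrow> b \<in> carrier A \<Longrightarrow> (c \<odot>\<^bsub>A\<^esub> a) \<otimes>\<^bsub>A\<^esub> b = c \<odot>\<^bsub>A\<^esub> (a \<otimes>\<^bsub>A\<^esub> b)"
    and smult_mult_right: "a \<in> carrier A \<Longrightarrow> b \<in> carrier A \<Longrightarrow> a \<otimes>\<^bsub>A\<^esub> (c \<odot>\<^bsub>A\<^esub> b) = c \<odot>\<^bsub>A\<^esub> (a \<otimes>\<^bsub>A\<^esub> b)"
begin

interpretation A: ring A by (rule ring)
interpretation AM: Module.module class_ring A by (rule algebra_module)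

lemma is_subalgebraI:
  assumes "H \<subseteq> carrier A" "\<one>\<^bsub>A\<^esub> \<in> H"
    "\<And>a b. a \<in> H \<Longrightarrow> b \<in> H \<Longrightarrow> a \<otimes>\<^bsub>A\<^esub> b \<in> H" "\<And>a b. a \<in> H \<Longrightarrow> b \<in> H \<Longrightarrow> a \<oplus>\<^bsub>A\<^esub> b \<in> H"
    "\<And>c a. a \<in> H \<Longrightarrow> c \<odot>\<^bsub>A\<^esub> a \<in> H"
  shows "is_subalgebra H A"
proof -
  have neg: "\<ominus>\<^bsub>A\<^esub> a \<in> H" if "a \<in> H" for a
  proof -
    have "a \<in> carrier A" using that assms(1) by blast
    then have "(- 1) \<odot>\<^bsub>A\<^esub> a \<oplus>\<^bsub>A\<^esub> a = \<zero>\<^bsub>A\<^esub>"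
      using AM.smult_l_distr[of "- 1" 1 a] AM.smult_one[of a] AM.smult_l_null[of a] by simp
    then have "\<ominus>\<^bsub>A\<^esub> a = (- 1) \<odot>\<^bsub>A\<^esub> a"
      using \<open>a \<in> carrier A\<close> AM.smult_closed[of "- 1" a] by (simp add: A.minus_equality)
    then show ?thesis using assms(5)[OF that] by simp
  qed
  have zero: "\<zero>\<^bsub>A\<^esub> \<in> H"
    using assms(4)[OF assms(2) neg[OF assms(2)]] by (simp add: A.r_neg)
  show ?thesis unfolding is_subalgebra_def
    using assms neg zero by (auto intro!: A.subringI AM.submoduleI)
qed

lemma is_subalgebraD:
  assumes "is_subalgebra H A"
  shows "H \<subseteq> carrier A" "\<one>\<^bsub>A\<^esub> \<in> H" "\<zero>\<^bsub>A\<^esub> \<in> H"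
    "\<And>a b. a \<in> H \<Longrightarrow> b \<in> H \<Longrightarrow> a \<otimes>\<^bsub>A\<^esub> b \<in> H" "\<And>a b. a \<in> H \<Longrightarrow> b \<in> H \<Longrightarrow> a \<oplus>\<^bsub>A\<^esub> b \<in> H"
    "\<And>c a. a \<in> H \<Longrightarrow> c \<odot>\<^bsub>A\<^esub> a \<in> H"
  using assms subringE[of H A] AM.submoduleE(4)[of H] unfolding is_subalgebra_def by auto

lemma generated_superset: "S \<subseteq> generated_subalgebra A S"
  unfolding generated_subalgebra_def by blast

lemma generated_least: "is_subalgebra H A \<Longrightarrow> S \<subseteq> H \<Longrightarrow> generated_subalgebra A S \<subseteq> H"
  unfolding generated_subalgebra_def by blast

lemma carrier_is_subalgebra: "is_subalgebra (carrier A) A"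
  by (rule is_subalgebraI) auto

lemma generated_is_subalgebra:
  assumes "S \<subseteq> carrier A" shows "is_subalgebra (generated_subalgebra A S) A"
proof (rule is_subalgebraI)
  show "generated_subalgebra A S \<subseteq> carrier A"
    by (rule generated_least[OF carrier_is_subalgebra assms])
qed (auto simp: generated_subalgebra_def dest: is_subalgebraD)

lemma generated_eqI:
  assumes "S \<subseteq> carrier A" "S \<subseteq> generated_subalgebra A G" "G \<subseteq> S"
  shows "generated_subalgebra A S = generated_subalgebra A G"
proof
  show "generated_subalgebra A S \<subseteq> generated_subalgebra A G"
    using assms by (intro generated_least generated_is_subalgebra) auto
  show "generated_subalgebra A G \<subseteq> generated_subalgebra A S"
    using assms(1,3) generated_superset[of S] by (intro generated_least generated_is_subalgebra) auto
qed

definition centralizer :: "'a set \<Rightarrow> 'a set" where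
  "centralizer S = {a \<in> carrier A. \<forall>b\<in>S. a \<otimes>\<^bsub>A\<^esub> b = b \<otimes>\<^bsub>A\<^esub> a}"

lemma centralizer_is_subalgebra:
  assumes S: "S \<subseteq> carrier A" shows "is_subalgebra (centralizer S) A"
proof (rule is_subalgebraI)
  show "centralizer S \<subseteq> carrier A" "\<one>\<^bsub>A\<^esub> \<in> centralizer S"
    using S by (auto simp: centralizer_def)
next
  fix a b assume ab: "a \<in> centralizer S" "b \<in> centralizer S"
  have c: "a \<in> carrier A" "b \<in> carrier A" using ab by (auto simp: centralizer_def)
  have "(a \<otimes>\<^bsub>A\<^esub> b) \<otimes>\<^bsub>A\<^esub> s = s \<otimes>\<^bsub>A\<^esub> (a \<otimes>\<^bsub>A\<^esub> b)"
    and "(a \<oplus>\<^bsub>A\<^esub> b) \<otimes>\<^bsub>A\<^esub> s = s \<otimes>\<^bsub>A\<^esub> (a \<oplus>\<^bsub>A\<^esub> b)" if s: "s \<in> S" for s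
  proof -
    have sc: "s \<in> carrier A" and as: "a \<otimes>\<^bsub>A\<^esub> s = s \<otimes>\<^bsub>A\<^esub> a" and bs: "b \<otimes>\<^bsub>A\<^esub> s = s \<otimes>\<^bsub>A\<^esub> b"
      using s S ab by (auto simp: centralizer_def)
    have "(a \<otimes>\<^bsub>A\<^esub> b) \<otimes>\<^bsub>A\<^esub> s = a \<otimes>\<^bsub>A\<^esub> (s \<otimes>\<^bsub>A\<^esub> b)"
      by (simp only: A.m_assoc[OF c sc] bs)
    also have "\<dots> = s \<otimes>\<^bsub>A\<^esub> (a \<otimes>\<^bsub>A\<^esub> b)"
      by (simp only: A.m_assoc[OF c(1) sc c(2), symmetric] as A.m_assoc[OF sc c])
    finally show "(a \<otimes>\<^bsub>A\<^esub> b) \<otimes>\<^bsub>A\<^esub> s = s \<otimes>\<^bsub>A\<^esub> (a \<otimes>\<^bsub>A\<^esub> b)" .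
    show "(a \<oplus>\<^bsub>A\<^esub> b) \<otimes>\<^bsub>A\<^esub> s = s \<otimes>\<^bsub>A\<^esub> (a \<oplus>\<^bsub>A\<^esub> b)"
      by (simp only: A.l_distr[OF c sc] A.r_distr[OF c sc] as bs)
  qed
  then show "a \<otimes>\<^bsub>A\<^esub> b \<in> centralizer S" "a \<oplus>\<^bsub>A\<^esub> b \<in> centralizer S"
    using c by (auto simp: centralizer_def)
next
  fix c a assume "a \<in> centralizer S"
  then show "c \<odot>\<^bsub>A\<^esub> a \<in> centralizer S"
    using S AM.smult_closed[of c a]
    by (auto simp: centralizer_def smult_mult_left smult_mult_right subset_iff)
qed

text \<open>The subalgebra generated by \<open>S\<close> lies in the centralizer of \<open>S\<close>, so \<open>S\<close> lies in the centralizer of that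
  subalgebra; the centralizer is a subalgebra, so it contains the whole generated subalgebra.\<close>

lemma generated_commutative:
  assumes S: "S \<subseteq> carrier A" and comm: "\<And>a b. a \<in> S \<Longrightarrow> b \<in> S \<Longrightarrow> a \<otimes>\<^bsub>A\<^esub> b = b \<otimes>\<^bsub>A\<^esub> a"
    and ab: "a \<in> generated_subalgebra A S" "b \<in> generated_subalgebra A S"
  shows "a \<otimes>\<^bsub>A\<^esub> b = b \<otimes>\<^bsub>A\<^esub> a"
proof -
  let ?H = "generated_subalgebra A S"
  have H: "?H \<subseteq> carrier A" using is_subalgebraD(1)[OF generated_is_subalgebra[OF S]] .
  have "?H \<subseteq> centralizer S"
    using S comm by (intro generated_least centralizer_is_subalgebra) (auto simp: centralizer_def)
  then have "S \<subseteq> centralizer ?H"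
    using S by (auto simp: centralizer_def)
  then have "?H \<subseteq> centralizer ?H"
    by (intro generated_least centralizer_is_subalgebra[OF H])
  then show ?thesis using ab by (auto simp: centralizer_def)
qed

end

subsection \<open>Endomorphisms\<close>

locale complex_space =
  fixes V :: "(complex, 'v) module"
  assumes space_module: "Module.module class_ring V"
begin

interpretation V: Module.module class_ring V by (rule space_module)

lemma smult_simps:
  "v \<in> carrier V \<Longrightarrow> c \<odot>\<^bsub>V\<^esub> v \<in> carrier V"
  "v \<in> carrier V \<Longrightarrow> (c + d) \<odot>\<^bsub>V\<^esub> v = c \<odot>\<^bsub>V\<^esub> v \<oplus>\<^bsub>V\<^esub> d \<odot>\<^bsub>V\<^esub> v"
  "v \<in> carrier V \<Longrightarrow> w \<in> carrier V \<Longrightarrow> c \<odot>\<^bsub>V\<^esub> (v \<oplus>\<^bsub>V\<^esub> w) = c \<odot>\<^bsub>V\<^esub> v \<oplus>\<^bsub>V\<^esub> c \<odot>\<^bsub>V\<^esub> w"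
  "v \<in> carrier V \<Longrightarrow> c \<odot>\<^bsub>V\<^esub> (d \<odot>\<^bsub>V\<^esub> v) = (c * d) \<odot>\<^bsub>V\<^esub> v"
  "v \<in> carrier V \<Longrightarrow> 1 \<odot>\<^bsub>V\<^esub> v = v"
  "v \<in> carrier V \<Longrightarrow> 0 \<odot>\<^bsub>V\<^esub> v = \<zero>\<^bsub>V\<^esub>"
  "c \<odot>\<^bsub>V\<^esub> \<zero>\<^bsub>V\<^esub> = \<zero>\<^bsub>V\<^esub>"
  using V.smult_closed[of c v] V.smult_l_distr[of c d v] V.smult_r_distr[of c v w]
    V.smult_assoc1[of c d v] V.smult_one[of v] V.smult_l_null[of v] V.smult_r_null[of c] by simp_all

lemma smult_finsum:
  "f \<in> A \<rightarrow> carrier V \<Longrightarrow> c \<odot>\<^bsub>V\<^esub> (\<Oplus>\<^bsub>V\<^esub>a\<in>A. f a) = (\<Oplus>\<^bsub>V\<^esub>a\<in>A. c \<odot>\<^bsub>V\<^esub> f a)"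
  using V.finsum_smult[of c f A] by simp

abbreviation "EV \<equiv> End_algebra V"

lemma End_simps:
  "mult EV = compose (carrier V)" "\<one>\<^bsub>EV\<^esub> = (\<lambda>e\<in>carrier V. e)" "\<zero>\<^bsub>EV\<^esub> = (\<lambda>e\<in>carrier V. \<zero>\<^bsub>V\<^esub>)"
  "a \<oplus>\<^bsub>EV\<^esub> b = (\<lambda>e\<in>carrier V. a e \<oplus>\<^bsub>V\<^esub> b e)" "c \<odot>\<^bsub>EV\<^esub> a = (\<lambda>e\<in>carrier V. c \<odot>\<^bsub>V\<^esub> a e)"
  by (simp_all add: End_algebra_def)

lemma End_carrier:
  "a \<in> carrier EV \<longleftrightarrow> a \<in> extensional (carrier V) \<and> (\<forall>e\<in>carrier V. a e \<in> carrier V) \<and>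
    (\<forall>e\<in>carrier V. \<forall>e'\<in>carrier V. a (e \<oplus>\<^bsub>V\<^esub> e') = a e \<oplus>\<^bsub>V\<^esub> a e') \<and>
    (\<forall>c. \<forall>e\<in>carrier V. a (c \<odot>\<^bsub>V\<^esub> e) = c \<odot>\<^bsub>V\<^esub> a e)"
  by (auto simp: End_algebra_def LinearCombinations.module_hom_def)

lemma End_closed: "a \<in> carrier EV \<Longrightarrow> e \<in> carrier V \<Longrightarrow> a e \<in> carrier V"
  and End_add: "a \<in> carrier EV \<Longrightarrow> e \<in> carrier V \<Longrightarrow> e' \<in> carrier V \<Longrightarrow> a (e \<oplus>\<^bsub>V\<^esub> e') = a e \<oplus>\<^bsub>V\<^esub> a e'"
  and End_smult: "a \<in> carrier EV \<Longrightarrow> e \<in> carrier V \<Longrightarrow> a (c \<odot>\<^bsub>V\<^esub> e) = c \<odot>\<^bsub>V\<^esub> a e"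
  by (auto simp: End_carrier)

lemma End_zero: "a \<in> carrier EV \<Longrightarrow> a \<zero>\<^bsub>V\<^esub> = \<zero>\<^bsub>V\<^esub>"
  using End_smult[of a "\<zero>\<^bsub>V\<^esub>" 0] End_closed[of a "\<zero>\<^bsub>V\<^esub>"] by (simp add: smult_simps)

lemma End_eqI:
  "a \<in> carrier EV \<Longrightarrow> b \<in> carrier EV \<Longrightarrow> (\<And>e. e \<in> carrier V \<Longrightarrow> a e = b e) \<Longrightarrow> a = b"
  by (auto simp: End_carrier intro: extensionalityI)

lemma End_memI:
  assumes "\<And>e. e \<in> carrier V \<Longrightarrow> f e \<in> carrier V"
    "\<And>e e'. e \<in> carrier V \<Longrightarrow> e' \<in> carrier V \<Longrightarrow> f (e \<oplus>\<^bsub>V\<^esub> e') = f e \<oplus>\<^bsub>V\<^esub> f e'"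
    "\<And>c e. e \<in> carrier V \<Longrightarrow> f (c \<odot>\<^bsub>V\<^esub> e) = c \<odot>\<^bsub>V\<^esub> f e"
  shows "(\<lambda>e\<in>carrier V. f e) \<in> carrier EV"
  using assms by (auto simp: End_carrier smult_simps)

lemma End_ops_closed:
  "\<one>\<^bsub>EV\<^esub> \<in> carrier EV" "\<zero>\<^bsub>EV\<^esub> \<in> carrier EV"
  "a \<in> carrier EV \<Longrightarrow> b \<in> carrier EV \<Longrightarrow> a \<oplus>\<^bsub>EV\<^esub> b \<in> carrier EV"
  "a \<in> carrier EV \<Longrightarrow> b \<in> carrier EV \<Longrightarrow> a \<otimes>\<^bsub>EV\<^esub> b \<in> carrier EV"
  "a \<in> carrier EV \<Longrightarrow> c \<odot>\<^bsub>EV\<^esub> a \<in> carrier EV"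
  unfolding End_simps compose_def
  by (rule End_memI; simp add: End_closed End_add End_smult smult_simps V.M.a_ac mult.commute)+

lemma End_apply:
  assumes "e \<in> carrier V"
  shows "\<one>\<^bsub>EV\<^esub> e = e" "\<zero>\<^bsub>EV\<^esub> e = \<zero>\<^bsub>V\<^esub>" "(a \<oplus>\<^bsub>EV\<^esub> b) e = a e \<oplus>\<^bsub>V\<^esub> b e" "(c \<odot>\<^bsub>EV\<^esub> a) e = c \<odot>\<^bsub>V\<^esub> a e"
    "(a \<otimes>\<^bsub>EV\<^esub> b) e = a (b e)"
  using assms by (simp_all add: End_simps compose_def)

lemma End_ring: "ring EV"
proof (rule ringI)
  show "abelian_group EV"
  proof (rule abelian_groupI)
    fix a assume a: "a \<in> carrier EV"
    show "\<exists>b\<in>carrier EV. b \<oplus>\<^bsub>EV\<^esub> a = \<zero>\<^bsub>EV\<^esub>"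
    proof (intro bexI[of _ "(- 1) \<odot>\<^bsub>EV\<^esub> a"] End_eqI)
      fix e assume e: "e \<in> carrier V"
      show "((- 1) \<odot>\<^bsub>EV\<^esub> a \<oplus>\<^bsub>EV\<^esub> a) e = \<zero>\<^bsub>EV\<^esub> e"
        using smult_simps(2)[OF End_closed[OF a e], of "- 1" 1] End_closed[OF a e] e
        by (simp add: End_apply smult_simps)
    qed (use a in \<open>auto intro!: End_ops_closed\<close>)
  qed (auto intro!: End_eqI End_ops_closed simp: End_apply End_closed V.M.a_ac)
  show "monoid EV"
    by (rule monoidI) (auto intro!: End_eqI End_ops_closed simp: End_apply End_closed)
qed (auto intro!: End_eqI End_ops_closed simp: End_apply End_closed End_add)

lemma End_module: "Module.module class_ring EV"
proof (rule Module.moduleI)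
  show "cring (class_ring :: complex ring)" by (rule class_cring.cring_axioms)
  show "abelian_group EV" by (rule ring.is_abelian_group[OF End_ring])
next
  fix c d :: complex and a b assume a: "a \<in> carrier EV" and b: "b \<in> carrier EV"
  note ops = End_ops_closed(3-5) a b
  show "c \<odot>\<^bsub>EV\<^esub> a \<in> carrier EV" by (rule End_ops_closed(5)[OF a])
  show "(c \<oplus>\<^bsub>class_ring\<^esub> d) \<odot>\<^bsub>EV\<^esub> a = c \<odot>\<^bsub>EV\<^esub> a \<oplus>\<^bsub>EV\<^esub> d \<odot>\<^bsub>EV\<^esub> a"
    by (rule End_eqI) (simp_all add: ops End_apply End_closed smult_simps)
  show "c \<odot>\<^bsub>EV\<^esub> (a \<oplus>\<^bsub>EV\<^esub> b) = c \<odot>\<^bsub>EV\<^esub> a \<oplus>\<^bsub>EV\<^esub> c \<odot>\<^bsub>EV\<^esub> b"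
    by (rule End_eqI) (simp_all add: ops End_apply End_closed smult_simps)
  show "(c \<otimes>\<^bsub>class_ring\<^esub> d) \<odot>\<^bsub>EV\<^esub> a = c \<odot>\<^bsub>EV\<^esub> (d \<odot>\<^bsub>EV\<^esub> a)"
    by (rule End_eqI) (simp_all add: ops End_apply End_closed smult_simps)
  show "\<one>\<^bsub>class_ring\<^esub> \<odot>\<^bsub>EV\<^esub> a = a"
    by (rule End_eqI) (simp_all add: ops End_apply End_closed smult_simps)
qed

sublocale complex_algebra EV
proof (rule complex_algebra.intro)
  show "ring EV" by (rule End_ring)
  show "Module.module class_ring EV" by (rule End_module)
next
  fix a b and c :: complex assume a: "a \<in> carrier EV" and b: "b \<in> carrier EV"
  note ops = End_ops_closed(3-5) a b
  show "(c \<odot>\<^bsub>EV\<^esub> a) \<otimes>\<^bsub>EV\<^esub> b = c \<odot>\<^bsub>EV\<^esub> (a \<otimes>\<^bsub>EV\<^esub> b)"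
    by (rule End_eqI) (simp_all add: ops End_apply End_closed)
  show "a \<otimes>\<^bsub>EV\<^esub> (c \<odot>\<^bsub>EV\<^esub> b) = c \<odot>\<^bsub>EV\<^esub> (a \<otimes>\<^bsub>EV\<^esub> b)"
    by (rule End_eqI) (simp_all add: ops End_apply End_closed End_smult)
qed

interpretation EV: ring EV by (rule End_ring)

lemma End_finsum_apply:
  assumes "finite A" "f \<in> A \<rightarrow> carrier EV" "e \<in> carrier V"
  shows "(\<Oplus>\<^bsub>EV\<^esub>a\<in>A. f a) e = (\<Oplus>\<^bsub>V\<^esub>a\<in>A. f a e)"
  using assms by (intro finsum_hom[of EV V A f "\<lambda>g. g e"] EV.abelian_monoid_axioms V.M.abelian_monoid_axioms)
    (auto simp: End_closed End_apply)

lemma End_apply_finsum: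
  assumes "a \<in> carrier EV" "finite A" "f \<in> A \<rightarrow> carrier V"
  shows "a (\<Oplus>\<^bsub>V\<^esub>x\<in>A. f x) = (\<Oplus>\<^bsub>V\<^esub>x\<in>A. a (f x))"
  using assms by (intro finsum_hom V.M.abelian_monoid_axioms) (auto simp: End_closed End_add End_zero)

end

subsection \<open>The tensor product with the group algebra\<close>

text \<open>Needed because the commutator is formed with the subtraction of this structure, which is determined by its
  additive group.\<close>

lemma tensor_group_algebra_abelian_group:
  assumes "ring R" shows "abelian_group (tensor_group_algebra n R)"
proof -
  interpret R: ring R by fact
  let ?A = "tensor_group_algebra n R"
  have fin_add: "finite {r \<in> carrier_vec n. f r \<noteq> \<zero>\<^bsub>R\<^esub>}"
    if "finite {r \<in> carrier_vec n. a r \<noteq> \<zero>\<^bsub>R\<^esub>}" "finite {r \<in> carrier_vec n. b r \<noteq> \<zero>\<^bsub>R\<^esub>}"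
      "\<And>r. r \<in> carrier_vec n \<Longrightarrow> a r = \<zero>\<^bsub>R\<^esub> \<Longrightarrow> b r = \<zero>\<^bsub>R\<^esub> \<Longrightarrow> f r = \<zero>\<^bsub>R\<^esub>" for a b f :: "int vec \<Rightarrow> 'a"
    by (rule finite_subset[OF _ finite_UnI[OF that(1,2)]]) (use that(3) in auto)
  have car: "a \<in> carrier ?A \<longleftrightarrow> a \<in> carrier_vec n \<rightarrow>\<^sub>E carrier R \<and> finite {r \<in> carrier_vec n. a r \<noteq> \<zero>\<^bsub>R\<^esub>}" for a
    by (simp add: tensor_group_algebra_def)
  have ops: "a \<oplus>\<^bsub>?A\<^esub> b = (\<lambda>r\<in>carrier_vec n. a r \<oplus>\<^bsub>R\<^esub> b r)" "\<zero>\<^bsub>?A\<^esub> = (\<lambda>r\<in>carrier_vec n. \<zero>\<^bsub>R\<^esub>)" for a b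
    by (simp_all add: tensor_group_algebra_def)
  have opr: "(a \<oplus>\<^bsub>?A\<^esub> b) r = a r \<oplus>\<^bsub>R\<^esub> b r" "\<zero>\<^bsub>?A\<^esub> r = \<zero>\<^bsub>R\<^esub>" if "r \<in> carrier_vec n" for a b r
    using that by (simp_all add: ops)
  have eqI: "a = b" if "a \<in> carrier ?A" "b \<in> carrier ?A" "\<And>r. r \<in> carrier_vec n \<Longrightarrow> a r = b r" for a b
    using that by (auto simp: car intro: PiE_ext)
  have mem: "a r \<in> carrier R" if "a \<in> carrier ?A" "r \<in> carrier_vec n" for a r
    using that by (auto simp: car)
  have addc: "a \<oplus>\<^bsub>?A\<^esub> b \<in> carrier ?A" if "a \<in> carrier ?A" "b \<in> carrier ?A" for a b
    using that fin_add[of a b "a \<oplus>\<^bsub>?A\<^esub> b"] by (auto simp: car ops intro!: restrict_PiE_iff[THEN iffD2])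
  have zeroc: "\<zero>\<^bsub>?A\<^esub> \<in> carrier ?A" by (auto simp: car ops)
  show ?thesis
  proof (rule abelian_groupI)
    fix a assume a: "a \<in> carrier ?A"
    have neg: "(\<lambda>r\<in>carrier_vec n. \<ominus>\<^bsub>R\<^esub> a r) \<in> carrier ?A"
      using a fin_add[of a a "\<lambda>r\<in>carrier_vec n. \<ominus>\<^bsub>R\<^esub> a r"] by (auto simp: car)
    show "\<exists>b\<in>carrier ?A. b \<oplus>\<^bsub>?A\<^esub> a = \<zero>\<^bsub>?A\<^esub>"
      by (rule bexI[OF _ neg], rule eqI[OF addc[OF neg a] zeroc])
         (use mem[OF a] in \<open>simp add: ops R.l_neg\<close>)
  qed (auto intro!: eqI addc zeroc simp: opr mem R.a_ac)
qed

lemma tensor_group_algebra_mult_closed: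
  assumes "ring R" "a \<in> carrier (tensor_group_algebra n R)" "b \<in> carrier (tensor_group_algebra n R)"
  shows "a \<otimes>\<^bsub>tensor_group_algebra n R\<^esub> b \<in> carrier (tensor_group_algebra n R)"
proof -
  interpret R: ring R by fact
  let ?A = "tensor_group_algebra n R"
  let ?Sa = "{p \<in> carrier_vec n. a p \<noteq> \<zero>\<^bsub>R\<^esub>}" and ?Sb = "{p \<in> carrier_vec n. b p \<noteq> \<zero>\<^bsub>R\<^esub>}"
  have car: "x \<in> carrier ?A \<longleftrightarrow> x \<in> carrier_vec n \<rightarrow>\<^sub>E carrier R \<and> finite {r \<in> carrier_vec n. x r \<noteq> \<zero>\<^bsub>R\<^esub>}" for x
    by (simp add: tensor_group_algebra_def)
  have m: "(a \<otimes>\<^bsub>?A\<^esub> b) r = (\<Oplus>\<^bsub>R\<^esub>p\<in>?Sa. a p \<otimes>\<^bsub>R\<^esub> b (r - p))" if "r \<in> carrier_vec n" for r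
    using that by (simp add: tensor_group_algebra_def)
  have ac: "a p \<in> carrier R" and bc: "b p \<in> carrier R" if "p \<in> carrier_vec n" for p
    using that assms(2,3) by (auto simp: car)
  have "(a \<otimes>\<^bsub>?A\<^esub> b) r = \<zero>\<^bsub>R\<^esub>" if r: "r \<in> carrier_vec n" "r \<notin> (\<lambda>(p, q). p + q) ` (?Sa \<times> ?Sb)" for r
  proof -
    have "b (r - p) = \<zero>\<^bsub>R\<^esub>" if p: "p \<in> ?Sa" for p
    proof (rule ccontr)
      assume "b (r - p) \<noteq> \<zero>\<^bsub>R\<^esub>"
      then have "(p, r - p) \<in> ?Sa \<times> ?Sb" using p r by auto
      moreover have "p + (r - p) = r" using p r by (intro eq_vecI) auto
      ultimately have "r \<in> (\<lambda>(p, q). p + q) ` (?Sa \<times> ?Sb)"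
        by (intro image_eqI[of _ _ "(p, r - p)"]) auto
      then show False using r(2) by contradiction
    qed
    then show ?thesis unfolding m[OF r(1)] using ac by (intro R.add.finprod_one_eqI) auto
  qed
  then have "{r \<in> carrier_vec n. (a \<otimes>\<^bsub>?A\<^esub> b) r \<noteq> \<zero>\<^bsub>R\<^esub>} \<subseteq> (\<lambda>(p, q). p + q) ` (?Sa \<times> ?Sb)"
    by blast
  then have "finite {r \<in> carrier_vec n. (a \<otimes>\<^bsub>?A\<^esub> b) r \<noteq> \<zero>\<^bsub>R\<^esub>}"
    by (rule finite_subset) (use assms(2,3) in \<open>auto simp: car\<close>)
  moreover have "a \<otimes>\<^bsub>?A\<^esub> b \<in> carrier_vec n \<rightarrow>\<^sub>E carrier R"
    using ac bc by (auto simp: tensor_group_algebra_def intro!: R.finsum_closed)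
  ultimately show ?thesis by (simp add: car)
qed

lemma commutator_eq_zero:
  assumes "ring R" "a \<in> carrier (tensor_group_algebra n R)" "b \<in> carrier (tensor_group_algebra n R)"
    "a \<otimes>\<^bsub>tensor_group_algebra n R\<^esub> b = b \<otimes>\<^bsub>tensor_group_algebra n R\<^esub> a"
  shows "commutator (tensor_group_algebra n R) a b = \<zero>\<^bsub>tensor_group_algebra n R\<^esub>"
proof -
  interpret abelian_group "tensor_group_algebra n R" by (rule tensor_group_algebra_abelian_group) fact
  show ?thesis unfolding commutator_def assms(4) a_minus_def
    by (rule r_neg[OF tensor_group_algebra_mult_closed[OF assms(1,3,2)]])
qed


section \<open>Independence of characters\<close>

lemma vec_add_diff: "(p :: int vec) \<in> carrier_vec n \<Longrightarrow> q \<in> carrier_vec n \<Longrightarrow> p + q - p = q"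
  by (intro eq_vecI) auto

lemma vec_diff_add: "(p :: int vec) \<in> carrier_vec n \<Longrightarrow> q \<in> carrier_vec n \<Longrightarrow> p + (q - p) = q"
  by (intro eq_vecI) auto

context complex_space
begin

interpretation V: Module.module class_ring V by (rule space_module)

lemma add_negative:
  assumes "v \<in> carrier V" shows "v \<oplus>\<^bsub>V\<^esub> (- 1) \<odot>\<^bsub>V\<^esub> v = \<zero>\<^bsub>V\<^esub>"
proof -
  have "v \<oplus>\<^bsub>V\<^esub> (- 1) \<odot>\<^bsub>V\<^esub> v = 1 \<odot>\<^bsub>V\<^esub> v \<oplus>\<^bsub>V\<^esub> (- 1) \<odot>\<^bsub>V\<^esub> v"
    by (simp only: smult_simps(5)[OF assms])
  also have "\<dots> = (1 + - 1) \<odot>\<^bsub>V\<^esub> v" by (rule smult_simps(2)[OF assms, symmetric])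
  also have "\<dots> = \<zero>\<^bsub>V\<^esub>" by (simp add: smult_simps(6)[OF assms])
  finally show ?thesis .
qed

lemma eq_of_difference_zero:
  assumes "v \<in> carrier V" "w \<in> carrier V" "v \<oplus>\<^bsub>V\<^esub> (- 1) \<odot>\<^bsub>V\<^esub> w = \<zero>\<^bsub>V\<^esub>"
  shows "v = w"
  using assms(3) V.M.add.right_cancel[OF smult_simps(1)[OF assms(2)] assms(1,2)]
  unfolding add_negative[OF assms(2), symmetric] by blast

lemma finsum_difference:
  assumes "f \<in> A \<rightarrow> carrier V" "g \<in> A \<rightarrow> carrier V" "(\<Oplus>\<^bsub>V\<^esub>j\<in>A. f j) = (\<Oplus>\<^bsub>V\<^esub>j\<in>A. g j)"
  shows "(\<Oplus>\<^bsub>V\<^esub>j\<in>A. f j \<oplus>\<^bsub>V\<^esub> (- 1) \<odot>\<^bsub>V\<^esub> g j) = \<zero>\<^bsub>V\<^esub>"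
proof -
  have "(\<Oplus>\<^bsub>V\<^esub>j\<in>A. f j \<oplus>\<^bsub>V\<^esub> (- 1) \<odot>\<^bsub>V\<^esub> g j) = (\<Oplus>\<^bsub>V\<^esub>j\<in>A. f j) \<oplus>\<^bsub>V\<^esub> (\<Oplus>\<^bsub>V\<^esub>j\<in>A. (- 1) \<odot>\<^bsub>V\<^esub> g j)"
    by (rule V.M.finsum_addf) (use assms smult_simps(1) in auto)
  also have "\<dots> = \<zero>\<^bsub>V\<^esub>"
    unfolding smult_finsum[OF assms(2), symmetric] assms(3)
    by (rule add_negative[OF V.M.finsum_closed[OF assms(2)]])
  finally show ?thesis .
qed

end

context toric_variety
begin

text \<open>Dedekind's argument with vectors as coefficients. Replacing \<open>t\<close> by \<open>t\<^sub>0 t\<close> and subtracting \<open>\<chi>\<^sup>r\<^sup>0(t\<^sub>0)\<close> times the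
  original relation removes the term of \<open>r\<^sub>0\<close> and multiplies that of \<open>r\<close> by \<open>\<chi>\<^sup>r(t\<^sub>0) - \<chi>\<^sup>r\<^sup>0(t\<^sub>0)\<close>, which is nonzero for
  a suitable \<open>t\<^sub>0\<close>.\<close>

lemma characters_independent:
  fixes V :: "(complex, 'v) module"
  assumes V: "Module.module class_ring V" and R: "finite R" "R \<subseteq> carrier_vec n"
    and z: "z \<in> R \<rightarrow> carrier V"
    and eq: "\<And>t. t \<in> torus n \<Longrightarrow> (\<Oplus>\<^bsub>V\<^esub>r\<in>R. chi r t \<odot>\<^bsub>V\<^esub> z r) = \<zero>\<^bsub>V\<^esub>"
    and r: "r \<in> R"
  shows "z r = \<zero>\<^bsub>V\<^esub>"
  using R z eq r
proof (induction R arbitrary: z r)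
  case empty
  then show ?case by simp
next
  case (insert r0 R)
  interpret complex_space V by (rule complex_space.intro) (rule V)
  interpret V: Module.module class_ring V by (rule V)
  have zc: "z i \<in> carrier V" if "i \<in> insert r0 R" for i using insert.prems(2) that by auto
  have r0: "r0 \<in> carrier_vec n" and Rc: "R \<subseteq> carrier_vec n" using insert.prems(1) by auto
  have zR: "z i = \<zero>\<^bsub>V\<^esub>" if i: "i \<in> R" for i
  proof -
    have "(chi j t0 - chi r0 t0) \<odot>\<^bsub>V\<^esub> z j = \<zero>\<^bsub>V\<^esub>" if t0: "t0 \<in> torus n" and j: "j \<in> R" for t0 j
    proof (rule insert.IH[OF Rc _ _ j])
      show "(\<lambda>j. (chi j t0 - chi r0 t0) \<odot>\<^bsub>V\<^esub> z j) \<in> R \<rightarrow> carrier V"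
        using zc smult_simps(1) by auto
      fix t assume t: "t \<in> torus n"
      define f where "f = (\<lambda>j. (chi j t0 * chi j t) \<odot>\<^bsub>V\<^esub> z j)"
      define g where "g = (\<lambda>j. (chi r0 t0 * chi j t) \<odot>\<^bsub>V\<^esub> z j)"
      have fg: "f \<in> R \<rightarrow> carrier V" "f r0 \<in> carrier V" "g \<in> R \<rightarrow> carrier V"
        using zc smult_simps(1) by (auto simp: f_def g_def)
      have sums: "(\<Oplus>\<^bsub>V\<^esub>j\<in>R. f j) \<in> carrier V" "(\<Oplus>\<^bsub>V\<^esub>j\<in>R. g j) \<in> carrier V"
        using fg by (auto intro: V.M.finsum_closed)
      have "f r0 \<oplus>\<^bsub>V\<^esub> (\<Oplus>\<^bsub>V\<^esub>j\<in>R. f j) = (\<Oplus>\<^bsub>V\<^esub>j\<in>insert r0 R. f j)"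
        by (rule V.M.finsum_insert[OF insert.hyps fg(1,2), symmetric])
      also have "\<dots> = \<zero>\<^bsub>V\<^esub>"
        using insert.prems(3)[OF act_in_torus[OF t0 t]] by (simp add: f_def chi_act)
      finally have F: "f r0 \<oplus>\<^bsub>V\<^esub> (\<Oplus>\<^bsub>V\<^esub>j\<in>R. f j) = \<zero>\<^bsub>V\<^esub>" .
      have "f r0 \<oplus>\<^bsub>V\<^esub> (\<Oplus>\<^bsub>V\<^esub>j\<in>R. g j) = g r0 \<oplus>\<^bsub>V\<^esub> (\<Oplus>\<^bsub>V\<^esub>j\<in>R. g j)"
        by (simp add: f_def g_def)
      also have "\<dots> = (\<Oplus>\<^bsub>V\<^esub>j\<in>insert r0 R. g j)"
        by (rule V.M.finsum_insert[OF insert.hyps fg(3), symmetric])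
           (use fg(2) in \<open>simp add: f_def g_def\<close>)
      also have "\<dots> = (\<Oplus>\<^bsub>V\<^esub>j\<in>insert r0 R. chi r0 t0 \<odot>\<^bsub>V\<^esub> (chi j t \<odot>\<^bsub>V\<^esub> z j))"
        by (rule V.M.finsum_cong') (use zc in \<open>auto simp: g_def smult_simps\<close>)
      also have "\<dots> = chi r0 t0 \<odot>\<^bsub>V\<^esub> (\<Oplus>\<^bsub>V\<^esub>j\<in>insert r0 R. chi j t \<odot>\<^bsub>V\<^esub> z j)"
        by (rule smult_finsum[symmetric]) (use zc smult_simps(1) in auto)
      also have "\<dots> = \<zero>\<^bsub>V\<^esub>" using insert.prems(3)[OF t] by (simp add: smult_simps)
      finally have "(\<Oplus>\<^bsub>V\<^esub>j\<in>R. g j) = (\<Oplus>\<^bsub>V\<^esub>j\<in>R. f j)"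
        using F fg(2) sums by (metis V.M.add.right_cancel V.M.a_comm)
      then have "(\<Oplus>\<^bsub>V\<^esub>j\<in>R. f j \<oplus>\<^bsub>V\<^esub> (- 1) \<odot>\<^bsub>V\<^esub> g j) = \<zero>\<^bsub>V\<^esub>"
        by (intro finsum_difference fg(1,3)) simp
      moreover have "(\<Oplus>\<^bsub>V\<^esub>j\<in>R. f j \<oplus>\<^bsub>V\<^esub> (- 1) \<odot>\<^bsub>V\<^esub> g j)
          = (\<Oplus>\<^bsub>V\<^esub>j\<in>R. chi j t \<odot>\<^bsub>V\<^esub> ((chi j t0 - chi r0 t0) \<odot>\<^bsub>V\<^esub> z j))"
      proof (rule V.M.finsum_cong')
        fix j assume "j \<in> R"
        then have "z j \<in> carrier V" using zc by blast
        then show "f j \<oplus>\<^bsub>V\<^esub> (- 1) \<odot>\<^bsub>V\<^esub> g j = chi j t \<odot>\<^bsub>V\<^esub> ((chi j t0 - chi r0 t0) \<odot>\<^bsub>V\<^esub> z j)"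
          using smult_simps(2)[of "z j" "chi j t0 * chi j t" "- (chi r0 t0 * chi j t)"]
          by (simp add: f_def g_def smult_simps(4) algebra_simps)
      qed (use zc smult_simps(1) in auto)
      ultimately show "(\<Oplus>\<^bsub>V\<^esub>j\<in>R. chi j t \<odot>\<^bsub>V\<^esub> ((chi j t0 - chi r0 t0) \<odot>\<^bsub>V\<^esub> z j)) = \<zero>\<^bsub>V\<^esub>"
        by simp
    qed
    moreover have "i \<in> carrier_vec n" "i \<noteq> r0" using i Rc insert.hyps(2) by auto
    then obtain t0 where "t0 \<in> torus n" "chi i t0 \<noteq> chi r0 t0"
      by (rule characters_separated[OF _ r0])
    ultimately have "inverse (chi i t0 - chi r0 t0) \<odot>\<^bsub>V\<^esub> ((chi i t0 - chi r0 t0) \<odot>\<^bsub>V\<^esub> z i) = \<zero>\<^bsub>V\<^esub>"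
      and "chi i t0 - chi r0 t0 \<noteq> 0"
      using i by (simp_all add: smult_simps)
    then show ?thesis using zc[of i] i by (simp add: smult_simps)
  qed
  have "\<zero>\<^bsub>V\<^esub> = (\<Oplus>\<^bsub>V\<^esub>j\<in>insert r0 R. chi j (torus_one n) \<odot>\<^bsub>V\<^esub> z j)"
    using insert.prems(3)[OF torus_one_in_torus] by simp
  also have "\<dots> = chi r0 (torus_one n) \<odot>\<^bsub>V\<^esub> z r0 \<oplus>\<^bsub>V\<^esub> (\<Oplus>\<^bsub>V\<^esub>j\<in>R. chi j (torus_one n) \<odot>\<^bsub>V\<^esub> z j)"
    by (rule V.M.finsum_insert[OF insert.hyps]) (use zc smult_simps(1) in auto)
  also have "(\<Oplus>\<^bsub>V\<^esub>j\<in>R. chi j (torus_one n) \<odot>\<^bsub>V\<^esub> z j) = \<zero>\<^bsub>V\<^esub>"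
    by (rule V.M.add.finprod_one_eqI) (simp add: zR smult_simps)
  finally have "z r0 = \<zero>\<^bsub>V\<^esub>" using zc[of r0] r0 by (simp add: chi_one smult_simps)
  then show ?case using zR insert.prems(4) by blast
qed

lemma tensor_mult_apply:
  assumes V: "Module.module class_ring V" and S: "finite S" "S \<subseteq> carrier_vec n"
    and a: "\<And>r. r \<in> carrier_vec n \<Longrightarrow> a r \<in> carrier (End_algebra V)"
           "\<And>r. r \<in> carrier_vec n \<Longrightarrow> r \<notin> S \<Longrightarrow> a r = \<zero>\<^bsub>End_algebra V\<^esub>"
    and b: "\<And>r. r \<in> carrier_vec n \<Longrightarrow> b r \<in> carrier (End_algebra V)"
    and r: "r \<in> carrier_vec n" and e: "e \<in> carrier V"
  shows "(a \<otimes>\<^bsub>tensor_group_algebra n (End_algebra V)\<^esub> b) r e = (\<Oplus>\<^bsub>V\<^esub>p\<in>S. a p (b (r - p) e))"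
proof -
  interpret complex_space V by (rule complex_space.intro) (rule V)
  interpret V: Module.module class_ring V by (rule V)
  interpret EV: ring EV by (rule End_ring)
  let ?supp = "{p \<in> carrier_vec n. a p \<noteq> \<zero>\<^bsub>EV\<^esub>}"
  have sub: "?supp \<subseteq> S" using a(2) by blast
  have rp: "r - p \<in> carrier_vec n" if "p \<in> carrier_vec n" for p using that r by auto
  have "(a \<otimes>\<^bsub>tensor_group_algebra n EV\<^esub> b) r e = (\<Oplus>\<^bsub>EV\<^esub>p\<in>?supp. a p \<otimes>\<^bsub>EV\<^esub> b (r - p)) e"
    using r by (simp add: tensor_group_algebra_def)
  also have "\<dots> = (\<Oplus>\<^bsub>V\<^esub>p\<in>?supp. (a p \<otimes>\<^bsub>EV\<^esub> b (r - p)) e)"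
    using a(1) b rp by (intro End_finsum_apply[OF finite_subset[OF sub S(1)] _ e]) auto
  also have "\<dots> = (\<Oplus>\<^bsub>V\<^esub>p\<in>S. a p (b (r - p) e))"
  proof (rule V.M.add.finprod_mono_neutral_cong_left[OF S(1) sub])
    fix p assume p: "p \<in> S - ?supp"
    then have "a p = \<zero>\<^bsub>EV\<^esub>" "p \<in> carrier_vec n" using S(2) by auto
    then show "a p (b (r - p) e) = \<zero>\<^bsub>V\<^esub>"
      using End_closed[OF b[OF rp] e] by (simp add: End_apply(2))
  next
    show "(\<lambda>p. a p (b (r - p) e)) \<in> S \<rightarrow> carrier V"
      using S(2) by (intro Pi_I End_closed[OF a(1) End_closed[OF b[OF rp] e]]) auto
  qed (use e in \<open>simp add: End_apply\<close>)
  finally show ?thesis .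
qed

text \<open>Evaluation at \<open>t\<close> is multiplicative. The set \<open>R\<close> may be larger than the set of sums \<open>p + q\<close>, so that it can be
  chosen to contain a given exponent.\<close>

lemma tensor_mult_evaluated:
  assumes V: "Module.module class_ring V" and S: "finite S" "S \<subseteq> carrier_vec n"
    and a: "\<And>r. r \<in> carrier_vec n \<Longrightarrow> a r \<in> carrier (End_algebra V)"
           "\<And>r. r \<in> carrier_vec n \<Longrightarrow> r \<notin> S \<Longrightarrow> a r = \<zero>\<^bsub>End_algebra V\<^esub>"
    and b: "\<And>r. r \<in> carrier_vec n \<Longrightarrow> b r \<in> carrier (End_algebra V)"
           "\<And>r. r \<in> carrier_vec n \<Longrightarrow> r \<notin> S \<Longrightarrow> b r = \<zero>\<^bsub>End_algebra V\<^esub>"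
    and R: "finite R" "R \<subseteq> carrier_vec n" "\<And>p q. p \<in> S \<Longrightarrow> q \<in> S \<Longrightarrow> p + q \<in> R"
    and t: "t \<in> torus n" and e: "e \<in> carrier V"
  shows "(\<Oplus>\<^bsub>V\<^esub>r\<in>R. chi r t \<odot>\<^bsub>V\<^esub> (a \<otimes>\<^bsub>tensor_group_algebra n (End_algebra V)\<^esub> b) r e)
    = (\<Oplus>\<^bsub>V\<^esub>p\<in>S. \<Oplus>\<^bsub>V\<^esub>q\<in>S. (chi p t * chi q t) \<odot>\<^bsub>V\<^esub> a p (b q e))"
proof -
  interpret complex_space V by (rule complex_space.intro) (rule V)
  interpret V: Module.module class_ring V by (rule V)
  have Sc: "p \<in> carrier_vec n" if "p \<in> S" for p using that S(2) by blast
  have Rc: "r \<in> carrier_vec n" if "r \<in> R" for r using that R(2) by blast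
  have abc: "a p (b q e) \<in> carrier V" if "p \<in> carrier_vec n" "q \<in> carrier_vec n" for p q
    by (rule End_closed[OF a(1)[OF that(1)] End_closed[OF b(1)[OF that(2)] e]])
  have trm: "chi r t \<odot>\<^bsub>V\<^esub> a p (b (r - p) e) \<in> carrier V" if "r \<in> R" "p \<in> S" for r p
    using that Sc Rc by (intro smult_simps(1) abc) auto
  have "(\<Oplus>\<^bsub>V\<^esub>r\<in>R. chi r t \<odot>\<^bsub>V\<^esub> (a \<otimes>\<^bsub>tensor_group_algebra n (End_algebra V)\<^esub> b) r e)
    = (\<Oplus>\<^bsub>V\<^esub>r\<in>R. \<Oplus>\<^bsub>V\<^esub>p\<in>S. chi r t \<odot>\<^bsub>V\<^esub> a p (b (r - p) e))"
  proof (rule V.M.finsum_cong')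
    fix r assume r: "r \<in> R"
    have "(\<lambda>p. a p (b (r - p) e)) \<in> S \<rightarrow> carrier V" using abc Sc Rc[OF r] by auto
    then show "chi r t \<odot>\<^bsub>V\<^esub> (a \<otimes>\<^bsub>tensor_group_algebra n (End_algebra V)\<^esub> b) r e
        = (\<Oplus>\<^bsub>V\<^esub>p\<in>S. chi r t \<odot>\<^bsub>V\<^esub> a p (b (r - p) e))"
      by (simp add: tensor_mult_apply[OF V S a b(1) Rc[OF r] e] smult_finsum)
  qed (use trm in \<open>auto intro!: V.M.finsum_closed\<close>)
  also have "\<dots> = (\<Oplus>\<^bsub>V\<^esub>p\<in>S. \<Oplus>\<^bsub>V\<^esub>r\<in>R. chi r t \<odot>\<^bsub>V\<^esub> a p (b (r - p) e))"
    by (rule V.M.finsum_swap[OF R(1) S(1) trm])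
  also have "\<dots> = (\<Oplus>\<^bsub>V\<^esub>p\<in>S. \<Oplus>\<^bsub>V\<^esub>q\<in>S. (chi p t * chi q t) \<odot>\<^bsub>V\<^esub> a p (b q e))"
  proof (rule V.M.finsum_cong')
    fix p assume p: "p \<in> S"
    have inj: "inj_on (\<lambda>q. p + q) S"
    proof (rule inj_onI)
      fix q q' assume q: "q \<in> S" "q' \<in> S" "p + q = p + q'"
      then show "q = q'" using vec_add_diff[OF Sc[OF p] Sc] by metis
    qed
    have qp: "(p + q) - p = q" if "q \<in> S" for q by (rule vec_add_diff[OF Sc[OF p] Sc[OF that]])
    have "(\<Oplus>\<^bsub>V\<^esub>r\<in>R. chi r t \<odot>\<^bsub>V\<^esub> a p (b (r - p) e))
        = (\<Oplus>\<^bsub>V\<^esub>r\<in>(\<lambda>q. p + q) ` S. chi r t \<odot>\<^bsub>V\<^esub> a p (b (r - p) e))"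
    proof (rule V.M.add.finprod_mono_neutral_cong_right[OF R(1)])
      fix r assume r: "r \<in> R - (\<lambda>q. p + q) ` S"
      have "r = p + (r - p)" using vec_diff_add[OF Sc[OF p] Rc] r by simp
      then have "r - p \<notin> S" using r by blast
      then have "b (r - p) = \<zero>\<^bsub>EV\<^esub>" using r p Sc Rc by (intro b(2)) auto
      then show "chi r t \<odot>\<^bsub>V\<^esub> a p (b (r - p) e) = \<zero>\<^bsub>V\<^esub>"
        using e by (simp add: End_apply End_zero[OF a(1)[OF Sc[OF p]]] smult_simps)
    qed (use R(3) p trm in auto)
    also have "\<dots> = (\<Oplus>\<^bsub>V\<^esub>q\<in>S. chi (p + q) t \<odot>\<^bsub>V\<^esub> a p (b ((p + q) - p) e))"
      by (rule V.M.finsum_reindex[OF _ inj]) (use R(3) p trm in auto)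
    also have "\<dots> = (\<Oplus>\<^bsub>V\<^esub>q\<in>S. (chi p t * chi q t) \<odot>\<^bsub>V\<^esub> a p (b q e))"
      by (rule V.M.finsum_cong') (use p Sc abc in \<open>auto simp: qp chi_add_torus[OF t] intro!: smult_simps(1)\<close>)
    finally show "(\<Oplus>\<^bsub>V\<^esub>r\<in>R. chi r t \<odot>\<^bsub>V\<^esub> a p (b (r - p) e))
        = (\<Oplus>\<^bsub>V\<^esub>q\<in>S. (chi p t * chi q t) \<odot>\<^bsub>V\<^esub> a p (b q e))" .
  qed (use Sc abc in \<open>auto intro!: V.M.finsum_closed smult_simps(1)\<close>)
  finally show ?thesis .
qed

text \<open>Elements of \<open>End V \<otimes> \<complex>[M]\<close> commute if their values at all points of the torus do, because the characters
  are independent.\<close>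

lemma tensor_commute:
  assumes V: "Module.module class_ring V" and S: "finite S" "S \<subseteq> carrier_vec n"
    and a: "\<And>r. r \<in> carrier_vec n \<Longrightarrow> a r \<in> carrier (End_algebra V)"
           "\<And>r. r \<in> carrier_vec n \<Longrightarrow> r \<notin> S \<Longrightarrow> a r = \<zero>\<^bsub>End_algebra V\<^esub>"
    and b: "\<And>r. r \<in> carrier_vec n \<Longrightarrow> b r \<in> carrier (End_algebra V)"
           "\<And>r. r \<in> carrier_vec n \<Longrightarrow> r \<notin> S \<Longrightarrow> b r = \<zero>\<^bsub>End_algebra V\<^esub>"
    and ab: "a \<in> carrier (tensor_group_algebra n (End_algebra V))"
            "b \<in> carrier (tensor_group_algebra n (End_algebra V))"
    and eq: "\<And>t e. t \<in> torus n \<Longrightarrow> e \<in> carrier V \<Longrightarrow>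
      (\<Oplus>\<^bsub>V\<^esub>p\<in>S. \<Oplus>\<^bsub>V\<^esub>q\<in>S. (chi p t * chi q t) \<odot>\<^bsub>V\<^esub> a p (b q e)) =
      (\<Oplus>\<^bsub>V\<^esub>p\<in>S. \<Oplus>\<^bsub>V\<^esub>q\<in>S. (chi p t * chi q t) \<odot>\<^bsub>V\<^esub> b p (a q e))"
  shows "a \<otimes>\<^bsub>tensor_group_algebra n (End_algebra V)\<^esub> b = b \<otimes>\<^bsub>tensor_group_algebra n (End_algebra V)\<^esub> a"
proof -
  interpret complex_space V by (rule complex_space.intro) (rule V)
  interpret V: Module.module class_ring V by (rule V)
  let ?A = "tensor_group_algebra n EV"
  have closed: "a \<otimes>\<^bsub>?A\<^esub> b \<in> carrier ?A" "b \<otimes>\<^bsub>?A\<^esub> a \<in> carrier ?A"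
    using tensor_group_algebra_mult_closed[OF End_ring] ab by blast+
  then have PiE: "a \<otimes>\<^bsub>?A\<^esub> b \<in> carrier_vec n \<rightarrow>\<^sub>E carrier EV" "b \<otimes>\<^bsub>?A\<^esub> a \<in> carrier_vec n \<rightarrow>\<^sub>E carrier EV"
    by (auto simp: tensor_group_algebra_def)
  show ?thesis
  proof (rule PiE_ext[OF PiE])
    fix r :: "int vec" assume r: "r \<in> carrier_vec n"
    define R where "R = insert r ((\<lambda>(p, q). p + q) ` (S \<times> S))"
    have R: "finite R" "R \<subseteq> carrier_vec n" "\<And>p q. p \<in> S \<Longrightarrow> q \<in> S \<Longrightarrow> p + q \<in> R" "r \<in> R"
      using S(1) S(2)[THEN subsetD] r by (auto simp: R_def)
    show "(a \<otimes>\<^bsub>?A\<^esub> b) r = (b \<otimes>\<^bsub>?A\<^esub> a) r"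
    proof (rule End_eqI)
      show c: "(a \<otimes>\<^bsub>?A\<^esub> b) r \<in> carrier EV" "(b \<otimes>\<^bsub>?A\<^esub> a) r \<in> carrier EV" using PiE r by auto
      fix e assume e: "e \<in> carrier V"
      have ce: "(a \<otimes>\<^bsub>?A\<^esub> b) i e \<in> carrier V" "(b \<otimes>\<^bsub>?A\<^esub> a) i e \<in> carrier V" if "i \<in> R" for i
        using End_closed[OF PiE_mem[OF PiE(1)] e] End_closed[OF PiE_mem[OF PiE(2)] e] R(2) that by blast+
      define d where "d i = (a \<otimes>\<^bsub>?A\<^esub> b) i e \<oplus>\<^bsub>V\<^esub> (- 1) \<odot>\<^bsub>V\<^esub> (b \<otimes>\<^bsub>?A\<^esub> a) i e" for i
      have dc: "d \<in> R \<rightarrow> carrier V" using ce smult_simps(1) by (auto simp: d_def)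
      have "d r = \<zero>\<^bsub>V\<^esub>"
      proof (rule characters_independent[OF V R(1,2) dc _ R(4)])
        fix t assume t: "t \<in> torus n"
        define f where "f i = chi i t \<odot>\<^bsub>V\<^esub> (a \<otimes>\<^bsub>?A\<^esub> b) i e" for i
        define g where "g i = chi i t \<odot>\<^bsub>V\<^esub> (b \<otimes>\<^bsub>?A\<^esub> a) i e" for i
        have fg: "f \<in> R \<rightarrow> carrier V" "g \<in> R \<rightarrow> carrier V"
          using ce smult_simps(1) by (auto simp: f_def g_def)
        have "(\<Oplus>\<^bsub>V\<^esub>i\<in>R. f i) = (\<Oplus>\<^bsub>V\<^esub>i\<in>R. g i)"
          unfolding f_def g_def
          by (rule trans[OF tensor_mult_evaluated[OF V S a b R(1-3) t e]
                trans[OF eq[OF t e] tensor_mult_evaluated[OF V S b a R(1-3) t e, symmetric]]])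
        then have "(\<Oplus>\<^bsub>V\<^esub>i\<in>R. f i \<oplus>\<^bsub>V\<^esub> (- 1) \<odot>\<^bsub>V\<^esub> g i) = \<zero>\<^bsub>V\<^esub>"
          by (rule finsum_difference[OF fg])
        moreover have "(\<Oplus>\<^bsub>V\<^esub>i\<in>R. f i \<oplus>\<^bsub>V\<^esub> (- 1) \<odot>\<^bsub>V\<^esub> g i) = (\<Oplus>\<^bsub>V\<^esub>i\<in>R. chi i t \<odot>\<^bsub>V\<^esub> d i)"
          by (rule V.M.finsum_cong')
             (use ce dc smult_simps(1) in \<open>auto simp: f_def g_def d_def smult_simps mult.commute\<close>)
        ultimately show "(\<Oplus>\<^bsub>V\<^esub>i\<in>R. chi i t \<odot>\<^bsub>V\<^esub> d i) = \<zero>\<^bsub>V\<^esub>" by simp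
      qed
      then show "(a \<otimes>\<^bsub>?A\<^esub> b) r e = (b \<otimes>\<^bsub>?A\<^esub> a) r e"
        unfolding d_def by (rule eq_of_difference_zero[OF ce[OF R(4)]])
    qed
  qed
qed

lemma eval_at_apply:
  assumes V: "Module.module class_ring V" and S: "finite S" "S \<subseteq> carrier_vec n"
    and a: "\<And>r. r \<in> carrier_vec n \<Longrightarrow> a r \<in> carrier (End_algebra V)"
           "\<And>r. r \<in> carrier_vec n \<Longrightarrow> r \<notin> S \<Longrightarrow> a r = \<zero>\<^bsub>End_algebra V\<^esub>"
  shows "eval_at (End_algebra V) a t \<in> carrier (End_algebra V)"
    and "e \<in> carrier V \<Longrightarrow> eval_at (End_algebra V) a t e = (\<Oplus>\<^bsub>V\<^esub>r\<in>S. chi r t \<odot>\<^bsub>V\<^esub> a r e)"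
proof -
  interpret complex_space V by (rule complex_space.intro) (rule V)
  interpret V: Module.module class_ring V by (rule V)
  interpret EV: ring EV by (rule End_ring)
  let ?supp = "{p \<in> carrier_vec n. a p \<noteq> \<zero>\<^bsub>EV\<^esub>}"
  have sub: "?supp \<subseteq> S" using a(2) by blast
  have trm: "(\<lambda>r. chi r t \<odot>\<^bsub>EV\<^esub> a r) \<in> ?supp \<rightarrow> carrier EV"
    using a(1) End_ops_closed by auto
  then show "eval_at EV a t \<in> carrier EV"
    unfolding eval_at_def by (rule EV.finsum_closed)
  assume e: "e \<in> carrier V"
  have "eval_at EV a t e = (\<Oplus>\<^bsub>V\<^esub>r\<in>?supp. (chi r t \<odot>\<^bsub>EV\<^esub> a r) e)"
    unfolding eval_at_def by (rule End_finsum_apply[OF finite_subset[OF sub S(1)] trm e])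
  also have "\<dots> = (\<Oplus>\<^bsub>V\<^esub>r\<in>S. chi r t \<odot>\<^bsub>V\<^esub> a r e)"
  proof (rule V.M.add.finprod_mono_neutral_cong_left[OF S(1) sub])
    fix p assume p: "p \<in> S - ?supp"
    then have "a p = \<zero>\<^bsub>EV\<^esub>" using S(2) by auto
    then show "chi p t \<odot>\<^bsub>V\<^esub> a p e = \<zero>\<^bsub>V\<^esub>" using e by (simp add: End_apply smult_simps)
  next
    show "(\<lambda>r. chi r t \<odot>\<^bsub>V\<^esub> a r e) \<in> S \<rightarrow> carrier V"
      using S(2) by (intro Pi_I smult_simps(1) End_closed[OF a(1) e]) auto
  qed (use e in \<open>simp add: End_apply\<close>)
  finally show "eval_at EV a t e = (\<Oplus>\<^bsub>V\<^esub>r\<in>S. chi r t \<odot>\<^bsub>V\<^esub> a r e)" .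
qed

lemma eval_at_mult_apply:
  assumes V: "Module.module class_ring V" and S: "finite S" "S \<subseteq> carrier_vec n"
    and a: "\<And>r. r \<in> carrier_vec n \<Longrightarrow> a r \<in> carrier (End_algebra V)"
           "\<And>r. r \<in> carrier_vec n \<Longrightarrow> r \<notin> S \<Longrightarrow> a r = \<zero>\<^bsub>End_algebra V\<^esub>"
    and b: "\<And>r. r \<in> carrier_vec n \<Longrightarrow> b r \<in> carrier (End_algebra V)"
           "\<And>r. r \<in> carrier_vec n \<Longrightarrow> r \<notin> S \<Longrightarrow> b r = \<zero>\<^bsub>End_algebra V\<^esub>"
    and e: "e \<in> carrier V"
  shows "(eval_at (End_algebra V) a t \<otimes>\<^bsub>End_algebra V\<^esub> eval_at (End_algebra V) b t) e
    = (\<Oplus>\<^bsub>V\<^esub>p\<in>S. \<Oplus>\<^bsub>V\<^esub>q\<in>S. (chi p t * chi q t) \<odot>\<^bsub>V\<^esub> a p (b q e))"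
proof -
  interpret complex_space V by (rule complex_space.intro) (rule V)
  interpret V: Module.module class_ring V by (rule V)
  have ac: "a p \<in> carrier EV" and bc: "b p \<in> carrier EV" if "p \<in> S" for p using that S(2) a(1) b(1) by auto
  have be: "(\<lambda>q. chi q t \<odot>\<^bsub>V\<^esub> b q e) \<in> S \<rightarrow> carrier V"
    by (intro Pi_I smult_simps(1) End_closed[OF bc e])
  have ev: "eval_at EV b t e = (\<Oplus>\<^bsub>V\<^esub>q\<in>S. chi q t \<odot>\<^bsub>V\<^esub> b q e)"
    by (rule eval_at_apply(2)[OF V S b e])
  have beval: "eval_at EV b t e \<in> carrier V"
    using End_closed[OF eval_at_apply(1)[OF V S b] e] .
  have "(eval_at EV a t \<otimes>\<^bsub>EV\<^esub> eval_at EV b t) e = (\<Oplus>\<^bsub>V\<^esub>p\<in>S. chi p t \<odot>\<^bsub>V\<^esub> a p (eval_at EV b t e))"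
    using e beval by (simp add: End_apply eval_at_apply(2)[OF V S a])
  also have "\<dots> = (\<Oplus>\<^bsub>V\<^esub>p\<in>S. \<Oplus>\<^bsub>V\<^esub>q\<in>S. (chi p t * chi q t) \<odot>\<^bsub>V\<^esub> a p (b q e))"
  proof (rule V.M.finsum_cong')
    fix p assume p: "p \<in> S"
    have "a p (eval_at EV b t e) = (\<Oplus>\<^bsub>V\<^esub>q\<in>S. a p (chi q t \<odot>\<^bsub>V\<^esub> b q e))"
      unfolding ev by (rule End_apply_finsum[OF ac[OF p] S(1) be])
    then have "chi p t \<odot>\<^bsub>V\<^esub> a p (eval_at EV b t e) = (\<Oplus>\<^bsub>V\<^esub>q\<in>S. chi p t \<odot>\<^bsub>V\<^esub> a p (chi q t \<odot>\<^bsub>V\<^esub> b q e))"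
      using be End_closed[OF ac[OF p]] by (simp add: smult_finsum Pi_iff)
    also have "\<dots> = (\<Oplus>\<^bsub>V\<^esub>q\<in>S. (chi p t * chi q t) \<odot>\<^bsub>V\<^esub> a p (b q e))"
      by (rule V.M.finsum_cong')
         (use ac[OF p] bc e in \<open>auto simp: End_smult End_closed smult_simps\<close>)
    finally show "chi p t \<odot>\<^bsub>V\<^esub> a p (eval_at EV b t e)
        = (\<Oplus>\<^bsub>V\<^esub>q\<in>S. (chi p t * chi q t) \<odot>\<^bsub>V\<^esub> a p (b q e))" .
  qed (auto intro!: V.M.finsum_closed smult_simps(1) End_closed[OF ac End_closed[OF bc e]])
  finally show ?thesis .
qed

lemma linear_to_tensor_N_in_End:
  assumes V: "Module.module class_ring V" and \<psi>: "linear_to_tensor_N V \<psi>" and s: "s \<in> carrier_vec n"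
  shows "(\<lambda>e\<in>carrier V. contract_N V s (\<psi> e)) \<in> carrier (End_algebra V)"
proof -
  interpret complex_space V by (rule complex_space.intro) (rule V)
  interpret V: Module.module class_ring V by (rule V)
  have c: "\<psi> e i \<in> carrier V" and add: "e' \<in> carrier V \<Longrightarrow> \<psi> (e \<oplus>\<^bsub>V\<^esub> e') i = \<psi> e i \<oplus>\<^bsub>V\<^esub> \<psi> e' i"
    and sm: "\<psi> (c \<odot>\<^bsub>V\<^esub> e) i = c \<odot>\<^bsub>V\<^esub> \<psi> e i" if "e \<in> carrier V" "i < n" for e e' i c
    using \<psi> that unfolding linear_to_tensor_N_def LinearCombinations.module_hom_def by auto
  show ?thesis unfolding contract_N_def
  proof (rule End_memI)
    fix e assume e: "e \<in> carrier V"
    have f: "(\<lambda>i. complex_of_int (s $ i) \<odot>\<^bsub>V\<^esub> \<psi> e i) \<in> {..<n} \<rightarrow> carrier V"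
      if "e \<in> carrier V" for e using that c smult_simps(1) by auto
    show "(\<Oplus>\<^bsub>V\<^esub>i\<in>{..<n}. complex_of_int (s $ i) \<odot>\<^bsub>V\<^esub> \<psi> e i) \<in> carrier V"
      by (rule V.M.finsum_closed[OF f[OF e]])
    show "(\<Oplus>\<^bsub>V\<^esub>i\<in>{..<n}. complex_of_int (s $ i) \<odot>\<^bsub>V\<^esub> \<psi> (k \<odot>\<^bsub>V\<^esub> e) i)
      = k \<odot>\<^bsub>V\<^esub> (\<Oplus>\<^bsub>V\<^esub>i\<in>{..<n}. complex_of_int (s $ i) \<odot>\<^bsub>V\<^esub> \<psi> e i)" for k
      unfolding smult_finsum[OF f[OF e]]
      by (rule V.M.finsum_cong') (use c e in \<open>auto simp: sm smult_simps mult.commute\<close>)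
    fix e' assume e': "e' \<in> carrier V"
    show "(\<Oplus>\<^bsub>V\<^esub>i\<in>{..<n}. complex_of_int (s $ i) \<odot>\<^bsub>V\<^esub> \<psi> (e \<oplus>\<^bsub>V\<^esub> e') i)
      = (\<Oplus>\<^bsub>V\<^esub>i\<in>{..<n}. complex_of_int (s $ i) \<odot>\<^bsub>V\<^esub> \<psi> e i) \<oplus>\<^bsub>V\<^esub>
        (\<Oplus>\<^bsub>V\<^esub>i\<in>{..<n}. complex_of_int (s $ i) \<odot>\<^bsub>V\<^esub> \<psi> e' i)"
      unfolding V.M.finsum_addf[OF f[OF e] f[OF e'], symmetric]
      by (rule V.M.finsum_cong') (use c e e' in \<open>auto simp: add smult_simps\<close>)
  qed
qed

end


section \<open>Dual sheaves and logarithmic differentials\<close>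

context toric_variety
begin

lemma linear_form_iff:
  "linear_form G W g \<longleftrightarrow> (\<forall>a\<in>carrier (sec G W). regular W (g a)) \<and>
    (\<forall>a\<in>carrier (sec G W). \<forall>b\<in>carrier (sec G W). g (a \<oplus>\<^bsub>sec G W\<^esub> b) = (\<lambda>x. g a x + g b x)) \<and>
    (\<forall>f. \<forall>a\<in>carrier (sec G W). regular W f \<longrightarrow> g (f \<odot>\<^bsub>sec G W\<^esub> a) = (\<lambda>x. f x * g a x))"
  unfolding linear_form_def LinearCombinations.module_hom_def by auto

lemma linear_formD:
  assumes "linear_form G W g" "a \<in> carrier (sec G W)"
  shows "regular W (g a)"
    "b \<in> carrier (sec G W) \<Longrightarrow> g (a \<oplus>\<^bsub>sec G W\<^esub> b) = (\<lambda>x. g a x + g b x)"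
    "regular W f \<Longrightarrow> g (f \<odot>\<^bsub>sec G W\<^esub> a) = (\<lambda>x. f x * g a x)"
  using assms unfolding linear_form_iff by blast+

lemma linear_formI:
  assumes "\<And>a. a \<in> carrier (sec G W) \<Longrightarrow> regular W (g a)"
    "\<And>a b. a \<in> carrier (sec G W) \<Longrightarrow> b \<in> carrier (sec G W) \<Longrightarrow> g (a \<oplus>\<^bsub>sec G W\<^esub> b) = (\<lambda>x. g a x + g b x)"
    "\<And>f a. a \<in> carrier (sec G W) \<Longrightarrow> regular W f \<Longrightarrow> g (f \<odot>\<^bsub>sec G W\<^esub> a) = (\<lambda>x. f x * g a x)"
  shows "linear_form G W g"
  unfolding linear_form_iff using assms by blast

lemma fam_sheaf_carrier:
  "\<gamma> \<in> carrier (sec (fam_sheaf D \<rho> P) U) \<longleftrightarrow>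
    \<gamma> \<in> (\<Pi>\<^sub>E W\<in>opens U. D W \<rightarrow>\<^sub>E {f. regular W f}) \<and>
    (\<forall>W\<in>opens U. P W (\<gamma> W) \<and> (\<forall>V\<in>opens W. \<forall>a\<in>D W. \<gamma> V (\<rho> W V a) = on_set V (\<gamma> W a)))"
  by (simp add: fam_sheaf_def)

lemma fam_sheafI:
  assumes "\<And>W a. W \<in> opens U \<Longrightarrow> a \<in> D W \<Longrightarrow> regular W (g W a)"
    "\<And>W. W \<in> opens U \<Longrightarrow> P W (\<lambda>a\<in>D W. g W a)"
    "\<And>W V a. W \<in> opens U \<Longrightarrow> V \<in> opens W \<Longrightarrow> a \<in> D W \<Longrightarrow> \<rho> W V a \<in> D V \<and> g V (\<rho> W V a) = on_set V (g W a)"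
  shows "(\<lambda>W\<in>opens U. \<lambda>a\<in>D W. g W a) \<in> carrier (sec (fam_sheaf D \<rho> P) U)"
  unfolding fam_sheaf_carrier using assms by (auto dest: opens_trans)

lemma fam_sheafD:
  assumes "\<gamma> \<in> carrier (sec (fam_sheaf D \<rho> P) U)" "W \<in> opens U"
  shows "a \<in> D W \<Longrightarrow> regular W (\<gamma> W a)" "P W (\<gamma> W)"
    "V \<in> opens W \<Longrightarrow> a \<in> D W \<Longrightarrow> \<gamma> V (\<rho> W V a) = on_set V (\<gamma> W a)"
  using assms unfolding fam_sheaf_carrier by (auto dest!: PiE_mem)

lemma fam_sheaf_eqI:
  assumes "\<gamma> \<in> carrier (sec (fam_sheaf D \<rho> P) U)" "\<delta> \<in> carrier (sec (fam_sheaf D \<rho> P) U)"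
    "\<And>W a. W \<in> opens U \<Longrightarrow> a \<in> D W \<Longrightarrow> \<gamma> W a = \<delta> W a"
  shows "\<gamma> = \<delta>"
proof (rule PiE_ext)
  show "\<gamma> \<in> (\<Pi>\<^sub>E W\<in>opens U. D W \<rightarrow>\<^sub>E {f. regular W f})" "\<delta> \<in> (\<Pi>\<^sub>E W\<in>opens U. D W \<rightarrow>\<^sub>E {f. regular W f})"
    using assms(1,2) unfolding fam_sheaf_carrier by blast+
  then show "\<gamma> W = \<delta> W" if "W \<in> opens U" for W
    using that assms(3)[OF that] by (intro PiE_ext[of "\<gamma> W" "D W" _ "\<delta> W"]) auto
qed

lemma fam_sheaf_ops:
  "\<gamma> \<oplus>\<^bsub>sec (fam_sheaf D \<rho> P) U\<^esub> \<delta> = (\<lambda>W\<in>opens U. \<lambda>a\<in>D W. \<lambda>x. \<gamma> W a x + \<delta> W a x)"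
  "f \<odot>\<^bsub>sec (fam_sheaf D \<rho> P) U\<^esub> \<gamma> = (\<lambda>W\<in>opens U. \<lambda>a\<in>D W. \<lambda>x. on_set W f x * \<gamma> W a x)"
  "\<zero>\<^bsub>sec (fam_sheaf D \<rho> P) U\<^esub> = (\<lambda>W\<in>opens U. \<lambda>a\<in>D W. \<lambda>_. 0)"
  "res (fam_sheaf D \<rho> P) U V = (\<lambda>\<gamma>. restrict \<gamma> (opens V))"
  by (simp_all add: fam_sheaf_def)

lemma fam_sheaf_restrict:
  assumes "\<gamma> \<in> carrier (sec (fam_sheaf D \<rho> P) U)" "V \<in> opens U"
  shows "restrict \<gamma> (opens V) \<in> carrier (sec (fam_sheaf D \<rho> P) V)"
  using assms unfolding fam_sheaf_carrier by (auto dest: opens_trans)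

text \<open>The condition on \<open>P\<close> is about the restricted function because sections of these sheaves are extensional.\<close>

lemma fam_sheaf_add_closed:
  assumes U: "U \<in> opens (torus n)"
    and \<gamma>: "\<gamma> \<in> carrier (sec (fam_sheaf D \<rho> P) U)" and \<delta>: "\<delta> \<in> carrier (sec (fam_sheaf D \<rho> P) U)"
    and P: "\<And>W. W \<in> opens U \<Longrightarrow> P W (\<lambda>a\<in>D W. \<lambda>x. \<gamma> W a x + \<delta> W a x)"
    and D: "\<And>W V a. V \<in> opens W \<Longrightarrow> W \<in> opens U \<Longrightarrow> a \<in> D W \<Longrightarrow> \<rho> W V a \<in> D V"
  shows "\<gamma> \<oplus>\<^bsub>sec (fam_sheaf D \<rho> P) U\<^esub> \<delta> \<in> carrier (sec (fam_sheaf D \<rho> P) U)"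
  unfolding fam_sheaf_ops
proof (rule fam_sheafI)
  fix W a assume W: "W \<in> opens U" and a: "a \<in> D W"
  show "regular W (\<lambda>x. \<gamma> W a x + \<delta> W a x)"
    by (rule regular_torus_add[OF opens_trans[OF W U] fam_sheafD(1)[OF \<gamma> W a] fam_sheafD(1)[OF \<delta> W a]])
  fix V assume V: "V \<in> opens W"
  show "\<rho> W V a \<in> D V \<and> (\<lambda>x. \<gamma> V (\<rho> W V a) x + \<delta> V (\<rho> W V a) x) = on_set V (\<lambda>x. \<gamma> W a x + \<delta> W a x)"
    using D[OF V W a] fam_sheafD(3)[OF \<gamma> W V a] fam_sheafD(3)[OF \<delta> W V a] by (auto simp: on_set_def)
qed (rule P)

lemma fam_sheaf_smult_closed:
  assumes U: "U \<in> opens (torus n)" and f: "regular U f"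
    and \<gamma>: "\<gamma> \<in> carrier (sec (fam_sheaf D \<rho> P) U)"
    and P: "\<And>W. W \<in> opens U \<Longrightarrow> P W (\<lambda>a\<in>D W. \<lambda>x. on_set W f x * \<gamma> W a x)"
    and D: "\<And>W V a. V \<in> opens W \<Longrightarrow> W \<in> opens U \<Longrightarrow> a \<in> D W \<Longrightarrow> \<rho> W V a \<in> D V"
  shows "f \<odot>\<^bsub>sec (fam_sheaf D \<rho> P) U\<^esub> \<gamma> \<in> carrier (sec (fam_sheaf D \<rho> P) U)"
  unfolding fam_sheaf_ops
proof (rule fam_sheafI)
  fix W a assume W: "W \<in> opens U" and a: "a \<in> D W"
  show "regular W (\<lambda>x. on_set W f x * \<gamma> W a x)"
    by (rule regular_torus_mult[OF opens_trans[OF W U] regular_restrict[OF f W] fam_sheafD(1)[OF \<gamma> W a]])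
  fix V assume V: "V \<in> opens W"
  then have "V \<subseteq> W" by (simp add: opens_def)
  then show "\<rho> W V a \<in> D V \<and> (\<lambda>x. on_set V f x * \<gamma> V (\<rho> W V a) x) = on_set V (\<lambda>x. on_set W f x * \<gamma> W a x)"
    using D[OF V W a] fam_sheafD(3)[OF \<gamma> W V a] by (auto simp: on_set_def fun_eq_iff)
qed (rule P)

subsection \<open>Duals\<close>

text \<open>The carriers are closed under restriction and under the two operations: what a presheaf must satisfy over
  the opens of the torus so that its dual has well-defined operations.\<close>

definition closed_presheaf :: "'t presheaf \<Rightarrow> bool" where
  "closed_presheaf G \<longleftrightarrow> (\<forall>W\<in>opens (torus n).
     (\<forall>a\<in>carrier (sec G W). (\<forall>V\<in>opens W. res G W V a \<in> carrier (sec G V)) \<and>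
       (\<forall>b\<in>carrier (sec G W). a \<oplus>\<^bsub>sec G W\<^esub> b \<in> carrier (sec G W)) \<and>
       (\<forall>f. regular W f \<longrightarrow> f \<odot>\<^bsub>sec G W\<^esub> a \<in> carrier (sec G W))))"

lemma closed_presheafD:
  assumes "closed_presheaf G" "W \<in> opens (torus n)" "a \<in> carrier (sec G W)"
  shows "V \<in> opens W \<Longrightarrow> res G W V a \<in> carrier (sec G V)"
    "b \<in> carrier (sec G W) \<Longrightarrow> a \<oplus>\<^bsub>sec G W\<^esub> b \<in> carrier (sec G W)"
    "regular W f \<Longrightarrow> f \<odot>\<^bsub>sec G W\<^esub> a \<in> carrier (sec G W)"
  using assms unfolding closed_presheaf_def by blast+

lemma linear_form_restrict:
  assumes "closed_presheaf G" "W \<in> opens (torus n)" "linear_form G W g"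
  shows "linear_form G W (\<lambda>a\<in>carrier (sec G W). g a)"
  using linear_formD[OF assms(3)] closed_presheafD(2,3)[OF assms(1,2)]
  by (intro linear_formI) simp_all

lemma linear_form_add:
  assumes "W \<in> opens (torus n)" "linear_form G W g" "linear_form G W h"
  shows "linear_form G W (\<lambda>a x. g a x + h a x)"
  using linear_formD[OF assms(2)] linear_formD[OF assms(3)] regular_torus_add[OF assms(1)]
  by (intro linear_formI) (simp_all add: algebra_simps)

lemma linear_form_smult:
  assumes "W \<in> opens (torus n)" "linear_form G W g" "regular W f"
  shows "linear_form G W (\<lambda>a x. f x * g a x)"
proof (rule linear_formI)
  fix a assume a: "a \<in> carrier (sec G W)"
  show "regular W (\<lambda>x. f x * g a x)"
    by (rule regular_torus_mult[OF assms(1,3) linear_formD(1)[OF assms(2) a]])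
  show "(\<lambda>x. f x * g (a \<oplus>\<^bsub>sec G W\<^esub> b) x) = (\<lambda>x. f x * g a x + f x * g b x)"
    if "b \<in> carrier (sec G W)" for b
    using linear_formD(2)[OF assms(2) a that] by (simp add: algebra_simps)
  show "(\<lambda>x. f x * g (h \<odot>\<^bsub>sec G W\<^esub> a) x) = (\<lambda>x. h x * (f x * g a x))" if "regular W h" for h
    using linear_formD(3)[OF assms(2) a that] by (simp add: algebra_simps)
qed

lemma dual_sheaf_closed:
  assumes G: "closed_presheaf G" shows "closed_presheaf (dual_sheaf G)"
  unfolding closed_presheaf_def
proof (intro ballI conjI allI impI)
  fix W \<gamma> assume W: "W \<in> opens (torus n)" and \<gamma>: "\<gamma> \<in> carrier (sec (dual_sheaf G) W)"
  have lf: "linear_form G W' (\<gamma> W')" if "W' \<in> opens W" "\<gamma> \<in> carrier (sec (dual_sheaf G) W)" for W' \<gamma>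
    using fam_sheafD(2)[OF that(2)[unfolded dual_sheaf_def] that(1)] .
  show "res (dual_sheaf G) W V \<gamma> \<in> carrier (sec (dual_sheaf G) V)" if "V \<in> opens W" for V
    using fam_sheaf_restrict[OF \<gamma>[unfolded dual_sheaf_def] that] by (simp add: dual_sheaf_def fam_sheaf_ops)
  show "\<gamma> \<oplus>\<^bsub>sec (dual_sheaf G) W\<^esub> \<delta> \<in> carrier (sec (dual_sheaf G) W)"
    if \<delta>: "\<delta> \<in> carrier (sec (dual_sheaf G) W)" for \<delta>
    unfolding dual_sheaf_def
  proof (rule fam_sheaf_add_closed[OF W])
    show "linear_form G W' (\<lambda>a\<in>carrier (sec G W'). \<lambda>x. \<gamma> W' a x + \<delta> W' a x)" if "W' \<in> opens W" for W'
      using linear_form_restrict[OF G opens_trans[OF that W]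
          linear_form_add[OF opens_trans[OF that W] lf[OF that \<gamma>] lf[OF that \<delta>]]] .
  qed (use \<gamma> \<delta> closed_presheafD(1)[OF G] opens_trans[OF _ W] in \<open>auto simp: dual_sheaf_def\<close>)
  show "f \<odot>\<^bsub>sec (dual_sheaf G) W\<^esub> \<gamma> \<in> carrier (sec (dual_sheaf G) W)" if f: "regular W f" for f
    unfolding dual_sheaf_def
  proof (rule fam_sheaf_smult_closed[OF W f])
    show "linear_form G W' (\<lambda>a\<in>carrier (sec G W'). \<lambda>x. on_set W' f x * \<gamma> W' a x)" if "W' \<in> opens W" for W'
      using linear_form_restrict[OF G opens_trans[OF that W]
          linear_form_smult[OF opens_trans[OF that W] lf[OF that \<gamma>] regular_restrict[OF f that]]] .
  qed (use \<gamma> closed_presheafD(1)[OF G] opens_trans[OF _ W] in \<open>auto simp: dual_sheaf_def\<close>)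
qed

lemma dual_sheafD:
  assumes "\<gamma> \<in> carrier (sec (dual_sheaf G) U)" "W \<in> opens U"
  shows "linear_form G W (\<gamma> W)" "a \<in> carrier (sec G W) \<Longrightarrow> regular W (\<gamma> W a)"
    "V \<in> opens W \<Longrightarrow> a \<in> carrier (sec G W) \<Longrightarrow> \<gamma> V (res G W V a) = on_set V (\<gamma> W a)"
  using fam_sheafD[OF assms(1)[unfolded dual_sheaf_def] assms(2)] by blast+

lemma dual_sheaf_apply:
  assumes "W \<in> opens U" "a \<in> carrier (sec G W)"
  shows "(\<gamma> \<oplus>\<^bsub>sec (dual_sheaf G) U\<^esub> \<delta>) W a = (\<lambda>x. \<gamma> W a x + \<delta> W a x)"
    "(f \<odot>\<^bsub>sec (dual_sheaf G) U\<^esub> \<gamma>) W a = (\<lambda>x. on_set W f x * \<gamma> W a x)"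
    "\<zero>\<^bsub>sec (dual_sheaf G) U\<^esub> W a = (\<lambda>x. 0)"
  using assms by (simp_all add: dual_sheaf_def fam_sheaf_ops)

lemma dual_sheaf_abelian_monoid:
  assumes G: "closed_presheaf G" and U: "U \<in> opens (torus n)"
  shows "abelian_monoid (sec (dual_sheaf G) U)"
proof (rule abelian_monoidI)
  note closed = closed_presheafD(2)[OF dual_sheaf_closed[OF G] U]
  have zero: "\<zero>\<^bsub>sec (dual_sheaf G) U\<^esub> \<in> carrier (sec (dual_sheaf G) U)"
  proof -
    have "(\<lambda>W\<in>opens U. \<lambda>a\<in>carrier (sec G W). \<lambda>_. 0) \<in> carrier (sec (dual_sheaf G) U)"
      unfolding dual_sheaf_def
    proof (rule fam_sheafI)
      fix W assume W: "W \<in> opens U"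
      have WT: "W \<in> opens (torus n)" using opens_trans[OF W U] .
      have z: "regular W (\<lambda>_. 0)"
        using regular_torus_const[OF WT, of 0] by (simp add: const_def on_set_def)
      show "regular W ((\<lambda>W a _. 0) W a)" for a using z by simp
      have "linear_form G W (\<lambda>a _. 0)" using z by (intro linear_formI) auto
      then show "linear_form G W (\<lambda>a\<in>carrier (sec G W). (\<lambda>W a _. 0) W a)"
        using linear_form_restrict[OF G WT] by simp
      fix V a assume V: "V \<in> opens W" and a: "a \<in> carrier (sec G W)"
      show "res G W V a \<in> carrier (sec G V) \<and> (\<lambda>W a _. 0) V (res G W V a) = on_set V ((\<lambda>W a _. 0) W a)"
        using closed_presheafD(1)[OF G WT a V] by (simp add: on_set_def)
    qed
    then show ?thesis by (simp add: dual_sheaf_def fam_sheaf_ops)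
  qed
  show "\<zero>\<^bsub>sec (dual_sheaf G) U\<^esub> \<in> carrier (sec (dual_sheaf G) U)" by (rule zero)
  have eqI: "\<gamma> = \<delta>" if "\<gamma> \<in> carrier (sec (dual_sheaf G) U)" "\<delta> \<in> carrier (sec (dual_sheaf G) U)"
    "\<And>W a. W \<in> opens U \<Longrightarrow> a \<in> carrier (sec G W) \<Longrightarrow> \<gamma> W a = \<delta> W a" for \<gamma> \<delta>
    using fam_sheaf_eqI[OF that(1,2)[unfolded dual_sheaf_def]] that(3) by blast
  fix \<gamma> \<delta> \<epsilon> assume g: "\<gamma> \<in> carrier (sec (dual_sheaf G) U)" and d: "\<delta> \<in> carrier (sec (dual_sheaf G) U)"
    and e: "\<epsilon> \<in> carrier (sec (dual_sheaf G) U)"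
  show "\<gamma> \<oplus>\<^bsub>sec (dual_sheaf G) U\<^esub> \<delta> \<in> carrier (sec (dual_sheaf G) U)" using closed[OF g d] .
  show "(\<gamma> \<oplus>\<^bsub>sec (dual_sheaf G) U\<^esub> \<delta>) \<oplus>\<^bsub>sec (dual_sheaf G) U\<^esub> \<epsilon>
      = \<gamma> \<oplus>\<^bsub>sec (dual_sheaf G) U\<^esub> (\<delta> \<oplus>\<^bsub>sec (dual_sheaf G) U\<^esub> \<epsilon>)"
    by (rule eqI[OF closed[OF closed[OF g d] e] closed[OF g closed[OF d e]]])
       (simp add: dual_sheaf_apply add.assoc)
  show "\<zero>\<^bsub>sec (dual_sheaf G) U\<^esub> \<oplus>\<^bsub>sec (dual_sheaf G) U\<^esub> \<gamma> = \<gamma>"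
    by (rule eqI[OF closed[OF zero g] g]) (simp add: dual_sheaf_apply)
  show "\<gamma> \<oplus>\<^bsub>sec (dual_sheaf G) U\<^esub> \<delta> = \<delta> \<oplus>\<^bsub>sec (dual_sheaf G) U\<^esub> \<gamma>"
    by (rule eqI[OF closed[OF g d] closed[OF d g]]) (simp add: dual_sheaf_apply add.commute)
qed

lemma finsum_hom_complex:
  assumes "abelian_monoid G" "finite A" "f \<in> A \<rightarrow> carrier G" "h \<zero>\<^bsub>G\<^esub> = (0 :: complex)"
    "\<And>x y. x \<in> carrier G \<Longrightarrow> y \<in> carrier G \<Longrightarrow> h (x \<oplus>\<^bsub>G\<^esub> y) = h x + h y"
  shows "h (\<Oplus>\<^bsub>G\<^esub>a\<in>A. f a) = (\<Sum>a\<in>A. h (f a))"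
proof -
  have C: "abelian_monoid (class_ring :: complex ring)"
    by (rule abelian_group.axioms(1)[OF ring.is_abelian_group[OF cring.axioms(1)[OF class_cring.cring_axioms]]])
  have "h (\<Oplus>\<^bsub>G\<^esub>a\<in>A. f a) = (\<Oplus>\<^bsub>class_ring\<^esub>a\<in>A. h (f a))"
    using assms by (intro finsum_hom C) auto
  then show ?thesis by (simp add: class_ring_simps)
qed

text \<open>Sums in the dual sheaf are evaluated pointwise, which turns the defining equation of the homogeneous
  components into equations between complex numbers.\<close>

lemma dual_sheaf_finsum:
  assumes "closed_presheaf G" "U \<in> opens (torus n)" "finite A"
    "f \<in> A \<rightarrow> carrier (sec (dual_sheaf G) U)" "W \<in> opens U" "a \<in> carrier (sec G W)"
  shows "(\<Oplus>\<^bsub>sec (dual_sheaf G) U\<^esub>i\<in>A. f i) W a x = (\<Sum>i\<in>A. f i W a x)"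
  by (rule finsum_hom_complex[OF dual_sheaf_abelian_monoid[OF assms(1,2)] assms(3,4), of "\<lambda>\<gamma>. \<gamma> W a x"])
     (simp_all add: dual_sheaf_apply[OF assms(5,6)])

subsection \<open>Vector fields and logarithmic differentials\<close>

lemma tangent_sheaf_closed: "closed_presheaf tangent_sheaf"
  unfolding closed_presheaf_def
proof (intro ballI conjI allI impI)
  fix W v assume W: "W \<in> opens (torus n)" and v: "v \<in> carrier (sec tangent_sheaf W)"
  have restr: "on_set V a \<in> carrier (reg_ring V)" if "V \<in> opens W'" "a \<in> carrier (reg_ring W')" for V W' a
    using regular_restrict that by simp
  have der: "derivation W' (v W')" if "W' \<in> opens W" "v \<in> carrier (sec tangent_sheaf W)" for W' v
    using fam_sheafD(2)[OF that(2)[unfolded tangent_sheaf_def] that(1)] .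
  show "res tangent_sheaf W V v \<in> carrier (sec tangent_sheaf V)" if "V \<in> opens W" for V
    using fam_sheaf_restrict[OF v[unfolded tangent_sheaf_def] that] by (simp add: tangent_sheaf_def fam_sheaf_ops)
  show "v \<oplus>\<^bsub>sec tangent_sheaf W\<^esub> w \<in> carrier (sec tangent_sheaf W)"
    if w: "w \<in> carrier (sec tangent_sheaf W)" for w
    unfolding tangent_sheaf_def
  proof (rule fam_sheaf_add_closed[OF W v[unfolded tangent_sheaf_def] w[unfolded tangent_sheaf_def] _ restr])
    fix W' assume W': "W' \<in> opens W"
    have T: "W' \<in> opens (torus n)" using opens_trans[OF W' W] .
    show "derivation W' (\<lambda>a\<in>carrier (reg_ring W'). \<lambda>x. v W' a x + w W' a x)"
      using der[OF W' v] der[OF W' w] regular_torus_add[OF T] regular_torus_mult[OF T] regular_torus_const[OF T]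
      unfolding derivation_def by (simp add: algebra_simps)
  qed
  show "f \<odot>\<^bsub>sec tangent_sheaf W\<^esub> v \<in> carrier (sec tangent_sheaf W)" if f: "regular W f" for f
    unfolding tangent_sheaf_def
  proof (rule fam_sheaf_smult_closed[OF W f v[unfolded tangent_sheaf_def] _ restr])
    fix W' assume W': "W' \<in> opens W"
    have T: "W' \<in> opens (torus n)" using opens_trans[OF W' W] .
    show "derivation W' (\<lambda>a\<in>carrier (reg_ring W'). \<lambda>x. on_set W' f x * v W' a x)"
      using der[OF W' v] regular_torus_add[OF T] regular_torus_mult[OF T] regular_torus_const[OF T]
      unfolding derivation_def by (simp add: algebra_simps)
  qed
qed

text \<open>The contraction of \<open>v\<close> with \<open>dlog \<chi>\<^sup>s\<close>. Over the torus \<open>\<chi>\<^sup>s\<close> is a unit with inverse \<open>\<chi>\<^sup>-\<^sup>s\<close>.\<close>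

definition dlog :: "int vec \<Rightarrow> point set \<Rightarrow> vfield \<Rightarrow> reg" where
  "dlog s W v = (\<lambda>x. on_set W (chi (- s)) x * v W (on_set W (chi s)) x)"

lemma dlog_linear:
  assumes W: "W \<in> opens (torus n)" and s: "s \<in> carrier_vec n"
  shows "linear_form tangent_sheaf W (dlog s W)"
proof (rule linear_formI)
  have zW: "W \<in> opens W" using opens_self[OF opens_torusD(1)[OF W]] .
  have r: "regular W (on_set W (chi s))" "regular W (on_set W (chi (- s)))"
    using regular_chi[OF W] s by auto
  fix v assume v: "v \<in> carrier (sec tangent_sheaf W)"
  show "regular W (dlog s W v)"
    unfolding dlog_def using fam_sheafD(1)[OF v[unfolded tangent_sheaf_def] zW] r
    by (intro regular_torus_mult[OF W]) auto
  show "dlog s W (v \<oplus>\<^bsub>sec tangent_sheaf W\<^esub> w) = (\<lambda>x. dlog s W v x + dlog s W w x)" for w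
    using zW r by (simp add: dlog_def tangent_sheaf_def fam_sheaf_ops algebra_simps)
  show "dlog s W (f \<odot>\<^bsub>sec tangent_sheaf W\<^esub> v) = (\<lambda>x. f x * dlog s W v x)" if "regular W f" for f
    using zW r that by (simp add: dlog_def tangent_sheaf_def fam_sheaf_ops algebra_simps)
qed

lemma dlog_restrict:
  assumes W: "W \<in> opens (torus n)" and s: "s \<in> carrier_vec n" and V: "V \<in> opens W"
    and v: "v \<in> carrier (sec tangent_sheaf W)"
  shows "dlog s V (res tangent_sheaf W V v) = on_set V (dlog s W v)"
proof -
  have sub: "V \<subseteq> W" and zV: "V \<in> opens V" and zW: "W \<in> opens W" using V W by (auto simp: opens_def)
  have r: "on_set W (chi s) \<in> carrier (reg_ring W)" using regular_chi[OF W s] by simp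
  have "v V (on_set V (on_set W (chi s))) = on_set V (v W (on_set W (chi s)))"
    using fam_sheafD(3)[OF v[unfolded tangent_sheaf_def] zW V r] .
  then show ?thesis
    using zV unfolding on_set_on_set[OF sub]
    by (intro ext) (simp add: dlog_def tangent_sheaf_def fam_sheaf_ops on_set_def subsetD[OF sub])
qed

text \<open>The differentials \<open>dlog \<chi>\<^sup>s\<close> are constant on invariant fields; this is what makes them read off the
  coordinates of the homogeneous components.\<close>

lemma dlog_invariant_field:
  assumes W: "W \<in> opens (torus n)" and s: "s \<in> carrier_vec n" and i: "i < n" and x: "x \<in> W"
  shows "dlog s W (invariant_field W (unit_vec n i)) x = of_int (s $ i)"
proof -
  have xT: "x \<in> torus n" using x W by (auto simp: opens_def)
  have "chi (- s) x * chi s x = chi (- s + s) x" using s by (intro chi_add_torus[OF xT, symmetric]) auto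
  also have "- s + s = 0\<^sub>v n" using s by auto
  finally have "chi (- s) x * chi s x = 1" using xT by (simp add: torus_def)
  then show ?thesis using x by (simp add: dlog_def invariant_field_chi[OF W s i] algebra_simps)
qed

end


section \<open>The transpose of a Higgs field\<close>

context toric_variety
begin

lemma linear_form_cong:
  assumes G: "closed_presheaf G" and W: "W \<in> opens (torus n)" and g: "linear_form G W g"
    and eq: "\<And>a. a \<in> carrier (sec G W) \<Longrightarrow> h a = g a"
  shows "linear_form G W h"
  using linear_formD[OF g] closed_presheafD(2,3)[OF G W] eq
  by (intro linear_formI) simp_all

lemma bilinear_sheafD:
  assumes "\<beta> \<in> carrier (sec (bilinear_sheaf G H) U)" "W \<in> opens U"
  shows "y \<in> carrier (sec H W) \<Longrightarrow> linear_form G W (\<lambda>x. \<beta> W (x, y))"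
    "x \<in> carrier (sec G W) \<Longrightarrow> linear_form H W (\<lambda>y. \<beta> W (x, y))"
    "x \<in> carrier (sec G W) \<Longrightarrow> y \<in> carrier (sec H W) \<Longrightarrow> regular W (\<beta> W (x, y))"
    "V \<in> opens W \<Longrightarrow> x \<in> carrier (sec G W) \<Longrightarrow> y \<in> carrier (sec H W) \<Longrightarrow>
      \<beta> V (res G W V x, res H W V y) = on_set V (\<beta> W (x, y))"
  using fam_sheafD(2)[OF assms(1)[unfolded bilinear_sheaf_def] assms(2)]
    fam_sheafD(1)[OF assms(1)[unfolded bilinear_sheaf_def] assms(2), of "(x, y)"]
    fam_sheafD(3)[OF assms(1)[unfolded bilinear_sheaf_def] assms(2), of V "(x, y)"]
  by auto

lemma bilinear_sheaf_closed:
  assumes G: "closed_presheaf G" and H: "closed_presheaf H"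
  shows "closed_presheaf (bilinear_sheaf G H)"
  unfolding closed_presheaf_def
proof (intro ballI conjI allI impI)
  fix W \<beta> assume W: "W \<in> opens (torus n)" and \<beta>: "\<beta> \<in> carrier (sec (bilinear_sheaf G H) W)"
  note cG = closed_presheafD[OF G] and cH = closed_presheafD[OF H]
  have restr: "map_prod (res G W' V) (res H W' V) a \<in> carrier (sec G V) \<times> carrier (sec H V)"
    if "V \<in> opens W'" "W' \<in> opens W" "a \<in> carrier (sec G W') \<times> carrier (sec H W')" for V W' a
    using that cG(1)[OF opens_trans[OF that(2) W]] cH(1)[OF opens_trans[OF that(2) W]] by auto
  show "res (bilinear_sheaf G H) W V \<beta> \<in> carrier (sec (bilinear_sheaf G H) V)" if "V \<in> opens W" for V
    using fam_sheaf_restrict[OF \<beta>[unfolded bilinear_sheaf_def] that] by (simp add: bilinear_sheaf_def fam_sheaf_ops)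
  show "\<beta> \<oplus>\<^bsub>sec (bilinear_sheaf G H) W\<^esub> \<delta> \<in> carrier (sec (bilinear_sheaf G H) W)"
    if \<delta>: "\<delta> \<in> carrier (sec (bilinear_sheaf G H) W)" for \<delta>
    unfolding bilinear_sheaf_def
  proof (rule fam_sheaf_add_closed[OF W \<beta>[unfolded bilinear_sheaf_def] \<delta>[unfolded bilinear_sheaf_def] _ restr],
      intro conjI ballI)
    fix W' assume W': "W' \<in> opens W"
    have T: "W' \<in> opens (torus n)" using opens_trans[OF W' W] .
    let ?b = "\<lambda>a\<in>carrier (sec G W') \<times> carrier (sec H W'). \<lambda>p. \<beta> W' a p + \<delta> W' a p"
    show "linear_form G W' (\<lambda>x. ?b (x, y))" if y: "y \<in> carrier (sec H W')" for y
      by (rule linear_form_cong[OF G T linear_form_add[OF T bilinear_sheafD(1)[OF \<beta> W' y] bilinear_sheafD(1)[OF \<delta> W' y]]])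
         (use y in simp)
    show "linear_form H W' (\<lambda>y. ?b (x, y))" if x: "x \<in> carrier (sec G W')" for x
      by (rule linear_form_cong[OF H T linear_form_add[OF T bilinear_sheafD(2)[OF \<beta> W' x] bilinear_sheafD(2)[OF \<delta> W' x]]])
         (use x in simp)
  qed
  show "f \<odot>\<^bsub>sec (bilinear_sheaf G H) W\<^esub> \<beta> \<in> carrier (sec (bilinear_sheaf G H) W)"
    if f: "regular W f" for f
    unfolding bilinear_sheaf_def
  proof (rule fam_sheaf_smult_closed[OF W f \<beta>[unfolded bilinear_sheaf_def] _ restr], intro conjI ballI)
    fix W' assume W': "W' \<in> opens W"
    have T: "W' \<in> opens (torus n)" using opens_trans[OF W' W] .
    let ?b = "\<lambda>a\<in>carrier (sec G W') \<times> carrier (sec H W'). \<lambda>p. on_set W' f p * \<beta> W' a p"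
    show "linear_form G W' (\<lambda>x. ?b (x, y))" if y: "y \<in> carrier (sec H W')" for y
      by (rule linear_form_cong[OF G T linear_form_smult[OF T bilinear_sheafD(1)[OF \<beta> W' y] regular_restrict[OF f W']]])
         (use y in simp)
    show "linear_form H W' (\<lambda>y. ?b (x, y))" if x: "x \<in> carrier (sec G W')" for x
      by (rule linear_form_cong[OF H T linear_form_smult[OF T bilinear_sheafD(2)[OF \<beta> W' x] regular_restrict[OF f W']]])
         (use x in simp)
  qed
qed

lemma tangent_res_res: "W \<in> opens V \<Longrightarrow> res tangent_sheaf V W (res tangent_sheaf U V v) = res tangent_sheaf U W v"
  by (auto simp: tangent_sheaf_def fam_sheaf_ops restrict_def fun_eq_iff dest: opens_trans)

end

context module_sheaf
begin

lemma closed_sections: "closed_presheaf F"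
  unfolding closed_presheaf_def
proof (intro ballI conjI allI impI)
  fix W a assume W: "W \<in> opens (torus n)" and a: "a \<in> carrier (sec F W)"
  have zW: "zopen W" using W by (simp add: opens_def)
  interpret Module.module "reg_ring W" "sec F W" by (rule section_module[OF zW])
  show "res F W V a \<in> carrier (sec F V)" if "V \<in> opens W" for V using res_closed[OF that zW a] .
  show "a \<oplus>\<^bsub>sec F W\<^esub> b \<in> carrier (sec F W)" if "b \<in> carrier (sec F W)" for b using a that by simp
  show "f \<odot>\<^bsub>sec F W\<^esub> a \<in> carrier (sec F W)" if "regular W f" for f using a that by simp
qed

lemmas closed_bilinear = bilinear_sheaf_closed[OF closed_sections tangent_sheaf_closed]

lemma pure_tensor_closed:
  assumes U: "U \<in> opens (torus n)" and s: "s \<in> carrier (sec F U)" and v: "v \<in> carrier (sec tangent_sheaf U)"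
  shows "pure_tensor F tangent_sheaf U s v \<in> carrier (sec (tensor F tangent_sheaf) U)"
  unfolding pure_tensor_def tensor_def dual_sheaf_def
proof (rule fam_sheafI)
  have zU: "zopen U" using U by (simp add: opens_def)
  have sW: "res F U W s \<in> carrier (sec F W)" and vW: "res tangent_sheaf U W v \<in> carrier (sec tangent_sheaf W)"
    if "W \<in> opens U" for W
    using closed_presheafD(1)[OF closed_sections U s that] closed_presheafD(1)[OF tangent_sheaf_closed U v that] .
  fix W assume W: "W \<in> opens U"
  have T: "W \<in> opens (torus n)" using opens_trans[OF W U] .
  have WW: "W \<in> opens W" using opens_self[OF opens_torusD(1)[OF T]] .
  show r: "regular W (\<beta> W (res F U W s, res tangent_sheaf U W v))"
    if "\<beta> \<in> carrier (sec (bilinear_sheaf F tangent_sheaf) W)" for \<beta>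
    using bilinear_sheafD(3)[OF that WW sW[OF W] vW[OF W]] .
  have "linear_form (bilinear_sheaf F tangent_sheaf) W (\<lambda>\<beta>. \<beta> W (res F U W s, res tangent_sheaf U W v))"
    using r sW[OF W] vW[OF W] WW by (intro linear_formI) (auto simp: bilinear_sheaf_def fam_sheaf_ops)
  then show "linear_form (bilinear_sheaf F tangent_sheaf) W
      (\<lambda>\<beta>\<in>carrier (sec (bilinear_sheaf F tangent_sheaf) W). \<beta> W (res F U W s, res tangent_sheaf U W v))"
    by (rule linear_form_restrict[OF closed_bilinear T])
  fix V \<beta> assume V: "V \<in> opens W" and \<beta>: "\<beta> \<in> carrier (sec (bilinear_sheaf F tangent_sheaf) W)"
  have "res (bilinear_sheaf F tangent_sheaf) W V \<beta> V = \<beta> V"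
    using V by (simp add: bilinear_sheaf_def fam_sheaf_ops opens_def)
  moreover have "\<beta> V (res F U V s, res tangent_sheaf U V v)
      = on_set V (\<beta> W (res F U W s, res tangent_sheaf U W v))"
    using bilinear_sheafD(4)[OF \<beta> WW V sW[OF W] vW[OF W]]
    by (simp add: res_res[OF V W zU s] tangent_res_res[OF V])
  ultimately show "res (bilinear_sheaf F tangent_sheaf) W V \<beta> \<in> carrier (sec (bilinear_sheaf F tangent_sheaf) V) \<and>
      res (bilinear_sheaf F tangent_sheaf) W V \<beta> V (res F U V s, res tangent_sheaf U V v)
      = on_set V (\<beta> W (res F U W s, res tangent_sheaf U W v))"
    using closed_presheafD(1)[OF closed_bilinear T \<beta> V] by simp
qed

text \<open>The bilinear form \<open>\<gamma> \<otimes> dlog \<chi>\<^sup>s\<close>\<close>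

definition log_form :: "point set \<Rightarrow> 's fam \<Rightarrow> int vec \<Rightarrow> ('s \<times> vfield) fam" where
  "log_form W \<gamma> s = (\<lambda>V\<in>opens W. \<lambda>a\<in>carrier (sec F V) \<times> carrier (sec tangent_sheaf V).
     \<lambda>x. \<gamma> V (fst a) x * dlog s V (snd a) x)"

lemma log_form_bilinear:
  assumes W: "W \<in> opens (torus n)" and \<gamma>: "\<gamma> \<in> carrier (sec (dual_sheaf F) W)" and s: "s \<in> carrier_vec n"
  shows "log_form W \<gamma> s \<in> carrier (sec (bilinear_sheaf F tangent_sheaf) W)"
  unfolding log_form_def bilinear_sheaf_def
proof (rule fam_sheafI)
  fix V assume V: "V \<in> opens W"
  have T: "V \<in> opens (torus n)" using opens_trans[OF V W] .
  note \<gamma>V = dual_sheafD[OF \<gamma> V] and dV = linear_formD[OF dlog_linear[OF T s]]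
  show "regular V (\<lambda>x. \<gamma> V (fst a) x * dlog s V (snd a) x)"
    if "a \<in> carrier (sec F V) \<times> carrier (sec tangent_sheaf V)" for a
    using that by (intro regular_torus_mult[OF T] \<gamma>V(2) dV(1)) auto
  let ?b = "\<lambda>a\<in>carrier (sec F V) \<times> carrier (sec tangent_sheaf V). \<lambda>x. \<gamma> V (fst a) x * dlog s V (snd a) x"
  show "(\<forall>y\<in>carrier (sec tangent_sheaf V). linear_form F V (\<lambda>x. ?b (x, y))) \<and>
        (\<forall>x\<in>carrier (sec F V). linear_form tangent_sheaf V (\<lambda>y. ?b (x, y)))"
  proof (intro conjI ballI)
    fix y assume y: "y \<in> carrier (sec tangent_sheaf V)"
    show "linear_form F V (\<lambda>x. ?b (x, y))"
      by (rule linear_form_cong[OF closed_sections T linear_form_smult[OF T \<gamma>V(1) dV(1)[OF y]]])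
         (use y in \<open>simp add: mult.commute\<close>)
  next
    fix x assume x: "x \<in> carrier (sec F V)"
    show "linear_form tangent_sheaf V (\<lambda>y. ?b (x, y))"
      by (rule linear_form_cong[OF tangent_sheaf_closed T linear_form_smult[OF T dlog_linear[OF T s] \<gamma>V(2)[OF x]]])
         (use x in simp)
  qed
  fix V' a assume V': "V' \<in> opens V" and a: "a \<in> carrier (sec F V) \<times> carrier (sec tangent_sheaf V)"
  obtain x y where xy: "a = (x, y)" "x \<in> carrier (sec F V)" "y \<in> carrier (sec tangent_sheaf V)" using a by auto
  show "map_prod (res F V V') (res tangent_sheaf V V') a \<in> carrier (sec F V') \<times> carrier (sec tangent_sheaf V') \<and>
      (\<lambda>x. \<gamma> V' (fst (map_prod (res F V V') (res tangent_sheaf V V') a)) x *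
            dlog s V' (snd (map_prod (res F V V') (res tangent_sheaf V V') a)) x)
      = on_set V' (\<lambda>x. \<gamma> V (fst a) x * dlog s V (snd a) x)"
    using closed_presheafD(1)[OF closed_sections T xy(2) V'] closed_presheafD(1)[OF tangent_sheaf_closed T xy(3) V']
      \<gamma>V(3)[OF V' xy(2)] dlog_restrict[OF T s V' xy(3)]
    by (auto simp: xy(1) on_set_def)
qed

text \<open>The form \<open>\<gamma> \<otimes> (dlog \<chi>\<^sup>s \<and> dlog \<chi>\<^sup>s\<^sup>')\<close>\<close>

definition wedge_form :: "point set \<Rightarrow> 's fam \<Rightarrow> int vec \<Rightarrow> int vec \<Rightarrow> ('s \<times> vfield \<times> vfield) fam" where
  "wedge_form W \<gamma> s s' =
     (\<lambda>V\<in>opens W. \<lambda>a\<in>carrier (sec F V) \<times> carrier (sec tangent_sheaf V) \<times> carrier (sec tangent_sheaf V).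
        \<lambda>x. \<gamma> V (fst a) x * (dlog s V (fst (snd a)) x * dlog s' V (snd (snd a)) x
                            - dlog s' V (fst (snd a)) x * dlog s V (snd (snd a)) x))"

lemma wedge_form_alternating:
  assumes W: "W \<in> opens (torus n)" and \<gamma>: "\<gamma> \<in> carrier (sec (dual_sheaf F) W)"
    and s: "s \<in> carrier_vec n" and s': "s' \<in> carrier_vec n"
  shows "wedge_form W \<gamma> s s' \<in> carrier (sec (alternating_sheaf F tangent_sheaf) W)"
  unfolding wedge_form_def alternating_sheaf_def
proof (rule fam_sheafI)
  fix V assume V: "V \<in> opens W"
  have T: "V \<in> opens (torus n)" using opens_trans[OF V W] .
  note \<gamma>V = dual_sheafD[OF \<gamma> V]
  note d = linear_formD[OF dlog_linear[OF T s]] linear_formD[OF dlog_linear[OF T s']]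
  let ?D = "carrier (sec F V) \<times> carrier (sec tangent_sheaf V) \<times> carrier (sec tangent_sheaf V)"
  let ?w = "\<lambda>y z x. dlog s V y x * dlog s' V z x - dlog s' V y x * dlog s V z x"
  let ?b = "\<lambda>a\<in>?D. \<lambda>x. \<gamma> V (fst a) x * ?w (fst (snd a)) (snd (snd a)) x"
  have w: "regular V (?w y z)" if "y \<in> carrier (sec tangent_sheaf V)" "z \<in> carrier (sec tangent_sheaf V)" for y z
    using regular_torus_add[OF T regular_torus_mult[OF T d(1)[OF that(1)] d(4)[OF that(2)]]
        regular_scale[OF regular_torus_mult[OF T d(4)[OF that(1)] d(1)[OF that(2)]], of "-1"]] by simp
  show "regular V (\<lambda>x. \<gamma> V (fst a) x * ?w (fst (snd a)) (snd (snd a)) x)" if "a \<in> ?D" for a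
    using that by (intro regular_torus_mult[OF T] \<gamma>V(2) w) auto
  show "trilinear F tangent_sheaf tangent_sheaf V ?b \<and>
      (\<forall>x\<in>carrier (sec F V). \<forall>y\<in>carrier (sec tangent_sheaf V). ?b (x, y, y) = \<zero>\<^bsub>reg_ring V\<^esub>)"
    unfolding trilinear_def
  proof (intro conjI ballI)
    fix y z assume y: "y \<in> carrier (sec tangent_sheaf V)" and z: "z \<in> carrier (sec tangent_sheaf V)"
    show "linear_form F V (\<lambda>x. ?b (x, y, z))"
      by (rule linear_form_cong[OF closed_sections T linear_form_smult[OF T \<gamma>V(1) w[OF y z]]])
         (use y z in \<open>simp add: mult.commute\<close>)
  next
    fix x z assume x: "x \<in> carrier (sec F V)" and z: "z \<in> carrier (sec tangent_sheaf V)"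
    have "linear_form tangent_sheaf V (\<lambda>y. ?w y z)"
      by (rule linear_form_cong[OF tangent_sheaf_closed T linear_form_add[OF T
            linear_form_smult[OF T dlog_linear[OF T s] d(4)[OF z]]
            linear_form_smult[OF T dlog_linear[OF T s'] regular_scale[OF d(1)[OF z], of "-1"]]]])
         (simp add: algebra_simps)
    then show "linear_form tangent_sheaf V (\<lambda>y. ?b (x, y, z))"
      by (rule linear_form_cong[OF tangent_sheaf_closed T linear_form_smult[OF T _ \<gamma>V(2)[OF x]]])
         (use x z in simp)
  next
    fix x y assume x: "x \<in> carrier (sec F V)" and y: "y \<in> carrier (sec tangent_sheaf V)"
    have "linear_form tangent_sheaf V (\<lambda>z. ?w y z)"
      by (rule linear_form_cong[OF tangent_sheaf_closed T linear_form_add[OF T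
            linear_form_smult[OF T dlog_linear[OF T s'] d(1)[OF y]]
            linear_form_smult[OF T dlog_linear[OF T s] regular_scale[OF d(4)[OF y], of "-1"]]]])
         (simp add: algebra_simps)
    then show "linear_form tangent_sheaf V (\<lambda>z. ?b (x, y, z))"
      by (rule linear_form_cong[OF tangent_sheaf_closed T linear_form_smult[OF T _ \<gamma>V(2)[OF x]]])
         (use x y in simp)
  next
    fix x y assume "x \<in> carrier (sec F V)" "y \<in> carrier (sec tangent_sheaf V)"
    then show "?b (x, y, y) = \<zero>\<^bsub>reg_ring V\<^esub>" by simp
  qed
  fix V' a assume V': "V' \<in> opens V" and a: "a \<in> ?D"
  obtain x y z where xyz: "a = (x, y, z)" "x \<in> carrier (sec F V)" "y \<in> carrier (sec tangent_sheaf V)"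
    "z \<in> carrier (sec tangent_sheaf V)" using a by auto
  note c = closed_presheafD(1)[OF closed_sections T xyz(2) V']
    closed_presheafD(1)[OF tangent_sheaf_closed T xyz(3) V']
    closed_presheafD(1)[OF tangent_sheaf_closed T xyz(4) V']
  note eqs = \<gamma>V(3)[OF V' xyz(2)] dlog_restrict[OF T s V' xyz(3)] dlog_restrict[OF T s' V' xyz(3)]
    dlog_restrict[OF T s V' xyz(4)] dlog_restrict[OF T s' V' xyz(4)]
  let ?r = "map_prod (res F V V') (map_prod (res tangent_sheaf V V') (res tangent_sheaf V V'))"
  show "?r a \<in> carrier (sec F V') \<times> carrier (sec tangent_sheaf V') \<times> carrier (sec tangent_sheaf V') \<and>
      (\<lambda>x. \<gamma> V' (fst (?r a)) x * (dlog s V' (fst (snd (?r a))) x * dlog s' V' (snd (snd (?r a))) x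
          - dlog s' V' (fst (snd (?r a))) x * dlog s V' (snd (snd (?r a))) x))
      = on_set V' (\<lambda>x. \<gamma> V (fst a) x * ?w (fst (snd a)) (snd (snd a)) x)"
    using c by (auto simp: xyz(1) eqs on_set_def)
qed

lemma alternating_is_trilinear:
  assumes "\<omega> \<in> carrier (sec (alternating_sheaf F tangent_sheaf) W)"
  shows "\<omega> \<in> carrier (sec (trilinear_sheaf F tangent_sheaf tangent_sheaf) W)"
  using assms unfolding alternating_sheaf_def trilinear_sheaf_def fam_sheaf_carrier by blast

end

locale higgs_sheaf = module_sheaf n \<Delta> F for n :: nat and \<Delta> :: "real vec set set" and F :: "'s presheaf" +
  fixes \<Phi> :: "point set \<Rightarrow> 's \<Rightarrow> 's tensor_T"
  assumes higgs: "higgs_field F \<Phi>"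
begin

lemma Phi_hom:
  assumes "zopen U"
  shows "\<Phi> U \<in> LinearCombinations.module_hom (reg_ring U) (sec F U) (sec (tensor F tangent_sheaf) U)"
    "V \<in> opens U \<Longrightarrow> s \<in> carrier (sec F U) \<Longrightarrow> res (tensor F tangent_sheaf) U V (\<Phi> U s) = \<Phi> V (res F U V s)"
  using higgs assms unfolding higgs_field_def pre_higgs_field_def sheaf_map_def by blast+

lemma Phi_closed:
  assumes "zopen U" "s \<in> carrier (sec F U)"
  shows "\<Phi> U s \<in> carrier (sec (dual_sheaf (bilinear_sheaf F tangent_sheaf)) U)"
  using LinearCombinations.module_hom_closed[OF Phi_hom(1)[OF assms(1)]] assms(2) by (auto simp: tensor_def)

lemma Phi_res:
  assumes "zopen U" "V \<in> opens U" "s \<in> carrier (sec F U)" "W \<in> opens V"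
  shows "\<Phi> V (res F U V s) W = \<Phi> U s W"
  using Phi_hom(2)[OF assms(1-3), symmetric] assms(4) by (simp add: tensor_def dual_sheaf_def fam_sheaf_ops)

text \<open>The linear form \<open>\<gamma> \<circ> \<Phi>\<^sub>s\<close>, where \<open>\<Phi>\<^sub>s\<close> is the contraction of \<open>\<Phi>\<close> with \<open>dlog \<chi>\<^sup>s\<close>. The contraction
  itself would have to be defined through the double dual of \<open>F\<close>; its transpose only evaluates \<open>\<Phi>\<close>.\<close>

definition Phi_transpose :: "point set \<Rightarrow> 's fam \<Rightarrow> int vec \<Rightarrow> 's fam" where
  "Phi_transpose W \<gamma> s = (\<lambda>V\<in>opens W. \<lambda>e\<in>carrier (sec F V). \<Phi> V e V (restrict (log_form W \<gamma> s) (opens V)))"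

lemma restrict_log_form:
  assumes W: "W \<in> opens (torus n)" and \<gamma>: "\<gamma> \<in> carrier (sec (dual_sheaf F) W)" and s: "s \<in> carrier_vec n"
    and V: "V \<in> opens W"
  shows "restrict (log_form W \<gamma> s) (opens V) \<in> carrier (sec (bilinear_sheaf F tangent_sheaf) V)"
  using fam_sheaf_restrict[OF log_form_bilinear[OF W \<gamma> s, unfolded bilinear_sheaf_def] V]
  by (simp add: bilinear_sheaf_def)

lemma Phi_linear:
  assumes V: "V \<in> opens (torus n)" and \<beta>: "\<beta> \<in> carrier (sec (bilinear_sheaf F tangent_sheaf) V)"
  shows "linear_form F V (\<lambda>e. \<Phi> V e V \<beta>)"
proof (rule linear_formI)
  have zV: "zopen V" and VV: "V \<in> opens V" using V opens_self by (auto simp: opens_def)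
  note h = Phi_hom(1)[OF zV]
  fix e assume e: "e \<in> carrier (sec F V)"
  show "regular V (\<Phi> V e V \<beta>)" using dual_sheafD(2)[OF Phi_closed[OF zV e] VV \<beta>] .
  show "\<Phi> V (e \<oplus>\<^bsub>sec F V\<^esub> e') V \<beta> = (\<lambda>x. \<Phi> V e V \<beta> x + \<Phi> V e' V \<beta> x)" if "e' \<in> carrier (sec F V)" for e'
    using LinearCombinations.module_hom_add[OF h e that] dual_sheaf_apply(1)[OF VV \<beta>] by (simp add: tensor_def)
  show "\<Phi> V (f \<odot>\<^bsub>sec F V\<^esub> e) V \<beta> = (\<lambda>x. f x * \<Phi> V e V \<beta> x)" if "regular V f" for f
    using LinearCombinations.module_hom_smult[OF h _ e, of f] dual_sheaf_apply(2)[OF VV \<beta>] that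
    by (simp add: tensor_def)
qed

lemma Phi_transpose_dual:
  assumes W: "W \<in> opens (torus n)" and \<gamma>: "\<gamma> \<in> carrier (sec (dual_sheaf F) W)" and s: "s \<in> carrier_vec n"
  shows "Phi_transpose W \<gamma> s \<in> carrier (sec (dual_sheaf F) W)"
  unfolding Phi_transpose_def dual_sheaf_def
proof (rule fam_sheafI)
  fix V assume V: "V \<in> opens W"
  have T: "V \<in> opens (torus n)" using opens_trans[OF V W] .
  have zV: "zopen V" and VV: "V \<in> opens V" using V opens_self by (auto simp: opens_def)
  let ?L = "\<lambda>V. restrict (log_form W \<gamma> s) (opens V)"
  note L = restrict_log_form[OF W \<gamma> s V] and lin = Phi_linear[OF T restrict_log_form[OF W \<gamma> s V]]
  show "regular V (\<Phi> V e V (?L V))" if "e \<in> carrier (sec F V)" for e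
    using linear_formD(1)[OF lin that] .
  show "linear_form F V (\<lambda>e\<in>carrier (sec F V). \<Phi> V e V (?L V))"
    using linear_form_restrict[OF closed_sections T lin] .
  fix V' e assume V': "V' \<in> opens V" and e: "e \<in> carrier (sec F V)"
  have 1: "\<Phi> V' (res F V V' e) V' (?L V') = \<Phi> V e V' (?L V')"
    using Phi_res[OF zV V' e] V' by (simp add: opens_def)
  have 2: "?L V' = res (bilinear_sheaf F tangent_sheaf) V V' (?L V)"
    using V' by (auto simp: bilinear_sheaf_def fam_sheaf_ops restrict_def fun_eq_iff dest: opens_trans)
  have 3: "\<Phi> V e V' (res (bilinear_sheaf F tangent_sheaf) V V' (?L V)) = on_set V' (\<Phi> V e V (?L V))"
    using dual_sheafD(3)[OF Phi_closed[OF zV e] VV V' L] .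
  show "res F V V' e \<in> carrier (sec F V') \<and>
      \<Phi> V' (res F V V' e) V' (?L V') = on_set V' (\<Phi> V e V (?L V))"
    unfolding 1 using res_closed[OF V' zV e] 3[folded 2] by blast
qed

text \<open>Contracting \<open>\<gamma> \<otimes> (dlog \<chi>\<^sup>s \<and> dlog \<chi>\<^sup>s\<^sup>')\<close> with a field \<open>v\<close> in the last place gives
  \<open>dlog \<chi>\<^sup>s\<^sup>'(v) \<gamma> \<otimes> dlog \<chi>\<^sup>s - dlog \<chi>\<^sup>s(v) \<gamma> \<otimes> dlog \<chi>\<^sup>s\<^sup>'\<close>, and \<open>\<Phi>(e)\<close> is linear in such forms.\<close>

lemma pullback_wedge_form:
  assumes W: "W \<in> opens (torus n)" and \<gamma>: "\<gamma> \<in> carrier (sec (dual_sheaf F) W)"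
    and s: "s \<in> carrier_vec n" and s': "s' \<in> carrier_vec n"
  shows "pullback_form F \<Phi> W (wedge_form W \<gamma> s s') =
    log_form W (Phi_transpose W \<gamma> s) s' \<oplus>\<^bsub>sec (bilinear_sheaf F tangent_sheaf) W\<^esub>
    const W (- 1) \<odot>\<^bsub>sec (bilinear_sheaf F tangent_sheaf) W\<^esub> log_form W (Phi_transpose W \<gamma> s') s"
    (is "_ = ?rhs")
proof -
  let ?B = "sec (bilinear_sheaf F tangent_sheaf)"
  let ?inner = "\<lambda>V v. \<lambda>V'\<in>opens V. restrict (\<lambda>(e', w). wedge_form W \<gamma> s s' V' (e', w, res tangent_sheaf V V' v))
          (carrier (sec F V') \<times> carrier (sec tangent_sheaf V'))"
  have key: "\<Phi> V e V (?inner V v) = (\<lambda>x. Phi_transpose W \<gamma> s V e x * dlog s' V v x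
      - Phi_transpose W \<gamma> s' V e x * dlog s V v x)"
    if V: "V \<in> opens W" and e: "e \<in> carrier (sec F V)" and v: "v \<in> carrier (sec tangent_sheaf V)" for V e v
  proof -
    have T: "V \<in> opens (torus n)" using opens_trans[OF V W] .
    have zV: "zopen V" and VV: "V \<in> opens V" using V opens_self by (auto simp: opens_def)
    let ?L = "\<lambda>s. restrict (log_form W \<gamma> s) (opens V)"
    note L = restrict_log_form[OF W \<gamma> s V] restrict_log_form[OF W \<gamma> s' V]
    have d: "regular V (dlog s V v)" "regular V (dlog s' V v)"
      using linear_formD(1)[OF dlog_linear[OF T s] v] linear_formD(1)[OF dlog_linear[OF T s'] v] .
    have d': "regular V (\<lambda>x. (- 1) * dlog s V v x)" by (rule regular_scale[OF d(1)])
    have "?inner V v = dlog s' V v \<odot>\<^bsub>?B V\<^esub> ?L s \<oplus>\<^bsub>?B V\<^esub> (\<lambda>x. (- 1) * dlog s V v x) \<odot>\<^bsub>?B V\<^esub> ?L s'"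
      unfolding bilinear_sheaf_def fam_sheaf_ops
    proof (intro restrict_ext)
      fix V' a assume V': "V' \<in> opens V" and a: "a \<in> carrier (sec F V') \<times> carrier (sec tangent_sheaf V')"
      have VW': "V' \<in> opens W" using opens_trans[OF V' V] .
      have vV': "res tangent_sheaf V V' v \<in> carrier (sec tangent_sheaf V')"
        using closed_presheafD(1)[OF tangent_sheaf_closed T v V'] .
      show "(case a of (e', w) \<Rightarrow> wedge_form W \<gamma> s s' V' (e', w, res tangent_sheaf V V' v)) =
        (\<lambda>x. (\<lambda>W'\<in>opens V. \<lambda>a\<in>carrier (sec F W') \<times> carrier (sec tangent_sheaf W'). \<lambda>x. on_set W' (dlog s' V v) x * ?L s W' a x) V' a x +
             (\<lambda>W'\<in>opens V. \<lambda>a\<in>carrier (sec F W') \<times> carrier (sec tangent_sheaf W'). \<lambda>x. on_set W' (\<lambda>x. (- 1) * dlog s V v x) x * ?L s' W' a x) V' a x)"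
        using a V' VW' vV'
        by (auto simp: wedge_form_def log_form_def dlog_restrict[OF T s V' v] dlog_restrict[OF T s' V' v]
            on_set_def algebra_simps)
    qed
    then have "\<Phi> V e V (?inner V v) = \<Phi> V e V (dlog s' V v \<odot>\<^bsub>?B V\<^esub> ?L s \<oplus>\<^bsub>?B V\<^esub>
        (\<lambda>x. (- 1) * dlog s V v x) \<odot>\<^bsub>?B V\<^esub> ?L s')" by simp
    \<comment> \<open>\<open>\<Phi> V e\<close> is a section of a double dual, so its component at \<open>V\<close> is linear on bilinear forms\<close>
    also have "\<dots> = (\<lambda>x. dlog s' V v x * \<Phi> V e V (?L s) x + (- 1) * dlog s V v x * \<Phi> V e V (?L s') x)"
      using linear_formD(2,3)[OF dual_sheafD(1)[OF Phi_closed[OF zV e] VV]] L d(2) d'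
        closed_presheafD(3)[OF closed_bilinear T] by simp
    finally show ?thesis using V e by (simp add: Phi_transpose_def algebra_simps)
  qed
  show ?thesis
    unfolding pullback_form_def bilinear_sheaf_def fam_sheaf_ops
  proof (intro restrict_ext)
    fix V a assume V: "V \<in> opens W" and a: "a \<in> carrier (sec F V) \<times> carrier (sec tangent_sheaf V)"
    obtain e v where ev: "a = (e, v)" "e \<in> carrier (sec F V)" "v \<in> carrier (sec tangent_sheaf V)" using a by auto
    have T: "V \<in> opens (torus n)" using opens_trans[OF V W] .
    have sub: "V \<subseteq> W" using V by (simp add: opens_def)
    have out: "dlog s V v x = 0" if "x \<notin> V" for x
      using regular_outside[OF linear_formD(1)[OF dlog_linear[OF T s] ev(3)] that] .
    show "(case a of (e, v) \<Rightarrow> \<Phi> V e V (?inner V v)) =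
      (\<lambda>x. log_form W (Phi_transpose W \<gamma> s) s' V a x +
        (\<lambda>V\<in>opens W. \<lambda>a\<in>carrier (sec F V) \<times> carrier (sec tangent_sheaf V).
          \<lambda>x. on_set V (const W (- 1)) x * log_form W (Phi_transpose W \<gamma> s') s V a x) V a x)"
      using V ev(2,3) out sub by (auto simp: ev(1) key[OF V ev(2,3)] log_form_def fun_eq_iff const_def on_set_def)
  qed
qed

lemma Phi_transpose_self:
  assumes "W \<in> opens (torus n)" "e \<in> carrier (sec F W)"
  shows "Phi_transpose W \<gamma> s W e = \<Phi> W e W (log_form W \<gamma> s)"
proof -
  have "restrict (log_form W \<gamma> s) (opens W) = log_form W \<gamma> s" by (simp add: log_form_def)
  then show ?thesis using assms by (simp add: Phi_transpose_def opens_self opens_def)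
qed

text \<open>The vanishing of \<open>\<Phi> \<and> \<Phi>\<close>, evaluated on \<open>\<gamma> \<otimes> (dlog \<chi>\<^sup>s \<and> dlog \<chi>\<^sup>s\<^sup>')\<close>. Its pullback along
  \<open>\<Phi> \<otimes> id\<close> is again made of forms \<open>\<delta> \<otimes> dlog\<close>, so applying \<open>\<Phi>\<close> once more yields iterated transposes.\<close>

lemma Phi_transpose_commute:
  assumes W: "W \<in> opens (torus n)" and \<gamma>: "\<gamma> \<in> carrier (sec (dual_sheaf F) W)"
    and s: "s \<in> carrier_vec n" and s': "s' \<in> carrier_vec n" and e: "e \<in> carrier (sec F W)"
  shows "Phi_transpose W (Phi_transpose W \<gamma> s) s' W e = Phi_transpose W (Phi_transpose W \<gamma> s') s W e"
proof -
  have zW: "zopen W" and WW: "W \<in> opens W" using W opens_self by (auto simp: opens_def)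
  let ?\<omega> = "wedge_form W \<gamma> s s'"
  note \<omega> = wedge_form_alternating[OF W \<gamma> s s']
  have "higgs_wedge F \<Phi> W e W ?\<omega> = (\<lambda>_. 0)"
    using higgs zW e WW \<omega> unfolding higgs_field_def by (simp add: tensor_wedge2_def dual_sheaf_apply(3))
  then have 0: "\<Phi> W e W (pullback_form F \<Phi> W ?\<omega>) = (\<lambda>_. 0)"
    using WW \<omega> alternating_is_trilinear[OF \<omega>] by (simp add: higgs_wedge_def id_wedge_def tensor_id_def)
  note t = Phi_transpose_dual[OF W \<gamma> s] Phi_transpose_dual[OF W \<gamma> s']
  have L: "log_form W (Phi_transpose W \<gamma> s) s' \<in> carrier (sec (bilinear_sheaf F tangent_sheaf) W)"
    "log_form W (Phi_transpose W \<gamma> s') s \<in> carrier (sec (bilinear_sheaf F tangent_sheaf) W)"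
    using log_form_bilinear[OF W t(1) s'] log_form_bilinear[OF W t(2) s] .
  have c: "regular W (const W (- 1))" by (rule regular_torus_const[OF W])
  note lin = linear_formD[OF dual_sheafD(1)[OF Phi_closed[OF zW e] WW]]
  have "(\<lambda>x. \<Phi> W e W (log_form W (Phi_transpose W \<gamma> s) s') x +
      const W (- 1) x * \<Phi> W e W (log_form W (Phi_transpose W \<gamma> s') s) x) = (\<lambda>_. 0)"
    using 0 lin(2)[OF L(1) closed_presheafD(3)[OF closed_bilinear W L(2) c]] lin(3)[OF L(2) c]
    unfolding pullback_wedge_form[OF W \<gamma> s s'] by simp
  then have eq: "\<Phi> W e W (log_form W (Phi_transpose W \<gamma> s) s') x +
      const W (- 1) x * \<Phi> W e W (log_form W (Phi_transpose W \<gamma> s') s) x = 0" for x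
    by (rule fun_cong)
  have "\<Phi> W e W (log_form W (Phi_transpose W \<gamma> s) s') x = \<Phi> W e W (log_form W (Phi_transpose W \<gamma> s') s) x" for x
  proof (cases "x \<in> W")
    case True
    then show ?thesis using eq[of x] by (simp add: const_def)
  next
    case False
    then show ?thesis using regular_outside[OF lin(1)[OF L(1)]] regular_outside[OF lin(1)[OF L(2)]] by simp
  qed
  then show ?thesis unfolding Phi_transpose_self[OF W e] by blast
qed

end


section \<open>The contractions commute\<close>

lemma (in module_sheaf) dual_apply_finsum:
  assumes W: "W \<in> opens (torus n)" and \<gamma>: "\<gamma> \<in> carrier (sec (dual_sheaf F) W)"
    and A: "finite A" "f \<in> A \<rightarrow> carrier (sec F (torus n))"
  shows "\<gamma> W (res F (torus n) W (\<Oplus>\<^bsub>sec F (torus n)\<^esub>i\<in>A. f i)) x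
    = (\<Sum>i\<in>A. \<gamma> W (res F (torus n) W (f i)) x)"
proof -
  have WW: "W \<in> opens W" using W opens_self by (auto simp: opens_def)
  note lin = linear_formD[OF dual_sheafD(1)[OF \<gamma> WW]]
  interpret T: Module.module "reg_ring (torus n)" "sec F (torus n)" by (rule torus_section_module)
  have zW: "zopen W" using W by (simp add: opens_def)
  interpret M: Module.module "reg_ring W" "sec F W" by (rule section_module[OF zW])
  note r = res_closed[OF W zopen_torus]
  show ?thesis
  proof (rule finsum_hom_complex[OF T.M.abelian_monoid_axioms A, of "\<lambda>a. \<gamma> W (res F (torus n) W a) x"])
    fix a b assume a: "a \<in> carrier (sec F (torus n))" and b: "b \<in> carrier (sec F (torus n))"
    show "\<gamma> W (res F (torus n) W (a \<oplus>\<^bsub>sec F (torus n)\<^esub> b)) x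
        = \<gamma> W (res F (torus n) W a) x + \<gamma> W (res F (torus n) W b) x"
      using lin(2)[OF r[OF a] r[OF b]] by (simp add: res_add[OF W zopen_torus a b])
  next
    have "\<gamma> W \<zero>\<^bsub>sec F W\<^esub> x = \<gamma> W \<zero>\<^bsub>sec F W\<^esub> x + \<gamma> W \<zero>\<^bsub>sec F W\<^esub> x"
      using fun_cong[OF lin(2)[OF M.M.zero_closed M.M.zero_closed], of x]
      by (simp only: M.M.r_zero[OF M.M.zero_closed])
    then show "\<gamma> W (res F (torus n) W \<zero>\<^bsub>sec F (torus n)\<^esub>) x = 0"
      by (simp add: res_zero[OF W zopen_torus])
  qed
qed

lemma (in module_sheaf) dual_apply_smult:
  assumes W: "W \<in> opens (torus n)" and \<gamma>: "\<gamma> \<in> carrier (sec (dual_sheaf F) W)"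
    and f: "regular (torus n) f" and a: "a \<in> carrier (sec F (torus n))"
  shows "\<gamma> W (res F (torus n) W (f \<odot>\<^bsub>sec F (torus n)\<^esub> a)) x
    = on_set W f x * \<gamma> W (res F (torus n) W a) x"
proof -
  have WW: "W \<in> opens W" using W opens_self by (auto simp: opens_def)
  show ?thesis
    using linear_formD(3)[OF dual_sheafD(1)[OF \<gamma> WW] res_closed[OF W zopen_torus a] regular_restrict[OF f W]]
    by (simp add: res_smult[OF W zopen_torus f a])
qed

locale toric_higgs = toric_module_sheaf n \<Delta> E \<alpha> + higgs_sheaf n \<Delta> E \<Phi>
  for n :: nat and \<Delta> :: "real vec set set" and E :: "'s presheaf"
    and \<alpha> :: "point \<Rightarrow> point set \<Rightarrow> 's \<Rightarrow> 's" and \<Phi> :: "point set \<Rightarrow> 's \<Rightarrow> 's tensor_T" +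
  fixes \<phi> :: "int vec \<Rightarrow> (point set \<times> 's) set \<Rightarrow> nat \<Rightarrow> (point set \<times> 's) set"
  assumes decomposition: "homogeneous_decomposition E \<alpha> \<Phi> \<phi>"
begin

abbreviation "V \<equiv> fibre_at_one E"
abbreviation "S \<equiv> component_support V \<phi>"
abbreviation "T \<equiv> torus n"

lemmas V_module = fibre_at_one_module

sublocale V_space: complex_space V
  by (rule complex_space.intro) (rule V_module)

interpretation V: Module.module class_ring V by (rule V_module)
interpretation ET: Module.module "reg_ring T" ET by (rule torus_section_module)

lemma S_finite: "finite S" and S_carrier: "S \<subseteq> carrier_vec n"
  using decomposition by (auto simp: homogeneous_decomposition_def component_support_def)

lemma phi_linear: "r \<in> carrier_vec n \<Longrightarrow> linear_to_tensor_N V (\<phi> r)"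
  using decomposition by (simp add: homogeneous_decomposition_def)

lemma phi_closed: "r \<in> carrier_vec n \<Longrightarrow> e \<in> carrier V \<Longrightarrow> i < n \<Longrightarrow> \<phi> r e i \<in> carrier V"
  using phi_linear[of r] unfolding linear_to_tensor_N_def LinearCombinations.module_hom_def by auto

lemma phi_zero: "r \<in> carrier_vec n \<Longrightarrow> r \<notin> S \<Longrightarrow> e \<in> carrier V \<Longrightarrow> i < n \<Longrightarrow> \<phi> r e i = \<zero>\<^bsub>V\<^esub>"
  by (auto simp: component_support_def)

lemma Phi_s_apply:
  "r \<in> carrier_vec n \<Longrightarrow> e \<in> carrier V \<Longrightarrow>
    Phi_s V \<phi> s r e = (\<Oplus>\<^bsub>V\<^esub>i\<in>{..<n}. complex_of_int (s $ i) \<odot>\<^bsub>V\<^esub> \<phi> r e i)"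
  by (simp add: Phi_s_def contract_N_def)

lemma Phi_s_End: "s \<in> carrier_vec n \<Longrightarrow> r \<in> carrier_vec n \<Longrightarrow> Phi_s V \<phi> s r \<in> carrier (End_algebra V)"
  using linear_to_tensor_N_in_End[OF V_module phi_linear] by (simp add: Phi_s_def)

lemma Phi_s_zero:
  assumes "s \<in> carrier_vec n" "r \<in> carrier_vec n" "r \<notin> S"
  shows "Phi_s V \<phi> s r = \<zero>\<^bsub>End_algebra V\<^esub>"
proof (rule V_space.End_eqI[OF Phi_s_End[OF assms(1,2)] V_space.End_ops_closed(2)])
  fix e assume e: "e \<in> carrier V"
  have "Phi_s V \<phi> s r e = \<zero>\<^bsub>V\<^esub>"
    unfolding Phi_s_apply[OF assms(2) e]
    by (rule V.M.add.finprod_one_eqI) (simp add: phi_zero[OF assms(2,3) e] V_space.smult_simps)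
  then show "Phi_s V \<phi> s r e = \<zero>\<^bsub>End_algebra V\<^esub> e" using e by (simp add: V_space.End_apply)
qed

lemma Phi_s_tensor:
  assumes "s \<in> carrier_vec n"
  shows "Phi_s V \<phi> s \<in> carrier (tensor_group_algebra n (End_algebra V))"
proof -
  have "{r \<in> carrier_vec n. Phi_s V \<phi> s r \<noteq> \<zero>\<^bsub>End_algebra V\<^esub>} \<subseteq> S" using Phi_s_zero[OF assms] by blast
  then have "finite {r \<in> carrier_vec n. Phi_s V \<phi> s r \<noteq> \<zero>\<^bsub>End_algebra V\<^esub>}"
    using S_finite by (rule finite_subset)
  moreover have "Phi_s V \<phi> s \<in> carrier_vec n \<rightarrow>\<^sub>E carrier (End_algebra V)"
    using Phi_s_End[OF assms] by (auto simp: Phi_s_def)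
  ultimately show ?thesis by (simp add: tensor_group_algebra_def)
qed

lemma S_chi: "r \<in> S \<Longrightarrow> regular T (on_set T (chi r))"
  using S_carrier regular_chi[OF opens_self[OF zopen_torus]] by blast

lemma T_opens: "T \<in> opens T" by (rule opens_self[OF zopen_torus])

abbreviation "Inv \<equiv> invariant_sections E \<alpha>"

text \<open>The section \<open>z r\<close> is the invariant section with value \<open>\<phi>\<^sup>r\<^sub>s(e)\<close> at \<open>1\<close>, and the last conclusion says
  that \<open>\<Phi>\<^sub>s\<close> maps \<open>e\<close> to \<open>\<Sum>\<^sub>r \<chi>\<^sup>r z r\<close>, tested on linear forms.\<close>

lemma contraction_of_invariant:
  assumes e: "e \<in> Inv" and s: "s \<in> carrier_vec n"
  obtains z where "\<And>r. r \<in> carrier_vec n \<Longrightarrow> z r \<in> Inv"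
    "\<And>r. r \<in> carrier_vec n \<Longrightarrow> value_at_one (z r) = Phi_s V \<phi> s r (value_at_one e)"
    "\<And>W \<gamma> x. W \<in> opens T \<Longrightarrow> \<gamma> \<in> carrier (sec (dual_sheaf E) W) \<Longrightarrow> x \<in> W \<Longrightarrow>
      Phi_transpose W \<gamma> s W (res E T W e) x = (\<Sum>r\<in>S. chi r x * \<gamma> W (res E T W (z r)) x)"
proof -
  let ?TE = "sec (tensor E tangent_sheaf) T"
  let ?D = "\<lambda>i. invariant_field T (unit_vec n i)"
  obtain u where u: "\<And>r i. r \<in> carrier_vec n \<Longrightarrow> i < n \<Longrightarrow> u r i \<in> Inv"
    "\<And>r i. r \<in> carrier_vec n \<Longrightarrow> i < n \<Longrightarrow> value_at_one (u r i) = \<phi> r (value_at_one e) i"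
    and \<Phi>e: "\<Phi> T e = (\<Oplus>\<^bsub>?TE\<^esub>r\<in>S. on_set T (chi r) \<odot>\<^bsub>?TE\<^esub>
             (\<Oplus>\<^bsub>?TE\<^esub>i\<in>{..<n}. pure_tensor E tangent_sheaf T (u r i) (?D i)))"
    using decomposition e unfolding homogeneous_decomposition_def value_at_one_def by blast
  have ec: "e \<in> carrier ET" using invariant_sectionsD(1)[OF e] .
  have uc: "u r i \<in> carrier ET" if "r \<in> carrier_vec n" "i < n" for r i
    using invariant_sectionsD(1)[OF u(1)[OF that]] .
  have cst: "regular T (const T c)" for c by (rule regular_const[OF zopen_torus])
  define z where "z r = (\<Oplus>\<^bsub>ET\<^esub>i\<in>{..<n}. const T (complex_of_int (s $ i)) \<odot>\<^bsub>ET\<^esub> u r i)" for r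
  have trm: "(\<lambda>i. const T (complex_of_int (s $ i)) \<odot>\<^bsub>ET\<^esub> u r i) \<in> {..<n} \<rightarrow> carrier ET"
    if "r \<in> carrier_vec n" for r using uc[OF that] cst by auto
  show thesis
  proof (rule that[of z])
    fix r :: "int vec" assume r: "r \<in> carrier_vec n"
    have "\<alpha> t T (z r) = z r" if t: "t \<in> T" for t
    proof -
      have tc: "translate t (const T c) = const T c" for c
        using act_in_torus_iff[OF torus_inv_in_torus[OF t]]
        by (auto simp: translate_def const_def on_set_def fun_eq_iff)
      show ?thesis unfolding z_def translation_finsum[OF t finite_lessThan trm[OF r]]
        by (rule ET.M.finsum_cong')
           (use trm[OF r] uc[OF r] invariant_sectionsD(2)[OF u(1)[OF r] t] translation_smult[OF t cst] in \<open>auto simp: tc\<close>)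
    qed
    moreover have "z r \<in> carrier ET" unfolding z_def by (rule ET.M.finsum_closed[OF trm[OF r]])
    ultimately show "z r \<in> Inv" by (simp add: invariant_sections_def)
    have "value_at_one (z r) = (\<Oplus>\<^bsub>V\<^esub>i\<in>{..<n}. value_at_one (const T (complex_of_int (s $ i)) \<odot>\<^bsub>ET\<^esub> u r i))"
      unfolding z_def by (rule value_at_one_finsum[OF finite_lessThan trm[OF r]])
    also have "\<dots> = (\<Oplus>\<^bsub>V\<^esub>i\<in>{..<n}. complex_of_int (s $ i) \<odot>\<^bsub>V\<^esub> \<phi> r (value_at_one e) i)"
    proof (rule V.M.finsum_cong')
      fix i assume i: "i \<in> {..<n}"
      then show "value_at_one (const T (complex_of_int (s $ i)) \<odot>\<^bsub>ET\<^esub> u r i)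
          = complex_of_int (s $ i) \<odot>\<^bsub>V\<^esub> \<phi> r (value_at_one e) i"
        using value_at_one_smult[OF uc[OF r] cst] u(2)[OF r] torus_one_in_torus by (simp add: const_def)
    qed (use phi_closed[OF r value_at_one_closed[OF ec]] V_space.smult_simps(1) in auto)
    also have "\<dots> = Phi_s V \<phi> s r (value_at_one e)"
      by (rule Phi_s_apply[OF r value_at_one_closed[OF ec], symmetric])
    finally show "value_at_one (z r) = Phi_s V \<phi> s r (value_at_one e)" .
  next
    fix W \<gamma> x assume W: "W \<in> opens T" and \<gamma>: "\<gamma> \<in> carrier (sec (dual_sheaf E) W)" and x: "x \<in> W"
    have WW: "W \<in> opens W" using W opens_self by (auto simp: opens_def)
    let ?L = "log_form W \<gamma> s"
    note L = log_form_bilinear[OF W \<gamma> s]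
    have Dc: "?D i \<in> carrier (sec tangent_sheaf T)" for i
      by (rule invariant_field_in_tangent_sheaf[OF T_opens]) simp
    have pt: "pure_tensor E tangent_sheaf T (u r i) (?D i) \<in> carrier ?TE" if "r \<in> S" "i < n" for r i
      using that S_carrier by (intro pure_tensor_closed[OF T_opens] uc Dc) auto
    have inner: "(\<Oplus>\<^bsub>?TE\<^esub>i\<in>{..<n}. pure_tensor E tangent_sheaf T (u r i) (?D i)) \<in> carrier ?TE" if "r \<in> S" for r
      using pt[OF that] unfolding tensor_def
      by (intro abelian_monoid.finsum_closed[OF dual_sheaf_abelian_monoid[OF closed_bilinear T_opens]]) auto
    have outer: "(\<lambda>r. on_set T (chi r) \<odot>\<^bsub>?TE\<^esub> (\<Oplus>\<^bsub>?TE\<^esub>i\<in>{..<n}. pure_tensor E tangent_sheaf T (u r i) (?D i)))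
        \<in> S \<rightarrow> carrier ?TE"
      using closed_presheafD(3)[OF dual_sheaf_closed[OF closed_bilinear] T_opens] inner S_chi
      unfolding tensor_def by blast
    have "Phi_transpose W \<gamma> s W (res E T W e) x = \<Phi> W (res E T W e) W ?L x"
      using Phi_transpose_self[OF W res_closed[OF W zopen_torus ec]] by simp
    also have "\<dots> = \<Phi> T e W ?L x" using Phi_res[OF zopen_torus W ec WW] by simp
    also have "\<dots> = (\<Sum>r\<in>S. (on_set T (chi r) \<odot>\<^bsub>?TE\<^esub>
             (\<Oplus>\<^bsub>?TE\<^esub>i\<in>{..<n}. pure_tensor E tangent_sheaf T (u r i) (?D i))) W ?L x)"
      unfolding \<Phi>e tensor_def
      by (rule dual_sheaf_finsum[OF closed_bilinear T_opens S_finite outer[unfolded tensor_def] W L])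
    also have "\<dots> = (\<Sum>r\<in>S. chi r x * \<gamma> W (res E T W (z r)) x)"
    proof (rule sum.cong)
      fix r assume rS: "r \<in> S"
      have r: "r \<in> carrier_vec n" using rS S_carrier by blast
      have "(\<Oplus>\<^bsub>?TE\<^esub>i\<in>{..<n}. pure_tensor E tangent_sheaf T (u r i) (?D i)) W ?L x
          = (\<Sum>i<n. pure_tensor E tangent_sheaf T (u r i) (?D i) W ?L x)"
        unfolding tensor_def
        by (rule dual_sheaf_finsum[OF closed_bilinear T_opens finite_lessThan _ W L])
           (use pt[OF rS] in \<open>auto simp: tensor_def\<close>)
      also have "\<dots> = (\<Sum>i<n. complex_of_int (s $ i) * \<gamma> W (res E T W (u r i)) x)"
      proof (rule sum.cong)
        fix i assume "i \<in> {..<n}"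
        then have i: "i < n" by simp
        have "res tangent_sheaf T W (?D i) = invariant_field W (unit_vec n i)"
          by (rule restrict_invariant_field[OF W])
        moreover have "invariant_field W (unit_vec n i) \<in> carrier (sec tangent_sheaf W)"
          by (rule invariant_field_in_tangent_sheaf[OF W]) simp
        ultimately show "pure_tensor E tangent_sheaf T (u r i) (?D i) W ?L x
            = complex_of_int (s $ i) * \<gamma> W (res E T W (u r i)) x"
          using W WW L res_closed[OF W zopen_torus uc[OF r i]] dlog_invariant_field[OF W s i x]
          by (simp add: pure_tensor_def) (simp add: log_form_def)
      qed simp
      also have "\<dots> = (\<Sum>i<n. \<gamma> W (res E T W (const T (complex_of_int (s $ i)) \<odot>\<^bsub>ET\<^esub> u r i)) x)"
      proof (rule sum.cong)
        fix i assume "i \<in> {..<n}"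
        then have i: "i < n" by simp
        have "on_set W (const T (complex_of_int (s $ i))) x = complex_of_int (s $ i)"
          using x W by (auto simp: const_def opens_def)
        then show "complex_of_int (s $ i) * \<gamma> W (res E T W (u r i)) x
            = \<gamma> W (res E T W (const T (complex_of_int (s $ i)) \<odot>\<^bsub>ET\<^esub> u r i)) x"
          using dual_apply_smult[OF W \<gamma> cst uc[OF r i], of "complex_of_int (s $ i)" x] by simp
      qed simp
      also have "\<dots> = \<gamma> W (res E T W (z r)) x"
        unfolding z_def by (rule dual_apply_finsum[OF W \<gamma> finite_lessThan trm[OF r], symmetric])
      finally show "(on_set T (chi r) \<odot>\<^bsub>?TE\<^esub>
             (\<Oplus>\<^bsub>?TE\<^esub>i\<in>{..<n}. pure_tensor E tangent_sheaf T (u r i) (?D i))) W ?L x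
          = chi r x * \<gamma> W (res E T W (z r)) x"
        using dual_sheaf_apply(2)[OF W L] x W by (simp add: tensor_def opens_def)
    qed simp
    finally show "Phi_transpose W \<gamma> s W (res E T W e) x = (\<Sum>r\<in>S. chi r x * \<gamma> W (res E T W (z r)) x)" .
  qed
qed

text \<open>Applying the previous lemma twice. The section \<open>y\<close> is \<open>\<Phi>\<^sub>s(\<Phi>\<^sub>s\<^sub>'(e)) = \<Sum>\<^sub>q \<chi>\<^sup>q \<Sum>\<^sub>p \<chi>\<^sup>p w q p\<close> with invariant
  \<open>w q p\<close>. Translation by the inverse of \<open>t\<close> multiplies \<open>\<chi>\<^sup>p\<close> by \<open>\<chi>\<^sup>p(t)\<close>, so that the value of the
  translate at \<open>1\<close> shows the composition at the point \<open>t\<close>.\<close>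

lemma composition_of_contractions:
  assumes e: "e \<in> Inv" and s: "s \<in> carrier_vec n" and s': "s' \<in> carrier_vec n"
  obtains y where "y \<in> carrier ET"
    "\<And>W \<gamma> x. W \<in> opens T \<Longrightarrow> \<gamma> \<in> carrier (sec (dual_sheaf E) W) \<Longrightarrow> x \<in> W \<Longrightarrow>
      Phi_transpose W (Phi_transpose W \<gamma> s) s' W (res E T W e) x = \<gamma> W (res E T W y) x"
    "\<And>t. t \<in> T \<Longrightarrow> value_at_one (\<alpha> (torus_inv t) T y)
      = (\<Oplus>\<^bsub>V\<^esub>p\<in>S. \<Oplus>\<^bsub>V\<^esub>q\<in>S. (chi p t * chi q t) \<odot>\<^bsub>V\<^esub> Phi_s V \<phi> s p (Phi_s V \<phi> s' q (value_at_one e)))"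
proof -
  obtain z where z: "\<And>r. r \<in> carrier_vec n \<Longrightarrow> z r \<in> Inv"
    "\<And>r. r \<in> carrier_vec n \<Longrightarrow> value_at_one (z r) = Phi_s V \<phi> s' r (value_at_one e)"
    "\<And>W \<gamma> x. W \<in> opens T \<Longrightarrow> \<gamma> \<in> carrier (sec (dual_sheaf E) W) \<Longrightarrow> x \<in> W \<Longrightarrow>
      Phi_transpose W \<gamma> s' W (res E T W e) x = (\<Sum>r\<in>S. chi r x * \<gamma> W (res E T W (z r)) x)"
    using contraction_of_invariant[OF e s'] by blast
  let ?P = "\<lambda>q w. (\<forall>r\<in>carrier_vec n. w r \<in> Inv \<and> value_at_one (w r) = Phi_s V \<phi> s r (value_at_one (z q))) \<and>
    (\<forall>W\<in>opens T. \<forall>\<gamma>\<in>carrier (sec (dual_sheaf E) W). \<forall>x\<in>W.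
      Phi_transpose W \<gamma> s W (res E T W (z q)) x = (\<Sum>r\<in>S. chi r x * \<gamma> W (res E T W (w r)) x))"
  have "\<forall>q\<in>S. \<exists>w. ?P q w"
  proof
    fix q assume "q \<in> S"
    then have "z q \<in> Inv" using z(1) S_carrier by blast
    then obtain w where w: "\<And>r. r \<in> carrier_vec n \<Longrightarrow> w r \<in> Inv"
      "\<And>r. r \<in> carrier_vec n \<Longrightarrow> value_at_one (w r) = Phi_s V \<phi> s r (value_at_one (z q))"
      "\<And>W \<gamma> x. W \<in> opens T \<Longrightarrow> \<gamma> \<in> carrier (sec (dual_sheaf E) W) \<Longrightarrow> x \<in> W \<Longrightarrow>
        Phi_transpose W \<gamma> s W (res E T W (z q)) x = (\<Sum>r\<in>S. chi r x * \<gamma> W (res E T W (w r)) x)"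
      using contraction_of_invariant[OF _ s] by blast
    show "\<exists>w. ?P q w" by (intro exI[of _ w] conjI ballI w)
  qed
  from bchoice[OF this] obtain w where "\<forall>q\<in>S. ?P q (w q)" ..
  then have w: "\<And>q r. q \<in> S \<Longrightarrow> r \<in> carrier_vec n \<Longrightarrow> w q r \<in> Inv"
    "\<And>q r. q \<in> S \<Longrightarrow> r \<in> carrier_vec n \<Longrightarrow> value_at_one (w q r) = Phi_s V \<phi> s r (value_at_one (z q))"
    "\<And>q W \<gamma> x. q \<in> S \<Longrightarrow> W \<in> opens T \<Longrightarrow> \<gamma> \<in> carrier (sec (dual_sheaf E) W) \<Longrightarrow> x \<in> W \<Longrightarrow>
      Phi_transpose W \<gamma> s W (res E T W (z q)) x = (\<Sum>r\<in>S. chi r x * \<gamma> W (res E T W (w q r)) x)"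
    by simp_all
  have Sc: "r \<in> carrier_vec n" if "r \<in> S" for r using that S_carrier by blast
  have wc: "w q p \<in> carrier ET" if "q \<in> S" "p \<in> S" for q p
    using invariant_sectionsD(1)[OF w(1)[OF that(1) Sc[OF that(2)]]] .
  let ?c = "\<lambda>r. on_set T (chi r)"
  define h where "h q = (\<Oplus>\<^bsub>ET\<^esub>p\<in>S. ?c p \<odot>\<^bsub>ET\<^esub> w q p)" for q
  define y where "y = (\<Oplus>\<^bsub>ET\<^esub>q\<in>S. ?c q \<odot>\<^bsub>ET\<^esub> h q)"
  have ht: "(\<lambda>p. ?c p \<odot>\<^bsub>ET\<^esub> w q p) \<in> S \<rightarrow> carrier ET" if "q \<in> S" for q
    using wc[OF that] S_chi by auto
  have hc: "h q \<in> carrier ET" if "q \<in> S" for q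
    unfolding h_def by (rule ET.M.finsum_closed[OF ht[OF that]])
  have yt: "(\<lambda>q. ?c q \<odot>\<^bsub>ET\<^esub> h q) \<in> S \<rightarrow> carrier ET" using hc S_chi by auto
  show thesis
  proof (rule that[of y])
    show "y \<in> carrier ET" unfolding y_def by (rule ET.M.finsum_closed[OF yt])
  next
    fix W \<gamma> x assume W: "W \<in> opens T" and \<gamma>: "\<gamma> \<in> carrier (sec (dual_sheaf E) W)" and x: "x \<in> W"
    have xc: "on_set W (?c r) x = chi r x" for r using x W by (auto simp: opens_def)
    have "Phi_transpose W (Phi_transpose W \<gamma> s) s' W (res E T W e) x
        = (\<Sum>q\<in>S. chi q x * Phi_transpose W \<gamma> s W (res E T W (z q)) x)"
      by (rule z(3)[OF W Phi_transpose_dual[OF W \<gamma> s] x])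
    also have "\<dots> = (\<Sum>q\<in>S. chi q x * (\<Sum>p\<in>S. chi p x * \<gamma> W (res E T W (w q p)) x))"
      using w(3)[OF _ W \<gamma> x] by simp
    also have "\<dots> = (\<Sum>q\<in>S. chi q x * \<gamma> W (res E T W (h q)) x)"
      unfolding h_def
      by (rule sum.cong) (auto simp: dual_apply_finsum[OF W \<gamma> S_finite ht] dual_apply_smult[OF W \<gamma> S_chi wc] xc)
    also have "\<dots> = \<gamma> W (res E T W y) x"
      unfolding y_def by (simp add: dual_apply_finsum[OF W \<gamma> S_finite yt] dual_apply_smult[OF W \<gamma> S_chi hc] xc)
    finally show "Phi_transpose W (Phi_transpose W \<gamma> s) s' W (res E T W e) x = \<gamma> W (res E T W y) x" .
  next
    fix t assume t: "t \<in> T"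
    let ?t = "torus_inv t"
    have t': "?t \<in> T" using torus_inv_in_torus[OF t] .
    let ?\<psi> = "\<lambda>q p. Phi_s V \<phi> s p (Phi_s V \<phi> s' q (value_at_one e))"
    have ec: "value_at_one e \<in> carrier V" using value_at_one_closed[OF invariant_sectionsD(1)[OF e]] .
    have \<psi>c: "?\<psi> q p \<in> carrier V" if "q \<in> S" "p \<in> S" for q p
      using V_space.End_closed[OF Phi_s_End[OF s Sc[OF that(2)]] V_space.End_closed[OF Phi_s_End[OF s' Sc[OF that(1)]] ec]] .
    have k: "value_at_one (\<alpha> ?t T (?c r \<odot>\<^bsub>ET\<^esub> a)) = chi r t \<odot>\<^bsub>V\<^esub> value_at_one (\<alpha> ?t T a)"
      if "r \<in> S" "a \<in> carrier ET" for r a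
    proof -
      have "\<alpha> ?t T (?c r \<odot>\<^bsub>ET\<^esub> a) = (\<lambda>x. chi r t * ?c r x) \<odot>\<^bsub>ET\<^esub> \<alpha> ?t T a"
        using translation_smult[OF t' S_chi[OF that(1)] that(2)] by (simp add: translate_chi[OF t'] chi_inv)
      then show ?thesis
        using value_at_one_smult[OF translation_closed[OF t' that(2)] regular_scale[OF S_chi[OF that(1)]]]
          torus_one_in_torus Sc[OF that(1)] by (simp add: chi_one)
    qed
    have kh: "value_at_one (\<alpha> ?t T (h q)) = (\<Oplus>\<^bsub>V\<^esub>p\<in>S. chi p t \<odot>\<^bsub>V\<^esub> ?\<psi> q p)" if q: "q \<in> S" for q
    proof -
      have "value_at_one (\<alpha> ?t T (h q)) = (\<Oplus>\<^bsub>V\<^esub>p\<in>S. value_at_one (\<alpha> ?t T (?c p \<odot>\<^bsub>ET\<^esub> w q p)))"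
        unfolding h_def translation_finsum[OF t' S_finite ht[OF q]]
        by (rule value_at_one_finsum[OF S_finite]) (use ht[OF q] translation_closed[OF t'] in auto)
      also have "\<dots> = (\<Oplus>\<^bsub>V\<^esub>p\<in>S. chi p t \<odot>\<^bsub>V\<^esub> ?\<psi> q p)"
      proof (rule V.M.finsum_cong')
        fix p assume p: "p \<in> S"
        have "\<alpha> ?t T (w q p) = w q p" by (rule invariant_sectionsD(2)[OF w(1)[OF q Sc[OF p]] t'])
        then show "value_at_one (\<alpha> ?t T (?c p \<odot>\<^bsub>ET\<^esub> w q p)) = chi p t \<odot>\<^bsub>V\<^esub> ?\<psi> q p"
          using k[OF p wc[OF q p]] w(2)[OF q Sc[OF p]] z(2)[OF Sc[OF q]] by simp
      qed (use \<psi>c[OF q] V_space.smult_simps(1) in auto)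
      finally show ?thesis .
    qed
    have "value_at_one (\<alpha> ?t T y) = (\<Oplus>\<^bsub>V\<^esub>q\<in>S. value_at_one (\<alpha> ?t T (?c q \<odot>\<^bsub>ET\<^esub> h q)))"
      unfolding y_def translation_finsum[OF t' S_finite yt]
      by (rule value_at_one_finsum[OF S_finite]) (use yt translation_closed[OF t'] in auto)
    also have "\<dots> = (\<Oplus>\<^bsub>V\<^esub>q\<in>S. \<Oplus>\<^bsub>V\<^esub>p\<in>S. (chi p t * chi q t) \<odot>\<^bsub>V\<^esub> ?\<psi> q p)"
    proof (rule V.M.finsum_cong')
      fix q assume q: "q \<in> S"
      have trm: "(\<lambda>p. chi p t \<odot>\<^bsub>V\<^esub> ?\<psi> q p) \<in> S \<rightarrow> carrier V"
        using \<psi>c[OF q] V_space.smult_simps(1) by auto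
      have "value_at_one (\<alpha> ?t T (?c q \<odot>\<^bsub>ET\<^esub> h q)) = (\<Oplus>\<^bsub>V\<^esub>p\<in>S. chi q t \<odot>\<^bsub>V\<^esub> (chi p t \<odot>\<^bsub>V\<^esub> ?\<psi> q p))"
        unfolding k[OF q hc[OF q]] kh[OF q] by (rule V_space.smult_finsum[OF trm])
      also have "\<dots> = (\<Oplus>\<^bsub>V\<^esub>p\<in>S. (chi p t * chi q t) \<odot>\<^bsub>V\<^esub> ?\<psi> q p)"
        by (rule V.M.finsum_cong') (use \<psi>c[OF q] in \<open>auto simp: V_space.smult_simps mult.commute\<close>)
      finally show "value_at_one (\<alpha> ?t T (?c q \<odot>\<^bsub>ET\<^esub> h q)) = (\<Oplus>\<^bsub>V\<^esub>p\<in>S. (chi p t * chi q t) \<odot>\<^bsub>V\<^esub> ?\<psi> q p)" .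
    qed (auto intro!: V.M.finsum_closed V_space.smult_simps(1) \<psi>c)
    also have "\<dots> = (\<Oplus>\<^bsub>V\<^esub>p\<in>S. \<Oplus>\<^bsub>V\<^esub>q\<in>S. (chi p t * chi q t) \<odot>\<^bsub>V\<^esub> ?\<psi> q p)"
      by (rule V.M.finsum_swap[OF S_finite S_finite V_space.smult_simps(1)[OF \<psi>c]])
    finally show "value_at_one (\<alpha> ?t T y) = (\<Oplus>\<^bsub>V\<^esub>p\<in>S. \<Oplus>\<^bsub>V\<^esub>q\<in>S. (chi p t * chi q t) \<odot>\<^bsub>V\<^esub> ?\<psi> q p)" .
  qed
qed

text \<open>Injectivity of \<open>E\<close> into its double dual.\<close>

lemma sections_separated:
  assumes "y \<in> carrier ET" "y' \<in> carrier ET"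
    "\<And>W \<gamma> x. W \<in> opens T \<Longrightarrow> \<gamma> \<in> carrier (sec (dual_sheaf E) W) \<Longrightarrow> x \<in> W \<Longrightarrow>
      \<gamma> W (res E T W y) x = \<gamma> W (res E T W y') x"
  shows "y = y'"
proof -
  have "\<gamma> W (res E T W y) = \<gamma> W (res E T W y')"
    if W: "W \<in> opens T" and \<gamma>: "\<gamma> \<in> carrier (sec (dual_sheaf E) W)" for W \<gamma>
  proof
    fix x
    have WW: "W \<in> opens W" using W opens_self by (auto simp: opens_def)
    show "\<gamma> W (res E T W y) x = \<gamma> W (res E T W y') x"
    proof (cases "x \<in> W")
      case False
      then show ?thesis
        using regular_outside[OF dual_sheafD(2)[OF \<gamma> WW res_closed[OF W zopen_torus]]] assms(1,2) by simp
    qed (rule assms(3)[OF W \<gamma>])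
  qed
  then have "bidual_map E T y = bidual_map E T y'"
    unfolding bidual_map_def by (intro restrict_ext) auto
  then show ?thesis
    using bij_betw_imp_inj_on[OF bidual_bij[OF zopen_torus]] assms(1,2) by (auto dest: inj_onD)
qed

lemma contractions_commute:
  assumes s: "s \<in> carrier_vec n" and s': "s' \<in> carrier_vec n" and t: "t \<in> T" and e: "e \<in> carrier V"
  shows "(\<Oplus>\<^bsub>V\<^esub>p\<in>S. \<Oplus>\<^bsub>V\<^esub>q\<in>S. (chi p t * chi q t) \<odot>\<^bsub>V\<^esub> Phi_s V \<phi> s p (Phi_s V \<phi> s' q e))
    = (\<Oplus>\<^bsub>V\<^esub>p\<in>S. \<Oplus>\<^bsub>V\<^esub>q\<in>S. (chi p t * chi q t) \<odot>\<^bsub>V\<^esub> Phi_s V \<phi> s' p (Phi_s V \<phi> s q e))"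
proof -
  obtain e' where e': "e' \<in> Inv" "e = value_at_one e'"
    using invariant_representative[OF e] by blast
  obtain y where y: "y \<in> carrier ET"
    "\<And>W \<gamma> x. W \<in> opens T \<Longrightarrow> \<gamma> \<in> carrier (sec (dual_sheaf E) W) \<Longrightarrow> x \<in> W \<Longrightarrow>
      Phi_transpose W (Phi_transpose W \<gamma> s) s' W (res E T W e') x = \<gamma> W (res E T W y) x"
    "\<And>t. t \<in> T \<Longrightarrow> value_at_one (\<alpha> (torus_inv t) T y)
      = (\<Oplus>\<^bsub>V\<^esub>p\<in>S. \<Oplus>\<^bsub>V\<^esub>q\<in>S. (chi p t * chi q t) \<odot>\<^bsub>V\<^esub> Phi_s V \<phi> s p (Phi_s V \<phi> s' q (value_at_one e')))"
    by (rule composition_of_contractions[OF e'(1) s s']) blast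
  obtain y' where y': "y' \<in> carrier ET"
    "\<And>W \<gamma> x. W \<in> opens T \<Longrightarrow> \<gamma> \<in> carrier (sec (dual_sheaf E) W) \<Longrightarrow> x \<in> W \<Longrightarrow>
      Phi_transpose W (Phi_transpose W \<gamma> s') s W (res E T W e') x = \<gamma> W (res E T W y') x"
    "\<And>t. t \<in> T \<Longrightarrow> value_at_one (\<alpha> (torus_inv t) T y')
      = (\<Oplus>\<^bsub>V\<^esub>p\<in>S. \<Oplus>\<^bsub>V\<^esub>q\<in>S. (chi p t * chi q t) \<odot>\<^bsub>V\<^esub> Phi_s V \<phi> s' p (Phi_s V \<phi> s q (value_at_one e')))"
    by (rule composition_of_contractions[OF e'(1) s' s]) blast
  have "y = y'"
  proof (rule sections_separated[OF y(1) y'(1)])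
    fix W \<gamma> x assume W: "W \<in> opens T" and \<gamma>: "\<gamma> \<in> carrier (sec (dual_sheaf E) W)" and x: "x \<in> W"
    have "res E T W e' \<in> carrier (sec E W)"
      using res_closed[OF W zopen_torus invariant_sectionsD(1)[OF e'(1)]] .
    then show "\<gamma> W (res E T W y) x = \<gamma> W (res E T W y') x"
      using y(2)[OF W \<gamma> x] y'(2)[OF W \<gamma> x] Phi_transpose_commute[OF W \<gamma> s s'] by simp
  qed
  then show ?thesis using y(3)[OF t] y'(3)[OF t] by (simp add: e'(2))
qed

lemma Phi_s_commutator:
  assumes s: "s \<in> carrier_vec n" and s': "s' \<in> carrier_vec n"
  shows "commutator (tensor_group_algebra n (End_algebra V)) (Phi_s V \<phi> s) (Phi_s V \<phi> s')
    = \<zero>\<^bsub>tensor_group_algebra n (End_algebra V)\<^esub>"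
proof (rule commutator_eq_zero[OF V_space.End_ring Phi_s_tensor[OF s] Phi_s_tensor[OF s']])
  show "Phi_s V \<phi> s \<otimes>\<^bsub>tensor_group_algebra n (End_algebra V)\<^esub> Phi_s V \<phi> s'
      = Phi_s V \<phi> s' \<otimes>\<^bsub>tensor_group_algebra n (End_algebra V)\<^esub> Phi_s V \<phi> s"
    by (rule tensor_commute[OF V_module S_finite S_carrier])
       (simp_all add: Phi_s_End Phi_s_zero Phi_s_tensor contractions_commute s s')
qed

lemma eval_Phi_s_closed:
  assumes "s \<in> carrier_vec n"
  shows "eval_at (End_algebra V) (Phi_s V \<phi> s) t \<in> carrier (End_algebra V)"
  by (rule eval_at_apply(1)[OF V_module S_finite S_carrier]) (simp_all add: Phi_s_End Phi_s_zero assms)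

lemma eval_Phi_s_apply:
  assumes "s \<in> carrier_vec n" "e \<in> carrier V"
  shows "eval_at (End_algebra V) (Phi_s V \<phi> s) t e = (\<Oplus>\<^bsub>V\<^esub>r\<in>S. chi r t \<odot>\<^bsub>V\<^esub> Phi_s V \<phi> s r e)"
  by (rule eval_at_apply(2)[OF V_module S_finite S_carrier]) (simp_all add: Phi_s_End Phi_s_zero assms)

lemma eval_Phi_s_mult:
  assumes "s \<in> carrier_vec n" "s' \<in> carrier_vec n" "e \<in> carrier V"
  shows "(eval_at (End_algebra V) (Phi_s V \<phi> s) t \<otimes>\<^bsub>End_algebra V\<^esub> eval_at (End_algebra V) (Phi_s V \<phi> s') t) e
    = (\<Oplus>\<^bsub>V\<^esub>p\<in>S. \<Oplus>\<^bsub>V\<^esub>q\<in>S. (chi p t * chi q t) \<odot>\<^bsub>V\<^esub> Phi_s V \<phi> s p (Phi_s V \<phi> s' q e))"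
  by (rule eval_at_mult_apply[OF V_module S_finite S_carrier]) (simp_all add: Phi_s_End Phi_s_zero assms)

lemma eval_commute:
  assumes s: "s \<in> carrier_vec n" and s': "s' \<in> carrier_vec n" and t: "t \<in> T"
  shows "eval_at (End_algebra V) (Phi_s V \<phi> s) t \<otimes>\<^bsub>End_algebra V\<^esub> eval_at (End_algebra V) (Phi_s V \<phi> s') t
    = eval_at (End_algebra V) (Phi_s V \<phi> s') t \<otimes>\<^bsub>End_algebra V\<^esub> eval_at (End_algebra V) (Phi_s V \<phi> s) t"
proof (rule V_space.End_eqI[OF V_space.End_ops_closed(4) V_space.End_ops_closed(4)])
  fix e assume e: "e \<in> carrier V"
  show "(eval_at (End_algebra V) (Phi_s V \<phi> s) t \<otimes>\<^bsub>End_algebra V\<^esub> eval_at (End_algebra V) (Phi_s V \<phi> s') t) e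
    = (eval_at (End_algebra V) (Phi_s V \<phi> s') t \<otimes>\<^bsub>End_algebra V\<^esub> eval_at (End_algebra V) (Phi_s V \<phi> s) t) e"
    unfolding eval_Phi_s_mult[OF s s' e] eval_Phi_s_mult[OF s' s e] by (rule contractions_commute[OF s s' t e])
qed (simp_all add: eval_Phi_s_closed s s')

text \<open>Linearity in \<open>s\<close>, by which the values for the unit vectors generate the whole algebra.\<close>

lemma eval_Phi_s_expansion:
  assumes s: "s \<in> carrier_vec n"
  shows "eval_at (End_algebra V) (Phi_s V \<phi> s) t
    = (\<Oplus>\<^bsub>End_algebra V\<^esub>i\<in>{..<n}. complex_of_int (s $ i) \<odot>\<^bsub>End_algebra V\<^esub>
        eval_at (End_algebra V) (Phi_s V \<phi> (unit_vec n i)) t)"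
proof -
  interpret EV: ring "End_algebra V" by (rule V_space.End_ring)
  let ?ev = "\<lambda>s. eval_at (End_algebra V) (Phi_s V \<phi> s) t"
  have unit: "unit_vec n i \<in> carrier_vec n" for i by simp
  note ev = eval_Phi_s_closed and ev_apply = eval_Phi_s_apply
  have trm: "(\<lambda>i. complex_of_int (s $ i) \<odot>\<^bsub>End_algebra V\<^esub> ?ev (unit_vec n i)) \<in> {..<n} \<rightarrow> carrier (End_algebra V)"
    by (intro Pi_I V_space.End_ops_closed(5) ev unit)
  show ?thesis
  proof (rule V_space.End_eqI[OF ev[OF s] EV.finsum_closed[OF trm]])
    fix e assume e: "e \<in> carrier V"
    have pc: "\<phi> r e i \<in> carrier V" if "r \<in> S" "i < n" for r i
      using phi_closed[OF _ e that(2)] that(1) S_carrier by blast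
    have Sr: "r \<in> carrier_vec n" if "r \<in> S" for r using that S_carrier by blast
    have Phi_unit: "Phi_s V \<phi> (unit_vec n i) r e = \<phi> r e i" if r: "r \<in> S" and i: "i < n" for r i
    proof -
      have "Phi_s V \<phi> (unit_vec n i) r e = (\<Oplus>\<^bsub>V\<^esub>j\<in>{..<n}. complex_of_int (unit_vec n i $ j) \<odot>\<^bsub>V\<^esub> \<phi> r e j)"
        by (rule Phi_s_apply[OF Sr[OF r] e])
      also have "\<dots> = (\<Oplus>\<^bsub>V\<^esub>j\<in>{..<n}. if i = j then \<phi> r e j else \<zero>\<^bsub>V\<^esub>)"
        by (rule V.M.finsum_cong') (use pc[OF r] i in \<open>auto simp: V_space.smult_simps\<close>)
      also have "\<dots> = \<phi> r e i"
        using i pc[OF r] by (intro V.M.finsum_singleton) auto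
      finally show ?thesis .
    qed
    have t1: "chi r t \<odot>\<^bsub>V\<^esub> (complex_of_int (s $ i) \<odot>\<^bsub>V\<^esub> \<phi> r e i) \<in> carrier V" if "r \<in> S" "i \<in> {..<n}" for r i
      using that by (intro V_space.smult_simps(1) pc) auto
    have "?ev s e = (\<Oplus>\<^bsub>V\<^esub>r\<in>S. \<Oplus>\<^bsub>V\<^esub>i\<in>{..<n}. chi r t \<odot>\<^bsub>V\<^esub> (complex_of_int (s $ i) \<odot>\<^bsub>V\<^esub> \<phi> r e i))"
      unfolding ev_apply[OF s e]
    proof (rule V.M.finsum_cong')
      fix r assume r: "r \<in> S"
      show "chi r t \<odot>\<^bsub>V\<^esub> Phi_s V \<phi> s r e = (\<Oplus>\<^bsub>V\<^esub>i\<in>{..<n}. chi r t \<odot>\<^bsub>V\<^esub> (complex_of_int (s $ i) \<odot>\<^bsub>V\<^esub> \<phi> r e i))"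
        unfolding Phi_s_apply[OF Sr[OF r] e]
        by (rule V_space.smult_finsum) (use pc[OF r] V_space.smult_simps(1) in auto)
    qed (auto intro!: V.M.finsum_closed t1)
    also have "\<dots> = (\<Oplus>\<^bsub>V\<^esub>i\<in>{..<n}. \<Oplus>\<^bsub>V\<^esub>r\<in>S. chi r t \<odot>\<^bsub>V\<^esub> (complex_of_int (s $ i) \<odot>\<^bsub>V\<^esub> \<phi> r e i))"
      by (rule V.M.finsum_swap[OF S_finite finite_lessThan t1])
    also have "\<dots> = (\<Oplus>\<^bsub>V\<^esub>i\<in>{..<n}. (complex_of_int (s $ i) \<odot>\<^bsub>End_algebra V\<^esub> ?ev (unit_vec n i)) e)"
    proof (rule V.M.finsum_cong')
      fix i assume i: "i \<in> {..<n}"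
      have c: "(\<lambda>r. chi r t \<odot>\<^bsub>V\<^esub> \<phi> r e i) \<in> S \<rightarrow> carrier V"
        using i by (intro Pi_I V_space.smult_simps(1) pc) auto
      have "?ev (unit_vec n i) e = (\<Oplus>\<^bsub>V\<^esub>r\<in>S. chi r t \<odot>\<^bsub>V\<^esub> \<phi> r e i)"
        unfolding ev_apply[OF unit e] by (rule V.M.finsum_cong') (use c i Phi_unit in auto)
      then have "(complex_of_int (s $ i) \<odot>\<^bsub>End_algebra V\<^esub> ?ev (unit_vec n i)) e
          = (\<Oplus>\<^bsub>V\<^esub>r\<in>S. complex_of_int (s $ i) \<odot>\<^bsub>V\<^esub> (chi r t \<odot>\<^bsub>V\<^esub> \<phi> r e i))"
        using V_space.smult_finsum[OF c] e by (simp add: V_space.End_apply)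
      also have "\<dots> = (\<Oplus>\<^bsub>V\<^esub>r\<in>S. chi r t \<odot>\<^bsub>V\<^esub> (complex_of_int (s $ i) \<odot>\<^bsub>V\<^esub> \<phi> r e i))"
        by (rule V.M.finsum_cong') (use pc i in \<open>auto simp: V_space.smult_simps mult.commute\<close>)
      finally show "(\<Oplus>\<^bsub>V\<^esub>r\<in>S. chi r t \<odot>\<^bsub>V\<^esub> (complex_of_int (s $ i) \<odot>\<^bsub>V\<^esub> \<phi> r e i))
          = (complex_of_int (s $ i) \<odot>\<^bsub>End_algebra V\<^esub> ?ev (unit_vec n i)) e" by simp
    qed (rule refl, intro Pi_I V_space.End_closed[OF _ e] V_space.End_ops_closed(5) ev unit)
    also have "\<dots> = (\<Oplus>\<^bsub>End_algebra V\<^esub>i\<in>{..<n}. complex_of_int (s $ i) \<odot>\<^bsub>End_algebra V\<^esub> ?ev (unit_vec n i)) e"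
      by (rule V_space.End_finsum_apply[OF finite_lessThan trm e, symmetric])
    finally show "?ev s e = (\<Oplus>\<^bsub>End_algebra V\<^esub>i\<in>{..<n}. complex_of_int (s $ i) \<odot>\<^bsub>End_algebra V\<^esub> ?ev (unit_vec n i)) e" .
  qed
qed

lemma higgs_algebra_properties:
  assumes t: "t \<in> T"
  shows "is_subalgebra (higgs_algebra V \<phi> t) (End_algebra V)"
    "subcring (higgs_algebra V \<phi> t) (End_algebra V)"
    "\<exists>G. finite G \<and> G \<subseteq> carrier (End_algebra V) \<and> higgs_algebra V \<phi> t = generated_subalgebra (End_algebra V) G"
proof -
  interpret EV: ring "End_algebra V" by (rule V_space.End_ring)
  let ?ev = "\<lambda>s. eval_at (End_algebra V) (Phi_s V \<phi> s) t"
  define gens where "gens = {?ev s | s. s \<in> carrier_vec n}"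
  define G where "G = (\<lambda>i. ?ev (unit_vec n i)) ` {..<n}"
  note ev = eval_Phi_s_closed
  have gens: "gens \<subseteq> carrier (End_algebra V)" using ev by (auto simp: gens_def)
  have H: "higgs_algebra V \<phi> t = generated_subalgebra (End_algebra V) gens"
    by (simp add: higgs_algebra_def gens_def)
  show sub: "is_subalgebra (higgs_algebra V \<phi> t) (End_algebra V)"
    unfolding H by (rule V_space.generated_is_subalgebra[OF gens])
  have comm: "a \<otimes>\<^bsub>End_algebra V\<^esub> b = b \<otimes>\<^bsub>End_algebra V\<^esub> a" if "a \<in> gens" "b \<in> gens" for a b
    using that eval_commute[OF _ _ t] by (auto simp: gens_def)
  show "subcring (higgs_algebra V \<phi> t) (End_algebra V)"
    using sub V_space.generated_commutative[OF gens comm] unfolding H is_subalgebra_def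
    by (intro EV.subcringI) auto
  have GG: "G \<subseteq> gens" by (auto simp: G_def gens_def)
  have "gens \<subseteq> generated_subalgebra (End_algebra V) G"
  proof
    fix a assume "a \<in> gens"
    then obtain s where s: "s \<in> carrier_vec n" "a = ?ev s" by (auto simp: gens_def)
    have sG: "is_subalgebra (generated_subalgebra (End_algebra V) G) (End_algebra V)"
      using GG gens by (intro V_space.generated_is_subalgebra) auto
    have "(\<Oplus>\<^bsub>End_algebra V\<^esub>i\<in>{..<n}. complex_of_int (s $ i) \<odot>\<^bsub>End_algebra V\<^esub> ?ev (unit_vec n i))
        \<in> generated_subalgebra (End_algebra V) G"
    proof (rule EV.finsum_induct)
      show "(\<lambda>i. complex_of_int (s $ i) \<odot>\<^bsub>End_algebra V\<^esub> ?ev (unit_vec n i)) \<in> {..<n} \<rightarrow> carrier (End_algebra V)"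
        by (intro Pi_I V_space.End_ops_closed(5) ev) simp
      show "complex_of_int (s $ i) \<odot>\<^bsub>End_algebra V\<^esub> ?ev (unit_vec n i) \<in> generated_subalgebra (End_algebra V) G"
        if "i \<in> {..<n}" for i
        using that V_space.generated_superset[of G] by (intro V_space.is_subalgebraD(6)[OF sG]) (auto simp: G_def)
    qed (use V_space.is_subalgebraD[OF sG] in auto)
    then show "a \<in> generated_subalgebra (End_algebra V) G"
      unfolding s(2) eval_Phi_s_expansion[OF s(1)] .
  qed
  then have "higgs_algebra V \<phi> t = generated_subalgebra (End_algebra V) G"
    unfolding H by (intro V_space.generated_eqI gens GG)
  moreover have "finite G" "G \<subseteq> carrier (End_algebra V)" using GG gens by (auto simp: G_def)
  ultimately show "\<exists>G. finite G \<and> G \<subseteq> carrier (End_algebra V) \<and>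
      higgs_algebra V \<phi> t = generated_subalgebra (End_algebra V) G" by blast
qed

end

theorem proposition12:
  fixes n :: nat and \<Delta> :: "real vec set set"
    and E :: "'s presheaf" and \<alpha> :: "point \<Rightarrow> point set \<Rightarrow> 's \<Rightarrow> 's"
    and \<Phi> :: "point set \<Rightarrow> 's \<Rightarrow> 's tensor_T"
    and \<phi> :: "int vec \<Rightarrow> (point set \<times> 's) set \<Rightarrow> nat \<Rightarrow> (point set \<times> 's) set"
  defines "V \<equiv> toric_variety.fibre_at_one n \<Delta> E"
  assumes "toric_variety n \<Delta>"
    and "toric_variety.toric_sheaf n \<Delta> E \<alpha>"
    and "toric_variety.higgs_field n \<Delta> E \<Phi>"
    and "toric_variety.homogeneous_decomposition n \<Delta> E \<alpha> \<Phi> \<phi>"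
  shows "(\<forall>s\<in>carrier_vec n. \<forall>s'\<in>carrier_vec n.
            commutator (tensor_group_algebra n (End_algebra V))
              (toric_variety.Phi_s n V \<phi> s) (toric_variety.Phi_s n V \<phi> s')
            = \<zero>\<^bsub>tensor_group_algebra n (End_algebra V)\<^esub>) \<and>
         (\<forall>t\<in>torus n.
            is_subalgebra (toric_variety.higgs_algebra n V \<phi> t) (End_algebra V) \<and>
            subcring (toric_variety.higgs_algebra n V \<phi> t) (End_algebra V) \<and>
            (\<exists>G. finite G \<and> G \<subseteq> carrier (End_algebra V) \<and>
               toric_variety.higgs_algebra n V \<phi> t = generated_subalgebra (End_algebra V) G) \<and>
            (\<lambda>e\<in>carrier V. e) \<in> toric_variety.higgs_algebra n V \<phi> t \<and>
            (\<forall>a\<in>toric_variety.higgs_algebra n V \<phi> t.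
               (\<lambda>e\<in>carrier V. e) \<otimes>\<^bsub>End_algebra V\<^esub> a = a \<and>
               a \<otimes>\<^bsub>End_algebra V\<^esub> (\<lambda>e\<in>carrier V. e) = a))"
proof -
  interpret toric_variety n \<Delta> by fact
  have "sheaf_of_modules E" using assms(3) by (simp add: toric_sheaf_def)
  then interpret H: toric_higgs n \<Delta> E \<alpha> \<Phi> \<phi>
    using assms(3-5) by unfold_locales
  interpret EV: ring "End_algebra V" unfolding V_def by (rule H.V_space.End_ring)
  have one: "(\<lambda>e\<in>carrier V. e) = \<one>\<^bsub>End_algebra V\<^esub>" by (simp add: End_algebra_def)
  note algebra = H.higgs_algebra_properties[folded V_def]
  have "a \<in> carrier (End_algebra V)" if "a \<in> higgs_algebra V \<phi> t" "t \<in> torus n" for a t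
    using subcringE(1)[OF algebra(2)[OF that(2)]] that(1) by blast
  moreover have "\<one>\<^bsub>End_algebra V\<^esub> \<in> higgs_algebra V \<phi> t" if "t \<in> torus n" for t
    using subcringE(3)[OF algebra(2)[OF that]] .
  ultimately show ?thesis
    unfolding one using algebra H.Phi_s_commutator[folded V_def] by simp
qed

end
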